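(* Let $w=w_{23}$ be the Atkin-Lehner involution of $X_0(92)$ attached to $23$. There exist $x,y,t\in\mathbb{Q}(X_0(92))$ such that $\mathbb{Q}(X_0(92))=\mathbb{Q}(x,y,t)$, the subfield of functions invariant under $w^*$ is $\mathbb{Q}(x,y)$, $w^*(t)=-t$, and $$y^2=x^3+x^2+2x+1,\qquad t^2=(3+x)^2(8+4x+4x^2+x^3)(8+20x+28x^2+25x^3+14x^4+5x^5+x^6).$$ In particular these two equations are equations for $X_0(92)$ over $\mathbb{Q}$ (up to birational equivalence over $\mathbb{Q}$).
   Context: $X_0(N)$ denotes the smooth projective curve over $\mathbb{Q}$ attached to $\Gamma_0(N)$, where $\mathbb{Q}(X_0(N))$ is the subfield of $\mathbb{C}(X_0(N))$ of functions with rational $q$-expansion at the cusp $\infty$, $q=e^{2\pi i z}$. For a positive divisor $d$ of $N$ coprime to $N/d$, the Atkin-Lehner involution $w_d$ of $X_0(N)$ is induced by any matrix $\frac{1}{\sqrt d}\begin{pmatrix} A d & B\\ N C & D d\end{pmatrix}$ of determinant $1$ with $A,B,C,D\in\mathbb{Z}$; it is defined over $\mathbb{Q}$. *)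

theory Defs
  imports "HOL-Complex_Analysis.Complex_Analysis"
begin

no_notation fps_nth (infixl \<open>$\<close> 75)

section \<open>The field of meromorphic functions on the upper half plane\<close>

definition uhp :: "complex set" where
  "uhp = {z. Im z > 0}"

lemma uhp_props: "open uhp" "connected uhp" "uhp \<noteq> {}"
proof -
  show "open uhp" unfolding uhp_def by (rule open_halfspace_Im_gt)
  have "convex uhp" unfolding uhp_def by (rule convex_halfspace_Im_gt)
  thus "connected uhp" by (rule convex_connected)
  have "\<i> \<in> uhp" by (simp add: uhp_def)
  thus "uhp \<noteq> {}" by blast
qed

text \<open>
  A meromorphic function is represented by its canonical representative: removable singularities
  are removed, and the value at every pole, and outside the half plane, is 0.
\<close>
typedef mero_uhp = "{f. f nicely_meromorphic_on uhp \<and> (\<forall>z. z \<notin> uhp \<longrightarrow> f z = 0)}"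
  morphisms eval_mero Abs_mero_uhp
  by (rule exI[of _ "\<lambda>_. 0"]) auto

definition mero_of :: "(complex \<Rightarrow> complex) \<Rightarrow> mero_uhp" where
  "mero_of f = Abs_mero_uhp (\<lambda>z. if z \<in> uhp then remove_sings f z else 0)"

lemma eval_mero_nice: "eval_mero F nicely_meromorphic_on uhp"
  using eval_mero[of F] by simp

lemma eval_mero_mero [meromorphic_intros]: "eval_mero F meromorphic_on uhp"
  using eval_mero_nice[of F] by (simp add: nicely_meromorphic_on_def)

lemma eval_mero_outside: "z \<notin> uhp \<Longrightarrow> eval_mero F z = 0"
  using eval_mero[of F] by simp

lemma remove_sings_eval_mero:
  assumes "z \<in> uhp"
  shows   "remove_sings (eval_mero F) z = eval_mero F z"
  using eval_mero_nice[of F] assms unfolding nicely_meromorphic_on_def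
  by (metis remove_sings_at_pole remove_sings_eqI)

lemma eval_mero_of:
  assumes "f meromorphic_on uhp"
  shows   "eval_mero (mero_of f) = (\<lambda>z. if z \<in> uhp then remove_sings f z else 0)"
proof -
  let ?g = "\<lambda>z. if z \<in> uhp then remove_sings f z else 0"
  have ev: "eventually (\<lambda>w. ?g w = remove_sings f w) (at z)" if "z \<in> uhp" for z
  proof -
    have "eventually (\<lambda>w. w \<in> uhp) (at z)"
      using uhp_props(1) that by (rule eventually_at_in_open')
    thus ?thesis by eventually_elim auto
  qed
  have nice: "remove_sings f nicely_meromorphic_on uhp"
    using assms by (rule remove_sings_nicely_meromorphic)
  have "?g nicely_meromorphic_on uhp"
    unfolding nicely_meromorphic_on_def
  proof (intro conjI ballI)
    show "?g meromorphic_on uhp"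
      using nice meromorphic_on_cong[OF ev refl]
      by (auto simp: nicely_meromorphic_on_def)
    fix z assume z: "z \<in> uhp"
    have "is_pole ?g z \<longleftrightarrow> is_pole (remove_sings f) z"
      by (rule is_pole_cong[OF ev[OF z] refl])
    moreover have "?g \<midarrow>z\<rightarrow> ?g z \<longleftrightarrow> remove_sings f \<midarrow>z\<rightarrow> ?g z"
      by (rule filterlim_cong[OF refl refl ev[OF z]])
    ultimately show "is_pole ?g z \<and> ?g z = 0 \<or> ?g \<midarrow>z\<rightarrow> ?g z"
      using nice z by (auto simp: nicely_meromorphic_on_def)
  qed
  thus ?thesis
    unfolding mero_of_def by (subst Abs_mero_uhp_inverse) auto
qed

lemma mero_of_eval [simp]: "mero_of (eval_mero F) = F"
proof -
  have "eval_mero (mero_of (eval_mero F)) = eval_mero F"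
    by (auto simp: eval_mero_of[OF eval_mero_mero] remove_sings_eval_mero eval_mero_outside)
  thus ?thesis by (simp add: eval_mero_inject)
qed

lemma mero_of_eqI:
  assumes "eventually (\<lambda>z. f z = g z) (cosparse uhp)"
  shows   "mero_of f = mero_of g"
proof -
  have "remove_sings f z = remove_sings g z" if "z \<in> uhp" for z
    by (rule remove_sings_cong[OF eventually_cosparse_imp_eventually_at[OF assms that] refl])
  hence "(\<lambda>z. if z \<in> uhp then remove_sings f z else 0) =
         (\<lambda>z. if z \<in> uhp then remove_sings g z else 0)" by auto
  thus ?thesis by (simp add: mero_of_def)
qed

lemma eventually_eval_mero_of:
  assumes "f meromorphic_on uhp"
  shows   "eventually (\<lambda>z. eval_mero (mero_of f) z = f z) (cosparse uhp)"
proof -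
  have "eventually (\<lambda>z. z \<in> uhp) (cosparse uhp)"
    by (rule eventually_in_cosparse) (use uhp_props in auto)
  with eventually_remove_sings_eq[OF assms] show ?thesis
    by eventually_elim (simp add: eval_mero_of[OF assms])
qed

lemma mero_uhp_eqI:
  assumes "eventually (\<lambda>z. eval_mero F z = eval_mero G z) (cosparse uhp)"
  shows   "F = G"
  using mero_of_eqI[OF assms] by simp

instantiation mero_uhp :: field
begin

definition "0 = mero_of (\<lambda>_. 0)"
definition "1 = mero_of (\<lambda>_. 1)"
definition "F + G = mero_of (\<lambda>z. eval_mero F z + eval_mero G z)"
definition "F - G = mero_of (\<lambda>z. eval_mero F z - eval_mero G z)"
definition "- F = mero_of (\<lambda>z. - eval_mero F z)"
definition "F * G = mero_of (\<lambda>z. eval_mero F z * eval_mero G z)"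
definition "inverse F = mero_of (\<lambda>z. inverse (eval_mero F z))"
definition "F div G = mero_of (\<lambda>z. eval_mero F z / eval_mero G z)"

lemma eventually_eval_mero_ops:
  "eventually (\<lambda>z. eval_mero 0 z = 0) (cosparse uhp)"
  "eventually (\<lambda>z. eval_mero 1 z = 1) (cosparse uhp)"
  "eventually (\<lambda>z. eval_mero (F + G) z = eval_mero F z + eval_mero G z) (cosparse uhp)"
  "eventually (\<lambda>z. eval_mero (F - G) z = eval_mero F z - eval_mero G z) (cosparse uhp)"
  "eventually (\<lambda>z. eval_mero (- F) z = - eval_mero F z) (cosparse uhp)"
  "eventually (\<lambda>z. eval_mero (F * G) z = eval_mero F z * eval_mero G z) (cosparse uhp)"
  "eventually (\<lambda>z. eval_mero (inverse F) z = inverse (eval_mero F z)) (cosparse uhp)"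
  "eventually (\<lambda>z. eval_mero (F div G) z = eval_mero F z / eval_mero G z) (cosparse uhp)"
  unfolding zero_mero_uhp_def one_mero_uhp_def plus_mero_uhp_def minus_mero_uhp_def
    uminus_mero_uhp_def times_mero_uhp_def inverse_mero_uhp_def divide_mero_uhp_def
  by (rule eventually_eval_mero_of; intro meromorphic_intros)+

lemma eventually_eval_mero_nonzero:
  assumes "F \<noteq> 0"
  shows   "eventually (\<lambda>z. eval_mero F z \<noteq> 0) (cosparse uhp)"
proof (rule ccontr)
  assume "\<not> ?thesis"
  with nicely_meromorphic_imp_constant_or_avoid[OF eval_mero_nice uhp_props(1,2), of F 0]
  have *: "\<forall>z\<in>uhp. eval_mero F z = 0" by blast
  have "eventually (\<lambda>z. z \<in> uhp) (cosparse uhp)"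
    by (rule eventually_in_cosparse) (use uhp_props in auto)
  with eventually_eval_mero_ops(1)
  have "eventually (\<lambda>z. eval_mero F z = eval_mero 0 z) (cosparse uhp)"
    by eventually_elim (use * in auto)
  with assms show False using mero_uhp_eqI by blast
qed

instance
proof
  fix a b c :: mero_uhp
  show "a + b + c = a + (b + c)"
    by (rule mero_uhp_eqI)
       (use eventually_eval_mero_ops(3)[of "a+b" c] eventually_eval_mero_ops(3)[of a b]
          eventually_eval_mero_ops(3)[of a "b+c"] eventually_eval_mero_ops(3)[of b c]
        in \<open>eventually_elim, simp add: algebra_simps\<close>)
  show "a + b = b + a"
    by (simp add: plus_mero_uhp_def add.commute)
  show "0 + a = a"
    by (rule mero_uhp_eqI)
       (use eventually_eval_mero_ops(3)[of 0 a] eventually_eval_mero_ops(1)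
        in \<open>eventually_elim, simp\<close>)
  show "- a + a = 0"
    by (rule mero_uhp_eqI)
       (use eventually_eval_mero_ops(3)[of "-a" a] eventually_eval_mero_ops(5)[of a]
          eventually_eval_mero_ops(1) in \<open>eventually_elim, simp\<close>)
  show "a - b = a + - b"
    by (rule mero_uhp_eqI)
       (use eventually_eval_mero_ops(3)[of a "-b"] eventually_eval_mero_ops(5)[of b]
          eventually_eval_mero_ops(4)[of a b] in \<open>eventually_elim, simp\<close>)
  show "a * b * c = a * (b * c)"
    by (rule mero_uhp_eqI)
       (use eventually_eval_mero_ops(6)[of "a*b" c] eventually_eval_mero_ops(6)[of a b]
          eventually_eval_mero_ops(6)[of a "b*c"] eventually_eval_mero_ops(6)[of b c]
        in \<open>eventually_elim, simp\<close>)
  show "a * b = b * a"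
    by (simp add: times_mero_uhp_def mult.commute)
  show "1 * a = a"
    by (rule mero_uhp_eqI)
       (use eventually_eval_mero_ops(6)[of 1 a] eventually_eval_mero_ops(2)
        in \<open>eventually_elim, simp\<close>)
  show "(a + b) * c = a * c + b * c"
    by (rule mero_uhp_eqI)
       (use eventually_eval_mero_ops(6)[of "a+b" c] eventually_eval_mero_ops(3)[of a b]
          eventually_eval_mero_ops(3)[of "a*c" "b*c"] eventually_eval_mero_ops(6)[of a c]
          eventually_eval_mero_ops(6)[of b c]
        in \<open>eventually_elim, simp add: algebra_simps\<close>)
  show "(0::mero_uhp) \<noteq> 1"
  proof
    assume "(0::mero_uhp) = 1"
    hence "eventually (\<lambda>z. eval_mero 0 z = 1) (cosparse uhp)"
      using eventually_eval_mero_ops(2) by simp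
    with eventually_eval_mero_ops(1) have "eventually (\<lambda>z. False) (cosparse uhp)"
      by eventually_elim simp
    thus False using uhp_props(3) by (simp add: eventually_False)
  qed
  show "a div b = a * inverse b"
    by (rule mero_uhp_eqI)
       (use eventually_eval_mero_ops(6)[of a "inverse b"] eventually_eval_mero_ops(7)[of b]
          eventually_eval_mero_ops(8)[of a b] in \<open>eventually_elim, simp add: field_simps\<close>)
  show "inverse (0::mero_uhp) = 0"
    by (rule mero_uhp_eqI)
       (use eventually_eval_mero_ops(7)[of 0] eventually_eval_mero_ops(1)
        in \<open>eventually_elim, simp\<close>)
  show "inverse a * a = 1" if "a \<noteq> 0"
    by (rule mero_uhp_eqI)
       (use eventually_eval_mero_ops(6)[of "inverse a" a] eventually_eval_mero_ops(7)[of a]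
          eventually_eval_mero_ops(2) eventually_eval_mero_nonzero[OF that]
        in \<open>eventually_elim, simp\<close>)
qed

end

lemma eventually_eval_mero_of_nat:
  "eventually (\<lambda>z. eval_mero (of_nat n) z = of_nat n) (cosparse uhp)"
proof (induction n)
  case 0
  show ?case using eventually_eval_mero_ops(1) by simp
next
  case (Suc n)
  from Suc eventually_eval_mero_ops(2) eventually_eval_mero_ops(3)[of 1 "of_nat n"]
  show ?case by eventually_elim simp
qed

instance mero_uhp :: field_char_0
proof
  show "inj (of_nat :: nat \<Rightarrow> mero_uhp)"
  proof
    fix m n :: nat
    assume "(of_nat m :: mero_uhp) = of_nat n"
    with eventually_eval_mero_of_nat[of m]
    have "eventually (\<lambda>z. eval_mero (of_nat n) z = of_nat m) (cosparse uhp)" by simp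
    with eventually_eval_mero_of_nat[of n] have "eventually (\<lambda>z. m = n) (cosparse uhp)"
      by eventually_elim simp
    thus "m = n" using uhp_props(3) by (cases "m = n") (auto simp: eventually_False)
  qed
qed


section \<open>Moebius transformations and pullback\<close>

definition moebius_mat :: "int ^ 2 ^ 2 \<Rightarrow> complex \<Rightarrow> complex" where
  "moebius_mat M z =
     moebius (of_int (M $ 1 $ 1)) (of_int (M $ 1 $ 2)) (of_int (M $ 2 $ 1)) (of_int (M $ 2 $ 2)) z"

lemma moebius_mat_def':
  "moebius_mat M z =
     (of_int (M $ 1 $ 1) * z + of_int (M $ 1 $ 2)) / (of_int (M $ 2 $ 1) * z + of_int (M $ 2 $ 2))"
  unfolding moebius_mat_def moebius_def ..

definition pullback :: "int ^ 2 ^ 2 \<Rightarrow> mero_uhp \<Rightarrow> mero_uhp" where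
  "pullback M F = mero_of (\<lambda>z. eval_mero F (moebius_mat M z))"

definition Gamma0 :: "nat \<Rightarrow> (int ^ 2 ^ 2) set" where
  "Gamma0 N = {M. det M = 1 \<and> int N dvd M $ 2 $ 1}"


section \<open>Function fields of modular curves\<close>

text \<open>
  \<open>L\<close> is the expansion in $e^{2\pi i z/h}$, valid for all \<open>z\<close> with large imaginary part.
\<close>
definition has_q_expansion :: "nat \<Rightarrow> mero_uhp \<Rightarrow> complex fls \<Rightarrow> bool" where
  "has_q_expansion h F L \<longleftrightarrow> fls_conv_radius L > 0 \<and>
     (\<forall>\<^sub>F z in filtercomap Im at_top.
        eval_mero F z = eval_fls L (exp (2 * of_real pi * \<i> * z / of_nat h)))"

text \<open>
  The next set is the function field of $X_0(N)$ over the complex numbers. Its second condition is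
  meromorphy at the cusps: they are the images of $\infty$ under $SL_2(\mathbb{Z})$, and all their
  widths divide $N$.
\<close>
definition modular_functions :: "nat \<Rightarrow> mero_uhp set" where
  "modular_functions N =
     {F. (\<forall>M\<in>Gamma0 N. pullback M F = F) \<and>
         (\<forall>M. det M = 1 \<longrightarrow> (\<exists>L. has_q_expansion N (pullback M F) L))}"

definition X0_function_field :: "nat \<Rightarrow> mero_uhp set" where
  "X0_function_field N =
     {F \<in> modular_functions N. \<exists>L. has_q_expansion 1 F L \<and> (\<forall>n. fls_nth L n \<in> \<rat>)}"


section \<open>Atkin--Lehner involutions\<close>

text \<open>
  The factor $1/\sqrt{d}$ does not affect the Moebius transformation; without it the determinant
  is $d$ instead of 1.
\<close>
definition atkin_lehner_matrices :: "nat \<Rightarrow> nat \<Rightarrow> (int ^ 2 ^ 2) set" where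
  "atkin_lehner_matrices N d =
     {M. det M = int d \<and> int d dvd M $ 1 $ 1 \<and> int d dvd M $ 2 $ 2 \<and> int N dvd M $ 2 $ 1}"

text \<open>
  On modular functions the choice of matrix is irrelevant; see \<open>atkin_lehner_eq_pullback\<close> below.
\<close>
definition atkin_lehner :: "nat \<Rightarrow> nat \<Rightarrow> mero_uhp \<Rightarrow> mero_uhp" where
  "atkin_lehner N d F = pullback (SOME M. M \<in> atkin_lehner_matrices N d) F"

lemma Im_moebius:
  "Im (moebius_mat M z) =
     of_int (det M) * Im z / (cmod (of_int (M $ 2 $ 1) * z + of_int (M $ 2 $ 2)))\<^sup>2"
proof -
  have "cnj (of_int (M $ 2 $ 1) * z + of_int (M $ 2 $ 2)) =
          of_int (M $ 2 $ 1) * cnj z + of_int (M $ 2 $ 2)" by simp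
  thus ?thesis
    unfolding moebius_mat_def' det_2
    by (subst complex_div_cnj) (simp add: cmod_power2 Im_divide_of_real algebra_simps
          flip: of_real_power)
qed

lemma moebius_denom_nonzero:
  fixes M :: "int ^ 2 ^ 2"
  assumes "z \<in> uhp" "det M > 0"
  shows   "of_int (M $ 2 $ 1) * z + of_int (M $ 2 $ 2) \<noteq> 0"
proof
  assume eq: "of_int (M $ 2 $ 1) * z + of_int (M $ 2 $ 2) = 0"
  hence "Im (of_int (M $ 2 $ 1) * z + of_int (M $ 2 $ 2)) = 0" by simp
  hence "M $ 2 $ 1 = 0" using assms(1) by (auto simp: uhp_def)
  moreover from this eq have "M $ 2 $ 2 = 0" by simp
  ultimately show False using assms(2) by (simp add: det_2)
qed

lemma moebius_in_uhp:
  assumes "z \<in> uhp" "det M > 0"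
  shows   "moebius_mat M z \<in> uhp"
  using assms moebius_denom_nonzero[OF assms] by (simp add: uhp_def Im_moebius)

lemma moebius_mult:
  assumes "z \<in> uhp" "det B > 0"
  shows   "moebius_mat (A ** B) z = moebius_mat A (moebius_mat B z)"
proof -
  define w where "w = of_int (B $ 2 $ 1) * z + of_int (B $ 2 $ 2)"
  have w: "w \<noteq> 0" using moebius_denom_nonzero[OF assms] by (simp add: w_def)
  define u where "u = of_int (B $ 1 $ 1) * z + of_int (B $ 1 $ 2)"
  have *: "a * (u / w) + b = (a * u + b * w) / w" for a b :: complex
    using w by (simp add: field_simps)
  have "moebius_mat A (moebius_mat B z) =
          (of_int (A $ 1 $ 1) * u + of_int (A $ 1 $ 2) * w) /
          (of_int (A $ 2 $ 1) * u + of_int (A $ 2 $ 2) * w)"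
    unfolding moebius_mat_def' u_def[symmetric] w_def[symmetric] * using w by simp
  also have "\<dots> = moebius_mat (A ** B) z"
    by (simp add: moebius_mat_def' matrix_matrix_mult_def sum_2 u_def w_def algebra_simps)
  finally show ?thesis ..
qed

lemma moebius_analytic:
  assumes "det M > 0"
  shows   "moebius_mat M analytic_on uhp"
proof -
  have "(\<lambda>z. moebius_mat M z) analytic_on uhp"
    unfolding moebius_mat_def' by (intro analytic_intros) (use moebius_denom_nonzero assms in auto)
  thus ?thesis .
qed

definition adj2 :: "int ^ 2 ^ 2 \<Rightarrow> int ^ 2 ^ 2" where
  "adj2 M = vector [vector [M $ 2 $ 2, - (M $ 1 $ 2)], vector [- (M $ 2 $ 1), M $ 1 $ 1]]"

lemma det_adj2: "det (adj2 M) = det M"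
  by (simp add: det_2 adj2_def)

lemma moebius_adj2:
  assumes "z \<in> uhp" "det M > 0"
  shows   "moebius_mat (adj2 M) (moebius_mat M z) = z" "moebius_mat M (moebius_mat (adj2 M) z) = z"
proof -
  have "adj2 M ** M = mat (det M)" "M ** adj2 M = mat (det M)"
    by (simp_all add: vec_eq_iff matrix_matrix_mult_def sum_2 adj2_def mat_def forall_2 det_2)
  moreover have "moebius_mat (mat (det M)) z = z" using assms by (simp add: moebius_mat_def' mat_def)
  ultimately show "moebius_mat (adj2 M) (moebius_mat M z) = z" "moebius_mat M (moebius_mat (adj2 M) z) = z"
    using moebius_mult[OF assms, of "adj2 M"] moebius_mult[of z "adj2 M" M] assms
    by (simp_all add: det_adj2)
qed

lemma filterlim_moebius_at:
  assumes "z \<in> uhp" "det M > 0"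
  shows   "filterlim (moebius_mat M) (at (moebius_mat M z)) (at z)"
proof -
  have "isCont (moebius_mat M) z"
    using moebius_analytic[OF assms(2)] assms(1)
    by (metis analytic_at_imp_isCont analytic_on_analytic_at)
  moreover have "eventually (\<lambda>w. moebius_mat M w \<noteq> moebius_mat M z) (at z)"
  proof -
    have "eventually (\<lambda>w. w \<in> uhp - {z}) (at z)"
      by (rule eventually_at_in_open) (use uhp_props(1) assms(1) in auto)
    thus ?thesis
      by eventually_elim (metis assms DiffE insertCI moebius_adj2(1))
  qed
  ultimately show ?thesis
    by (auto simp: filterlim_at isCont_def)
qed

lemma filtermap_moebius_at:
  assumes "z \<in> uhp" "det M > 0"
  shows   "filtermap (moebius_mat M) (at z) = at (moebius_mat M z)"
proof (rule filtermap_fun_inverse)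
  have mem: "moebius_mat M z \<in> uhp" using moebius_in_uhp assms by blast
  show "filterlim (moebius_mat (adj2 M)) (at z) (at (moebius_mat M z))"
    using filterlim_moebius_at[OF mem, of "adj2 M"] assms by (simp add: det_adj2 moebius_adj2)
  show "filterlim (moebius_mat M) (at (moebius_mat M z)) (at z)"
    using assms by (rule filterlim_moebius_at)
  have "eventually (\<lambda>w. w \<in> uhp) (at (moebius_mat M z))"
    using uhp_props(1) mem by (rule eventually_at_in_open')
  thus "eventually (\<lambda>w. moebius_mat M (moebius_mat (adj2 M) w) = w) (at (moebius_mat M z))"
    by eventually_elim (use assms in \<open>simp add: moebius_adj2\<close>)
qed

lemma eval_pullback:
  assumes "det M > 0" "z \<in> uhp"
  shows   "eval_mero (pullback M F) z = eval_mero F (moebius_mat M z)"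
proof -
  have "(\<lambda>z. eval_mero F (moebius_mat M z)) meromorphic_on uhp"
    by (rule meromorphic_on_compose[OF eval_mero_mero moebius_analytic[OF assms(1)]])
       (use moebius_in_uhp assms(1) in auto)
  hence "eval_mero (pullback M F) z = remove_sings (eval_mero F \<circ> moebius_mat M) z"
    using assms(2) by (simp add: pullback_def eval_mero_of o_def)
  also have "\<dots> = remove_sings (eval_mero F) (moebius_mat M z)"
    by (rule remove_sings_compose) (rule filtermap_moebius_at[OF assms(2,1)])
  also have "\<dots> = eval_mero F (moebius_mat M z)"
    by (rule remove_sings_eval_mero) (use moebius_in_uhp assms in auto)
  finally show ?thesis .
qed

lemma mero_uhp_ext:
  assumes "\<And>z. z \<in> uhp \<Longrightarrow> eval_mero F z = eval_mero G z"
  shows   "F = G"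
proof -
  have "eval_mero F = eval_mero G"
    using assms eval_mero_outside by (metis ext)
  thus ?thesis by (simp add: eval_mero_inject)
qed

lemma pullback_mult:
  assumes "det A > 0" "det B > 0"
  shows   "pullback (A ** B) F = pullback B (pullback A F)"
proof (rule mero_uhp_ext)
  fix z assume z: "z \<in> uhp"
  have "det (A ** B) > 0" using assms by (simp add: det_mul)
  with z assms show "eval_mero (pullback (A ** B) F) z = eval_mero (pullback B (pullback A F)) z"
    by (simp add: eval_pullback moebius_in_uhp moebius_mult)
qed

lemma atkin_lehner_matrices_nonempty:
  assumes "d > 0" "d dvd N" "coprime d (N div d)"
  shows   "atkin_lehner_matrices N d \<noteq> {}"
proof -
  obtain m where N: "N = d * m" using assms(2) by blast
  have "coprime (int d) (int m)" using assms N by simp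
  then obtain u v where uv: "u * int d + v * int m = 1"
    using bezout_int[of "int d" "int m"] by (auto simp: coprime_iff_gcd_eq_1)
  define M :: "int ^ 2 ^ 2" where
    "M = vector [vector [int d * u, - v], vector [int N, int d]]"
  have "det M = int d * (u * int d + v * int m)"
    by (simp add: det_2 M_def N algebra_simps)
  hence "M \<in> atkin_lehner_matrices N d"
    by (simp add: atkin_lehner_matrices_def uv M_def)
  thus ?thesis by blast
qed

lemma atkin_lehner_eq_pullback:
  assumes "d > 0" "d dvd N"
  assumes F: "F \<in> modular_functions N" and M: "M \<in> atkin_lehner_matrices N d"
  shows   "atkin_lehner N d F = pullback M F"
proof -
  have eq: "pullback W' F = pullback W F"
    if W: "W \<in> atkin_lehner_matrices N d" and W': "W' \<in> atkin_lehner_matrices N d" for W W'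
  proof -
    obtain m where N: "N = d * m" using assms(2) by blast
    from W obtain a b c e where 1: "W $ 1 $ 1 = int d * a" "W $ 1 $ 2 = b"
      "W $ 2 $ 1 = int N * c" "W $ 2 $ 2 = int d * e" "det W = int d"
      by (auto simp: atkin_lehner_matrices_def elim!: dvdE)
    from W' obtain a' b' c' e' where 2: "W' $ 1 $ 1 = int d * a'" "W' $ 1 $ 2 = b'"
      "W' $ 2 $ 1 = int N * c'" "W' $ 2 $ 2 = int d * e'" "det W' = int d"
      by (auto simp: atkin_lehner_matrices_def elim!: dvdE)
    have "int d * (int d * a * e - int m * b * c) = int d * 1"
      using 1 by (simp add: det_2 N algebra_simps)
    hence d1: "int d * a * e - int m * b * c = 1" using assms(1) by simp
    have "int d * (int d * a' * e' - int m * b' * c') = int d * 1"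
      using 2 by (simp add: det_2 N algebra_simps)
    hence d2: "int d * a' * e' - int m * b' * c' = 1" using assms(1) by simp
    define G :: "int ^ 2 ^ 2" where
      "G = vector [vector [int d * a' * e - int m * b' * c, a * b' - a' * b],
                   vector [int N * (c' * e - c * e'), int d * e' * a - int m * c' * b]]"
    have GW: "G ** W = W'"
    proof -
      have "(int d * a' * e - int m * b' * c) * (int d * a) + (a * b' - a' * b) * (int N * c) =
              int d * a' * (int d * a * e - int m * b * c)"
        by (simp add: N algebra_simps)
      moreover have "(int d * a' * e - int m * b' * c) * b + (a * b' - a' * b) * (int d * e) =
              b' * (int d * a * e - int m * b * c)"
        by (simp add: N algebra_simps)
      moreover have "int N * (c' * e - c * e') * (int d * a) +
              (int d * e' * a - int m * c' * b) * (int N * c) =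
              int N * c' * (int d * a * e - int m * b * c)"
        by (simp add: N algebra_simps)
      moreover have "int N * (c' * e - c * e') * b +
              (int d * e' * a - int m * c' * b) * (int d * e) =
              int d * e' * (int d * a * e - int m * b * c)"
        by (simp add: N algebra_simps)
      ultimately show ?thesis
        unfolding d1 by (simp add: vec_eq_iff forall_2 matrix_matrix_mult_def sum_2 G_def 1 2)
    qed
    have "det G * int d = int d" using det_mul[of G W] 1(5) 2(5) by (simp add: GW)
    hence "det G = 1" using assms(1) by simp
    moreover from this have "G \<in> Gamma0 N" by (simp add: Gamma0_def G_def)
    hence "pullback G F = F" using F by (simp add: modular_functions_def)
    ultimately show ?thesis
      using pullback_mult[of G W F] 1(5) assms(1) by (simp add: GW)
  qed
  have "(SOME M. M \<in> atkin_lehner_matrices N d) \<in> atkin_lehner_matrices N d"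
    using M by (rule someI)
  from eq[OF M this] show ?thesis by (simp add: atkin_lehner_def)
qed


section \<open>Fields generated over the rational numbers, and affine models\<close>

definition is_subfield :: "'a :: field set \<Rightarrow> bool" where
  "is_subfield K \<longleftrightarrow> 0 \<in> K \<and> 1 \<in> K \<and>
     (\<forall>a\<in>K. \<forall>b\<in>K. a + b \<in> K \<and> a * b \<in> K) \<and> (\<forall>a\<in>K. - a \<in> K \<and> inverse a \<in> K)"

definition rat_adjoin :: "'a :: field_char_0 set \<Rightarrow> 'a set" where
  "rat_adjoin S = \<Inter> {K. is_subfield K \<and> \<rat> \<union> S \<subseteq> K}"

text \<open>
  The type \<open>rat poly poly poly\<close> is $\mathbb{Q}[X][Y][T]$, with \<open>varT\<close> the outermost variable.
\<close>
definition varX :: "rat poly poly poly" where "varX = [:[:[:0, 1:]:]:]"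
definition varY :: "rat poly poly poly" where "varY = [:[:0, 1:]:]"
definition varT :: "rat poly poly poly" where "varT = [:0, 1:]"

definition eval3 :: "rat poly poly poly \<Rightarrow> 'a :: field_char_0 \<Rightarrow> 'a \<Rightarrow> 'a \<Rightarrow> 'a" where
  "eval3 P x y t =
     poly (map_poly (\<lambda>Q. poly (map_poly (\<lambda>R. poly (map_poly of_rat R) x) Q) y) P) t"

text \<open>
  \<open>is_birational_model K P Q x y t\<close> says that $X \mapsto x$, $Y \mapsto y$, $T \mapsto t$ induces
  an isomorphism from the fraction field of $\mathbb{Q}[X,Y,T]/(P,Q)$ onto \<open>K\<close>: the curve
  $P = Q = 0$ is integral over $\mathbb{Q}$ with function field \<open>K\<close> and generic point $(x,y,t)$.
\<close>
definition is_birational_model ::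
  "'a :: field_char_0 set \<Rightarrow> rat poly poly poly \<Rightarrow> rat poly poly poly \<Rightarrow> 'a \<Rightarrow> 'a \<Rightarrow> 'a \<Rightarrow> bool"
where
  "is_birational_model K P Q x y t \<longleftrightarrow>
     rat_adjoin {x, y, t} = K \<and> {R. eval3 R x y t = 0} = {A * P + B * Q |A B. True}"

lemma map_poly_additive:
  fixes h :: "'a :: comm_monoid_add \<Rightarrow> 'b :: comm_monoid_add"
  assumes "h 0 = 0" "\<And>a b. h (a + b) = h a + h b"
  shows   "map_poly h (p + q) = map_poly h p + map_poly h q"
  by (rule poly_eqI) (simp add: coeff_map_poly assms)

lemma eval3_hom:
  "eval3 varX x y t = x" "eval3 varY x y t = y" "eval3 varT x y t = t"
  "eval3 (P + Q) x y t = eval3 P x y t + eval3 Q x y t"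
  "eval3 (P * Q) x y t = eval3 P x y t * eval3 Q x y t"
  "eval3 1 x y t = 1"
proof -
  define h1 where "h1 = (\<lambda>R :: rat poly. poly (map_poly of_rat R) x)"
  define h2 where "h2 = (\<lambda>Q :: rat poly poly. poly (map_poly h1 Q) y)"
  have h1: "h1 0 = 0" "h1 1 = 1" "h1 (a + b) = h1 a + h1 b" "h1 (a * b) = h1 a * h1 b" for a b
  proof -
    show "h1 0 = 0" "h1 1 = 1" by (simp_all add: h1_def)
    show s: "h1 (a + b) = h1 a + h1 b" for a b
      unfolding h1_def by (subst map_poly_additive) (simp_all add: of_rat_add)
    have "h1 (pCons c a) = of_rat c + x * h1 a" for c a
      by (simp add: h1_def map_poly_pCons)
    moreover have "h1 (smult c a) = of_rat c * h1 a" for c a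
      by (induction a) (simp_all add: h1_def map_poly_pCons of_rat_mult algebra_simps)
    ultimately show "h1 (a * b) = h1 a * h1 b"
      by (induction a) (simp_all add: s algebra_simps, simp add: h1_def)
  qed
  have h2: "h2 0 = 0" "h2 1 = 1" "h2 (a + b) = h2 a + h2 b" "h2 (a * b) = h2 a * h2 b" for a b
  proof -
    show "h2 0 = 0" "h2 1 = 1" by (simp_all add: h2_def h1 map_poly_1')
    show s: "h2 (a + b) = h2 a + h2 b" for a b
      unfolding h2_def by (subst map_poly_additive) (simp_all add: h1)
    have "h2 (pCons c a) = h1 c + y * h2 a" for c a
      by (simp add: h2_def map_poly_pCons h1)
    moreover have "h2 (smult c a) = h1 c * h2 a" for c a
      by (induction a) (simp_all add: h2_def map_poly_pCons h1 algebra_simps)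
    ultimately show "h2 (a * b) = h2 a * h2 b"
      by (induction a) (simp_all add: s h1 algebra_simps, simp add: h2_def)
  qed
  define h3 where "h3 = (\<lambda>P. eval3 P x y t)"
  have h3_def': "h3 P = poly (map_poly h2 P) t" for P
    unfolding h3_def eval3_def h2_def h1_def ..
  have s: "h3 (a + b) = h3 a + h3 b" for a b
    unfolding h3_def' by (subst map_poly_additive) (simp_all add: h2)
  have p: "h3 (pCons c a) = h2 c + t * h3 a" for c a
    by (simp add: h3_def' map_poly_pCons h2)
  have z: "h3 0 = 0" by (simp add: h3_def')
  have "h3 (smult c a) = h2 c * h3 a" for c a
    by (induction a) (simp_all add: p z h2 algebra_simps)
  hence m: "h3 (a * b) = h3 a * h3 b" for a b
    by (induction a) (simp_all add: s p z h2 algebra_simps)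
  have p2: "h2 (pCons c a) = h1 c + y * h2 a" for c a
    by (simp add: h2_def map_poly_pCons h1)
  have p1: "h1 (pCons c a) = of_rat c + x * h1 a" for c a
    by (simp add: h1_def map_poly_pCons)
  show "eval3 (P + Q) x y t = eval3 P x y t + eval3 Q x y t"
       "eval3 (P * Q) x y t = eval3 P x y t * eval3 Q x y t"
    using s m by (simp_all add: h3_def)
  have "h3 1 = 1" "h3 varX = x" "h3 varY = y" "h3 varT = t"
    by (simp_all add: one_pCons varX_def varY_def varT_def p z p2 p1 h2 h1)
  thus "eval3 1 x y t = 1" "eval3 varX x y t = x" "eval3 varY x y t = y" "eval3 varT x y t = t"
    by (simp_all add: h3_def)
qed

end

theory Submission
  imports Defs "HOL-Computational_Algebra.Fundamental_Theorem_Algebra"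
begin

text \<open>
  Let $\eta$ be Dedekind's function, $\varphi(z) = \eta(2z)/\eta(z)$, $\kappa(z) = \eta(2z)^4/\eta(z)^2$ and
  $f(z) = 1/(\varphi(z)\varphi(23z))$. Put $x(z) = f(2z)$, $A = x f$, $y = A + 1 + x$,
  $K(z) = \kappa(2z)/\kappa(46z)$ and $t = K + 23/K$. From $\eta(-1/z) = \sqrt{-iz}\,\eta(z)$ (a conditionally
  convergent lattice sum) one gets that these functions are on $X_0(92)$, that $w_{23}$ fixes $x$, $f$, $y$ and sends
  $K$ to $-23/K$, and the orders of all of them at the cusps. The $w_{23}$-invariant functions without poles outside
  the cusps $a/c$ with $4 \mid c$ behave as if there were one single pole, at $\infty$: such a function vanishes as
  soon as its expansion at $\infty$ has only positive exponents. Comparing finitely many coefficients gives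
  $A - x^3/A = -2 - 2x$ and $K - 23/K = y(x^4 + 7x^3 + 18x^2 + 26x + 22)$, hence both equations, since
  $t^2 = (K - 23/K)^2 + 92$. As $x$ and $y$ have pole orders $2$ and $3$, and order $1$ would parametrize an elliptic
  curve rationally, subtracting leading terms shows that the functions just described are the polynomials in $x$
  and $y$. An arbitrary invariant function becomes one of them after multiplication by a polynomial in $x$, and an arbitrary
  function is $a + bt$ with $a$, $b$ invariant. A $\mathbb{Q}$-linear functional on $\mathbb{C}$ turns the resulting
  linear relations into relations over $\mathbb{Q}$.
\<close>

subsection \<open>The cotangent and Lipschitz sums\<close>

text \<open>X_0(92) has just two cusps a/c with \<open>4 dvd c\<close>, namely \<infinity> and one
  that w_23 exchanges with it. On the quotient they become one point at which q is still a local
  parameter, so pole orders there are read off the expansion at \<infinity>. Uniqueness rests on a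
  norm argument: if a holomorphic invariant function, bounded at the other cusps, decays at
  \<infinity>, the product of its finitely many SL_2(Z)-conjugates has level one and decays at the
  only cusp, so it is 0 by the maximum principle. The multipliers work out for arithmetic reasons.
  In f the 24-th roots of unity cancel because 1 + 23 = 24. The form \<kappa> has weight 1 and its
  multiplier involves the nontrivial character modulo 4; the weight produces the 23 in -23/K and the
  residue of 23 modulo 4 the sign. Hence K + 23/K is anti-invariant, and 92 = 4 * 23 is the
  difference of the squares of K + 23/K and K - 23/K. The polynomial in the second relation arises
  by cancelling the leading terms of K - 23/K, whose pole has order 11 = 3 + 2 * 4, against y * x^j;
  so twelve coefficients of every expansion suffice.\<close>

lemma not_nonpos_Int_if_Im: "Im z \<noteq> 0 \<Longrightarrow> z \<notin> \<int>\<^sub>\<le>\<^sub>0"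
  by (auto elim!: nonpos_Ints_cases)

lemma sin_pi_nonzero_if_Im:
  assumes "Im z \<noteq> 0"
  shows "sin (of_real pi * z) \<noteq> 0"
proof
  assume "sin (of_real pi * z) = 0"
  then obtain n where "of_real pi * z = of_real (real_of_int n * pi)" by (auto simp: sin_eq_0)
  hence "Im (of_real pi * z) = 0" by (simp only: Im_complex_of_real)
  thus False using assms by simp
qed

lemma open_Im_nonzero: "open {z::complex. Im z \<noteq> 0}"
proof -
  have "{z::complex. Im z \<noteq> 0} = {z. Im z > 0} \<union> {z. Im z < 0}" by auto
  thus ?thesis using open_halfspace_Im_gt open_halfspace_Im_lt by auto
qed

text \<open>Logarithmic derivative of the reflection formula of Gamma, by which the product
  \<open>?g\<close> of the proof is constant off the real axis.\<close>

lemma Digamma_reflection: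
  assumes "Im z \<noteq> 0"
  shows "Digamma (1 - z) - Digamma z = of_real pi * cot (of_real pi * z)"
proof -
  have nz: "z \<notin> \<int>\<^sub>\<le>\<^sub>0" "1 - z \<notin> \<int>\<^sub>\<le>\<^sub>0"
    using assms by (auto intro!: not_nonpos_Int_if_Im)
  have s: "sin (of_real pi * z) \<noteq> 0" using sin_pi_nonzero_if_Im assms .
  let ?g = "\<lambda>z::complex. Gamma z * Gamma (1 - z) * sin (of_real pi * z)"
  have 1: "(?g has_field_derivative
     (Gamma z * Digamma z * Gamma (1-z) - Gamma z * (Gamma (1-z) * Digamma (1-z))) * sin (of_real pi * z)
      + Gamma z * Gamma (1-z) * (cos (of_real pi * z) * of_real pi)) (at z)"
    by (rule derivative_eq_intros refl nz | simp add: nz algebra_simps)+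
  have 2: "(?g has_field_derivative 0) (at z)"
  proof (rule has_field_derivative_transform_within_open[OF _ open_Im_nonzero])
    show "((\<lambda>_. of_real pi) has_field_derivative 0) (at z)" by simp
  qed (use assms sin_pi_nonzero_if_Im in \<open>auto simp: Gamma_reflection_complex\<close>)
  have "Gamma z * Gamma (1-z) * ((Digamma z - Digamma (1-z)) * sin (of_real pi * z) + cos (of_real pi * z) * of_real pi) = 0"
    using DERIV_unique[OF 1 2] by (simp add: algebra_simps)
  hence "(Digamma z - Digamma (1-z)) * sin (of_real pi * z) + cos (of_real pi * z) * of_real pi = 0"
    using nz by (auto simp: Gamma_eq_zero_iff)
  thus ?thesis using s by (simp add: cot_def field_simps)
qed

lemma Trigamma_reflection:
  assumes "Im z \<noteq> 0"
  shows "Polygamma 1 z + Polygamma 1 (1 - z) = (of_real pi)\<^sup>2 / sin (of_real pi * z) ^ 2"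
proof -
  have nz: "z \<notin> \<int>\<^sub>\<le>\<^sub>0" "1 - z \<notin> \<int>\<^sub>\<le>\<^sub>0"
    using assms by (auto intro!: not_nonpos_Int_if_Im)
  have s: "sin (of_real pi * z) \<noteq> 0" using sin_pi_nonzero_if_Im assms .
  let ?h = "\<lambda>z::complex. Digamma (1 - z) - Digamma z"
  have 1: "(?h has_field_derivative - Polygamma (Suc 0) (1 - z) - Polygamma (Suc 0) z) (at z)"
    by (rule derivative_eq_intros refl | simp add: nz)+
  have "((\<lambda>z. of_real pi * cot (of_real pi * z)) has_field_derivative
       of_real pi * (- inverse (sin (of_real pi * z) ^ 2) * of_real pi)) (at z)"
    by (rule DERIV_cmult, rule DERIV_chain2[where g = "\<lambda>z. of_real pi * z", OF DERIV_cot[OF s]])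
       (rule derivative_eq_intros refl | simp)+
  hence 2: "(?h has_field_derivative of_real pi * (- inverse (sin (of_real pi * z) ^ 2) * of_real pi)) (at z)"
    by (rule has_field_derivative_transform_within_open[OF _ open_Im_nonzero])
       (use assms Digamma_reflection in auto)
  have "- Polygamma (Suc 0) (1 - z) - Polygamma (Suc 0) z =
      of_real pi * (- inverse (sin (of_real pi * z) ^ 2) * of_real pi)"
    by (rule DERIV_unique[OF 1 2])
  hence "Polygamma (Suc 0) z + Polygamma (Suc 0) (1 - z) = of_real pi * of_real pi * inverse (sin (of_real pi * z) ^ 2)"
    by (simp add: algebra_simps)
  thus ?thesis by (simp add: power2_eq_square divide_inverse)
qed

lemma sin_pi_sq:
  "sin (of_real pi * w) ^ 2 = - ((1 - exp (2 * of_real pi * \<i> * w))\<^sup>2 / (4 * exp (2 * of_real pi * \<i> * w)))"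
proof -
  define e where "e = exp (\<i> * (of_real pi * w))"
  have [simp]: "e \<noteq> 0" by (simp add: e_def)
  have E: "exp (2 * of_real pi * \<i> * w) = e\<^sup>2"
    by (simp add: e_def power2_eq_square flip: exp_add) (simp add: algebra_simps)
  have "exp (-(\<i> * (of_real pi * w))) = inverse e" by (simp add: e_def exp_minus)
  hence s: "sin (of_real pi * w) = (e - inverse e) / (2 * \<i>)" by (simp add: sin_exp_eq e_def)
  show ?thesis unfolding E s
    by (simp add: power_divide power_mult_distrib field_simps power2_eq_square)
qed

lemma norm_exp_2pii: "norm (exp (2 * of_real pi * \<i> * w)) = exp (-2 * pi * Im w)"
  by (simp add: norm_exp_eq_Re)

text \<open>Lipschitz's formula of weight 2: the two-sided sum of (w + m)^-2 with the indices m and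
  -(m + 1) paired. Its halves are Trigamma series at w and 1 - w, so the reflection formula
  evaluates it.\<close>

lemma Lipschitz_sums:
  assumes "Im w > 0"
  shows "(\<lambda>m. 1 / (w + of_nat m)^2 + 1 / (w - of_nat (Suc m))^2) sums
      (-4 * (of_real pi)\<^sup>2 * (exp (2 * of_real pi * \<i> * w) / (1 - exp (2 * of_real pi * \<i> * w))\<^sup>2))"
proof -
  have w: "w \<noteq> 0" "1 - w \<noteq> 0" using assms by (auto simp: complex_eq_iff)
  have "(\<lambda>k. inverse ((w + of_nat k)^Suc 1) + inverse ((1 - w + of_nat k)^Suc 1)) sums
     ((-1) ^ Suc 1 * Polygamma 1 w / fact 1 + (-1) ^ Suc 1 * Polygamma 1 (1 - w) / fact 1)"
    by (intro sums_add Polygamma_LIMSEQ w) auto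
  moreover have "inverse ((w + of_nat k)^Suc 1) + inverse ((1 - w + of_nat k)^Suc 1) =
      1 / (w + of_nat k)^2 + 1 / (w - of_nat (Suc k))^2" for k
  proof -
    have "(1 - w + of_nat k)^Suc 1 = (w - of_nat (Suc k))^2"
      by (simp add: power2_eq_square algebra_simps)
    thus ?thesis by (simp add: divide_inverse power2_eq_square del: of_nat_Suc)
  qed
  moreover have "(-1) ^ Suc 1 * Polygamma 1 w / fact 1 + (-1) ^ Suc 1 * Polygamma 1 (1 - w) / fact 1 =
      (of_real pi)\<^sup>2 / sin (of_real pi * w) ^ 2"
  proof -
    have "Polygamma 1 w + Polygamma 1 (1 - w) = (of_real pi)\<^sup>2 / sin (of_real pi * w) ^ 2"
      using assms by (intro Trigamma_reflection) auto
    thus ?thesis by simp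
  qed
  moreover have "(of_real pi)\<^sup>2 / sin (of_real pi * w) ^ 2 =
      -4 * (of_real pi)\<^sup>2 * (exp (2 * of_real pi * \<i> * w) / (1 - exp (2 * of_real pi * \<i> * w))\<^sup>2)"
    by (simp add: sin_pi_sq)
  ultimately show ?thesis by (simp only:)
qed

text \<open>Partial fractions of the cotangent. At w = M / z they sum the correction terms of the
  first M columns in \<open>lattice_sums_swap\<close>.\<close>

lemma cot_sums:
  assumes "Im w \<noteq> 0"
  shows "(\<lambda>n. 1 / (of_nat (Suc n) - w) - 1 / (of_nat (Suc n) + w)) sums
     (1 / w - of_real pi * cot (of_real pi * w))"
proof -
  have w: "w \<noteq> 0" "1 - w \<noteq> 0" "1 + w \<noteq> 0" using assms by (auto simp: complex_eq_iff)
  have D: "(\<lambda>n. inverse (of_nat (Suc n)) - inverse (z + of_nat n)) sums (Digamma z + euler_mascheroni)"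
    if "z \<noteq> 0" for z :: complex
    using summable_Digamma[OF that] by (simp add: Digamma_def summable_sums)
  have "(\<lambda>n. (inverse (of_nat (Suc n)) - inverse (1 + w + of_nat n)) - (inverse (of_nat (Suc n)) - inverse (1 - w + of_nat n)))
     sums ((Digamma (1 + w) + euler_mascheroni) - (Digamma (1 - w) + euler_mascheroni))"
    by (intro sums_diff D w)
  moreover have "Digamma (1 + w) = Digamma w + 1 / w"
    using Digamma_plus1[OF w(1)] by (simp add: add.commute)
  moreover note Digamma_reflection[OF assms]
  ultimately show ?thesis
    by (simp add: algebra_simps divide_inverse)
qed

text \<open>This limit is the source of the term \<open>of_real pi * \<i> / z\<close> in
  \<open>lattice_sums_swap\<close>, and hence of the weight of \<eta>.\<close>

lemma cot_tendsto:
  assumes "Im u < 0"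
  shows "(\<lambda>M. cot (of_real pi * (of_nat M * u))) \<longlonglongrightarrow> \<i>"
proof -
  define r where "r = exp (-(2 * of_real pi * \<i> * u))"
  have "norm r < 1" using assms by (simp add: r_def norm_exp_eq_Re mult_pos_neg)
  hence r: "(\<lambda>M. r ^ M) \<longlonglongrightarrow> 0" by (rule LIMSEQ_power_zero)
  have "cot (of_real pi * (of_nat M * u)) = \<i> * (1 + r ^ M) / (1 - r ^ M)" if "M > 0" for M
  proof -
    define e where "e = exp (\<i> * (of_real pi * (of_nat M * u)))"
    have [simp]: "e \<noteq> 0" by (simp add: e_def)
    have "e\<^sup>2 * r ^ M = 1"
      by (simp add: e_def r_def power2_eq_square algebra_simps flip: exp_of_nat_mult exp_add)
    hence rM: "r ^ M = inverse e ^ 2" by (simp add: field_simps)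
    have "exp (-(\<i> * (of_real pi * (of_nat M * u)))) = inverse e" by (simp add: e_def exp_minus)
    hence "cot (of_real pi * (of_nat M * u)) = ((e + inverse e) / 2) / ((e - inverse e) / (2 * \<i>))"
      by (simp add: cot_def sin_exp_eq cos_exp_eq e_def)
    also have "\<dots> = \<i> * (1 + r ^ M) / (1 - r ^ M)"
    proof (cases "e\<^sup>2 = 1")
      case True
      thus ?thesis unfolding rM by (auto simp: power2_eq_square field_simps)
    next
      case False
      thus ?thesis unfolding rM by (simp add: field_simps power2_eq_square)
    qed
    finally show ?thesis .
  qed
  hence "eventually (\<lambda>M. \<i> * (1 + r ^ M) / (1 - r ^ M) = cot (of_real pi * (of_nat M * u))) sequentially"
    by (intro eventually_mono[OF eventually_gt_at_top[of 0]]) auto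
  moreover have "(\<lambda>M. \<i> * (1 + r ^ M) / (1 - r ^ M)) \<longlonglongrightarrow> \<i> * (1 + 0) / (1 - 0)"
    by (intro tendsto_intros r) auto
  ultimately show ?thesis using Lim_transform_eventually by fastforce
qed

subsection \<open>Interchange of the conditionally convergent lattice sum\<close>

lemma double_sums_swap:
  fixes e :: "nat \<Rightarrow> nat \<Rightarrow> complex" and b :: "nat \<Rightarrow> real"
  assumes b: "summable b" "\<And>n. b n \<ge> 0" and le: "\<And>n m. norm (e n m) \<le> C * (b n * b m)"
  obtains X r c where "\<And>n. e n sums r n" "r sums X" "\<And>m. (\<lambda>n. e n m) sums c m" "c sums X"
proof -
  have bs: "b summable_on UNIV"
    using b by (intro summable_nonneg_imp_summable_on) auto
  have "(\<lambda>(n,m). b n * b m) summable_on UNIV \<times> UNIV"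
    using bs b by (intro summable_on_SigmaI[where g = "\<lambda>n. b n * infsum b UNIV"])
      (auto intro!: summable_on_cmult_left has_sum_cmult_right has_sum_infsum)
  hence "(\<lambda>p. C * (case p of (n,m) \<Rightarrow> b n * b m)) summable_on UNIV \<times> UNIV"
    by (rule summable_on_cmult_right)
  hence "(\<lambda>p. norm ((\<lambda>(n,m). e n m) p)) summable_on UNIV \<times> UNIV"
    by (rule Infinite_Sum.abs_summable_on_comparison_test') (use le in auto)
  hence sm: "(\<lambda>(n,m). e n m) summable_on UNIV \<times> UNIV"
    by (rule abs_summable_summable)
  have rowsum: "e n summable_on UNIV" for n
    using summable_on_SigmaD1[OF sm, of n] by simp
  have sm': "(\<lambda>(m,n). e n m) summable_on UNIV \<times> UNIV"
    using sm by (subst summable_on_swap) auto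
  have colsum: "(\<lambda>n. e n m) summable_on UNIV" for m
    using summable_on_SigmaD1[OF sm', of m] by simp
  have "((\<lambda>(n,m). e n m) has_sum infsum (\<lambda>(n,m). e n m) (UNIV \<times> UNIV)) (UNIV \<times> UNIV)"
    using sm by (rule has_sum_infsum)
  hence 1: "((\<lambda>n. infsum (e n) UNIV) has_sum infsum (\<lambda>(n,m). e n m) (UNIV \<times> UNIV)) UNIV"
    by (rule has_sum_SigmaD) (use rowsum in auto)
  have "((\<lambda>(m,n). e n m) has_sum infsum (\<lambda>(n,m). e n m) (UNIV \<times> UNIV)) (UNIV \<times> UNIV)"
    using has_sum_infsum[OF sm] by (subst has_sum_swap) auto
  hence 2: "((\<lambda>m. infsum (\<lambda>n. e n m) UNIV) has_sum infsum (\<lambda>(n,m). e n m) (UNIV \<times> UNIV)) UNIV"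
    by (rule has_sum_SigmaD) (use colsum in auto)
  show ?thesis
    by (rule that[of "\<lambda>n. infsum (e n) UNIV" "infsum (\<lambda>(n,m). e n m) (UNIV \<times> UNIV)" "\<lambda>m. infsum (\<lambda>n. e n m) UNIV"])
       (use rowsum colsum 1 2 in \<open>auto intro: has_sum_imp_sums\<close>)
qed

lemma lattice_lower_bound:
  assumes "Im z > 0"
  obtains k where "k > 0" "\<And>u v::real. norm (of_real u * z + of_real v) \<ge> k * (\<bar>u\<bar> + \<bar>v\<bar>)"
proof -
  define A where "A = 1 / Im z + 1 + norm z / Im z"
  have A: "A > 0" using assms by (auto simp: A_def intro!: add_pos_nonneg)
  have "norm (of_real u * z + of_real v) \<ge> (1 / A) * (\<bar>u\<bar> + \<bar>v\<bar>)" for u v :: real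
  proof -
    define N where "N = norm (of_real u * z + of_real v)"
    have "\<bar>Im (of_real u * z + of_real v)\<bar> \<le> N" unfolding N_def by (rule abs_Im_le_cmod)
    hence u: "\<bar>u\<bar> * Im z \<le> N" using assms by (simp add: abs_mult)
    hence u': "\<bar>u\<bar> \<le> N / Im z" using assms by (simp add: field_simps)
    have "norm (of_real v :: complex) \<le> N + norm (of_real u * z)"
      unfolding N_def by (metis add_diff_cancel_left' norm_triangle_ineq4 add.commute)
    hence "\<bar>v\<bar> \<le> N + \<bar>u\<bar> * norm z" by (simp add: norm_mult)
    also have "\<bar>u\<bar> * norm z \<le> N / Im z * norm z" using u' by (intro mult_right_mono) auto
    finally have "\<bar>u\<bar> + \<bar>v\<bar> \<le> N * A" using u' by (simp add: A_def algebra_simps)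
    thus ?thesis using A by (simp add: N_def field_simps)
  qed
  thus ?thesis using A by (intro that[of "1 / A"]) auto
qed

text \<open>Splits an inverse cube evenly between two indices: the exponent -3/2 is still summable,
  and the product of two weights dominates x^-3 for every x above both indices.\<close>

definition cube_weight :: "nat \<Rightarrow> real" where "cube_weight n = real (Suc n) powr (-3/2)"

lemma cube_weight: "summable cube_weight" "cube_weight n \<ge> 0"
proof -
  have "summable (\<lambda>n. real (Suc n) powr (-3/2))"
    using summable_real_powr_iff[of "-3/2"] by (subst summable_Suc_iff) simp
  thus "summable cube_weight" by (simp add: cube_weight_def[abs_def])
qed (simp add: cube_weight_def)

lemma cube_weight_bound:
  assumes "x \<ge> real (Suc n)" "x \<ge> real (Suc m)"
  shows "1 / x ^ 3 \<le> cube_weight n * cube_weight m"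
proof -
  have x: "x > 0" using assms by simp
  have "x powr (-3/2) * x powr (-3/2) = x powr (-3)" by (simp flip: powr_add)
  also have "\<dots> = 1 / x ^ 3" using x powr_realpow[of x 3] by (simp add: powr_minus_divide)
  finally have "1 / x ^ 3 = x powr (-3/2) * x powr (-3/2)" ..
  also have "\<dots> \<le> cube_weight n * cube_weight m"
    unfolding cube_weight_def using assms by (intro mult_mono powr_mono2') auto
  finally show ?thesis .
qed

text \<open>The double sum of (n z + m)^-2 converges only conditionally, and its two orders of
  summation differ. Subtracting a comparison term \<open>b\<close> that telescopes in m leaves terms
  of cubic decay, which may be interchanged. The rows of \<open>b\<close> sum to 0, whereas its
  columns, summed over n first, leave a cotangent whose limit is the discrepancy.\<close>

lemma lattice_sums_swap:
  assumes z: "Im z > 0"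
  defines "a \<equiv> \<lambda>n m. 1 / (of_nat (Suc n) * z + of_nat m)^2 + 1 / (of_nat (Suc n) * z - of_nat (Suc m))^2"
  assumes row: "\<And>n. a n sums R n" and col: "\<And>m. (\<lambda>n. a n m) sums S m"
  obtains X where "R sums X" "S sums (X - of_real pi * \<i> / z)"
proof -
  have z0: "z \<noteq> 0" using z by auto
  obtain k where k: "k > 0" "\<And>u v::real. norm (of_real u * z + of_real v) \<ge> k * (\<bar>u\<bar> + \<bar>v\<bar>)"
    using lattice_lower_bound[OF z] by metis
  define \<nu> where "\<nu> = (\<lambda>n. of_nat (Suc n) * z)"
  have nz: "\<nu> n + of_real r \<noteq> 0" for n r
  proof -
    have "Im (\<nu> n + of_real r) = real (Suc n) * Im z" by (simp add: \<nu>_def)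
    also have "\<dots> > 0" using z by simp
    finally show ?thesis by (metis less_irrefl zero_complex.simps(2))
  qed
  have nz1: "\<nu> n + of_nat m \<noteq> 0" "\<nu> n - of_nat m \<noteq> 0" for n m
    using nz[of n "real m"] nz[of n "-real m"] by auto
  have lower: "norm (\<nu> n + of_nat m) \<ge> k * real (Suc n + m)" "norm (\<nu> n - of_nat m) \<ge> k * real (Suc n + m)" for n m
    using k(2)[of "real (Suc n)" "real m"] k(2)[of "real (Suc n)" "-real m"] by (auto simp: \<nu>_def add.assoc)
  \<comment> \<open>Up to cubic error 1/p^2 is 1/p - 1/(p + 1); each half of \<open>a\<close> is
    replaced by such a difference.\<close>
  define b where "b = (\<lambda>n m. (1 / (\<nu> n + of_nat m) - 1 / (\<nu> n + of_nat (Suc m)))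
                    + (1 / (\<nu> n - of_nat (Suc m)) - 1 / (\<nu> n - of_nat m)))"
  define e where "e = (\<lambda>n m. a n m - b n m)"
  have e_eq: "e n m = 1 / ((\<nu> n + of_nat m)^2 * (\<nu> n + of_nat (Suc m))) + 1 / ((\<nu> n - of_nat (Suc m))^2 * (\<nu> n - of_nat m))" for n m
  proof -
    have 1: "1 / p^2 - (1 / p - 1 / (p + 1)) = 1 / (p^2 * (p + 1))" if "p \<noteq> 0" "p + 1 \<noteq> 0" for p :: complex
      using that by (simp add: divide_simps power2_eq_square)
    have "e n m = (1 / (\<nu> n + of_nat m)^2 - (1 / (\<nu> n + of_nat m) - 1 / (\<nu> n + of_nat (Suc m)))) +
       (1 / (\<nu> n - of_nat (Suc m))^2 - (1 / (\<nu> n - of_nat (Suc m)) - 1 / (\<nu> n - of_nat m)))"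
      unfolding e_def a_def b_def \<nu>_def by (rule add_diff_add)
    also have "\<nu> n + of_nat (Suc m) = (\<nu> n + of_nat m) + 1" by simp
    also have "1 / (\<nu> n + of_nat m)^2 - (1 / (\<nu> n + of_nat m) - 1 / ((\<nu> n + of_nat m) + 1)) =
       1 / ((\<nu> n + of_nat m)^2 * ((\<nu> n + of_nat m) + 1))"
      by (rule 1) (use nz1(1)[of n m] nz1(1)[of n "Suc m"] in \<open>simp_all add: add_ac\<close>)
    also have "\<nu> n - of_nat m = (\<nu> n - of_nat (Suc m)) + 1" by simp
    also have "1 / (\<nu> n - of_nat (Suc m))^2 - (1 / (\<nu> n - of_nat (Suc m)) - 1 / ((\<nu> n - of_nat (Suc m)) + 1)) =
       1 / ((\<nu> n - of_nat (Suc m))^2 * ((\<nu> n - of_nat (Suc m)) + 1))"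
      by (rule 1) (use nz1(2)[of n m] nz1(2)[of n "Suc m"] in \<open>simp_all add: diff_diff_eq\<close>)
    finally show ?thesis by (simp add: add_ac diff_diff_eq)
  qed
  have bound: "norm (e n m) \<le> (2 / k ^ 3) * (cube_weight n * cube_weight m)" for n m
  proof -
    define x where "x = real (Suc n + m)"
    have x: "x \<ge> real (Suc n)" "x \<ge> real (Suc m)" "x > 0" by (auto simp: x_def)
    have cubic: "norm (1 / (p^2 * q)) \<le> 1 / (k ^ 3 * x ^ 3)" if "norm p \<ge> k * x" "norm q \<ge> k * x" for p q :: complex
    proof -
      have "(k * x) ^ 2 * (k * x) \<le> norm p ^ 2 * norm q"
        using that k(1) x by (intro mult_mono power_mono) auto
      hence "k ^ 3 * x ^ 3 \<le> norm (p^2 * q)"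
        by (simp add: norm_mult norm_power power2_eq_square power3_eq_cube mult_ac)
      thus ?thesis using k(1) x by (simp add: norm_divide frac_le)
    qed
    have "k * x \<le> k * real (Suc n + Suc m)" using k(1) by (simp add: x_def)
    hence l: "k * x \<le> norm (\<nu> n + of_nat (Suc m))" "k * x \<le> norm (\<nu> n - of_nat (Suc m))"
       "k * x \<le> norm (\<nu> n + of_nat m)" "k * x \<le> norm (\<nu> n - of_nat m)"
      using lower[of n "Suc m"] lower[of n m] unfolding x_def by linarith+
    have "norm (e n m) \<le> 1 / (k ^ 3 * x ^ 3) + 1 / (k ^ 3 * x ^ 3)"
      unfolding e_eq by (rule order.trans[OF norm_triangle_ineq]) (intro add_mono cubic l)
    also have "\<dots> = (2 / k ^ 3) * (1 / x ^ 3)" by simp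
    also have "\<dots> \<le> (2 / k ^ 3) * (cube_weight n * cube_weight m)"
      using k(1) x by (intro mult_left_mono cube_weight_bound) auto
    finally show ?thesis .
  qed
  obtain X r c where X: "\<And>n. e n sums r n" "r sums X" "\<And>m. (\<lambda>n. e n m) sums c m" "c sums X"
    using double_sums_swap[OF cube_weight bound] by metis
  have brow: "b n sums 0" for n
  proof -
    have lim0: "(\<lambda>m. 1 / (w + of_nat m)) \<longlonglongrightarrow> 0" for w :: complex
      by (rule tendsto_divide_0[OF tendsto_const tendsto_add_filterlim_at_infinity[OF tendsto_const tendsto_of_nat]])
    have lim: "(\<lambda>m. 1 / (\<nu> n + of_nat m)) \<longlonglongrightarrow> 0" by (rule lim0)
    have "(\<lambda>m. - (1 / (- \<nu> n + of_nat m))) \<longlonglongrightarrow> - 0" by (rule tendsto_minus[OF lim0])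
    moreover have "- (1 / (- \<nu> n + of_nat m)) = 1 / (\<nu> n - of_nat m)" for m
      by (metis minus_diff_eq minus_divide_right uminus_add_conv_diff)
    ultimately have lim': "(\<lambda>m. 1 / (\<nu> n - of_nat m)) \<longlonglongrightarrow> 0" by (simp only: minus_zero)
    have "(\<lambda>m. (1 / (\<nu> n + of_nat m) - 1 / (\<nu> n + of_nat (Suc m)))
                    + (1 / (\<nu> n - of_nat (Suc m)) - 1 / (\<nu> n - of_nat m))) sums
          ((1 / (\<nu> n + of_nat 0) - 0) + (0 - 1 / (\<nu> n - of_nat 0)))"
      by (intro sums_add telescope_sums[OF lim'] telescope_sums'[OF lim])
    thus ?thesis by (simp add: b_def)
  qed
  have "r n = R n" for n
  proof -
    have "(\<lambda>m. a n m - b n m) sums (R n - 0)" by (rule sums_diff[OF row brow])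
    moreover have "(\<lambda>m. a n m - b n m) sums r n" using X(1)[of n] by (simp add: e_def)
    ultimately show ?thesis using sums_unique2 by fastforce
  qed
  hence RX: "R sums X" using X(2) by presburger
  \<comment> \<open>The first M columns of \<open>b\<close>, added along row n. Their sum over n is
    a cotangent at M / z; only afterwards does M tend to infinity.\<close>
  define t where "t = (\<lambda>M n. 1 / (\<nu> n - of_nat M) - 1 / (\<nu> n + of_nat M))"
  define u where "u = 1 / z"
  have Imu: "Im u < 0" using z by (simp add: u_def Im_divide divide_neg_pos sum_power2_gt_zero_iff)
  have bcol: "(\<Sum>m<M. b n m) = t M n" for M n
    by (induction M) (simp_all add: b_def t_def)
  have tsum: "t M sums (u * (1 / (of_nat M * u) - of_real pi * cot (of_real pi * (of_nat M * u))))" if "M > 0" for M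
  proof -
    have "Im (of_nat M * u) \<noteq> 0" using Imu that by simp
    from sums_mult[OF cot_sums[OF this], of u]
    have "(\<lambda>n. u * (1 / (of_nat (Suc n) - of_nat M * u) - 1 / (of_nat (Suc n) + of_nat M * u))) sums
      (u * (1 / (of_nat M * u) - of_real pi * cot (of_real pi * (of_nat M * u))))" .
    moreover have "u * (1 / (of_nat (Suc n) - of_nat M * u) - 1 / (of_nat (Suc n) + of_nat M * u)) = t M n" for n
    proof -
      have "of_nat (Suc n) - of_nat M * u = (\<nu> n - of_nat M) / z" "of_nat (Suc n) + of_nat M * u = (\<nu> n + of_nat M) / z"
        using z0 by (simp_all add: u_def \<nu>_def field_simps)
      thus ?thesis using z0 by (simp add: u_def t_def field_simps)
    qed
    ultimately show ?thesis by simp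
  qed
  have part: "(\<Sum>m<M. S m) = (\<Sum>m<M. c m) + u * (1 / (of_nat M * u) - of_real pi * cot (of_real pi * (of_nat M * u)))"
    if "M > 0" for M
  proof -
    have "(\<lambda>n. (\<Sum>m<M. a n m)) sums (\<Sum>m<M. S m)" by (intro sums_sum col)
    moreover have "(\<lambda>n. (\<Sum>m<M. e n m)) sums (\<Sum>m<M. c m)" by (intro sums_sum X)
    ultimately have "(\<lambda>n. (\<Sum>m<M. a n m) - (\<Sum>m<M. e n m)) sums ((\<Sum>m<M. S m) - (\<Sum>m<M. c m))"
      by (rule sums_diff)
    moreover have "(\<Sum>m<M. a n m) - (\<Sum>m<M. e n m) = t M n" for n
      by (simp add: e_def sum_subtractf bcol)
    ultimately have "t M sums ((\<Sum>m<M. S m) - (\<Sum>m<M. c m))" by simp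
    from sums_unique2[OF this tsum[OF that]] show ?thesis by (simp add: algebra_simps)
  qed
  have "(\<lambda>M. (\<Sum>m<M. c m) + u * (1 / (of_nat M * u) - of_real pi * cot (of_real pi * (of_nat M * u))))
     \<longlonglongrightarrow> X + u * (0 - of_real pi * \<i>)"
  proof (intro tendsto_intros cot_tendsto Imu)
    show "(\<lambda>M. \<Sum>m<M. c m) \<longlonglongrightarrow> X" using X(4) by (simp add: sums_def)
    have "(\<lambda>M. (1 / u) * (1 / of_nat M)) \<longlonglongrightarrow> (1 / u) * 0"
      by (intro tendsto_intros lim_1_over_n)
    thus "(\<lambda>M. 1 / (of_nat M * u)) \<longlonglongrightarrow> 0" by (simp add: mult.commute)
  qed
  hence "(\<lambda>M. \<Sum>m<M. S m) \<longlonglongrightarrow> X + u * (0 - of_real pi * \<i>)"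
    by (rule Lim_transform_eventually)
       (use part in \<open>auto intro!: eventually_mono[OF eventually_gt_at_top[of 0]]\<close>)
  hence "S sums (X - of_real pi * \<i> / z)" by (simp add: sums_def u_def)
  with RX show ?thesis by (rule that)
qed

subsection \<open>The inversion formula for the logarithm of \<open>\<eta>\<close>\<close>

definition divisor_sum :: "nat \<Rightarrow> nat" where "divisor_sum n = (\<Sum>d | d dvd n. d)"

lemma divisor_sum_0 [simp]: "divisor_sum 0 = 0"
  by (simp add: divisor_sum_def)

lemma divisor_sum_le: "divisor_sum n \<le> n * n"
proof (cases "n = 0")
  case False
  hence "{d. d dvd n} \<subseteq> {1..n}" by (auto dest: dvd_imp_le intro!: Suc_leI Nat.gr0I)
  hence "divisor_sum n \<le> (\<Sum>d\<in>{1..n}. n)"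
    unfolding divisor_sum_def by (intro order.trans[OF sum_mono2 sum_mono]) auto
  thus ?thesis by simp
qed simp

text \<open>$\log \prod_{n \ge 1} (1 - q^n)$; the quotient at \<open>n = 0\<close> is \<open>0 / 0 = 0\<close>.\<close>
definition eta_log_fps :: "complex fps" where
  "eta_log_fps = Abs_fps (\<lambda>n. - of_nat (divisor_sum n) / of_nat n)"

lemma eta_log_fps_conv_radius: "fps_conv_radius eta_log_fps \<ge> 1"
  unfolding fps_conv_radius_def one_ereal_def
proof (rule conv_radius_geI_ex)
  fix r :: real assume r: "0 < r" "ereal r < ereal 1"
  have "summable (\<lambda>n. of_nat (Suc n) * r ^ n)"
    using geometric_deriv_sums[of r] r by (auto simp: sums_iff)
  hence "summable (\<lambda>n. fps_nth eta_log_fps n * of_real r ^ n)"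
  proof (rule summable_comparison_test'[of _ 0])
    fix n :: nat
    have "real (divisor_sum n) / real n \<le> real (Suc n)"
    proof (cases "n = 0")
      case False
      have "real (divisor_sum n) \<le> real (n * n)" using divisor_sum_le[of n] by (simp only: of_nat_le_iff)
      thus ?thesis using False by (simp add: field_simps)
    qed auto
    hence "real (divisor_sum n) / real n * r ^ n \<le> real (Suc n) * r ^ n"
      using r by (intro mult_right_mono) auto
    thus "norm (fps_nth eta_log_fps n * of_real r ^ n) \<le> of_nat (Suc n) * r ^ n"
      using r by (simp add: eta_log_fps_def norm_mult norm_divide norm_power)
  qed
  thus "\<exists>z::complex. norm z = r \<and> summable (\<lambda>n. fps_nth eta_log_fps n * z ^ n)"
    using r by (intro exI[of _ "of_real r"]) auto
qed

text \<open>Both series rearrange the sum of k q^(n k) over positive n and k. Summing over k first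
  gives derivatives of geometric series; collecting the terms with the same product n k gives the
  divisor sums.\<close>

lemma Lambert_sums:
  fixes q :: complex
  assumes q: "norm q < 1"
  obtains L where "(\<lambda>n. of_nat (divisor_sum n) * q ^ n) sums L"
    "(\<lambda>n. q ^ Suc n / (1 - q ^ Suc n)\<^sup>2) sums L"
proof -
  define f where "f = (\<lambda>(n,k). of_nat (Suc k) * (q ^ Suc n) ^ Suc k)"
  have gs: "(\<lambda>k. of_nat (Suc k) * x ^ Suc k) sums (x / (1 - x)\<^sup>2)" if "norm x < 1" for x :: "'b :: {real_normed_field, banach}"
    using sums_mult[OF geometric_deriv_sums[OF that], of x] by (simp add: mult_ac)
  have qn: "norm (q ^ Suc n) < 1" for n
    using q by (simp add: norm_power power_less_one_iff del: power_Suc)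
  define r where "r = norm q"
  have r: "r \<ge> 0" "r < 1" using q by (auto simp: r_def)
  have "(\<lambda>p. norm (f p)) summable_on UNIV \<times> UNIV"
  proof (rule summable_on_SigmaI)
    fix n :: nat
    have "(\<lambda>k. of_nat (Suc k) * (r ^ Suc n) ^ Suc k) sums (r ^ Suc n / (1 - r ^ Suc n)\<^sup>2)"
      using qn[of n] by (intro gs) (simp add: r_def norm_power norm_mult)
    hence "((\<lambda>k. of_nat (Suc k) * (r ^ Suc n) ^ Suc k) has_sum (r ^ Suc n / (1 - r ^ Suc n)\<^sup>2)) UNIV"
      by (intro sums_nonneg_imp_has_sum) (use r in auto)
    thus "((\<lambda>k. norm (f (n, k))) has_sum (r ^ Suc n / (1 - r ^ Suc n)\<^sup>2)) UNIV"
      by (simp add: f_def norm_mult norm_power r_def del: power_Suc of_nat_Suc)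
  next
    have "summable (\<lambda>n. r ^ Suc n * (1 / (1 - r)\<^sup>2))"
      using r by (intro summable_mult2 summable_ignore_initial_segment[where k = 1, simplified] summable_geometric) auto
    hence "summable (\<lambda>n. r ^ Suc n / (1 - r ^ Suc n)\<^sup>2)"
    proof (rule summable_comparison_test'[of _ 0])
      fix n :: nat
      have "r ^ Suc n \<le> r" using r power_decreasing[of 1 "Suc n" r] by simp
      hence "r ^ Suc n / (1 - r ^ Suc n)\<^sup>2 \<le> r ^ Suc n / (1 - r)\<^sup>2"
        using r by (intro divide_left_mono power_mono mult_pos_pos zero_less_power) auto
      thus "norm (r ^ Suc n / (1 - r ^ Suc n)\<^sup>2) \<le> r ^ Suc n * (1 / (1 - r)\<^sup>2)"
        using r by (simp add: abs_mult)
    qed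
    thus "(\<lambda>n. r ^ Suc n / (1 - r ^ Suc n)\<^sup>2) summable_on UNIV"
      using r by (intro summable_nonneg_imp_summable_on) auto
  qed auto
  hence fs: "f summable_on UNIV \<times> UNIV" by (rule abs_summable_summable)
  define L where "L = infsum f (UNIV \<times> UNIV)"
  have fL: "(f has_sum L) (UNIV \<times> UNIV)" using fs unfolding L_def by (rule has_sum_infsum)
  have "((\<lambda>n. q ^ Suc n / (1 - q ^ Suc n)\<^sup>2) has_sum L) UNIV"
  proof (rule has_sum_SigmaD[OF fL])
    fix n :: nat
    have "(\<lambda>k. f (n, k)) summable_on UNIV"
      using summable_on_SigmaD1[of "\<lambda>n k. f (n,k)" UNIV "\<lambda>_. UNIV" n] fs by (simp add: case_prod_unfold)
    then obtain s where s: "((\<lambda>k. f (n, k)) has_sum s) UNIV" by (auto simp: summable_on_def)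
    hence "(\<lambda>k. f (n, k)) sums s" by (rule has_sum_imp_sums)
    moreover have "(\<lambda>k. f (n, k)) sums (q ^ Suc n / (1 - q ^ Suc n)\<^sup>2)"
      using gs[OF qn[of n]] by (simp add: f_def del: power_Suc of_nat_Suc)
    ultimately have "s = q ^ Suc n / (1 - q ^ Suc n)\<^sup>2" by (rule sums_unique2)
    with s show "((\<lambda>k. f (n, k)) has_sum (q ^ Suc n / (1 - q ^ Suc n)\<^sup>2)) UNIV" by simp
  qed
  hence 1: "(\<lambda>n. q ^ Suc n / (1 - q ^ Suc n)\<^sup>2) sums L" by (rule has_sum_imp_sums)
  define g where "g = (\<lambda>(N,d). of_nat d * q ^ N :: complex)"
  \<comment> \<open>The bijection between pairs (n, k) of positive integers and pairs (N, d) with d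
    dividing N, given by N = n k and d = k. The shifts by one occur because \<open>n\<close> and
    \<open>k\<close> start at 0.\<close>
  define i j where "i = (\<lambda>(N::nat,d::nat). (N div d - 1, d - 1))" and "j = (\<lambda>(n,k). (Suc n * Suc k, Suc k))"
  have "(f has_sum L) (UNIV \<times> UNIV) \<longleftrightarrow> (g has_sum L) (SIGMA N:{1..}. {d. d dvd N})"
  proof (rule has_sum_reindex_bij_witness[where i = i and j = j])
    show "i (j a) = a" "j a \<in> (SIGMA N:{1..}. {d. d dvd N})" for a
      by (auto simp: i_def j_def simp del: mult_Suc mult_Suc_right split: prod.splits)
    show "j (i b) = b" if "b \<in> (SIGMA N:{1..}. {d. d dvd N})" for b
    proof -
      obtain N d where [simp]: "b = (N, d)" by (cases b)
      from that obtain e where e: "N = d * e" "N \<ge> 1" by auto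
      then obtain d' e' where "d = Suc d'" "e = Suc e'" by (cases d; cases e) auto
      thus ?thesis using e by (simp add: i_def j_def mult.commute[of "Suc d'"] del: mult_Suc mult_Suc_right)
    qed
    show "g (j a) = f a" for a
      by (cases a) (simp only: g_def f_def j_def case_prod_conv power_mult)
  qed auto
  with fL have "(g has_sum L) (SIGMA N:{1..}. {d. d dvd N})" by simp
  hence "((\<lambda>N. of_nat (divisor_sum N) * q ^ N) has_sum L) {1..}"
  proof (rule has_sum_SigmaD)
    fix N :: nat assume "N \<in> {1..}"
    hence "finite {d. d dvd N}" by auto
    hence "((\<lambda>d. g (N, d)) has_sum (\<Sum>d | d dvd N. g (N, d))) {d. d dvd N}"
      by (rule has_sum_finite)
    thus "((\<lambda>d. g (N, d)) has_sum of_nat (divisor_sum N) * q ^ N) {d. d dvd N}"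
      by (simp add: g_def divisor_sum_def sum_distrib_right)
  qed
  also have "?this \<longleftrightarrow> ((\<lambda>N. of_nat (divisor_sum N) * q ^ N) has_sum L) UNIV"
    by (rule has_sum_cong_neutral) (auto simp: not_le)
  finally have "(\<lambda>n. of_nat (divisor_sum n) * q ^ n) sums L" by (rule has_sum_imp_sums)
  from this 1 show ?thesis by (rule that)
qed

text \<open>A holomorphic logarithm of Dedekind's \<eta>. Eta quotients are exponentials of integer
  combinations of its values, so no branch has to be chosen for them.\<close>

definition eta_log :: "complex \<Rightarrow> complex" where
  "eta_log z = of_real pi * \<i> * z / 12 + eval_fps eta_log_fps (exp (2 * of_real pi * \<i> * z))"

lemma norm_q_less_1: "Im z > 0 \<Longrightarrow> norm (exp (2 * of_real pi * \<i> * z)) < 1"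
  by (simp add: norm_exp_2pii)

text \<open>The derivative is (pi i / 12) E_2 with the Eisenstein series E_2 = 1 - 24 L.\<close>

lemma eta_log_has_field_derivative:
  assumes z: "Im z > 0"
    and L: "(\<lambda>n. of_nat (divisor_sum n) * exp (2 * of_real pi * \<i> * z) ^ n) sums L"
  shows "(eta_log has_field_derivative of_real pi * \<i> / 12 - 2 * of_real pi * \<i> * L) (at z)"
proof -
  define q where "q = exp (2 * of_real pi * \<i> * z)"
  have q: "norm q < 1" using norm_q_less_1[OF z] by (simp add: q_def)
  have qr: "ereal (norm q) < fps_conv_radius eta_log_fps"
    using q by (intro less_le_trans[OF _ eta_log_fps_conv_radius]) (simp add: one_ereal_def)
  have rd: "fps_conv_radius (fps_deriv eta_log_fps) \<ge> 1"
    using order.trans[OF eta_log_fps_conv_radius fps_conv_radius_deriv] .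
  have qrd: "ereal (norm q) < fps_conv_radius (fps_deriv eta_log_fps)"
    using q by (intro less_le_trans[OF _ rd]) (simp add: one_ereal_def)
  have "(\<lambda>n. fps_nth (fps_deriv eta_log_fps) n * q ^ n) sums eval_fps (fps_deriv eta_log_fps) q"
    using qrd by (rule sums_eval_fps)
  hence "(\<lambda>n. q * (fps_nth (fps_deriv eta_log_fps) n * q ^ n)) sums (q * eval_fps (fps_deriv eta_log_fps) q)"
    by (rule sums_mult)
  moreover have "q * (fps_nth (fps_deriv eta_log_fps) n * q ^ n) = - (of_nat (divisor_sum (Suc n)) * q ^ Suc n)" for n
    by (simp add: eta_log_fps_def del: of_nat_Suc)
  ultimately have "(\<lambda>n. - (of_nat (divisor_sum (Suc n)) * q ^ Suc n)) sums (q * eval_fps (fps_deriv eta_log_fps) q)"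
    by simp
  moreover have "(\<lambda>n. of_nat (divisor_sum (Suc n)) * q ^ Suc n) sums L"
    using L by (subst sums_Suc_iff) (simp add: q_def)
  hence "(\<lambda>n. - (of_nat (divisor_sum (Suc n)) * q ^ Suc n)) sums - L" by (rule sums_minus)
  ultimately have qS: "q * eval_fps (fps_deriv eta_log_fps) q = - L" by (rule sums_unique2)
  have "((\<lambda>w. of_real pi * \<i> * w / 12 + eval_fps eta_log_fps (exp (2 * of_real pi * \<i> * w))) has_field_derivative
    of_real pi * \<i> / 12 + eval_fps (fps_deriv eta_log_fps) q * (q * (2 * of_real pi * \<i>))) (at z)"
  proof (intro DERIV_add)
    show "((\<lambda>w. eval_fps eta_log_fps (exp (2 * of_real pi * \<i> * w))) has_field_derivative
          eval_fps (fps_deriv eta_log_fps) q * (q * (2 * of_real pi * \<i>))) (at z)"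
    proof (rule DERIV_chain2[where f = "eval_fps eta_log_fps" and g = "\<lambda>w. exp (2 * of_real pi * \<i> * w)"])
      show "(eval_fps eta_log_fps has_field_derivative eval_fps (fps_deriv eta_log_fps) q) (at (exp (2 * of_real pi * \<i> * z)))"
        unfolding q_def[symmetric] using qr by (rule has_field_derivative_eval_fps)
      show "((\<lambda>w. exp (2 * of_real pi * \<i> * w)) has_field_derivative q * (2 * of_real pi * \<i>)) (at z)"
        by (rule derivative_eq_intros refl | simp add: q_def)+
    qed
  qed (rule derivative_eq_intros refl | simp)+
  moreover have "eval_fps (fps_deriv eta_log_fps) q * (q * (2 * of_real pi * \<i>)) = - 2 * of_real pi * \<i> * L"
  proof -
    have "eval_fps (fps_deriv eta_log_fps) q * (q * (2 * of_real pi * \<i>)) =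
        (q * eval_fps (fps_deriv eta_log_fps) q) * (2 * of_real pi * \<i>)" by (simp only: mult_ac)
    thus ?thesis unfolding qS by simp
  qed
  ultimately show ?thesis by (simp add: eta_log_def[abs_def])
qed

text \<open>In terms of E_2 = 1 - 24 L this is E_2(-1/z) = z^2 E_2(z) + 6 z / (pi i). After division
  by z^2 the rows of the lattice sum at -1/z are columns of the one at z, so the anomalous term is
  the one found in \<open>lattice_sums_swap\<close>.\<close>

lemma divisor_sum_series_inversion:
  assumes z: "Im z > 0"
    and L: "(\<lambda>n. of_nat (divisor_sum n) * exp (2 * of_real pi * \<i> * z) ^ n) sums L"
    and L': "(\<lambda>n. of_nat (divisor_sum n) * exp (2 * of_real pi * \<i> * (-1/z)) ^ n) sums L'"
  shows "L' / z\<^sup>2 = L - 1 / 24 + \<i> / (4 * of_real pi * z) + 1 / (24 * z\<^sup>2)"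
proof -
  have z0: "z \<noteq> 0" using z by auto
  have w: "Im (-1/z) > 0" using z by (simp add: Im_divide sum_power2_gt_zero_iff)
  define Q where "Q = (\<lambda>w::complex. \<lambda>n. -4 * (of_real pi)\<^sup>2 * (exp (2 * of_real pi * \<i> * w) ^ Suc n / (1 - exp (2 * of_real pi * \<i> * w) ^ Suc n)\<^sup>2))"
  have rows: "(\<lambda>m. 1 / (of_nat (Suc n) * w + of_nat m)^2 + 1 / (of_nat (Suc n) * w - of_nat (Suc m))^2) sums Q w n"
    if "Im w > 0" for w n
  proof -
    have "exp (2 * of_real pi * \<i> * (of_nat (Suc n) * w)) = exp (2 * of_real pi * \<i> * w) ^ Suc n"
      by (subst exp_of_nat_mult [symmetric]) (simp add: algebra_simps)
    thus ?thesis using Lipschitz_sums[of "of_nat (Suc n) * w"] that by (simp only: Q_def) simp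
  qed
  have Qs: "Q w sums (-4 * (of_real pi)\<^sup>2 * M)"
    if w': "Im w > 0" and M: "(\<lambda>n. of_nat (divisor_sum n) * exp (2 * of_real pi * \<i> * w) ^ n) sums M" for w M
  proof -
    obtain N where N: "(\<lambda>n. of_nat (divisor_sum n) * exp (2 * of_real pi * \<i> * w) ^ n) sums N"
      "(\<lambda>n. exp (2 * of_real pi * \<i> * w) ^ Suc n / (1 - exp (2 * of_real pi * \<i> * w) ^ Suc n)\<^sup>2) sums N"
      using Lambert_sums[OF norm_q_less_1[OF w']] by blast
    have "N = M" using N(1) M by (rule sums_unique2)
    thus ?thesis unfolding Q_def using N(2) by (intro sums_mult) simp
  qed
  obtain k where k: "k > 0" "\<And>u v::real. norm (of_real u * z + of_real v) \<ge> k * (\<bar>u\<bar> + \<bar>v\<bar>)"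
    using lattice_lower_bound[OF z] by metis
  \<comment> \<open>Half a column of the lattice: offset j and positive multiples of z only.\<close>
  define c where "c = (\<lambda>j::int. \<Sum>n. 1 / (of_nat (Suc n) * z + of_int j)^2)"
  define h where "h = (\<lambda>n::nat. 1 / real (Suc n) ^ 2)"
  have hs: "summable h"
    using sums_summable[OF inverse_squares_sums] by (simp add: h_def add.commute)
  have bound: "norm (1 / (of_nat (Suc n) * z + of_int j)^2) \<le> (1 / k\<^sup>2) * h (n + nat \<bar>j\<bar>)" for n j
  proof -
    have "k * (real (Suc n) + \<bar>real_of_int j\<bar>) \<le> norm (of_nat (Suc n) * z + of_int j)"
      using k(2)[of "real (Suc n)" "real_of_int j"] by simp
    hence "(k * (real (Suc n) + \<bar>real_of_int j\<bar>))\<^sup>2 \<le> norm (of_nat (Suc n) * z + of_int j) ^ 2"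
      using k(1) by (intro power_mono) auto
    moreover have "0 < (k * (real (Suc n) + \<bar>real_of_int j\<bar>))\<^sup>2"
      using k(1) by (intro zero_less_power mult_pos_pos) (auto intro!: add_pos_nonneg)
    ultimately have "1 / norm (of_nat (Suc n) * z + of_int j) ^ 2 \<le> 1 / (k * (real (Suc n) + \<bar>real_of_int j\<bar>))\<^sup>2"
      by (intro frac_le) auto
    also have "\<dots> = (1 / k\<^sup>2) * h (n + nat \<bar>j\<bar>)"
      by (simp add: h_def power_mult_distrib add_ac)
    finally show ?thesis by (simp add: norm_divide norm_power)
  qed
  have hs': "summable (\<lambda>n. (1 / k\<^sup>2) * h (n + m))" for m
    by (intro summable_mult summable_ignore_initial_segment hs)
  have cs: "(\<lambda>n. 1 / (of_nat (Suc n) * z + of_int j)^2) sums c j" for j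
    unfolding c_def using bound by (intro summable_sums summable_comparison_test'[OF hs'[of "nat \<bar>j\<bar>"], of 0]) auto
  have c_le: "norm (c (int m)) \<le> (1 / k\<^sup>2) * (\<Sum>n. h (n + m))" for m
  proof -
    have "norm (c (int m)) \<le> (\<Sum>n. (1 / k\<^sup>2) * h (n + m))"
      unfolding c_def using bound[of _ "int m"] by (intro norm_suminf_le hs') auto
    also have "\<dots> = (1 / k\<^sup>2) * (\<Sum>n. h (n + m))"
      by (intro suminf_mult summable_ignore_initial_segment hs)
    finally show ?thesis .
  qed
  have "(\<lambda>m. suminf h - (\<Sum>n<m. h n)) \<longlonglongrightarrow> suminf h - suminf h"
    by (intro tendsto_intros summable_LIMSEQ hs)
  hence "(\<lambda>m. (1 / k\<^sup>2) * (\<Sum>n. h (n + m))) \<longlonglongrightarrow> (1 / k\<^sup>2) * 0"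
    by (intro tendsto_intros) (simp add: suminf_minus_initial_segment[OF hs])
  hence c0: "(\<lambda>m. c (int m)) \<longlonglongrightarrow> 0"
    using c_le by (intro Lim_null_comparison[of "\<lambda>m. c (int m)"]) (auto intro!: always_eventually)
  have c_0: "c 0 = (of_real pi)\<^sup>2 / (6 * z\<^sup>2)"
  proof -
    have "(\<lambda>n. of_real (1 / (real n + 1)\<^sup>2) / z\<^sup>2) sums (of_real (pi\<^sup>2 / 6) / z\<^sup>2)"
      using inverse_squares_sums by (intro sums_divide sums_of_real) (simp add: add.commute)
    moreover have "of_real (1 / (real n + 1)\<^sup>2) / z\<^sup>2 = 1 / (of_nat (Suc n) * z + of_int 0)^2" for n
      by (simp add: power_mult_distrib add.commute)
    ultimately have "(\<lambda>n. 1 / (of_nat (Suc n) * z + of_int 0)^2) sums (of_real (pi\<^sup>2 / 6) / z\<^sup>2)" by simp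
    from sums_unique2[OF cs this] show ?thesis by simp
  qed
  define S where "S = (\<lambda>m. c (int m) + c (- int (Suc m)))"
  have col: "(\<lambda>n. 1 / (of_nat (Suc n) * z + of_nat m)^2 + 1 / (of_nat (Suc n) * z - of_nat (Suc m))^2) sums S m" for m
    using sums_add[OF cs[of "int m"] cs[of "- int (Suc m)"]]
    by (simp only: S_def of_int_minus of_int_of_nat_eq add_uminus_conv_diff)
  obtain X where X: "Q z sums X" "S sums (X - of_real pi * \<i> / z)"
    using lattice_sums_swap[OF z rows[OF z] col] by blast
  have X_eq: "X = -4 * (of_real pi)\<^sup>2 * L" using X(1) Qs[OF z L] by (rule sums_unique2)
  \<comment> \<open>Since z * (m - n / z) = m z - n, row n at -1/z is made of the half columns with
    offsets -n and n and of the point with m = 0, which contributes 1/n^2. In the code n is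
    \<open>Suc n\<close>.\<close>
  have Q': "Q (-1/z) n / z\<^sup>2 = of_real (h n) + c (- int (Suc n)) + c (int (Suc n))" for n
  proof -
    have A: "(\<lambda>m. 1 / (of_nat (Suc m) * z + of_int (int (Suc n)))^2) sums c (int (Suc n))" by (rule cs)
    have B: "(\<lambda>m. 1 / (of_nat m * z + of_int (- int (Suc n)))^2) sums (c (- int (Suc n)) + 1 / (of_nat 0 * z + of_int (- int (Suc n)))^2)"
      using cs[of "- int (Suc n)"] by (rule sums_Suc)
    have s1: "(\<lambda>m. 1 / (of_nat m * z + of_int (- int (Suc n)))^2 + 1 / (of_nat (Suc m) * z + of_int (int (Suc n)))^2) sums
         (c (- int (Suc n)) + 1 / (of_nat 0 * z + of_int (- int (Suc n)))^2 + c (int (Suc n)))"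
      by (rule sums_add[OF B A])
    have s2: "(\<lambda>m. (1 / (of_nat (Suc n) * (-1/z) + of_nat m)^2 + 1 / (of_nat (Suc n) * (-1/z) - of_nat (Suc m))^2) / z\<^sup>2) sums (Q (-1/z) n / z\<^sup>2)"
      by (rule sums_divide[OF rows[OF w]])
    have *: "(1 / (of_nat (Suc n) * (-1/z) + of_nat m)^2 + 1 / (of_nat (Suc n) * (-1/z) - of_nat (Suc m))^2) / z\<^sup>2
       = 1 / (of_nat m * z + of_int (- int (Suc n)))^2 + 1 / (of_nat (Suc m) * z + of_int (int (Suc n)))^2" for m
    proof -
      have "of_nat (Suc n) * (-1/z) + of_nat m = (of_nat m * z + of_int (- int (Suc n))) / z"
           "of_nat (Suc n) * (-1/z) - of_nat (Suc m) = - ((of_nat (Suc m) * z + of_int (int (Suc n))) / z)"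
        using z0 by (simp_all add: field_simps)
      thus ?thesis using z0 by (simp only: power2_minus power_divide) (simp add: add_divide_distrib del: of_nat_Suc of_int_minus)
    qed
    have "Q (-1/z) n / z\<^sup>2 = c (- int (Suc n)) + 1 / (of_nat 0 * z + of_int (- int (Suc n)))^2 + c (int (Suc n))"
      by (rule sums_unique2[OF s2[unfolded *] s1])
    thus ?thesis by (simp add: h_def del: of_nat_Suc)
  qed
  \<comment> \<open>\<open>S\<close> pairs the offsets m and -(m + 1), whereas \<open>Q'\<close>
    pairs m + 1 and -(m + 1). Apart from the terms \<open>h\<close>, the partial sums therefore
    differ by c M - c 0, and c M tends to 0.\<close>
  have *: "(\<Sum>n<M. Q (-1/z) n / z\<^sup>2) = of_real (\<Sum>n<M. h n) + (\<Sum>m<M. S m) + (c (int M) - c 0)" for M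
    unfolding Q' by (induction M) (simp_all add: S_def)
  have l1: "(\<lambda>M. of_real (\<Sum>n<M. h n) + (\<Sum>m<M. S m) + (c (int M) - c 0)) \<longlonglongrightarrow>
       of_real (pi\<^sup>2 / 6) + (X - of_real pi * \<i> / z) + (0 - c 0)"
    using X(2) inverse_squares_sums by (intro tendsto_intros c0) (auto simp: sums_def h_def add.commute)
  have l2: "(\<lambda>M. \<Sum>n<M. Q (-1/z) n / z\<^sup>2) \<longlonglongrightarrow> -4 * (of_real pi)\<^sup>2 * L' / z\<^sup>2"
    using sums_divide[OF Qs[OF w L']] unfolding sums_def .
  have "-4 * (of_real pi)\<^sup>2 * L' / z\<^sup>2 = of_real (pi\<^sup>2 / 6) + (X - of_real pi * \<i> / z) + (0 - c 0)"
    by (rule LIMSEQ_unique[OF l2[unfolded *] l1])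
  hence "L' / z\<^sup>2 = (of_real (pi\<^sup>2 / 6) + (-4 * (of_real pi)\<^sup>2 * L - of_real pi * \<i> / z) - (of_real pi)\<^sup>2 / (6 * z\<^sup>2)) / (-4 * (of_real pi)\<^sup>2)"
    by (subst eq_divide_eq) (simp add: X_eq c_0 mult.commute)
  also have "\<dots> = L - 1 / 24 + \<i> / (4 * of_real pi * z) + 1 / (24 * z\<^sup>2)"
    using z0 by (simp add: field_simps power2_eq_square)
  finally show ?thesis .
qed

text \<open>The anomalous term of E_2 is the derivative of half the logarithm of -i z, so the defect
  \<open>J\<close> is constant. At the fixed point i of z \<mapsto> -1/z it vanishes.\<close>

lemma eta_log_inversion:
  assumes z: "Im z > 0"
  shows "eta_log (-1/z) = eta_log z + Ln (-\<i> * z) / 2"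
proof -
  define J where "J = (\<lambda>z. eta_log (-1/z) - eta_log z - Ln (-\<i> * z) / 2)"
  have D: "(J has_field_derivative 0) (at z)" if z: "Im z > 0" for z
  proof -
    have z0: "z \<noteq> 0" using z by auto
    have w: "Im (-1/z) > 0" using z by (simp add: Im_divide sum_power2_gt_zero_iff)
    obtain L where L: "(\<lambda>n. of_nat (divisor_sum n) * exp (2 * of_real pi * \<i> * z) ^ n) sums L"
      by (rule Lambert_sums[OF norm_q_less_1[OF z]]) (rule that)
    obtain L' where L': "(\<lambda>n. of_nat (divisor_sum n) * exp (2 * of_real pi * \<i> * (-1/z)) ^ n) sums L'"
      by (rule Lambert_sums[OF norm_q_less_1[OF w]]) (rule that)
    have "-\<i> * z \<notin> \<real>\<^sub>\<le>\<^sub>0" using z by (auto simp: complex_nonpos_Reals_iff)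
    hence Ld: "((\<lambda>z. Ln (-\<i> * z)) has_field_derivative inverse (-\<i> * z) * (-\<i>)) (at z)"
      by (intro DERIV_chain2[where f = Ln]) (auto intro!: derivative_eq_intros has_field_derivative_Ln)
    have wd: "((\<lambda>z. -1/z) has_field_derivative 1 / z\<^sup>2) (at z)"
      using z0 by (auto intro!: derivative_eq_intros simp: power2_eq_square field_simps)
    have "(J has_field_derivative (of_real pi * \<i> / 12 - 2 * of_real pi * \<i> * L') * (1 / z\<^sup>2)
        - (of_real pi * \<i> / 12 - 2 * of_real pi * \<i> * L) - (inverse (-\<i> * z) * (-\<i>)) / 2) (at z)"
      unfolding J_def
      by (intro DERIV_diff DERIV_cdivide Ld eta_log_has_field_derivative[OF z L]
            DERIV_chain2[OF eta_log_has_field_derivative[OF w L'] wd])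
    moreover have "(of_real pi * \<i> / 12 - 2 * of_real pi * \<i> * L') * (1 / z\<^sup>2) =
        of_real pi * \<i> / (12 * z\<^sup>2) - 2 * of_real pi * \<i> * (L' / z\<^sup>2)"
      by (simp add: diff_divide_distrib)
    moreover have "of_real pi * \<i> / (12 * z\<^sup>2) - 2 * of_real pi * \<i> * (L' / z\<^sup>2)
        - (of_real pi * \<i> / 12 - 2 * of_real pi * \<i> * L) - (inverse (-\<i> * z) * (-\<i>)) / 2 = 0"
      unfolding divisor_sum_series_inversion[OF z L L'] using z0 by (simp add: field_simps power2_eq_square)
    ultimately show ?thesis by simp
  qed
  have "J z = J \<i>"
  proof -
    obtain c where "\<forall>x\<in>{z. Im z > 0}. J x = c"
      using has_field_derivative_zero_constant[of "{z. Im z > 0}" J] D convex_halfspace_Im_gt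
      by (auto intro: has_field_derivative_at_within)
    thus ?thesis using z by simp
  qed
  moreover have "J \<i> = 0" by (simp add: J_def)
  ultimately have "eta_log (-1/z) - eta_log z - Ln (-\<i> * z) / 2 = 0" by (simp only: J_def)
  thus ?thesis by (simp only: diff_diff_eq right_minus_eq)
qed

subsection \<open>Multipliers of eta quotients\<close>

definition mob :: "int \<Rightarrow> int \<Rightarrow> int \<Rightarrow> int \<Rightarrow> complex \<Rightarrow> complex" where
  "mob a b c d z = (of_int a * z + of_int b) / (of_int c * z + of_int d)"

lemma mob_denom_nonzero:
  assumes "Im z > 0" "c \<noteq> 0 \<or> d \<noteq> 0"
  shows "of_int c * z + of_int d \<noteq> 0"
proof
  assume eq: "of_int c * z + of_int d = 0"
  hence "Im (of_int c * z + of_int d) = 0" by simp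
  hence "c = 0" using assms(1) by auto
  with eq assms(2) show False by simp
qed

lemma Im_mob: "Im (mob a b c d z) = of_int (a * d - b * c) * Im z / (norm (of_int c * z + of_int d))\<^sup>2"
proof -
  have "cnj (of_int c * z + of_int d) = of_int c * cnj z + of_int d" by simp
  thus ?thesis unfolding mob_def
    by (subst complex_div_cnj)
       (simp add: cmod_power2 Im_divide_of_real algebra_simps flip: of_real_power)
qed

lemma Im_mob_pos:
  assumes "Im z > 0" "a * d - b * c > 0"
  shows "Im (mob a b c d z) > 0"
proof -
  have "c \<noteq> 0 \<or> d \<noteq> 0" using assms(2) by auto
  moreover have "real_of_int (a * d - b * c) > 0" using assms(2) by (simp only: of_int_0_less_iff)
  ultimately show ?thesis unfolding Im_mob
    using mob_denom_nonzero[OF assms(1), of c d] assms(1)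
    by (intro divide_pos_pos mult_pos_pos zero_less_power) (simp_all del: of_int_diff of_int_mult)
qed

lemma eta_log_translate: "eta_log (z + of_int b) = eta_log z + of_real pi * \<i> * of_int b / 12"
proof -
  have "exp (2 * of_real pi * \<i> * (z + of_int b)) = exp (2 * of_real pi * \<i> * z) * exp (2 * of_real pi * \<i> * of_int b)"
    by (simp add: ring_distribs flip: exp_add)
  also have "exp (2 * of_real pi * \<i> * of_int b) = 1"
    using exp_integer_2pi[of "of_int b"] by (simp add: mult_ac)
  finally show ?thesis by (simp add: eta_log_def ring_distribs add_divide_distrib)
qed

definition phi_log :: "complex \<Rightarrow> complex" where "phi_log z = eta_log (2 * z) - eta_log z"
definition kappa_log :: "complex \<Rightarrow> complex" where "kappa_log z = 4 * eta_log (2 * z) - 2 * eta_log z"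

lemma phi_log_translate: "phi_log (z + of_int b) = phi_log z + of_real pi * \<i> * of_int b / 12"
  using eta_log_translate[of "2 * z" "2 * b"] eta_log_translate[of z b]
  by (simp add: phi_log_def ring_distribs)

lemma kappa_log_translate: "kappa_log (z + of_int b) = kappa_log z + of_real pi * \<i> * of_int b / 2"
  using eta_log_translate[of "2 * z" "2 * b"] eta_log_translate[of z b]
  by (simp add: kappa_log_def ring_distribs)

lemma phi_log_inversion:
  assumes "Im u > 0"
  shows "phi_log (-1/u) = eta_log (u / 2) - eta_log u - of_real (ln 2) / 2"
proof -
  have u: "u \<noteq> 0" using assms by auto
  have "Ln (of_real (1/2) * (-\<i> * u)) = of_real (ln (1/2)) + Ln (-\<i> * u)"
    using u Ln_times_of_real[of "1/2" "-\<i> * u"] Ln_of_real[of "1/2"] by simp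
  hence L: "Ln (-\<i> * (u/2)) = Ln (-\<i> * u) - of_real (ln 2)"
    by (simp add: ln_div mult.commute)
  have "phi_log (-1/u) = eta_log (-1/(u/2)) - eta_log (-1/u)" by (simp add: phi_log_def)
  also have "\<dots> = eta_log (u/2) - eta_log u + (Ln (-\<i> * (u/2)) - Ln (-\<i> * u)) / 2"
    using assms eta_log_inversion[of "u/2"] eta_log_inversion[of u] by (simp add: diff_divide_distrib)
  also have "\<dots> = eta_log (u / 2) - eta_log u - of_real (ln 2) / 2" unfolding L by simp
  finally show ?thesis .
qed

text \<open>Together with z \<mapsto> z + 1 and the matrix -1 this generates \<Gamma>_0(2). It is
  conjugate to the translation by -2 under z \<mapsto> -1/z, which is how its effect on \<eta> is
  found.\<close>

definition Vmap :: "complex \<Rightarrow> complex" where "Vmap z = z / (2 * z + 1)"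

lemma Vmap_eq:
  assumes "Im z > 0"
  shows "Vmap z = -1 / (-1/z + of_int (-2))" "Im (-1/z + of_int (-2)) > 0" "2 * z + 1 \<noteq> 0"
proof -
  have "z \<noteq> 0" using assms by auto
  have d: "2 * z + 1 \<noteq> 0" using mob_denom_nonzero[OF assms, of 2 1] by simp
  thus "2 * z + 1 \<noteq> 0" .
  have "-1/z + of_int (-2) = - ((2 * z + 1) / z)" using \<open>z \<noteq> 0\<close> by (simp add: field_simps)
  thus "Vmap z = -1 / (-1/z + of_int (-2))" using d \<open>z \<noteq> 0\<close> by (simp add: Vmap_def)
  show "Im (-1/z + of_int (-2)) > 0" using assms by (simp add: Im_divide sum_power2_gt_zero_iff)
qed

text \<open>In the coordinate u = -1/z the map is a translation by -2, and \<phi> becomes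
  \<eta>(u/2)/\<eta>(u) up to a constant. In units of pi i / 12 the numerator contributes -1 and the
  denominator +2.\<close>

lemma phi_log_Vmap:
  assumes z: "Im z > 0"
  shows "phi_log (Vmap z) = phi_log z + of_real pi * \<i> / 12"
proof -
  have z0: "z \<noteq> 0" using z by auto
  have w: "Im (-1/z) > 0" using z by (simp add: Im_divide sum_power2_gt_zero_iff)
  define u where "u = -1/z + of_int (-2)"
  have "phi_log (Vmap z) = eta_log (u / 2) - eta_log u - of_real (ln 2) / 2"
    using Vmap_eq[OF z] phi_log_inversion[of u] by (simp add: u_def)
  also have "u / 2 = -1/z/2 + of_int (-1)" by (simp add: u_def add_divide_distrib)
  also have "eta_log \<dots> = eta_log (-1/z/2) + of_real pi * \<i> * of_int (-1) / 12" by (rule eta_log_translate)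
  also have "eta_log u = eta_log (-1/z) + of_real pi * \<i> * of_int (-2) / 12"
    unfolding u_def by (rule eta_log_translate)
  finally have 1: "phi_log (Vmap z) = eta_log (-1/z/2) - eta_log (-1/z) - of_real (ln 2) / 2 + of_real pi * \<i> / 12"
    by simp
  show ?thesis using phi_log_inversion[OF w] unfolding 1 by simp
qed

lemma exp_kappa_log_Vmap:
  assumes z: "Im z > 0"
  shows "exp (kappa_log (Vmap z)) = (2 * z + 1) * exp (kappa_log z)"
proof -
  have z0: "z \<noteq> 0" using z by auto
  have k: "kappa_log w = 4 * phi_log w + 2 * eta_log w" for w by (simp add: kappa_log_def phi_log_def)
  define u where "u = -1/z + of_int (-2)"
  have u: "Im u > 0" "Vmap z = -1/u" using Vmap_eq[OF z] by (auto simp: u_def)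
  have u0: "u \<noteq> 0" using u by auto
  have "eta_log (Vmap z) = eta_log u + Ln (-\<i> * u) / 2" unfolding u by (rule eta_log_inversion[OF u(1)])
  also have "eta_log u = eta_log (-1/z) + of_real pi * \<i> * of_int (-2) / 12"
    unfolding u_def by (rule eta_log_translate)
  also have "eta_log (-1/z) = eta_log z + Ln (-\<i> * z) / 2" by (rule eta_log_inversion[OF z])
  finally have e: "2 * eta_log (Vmap z) = 2 * eta_log z + Ln (-\<i> * z) + Ln (-\<i> * u) - of_real pi * \<i> / 3"
    by simp
  \<comment> \<open>The roots of unity cancel: four times pi i / 12 from \<open>phi_log_Vmap\<close>
    against - pi i / 3 from the translation of \<open>eta_log\<close>.\<close>
  have "kappa_log (Vmap z) = kappa_log z + Ln (-\<i> * z) + Ln (-\<i> * u)"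
    unfolding k e phi_log_Vmap[OF z] by simp
  hence "exp (kappa_log (Vmap z)) = exp (kappa_log z) * (-\<i> * z) * (-\<i> * u)"
    using z0 u0 by (simp add: exp_add)
  also have "(-\<i> * z) * (-\<i> * u) = 2 * z + 1"
    using z0 by (simp add: u_def field_simps)
  hence "exp (kappa_log z) * (-\<i> * z) * (-\<i> * u) = (2 * z + 1) * exp (kappa_log z)"
    by (simp only: mult.assoc) (simp only: mult.commute)
  finally show ?thesis .
qed

text \<open>Euclidean descent on the first column (a, 2 e). As a is odd, the absolute values of a
  and 2 e never tie, so adding or subtracting the smaller entry to the larger always decreases the
  measure. The hypotheses on T and V are equivalences because both signs occur.\<close>

lemma Gamma0_2_induct:
  fixes P :: "int \<Rightarrow> int \<Rightarrow> int \<Rightarrow> int \<Rightarrow> bool"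
  assumes det: "a * d - 2 * b * e = 1"
    and base: "\<And>b. P 1 b 0 1" "\<And>b. P (-1) b 0 (-1)"
    and T: "\<And>a b e d. a * d - 2 * b * e = 1 \<Longrightarrow> P a b e d \<longleftrightarrow> P (a + 2 * e) (b + d) e d"
    and V: "\<And>a b e d. a * d - 2 * b * e = 1 \<Longrightarrow> P a b e d \<longleftrightarrow> P a b (e + a) (d + 2 * b)"
  shows "P a b e d"
  using det
proof (induction "nat (\<bar>a\<bar> + 2 * \<bar>e\<bar>)" arbitrary: a b e d rule: less_induct)
  case less
  have IH: "P a' b' e' d'" if "a' * d' - 2 * b' * e' = 1" "\<bar>a'\<bar> + 2 * \<bar>e'\<bar> < \<bar>a\<bar> + 2 * \<bar>e\<bar>" for a' b' e' d'
    by (rule less.hyps) (use that in auto)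
  show ?case
  proof (cases "e = 0")
    case True
    hence "a * d = 1" using less.prems by simp
    hence "a = 1 \<and> d = 1 \<or> a = -1 \<and> d = -1" by (auto simp: zmult_eq_1_iff)
    thus ?thesis using base True by auto
  next
    case e: False
    have a: "odd a" using less.prems by (metis dvd_diff_left_iff dvd_mult2 dvd_triv_left odd_one mult.assoc)
    consider "\<bar>a\<bar> > 2 * \<bar>e\<bar>" "a * e > 0" | "\<bar>a\<bar> > 2 * \<bar>e\<bar>" "a * e < 0"
      | "\<bar>a\<bar> < 2 * \<bar>e\<bar>" "a * e > 0" | "\<bar>a\<bar> < 2 * \<bar>e\<bar>" "a * e < 0"
    proof -
      have "a \<noteq> 0" using a by auto
      moreover have "\<bar>a\<bar> \<noteq> 2 * \<bar>e\<bar>" using a by presburger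
      ultimately show ?thesis using that e by (metis linorder_neqE mult_eq_0_iff)
    qed
    thus ?thesis
    proof cases
      case 1
      have "P (a - 2 * e) (b - d) e d"
        using 1 less.prems by (intro IH) (auto simp: algebra_simps zero_less_mult_iff)
      thus ?thesis using T[of "a - 2 * e" d "b - d" e] less.prems by (simp add: algebra_simps)
    next
      case 2
      have "P (a + 2 * e) (b + d) e d"
        using 2 less.prems by (intro IH) (auto simp: algebra_simps mult_less_0_iff)
      thus ?thesis using T[of a d b e] less.prems by simp
    next
      case 3
      have "P a b (e - a) (d - 2 * b)"
        using 3 less.prems by (intro IH) (auto simp: algebra_simps zero_less_mult_iff)
      thus ?thesis using V[of a "d - 2 * b" b "e - a"] less.prems by (simp add: algebra_simps)
    next
      case 4
      have "P a b (e + a) (d + 2 * b)"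
        using 4 less.prems by (intro IH) (auto simp: algebra_simps mult_less_0_iff)
      thus ?thesis using V[of a d b e] less.prems by simp
    qed
  qed
qed

lemma odd_square_mod_8:
  fixes a :: int
  assumes "odd a"
  obtains k where "a * a = 1 + 8 * k"
proof -
  from assms obtain m where m: "a = 2 * m + 1" by (auto elim: oddE)
  have "even (m * (m + 1))" by simp
  then obtain k where "m * (m + 1) = 2 * k" by (elim evenE)
  hence "a * a = 1 + 8 * k" by (simp add: m algebra_simps)
  thus ?thesis by (rule that)
qed

text \<open>
  Up to a 24-th root of unity, \<open>\<eta>(2z)/\<eta>(z)\<close> is invariant under $\Gamma_0(2)$; the exponent below, for a
  matrix with lower left entry \<open>2e\<close>, comes from the classical formula for the multiplier of \<open>\<eta>\<close>.
\<close>
definition phi_exponent :: "int \<Rightarrow> int \<Rightarrow> int \<Rightarrow> int \<Rightarrow> int" where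
  "phi_exponent a b e d = b * d * (1 + 2 * e * e) + 2 * d * e - a * e + 3 * ((d * d - 1) div 2)"

lemma dvd_24I: "(8::int) dvd n \<Longrightarrow> 3 dvd n \<Longrightarrow> 24 dvd n"
proof -
  assume "8 dvd n" "3 dvd n"
  then obtain k where k: "n = 8 * k" by auto
  with \<open>3 dvd n\<close> have "3 dvd k" by presburger
  thus "24 dvd n" unfolding k by auto
qed

lemma square_mod_3: "(3::int) dvd a \<or> 3 dvd a * a - 1"
proof -
  have "a = 3 * (a div 3) \<or> a = 3 * (a div 3) + 1 \<or> a = 3 * (a div 3) + 2" by presburger
  then consider m where "a = 3 * m" | m where "a = 3 * m + 1" | m where "a = 3 * m + 2" by blast
  thus ?thesis
  proof cases
    case (2 m)
    hence "a * a - 1 = 3 * (3 * m * m + 2 * m)" by (simp add: algebra_simps)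
    thus ?thesis by (metis dvd_triv_left)
  next
    case (3 m)
    hence "a * a - 1 = 3 * (3 * m * m + 4 * m + 1)" by (simp add: algebra_simps)
    thus ?thesis by (metis dvd_triv_left)
  qed auto
qed

text \<open>The defect is (d^2 - 1)(1 + 2 e^2). Modulo 8 the first factor vanishes since d is odd.
  Modulo 3 the determinant prevents 3 from dividing both d and e, and either d^2 = 1 or e^2 = 1
  makes a factor vanish.\<close>

lemma phi_exponent_T:
  assumes det: "a * d - 2 * b * e = 1"
  shows "24 dvd phi_exponent (a + 2 * e) (b + d) e d - phi_exponent a b e d - 1"
proof -
  have d: "odd d" using det by (metis dvd_diff_left_iff dvd_mult dvd_mult2 dvd_triv_left odd_one mult.assoc)
  have eq: "phi_exponent (a + 2 * e) (b + d) e d - phi_exponent a b e d - 1 = (d * d - 1) * (1 + 2 * e * e)"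
    by (simp add: phi_exponent_def algebra_simps)
  obtain k where k: "d * d = 1 + 8 * k" using odd_square_mod_8[OF d] .
  have "8 dvd (d * d - 1) * (1 + 2 * e * e)" by (simp add: k)
  moreover have "3 dvd (d * d - 1) * (1 + 2 * e * e)"
  proof (cases "3 dvd d * d - 1")
    case False
    hence "3 dvd d" using square_mod_3 by blast
    have "\<not> 3 dvd e"
    proof
      assume "3 dvd e"
      with \<open>3 dvd d\<close> have "3 dvd a * d - 2 * b * e" by (intro dvd_diff dvd_mult)
      thus False unfolding det by simp
    qed
    hence "3 dvd e * e - 1" using square_mod_3 by blast
    hence "3 dvd 2 * (e * e - 1) + 3" by presburger
    also have "2 * (e * e - 1) + 3 = 1 + 2 * e * e" by simp
    finally show ?thesis by (rule dvd_mult)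
  qed (rule dvd_mult2)
  ultimately show ?thesis unfolding eq by (rule dvd_24I)
qed

lemma phi_exponent_V:
  assumes det: "a * d - 2 * b * e = 1"
  shows "24 dvd phi_exponent a b (e + a) (d + 2 * b) - phi_exponent a b e d - 1"
proof -
  have a: "odd a" using det by (metis dvd_diff_left_iff dvd_mult2 dvd_triv_left odd_one mult.assoc)
  have ad: "a * d = 1 + 2 * b * e" using det by simp
  have dv: "((d + 2 * b) * (d + 2 * b) - 1) div 2 = (d * d - 1) div 2 + 2 * b * (d + b)"
  proof -
    have "(d + 2 * b) * (d + 2 * b) - 1 = (d * d - 1) + 2 * (2 * b * (d + b))" by (simp add: algebra_simps)
    thus ?thesis by simp
  qed
  have "phi_exponent a b (e + a) (d + 2 * b) - phi_exponent a b e d - 1 =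
      4 * b * e * (a * d) + 2 * a * b * (a * d) + 2 * (a * d) + 8 * b * b + 4 * b * b * e * e + 8 * a * b * b * e + 4 * a * a * b * b
       + 4 * b * e + 4 * a * b - a * a + 6 * b * d - 1"
    unfolding phi_exponent_def dv by (simp add: algebra_simps)
  also have "\<dots> = 12 * b * b * e * e + 12 * a * b * b * e + 12 * b * e + 8 * b * b + 4 * a * a * b * b + 6 * a * b + 6 * b * d - a * a + 1"
    unfolding ad by (simp add: algebra_simps)
  finally have eq: "phi_exponent a b (e + a) (d + 2 * b) - phi_exponent a b e d - 1 =
     12 * b * b * e * e + 12 * a * b * b * e + 12 * b * e + 8 * b * b + 4 * a * a * b * b + 6 * a * b + 6 * b * d - a * a + 1" .
  let ?X = "12 * b * b * e * e + 12 * a * b * b * e + 12 * b * e + 8 * b * b + 4 * a * a * b * b + 6 * a * b + 6 * b * d - a * a + 1"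
  obtain k where k: "a * a = 1 + 8 * k" using odd_square_mod_8[OF a] .
  \<comment> \<open>As a * a is 1 modulo 8, d may be replaced by a * (a * d) modulo 8. What remains
    is a multiple of 8 plus four times an even integer.\<close>
  have "a * (a * d) = a + 2 * a * b * e" unfolding ad by (simp add: algebra_simps)
  hence "(1 + 8 * k) * d = a + 2 * a * b * e" by (simp flip: k add: mult.assoc)
  hence d: "d = a + 2 * a * b * e - 8 * (k * d)" by (simp add: algebra_simps)
  have "even (b * e * (b * e + a * b + 1) + b * b + a * b * (1 + b * e))"
    using a by (cases "even b"; cases "even e") auto
  then obtain m where m: "b * e * (b * e + a * b + 1) + b * b + a * b * (1 + b * e) = 2 * m" by (elim evenE)
  have "?X = 12 * b * b * e * e + 12 * a * b * b * e + 12 * b * e + 8 * b * b + 4 * (a * a) * b * b + 6 * a * b + 6 * b * (a + 2 * a * b * e - 8 * (k * d)) - (a * a) + 1"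
    by (subst d[symmetric]) (simp add: mult.assoc)
  also have "\<dots> = 8 * (b * b * e * e + a * b * b * e + b * e + b * b + 4 * k * b * b + a * b + a * b * b * e - 6 * b * k * d - k)
     + 4 * (b * e * (b * e + a * b + 1) + b * b + a * b * (1 + b * e))"
    unfolding k by (simp add: algebra_simps)
  also have "8 dvd \<dots>" unfolding m by simp
  finally have 8: "8 dvd ?X" .
  \<comment> \<open>Modulo 3 only (b^2 - 1)(a^2 + 2) is left; one factor vanishes since the
    determinant prevents 3 from dividing both a and b.\<close>
  have eq3: "?X = 3 * (4 * b * b * e * e + 4 * a * b * b * e + 4 * b * e + 2 * a * b + 2 * b * d + 2 * b * b + a * a * b * b + 1) + (b * b - 1) * (a * a + 2)"
    by (simp add: algebra_simps)
  have "3 dvd (b * b - 1) * (a * a + 2)"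
  proof (cases "3 dvd b * b - 1")
    case False
    hence b3: "3 dvd b" using square_mod_3 by blast
    have "\<not> 3 dvd a"
    proof
      assume "3 dvd a"
      with b3 have "3 dvd a * d - 2 * b * e" by (intro dvd_diff dvd_mult dvd_mult2)
      thus False unfolding det by simp
    qed
    hence "3 dvd a * a - 1" using square_mod_3 by blast
    hence "3 dvd a * a + 2" by presburger
    thus ?thesis by (rule dvd_mult)
  qed (rule dvd_mult2)
  hence "3 dvd ?X" unfolding eq3 by (intro dvd_add) auto
  with 8 show ?thesis unfolding eq by (rule dvd_24I)
qed

lemma exp_pi_12_cong:
  assumes "24 dvd m - n"
  shows "exp (of_real pi * \<i> * of_int m / 12) = exp (of_real pi * \<i> * of_int n / 12)"
proof -
  from assms obtain k where "m - n = 24 * k" by auto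
  hence m: "m = n + 24 * k" by simp
  have "of_real pi * \<i> * of_int m / 12 = of_real pi * \<i> * of_int n / 12 + 2 * of_int k * of_real pi * \<i>"
    by (simp add: m algebra_simps add_divide_distrib)
  thus ?thesis using exp_integer_2pi[of "of_int k"] by (simp only: exp_add) simp
qed

lemma mob_T:
  assumes "Im z > 0" "c \<noteq> 0 \<or> d \<noteq> 0"
  shows "mob (a + c) (b + d) c d z = mob a b c d z + 1"
  using mob_denom_nonzero[OF assms] by (simp add: mob_def field_simps)

lemma mob_V:
  assumes "Im z > 0" "a * d - b * c = 1"
  shows "mob a b (c + 2 * a) (d + 2 * b) z = Vmap (mob a b c d z)"
    "2 * mob a b c d z + 1 = (of_int (c + 2 * a) * z + of_int (d + 2 * b)) / (of_int c * z + of_int d)"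
proof -
  have "c \<noteq> 0 \<or> d \<noteq> 0" using assms(2) by auto
  note nz = mob_denom_nonzero[OF assms(1) this]
  show *: "2 * mob a b c d z + 1 = (of_int (c + 2 * a) * z + of_int (d + 2 * b)) / (of_int c * z + of_int d)"
    using nz by (simp add: mob_def field_simps)
  show "mob a b (c + 2 * a) (d + 2 * b) z = Vmap (mob a b c d z)"
    unfolding Vmap_def * using nz by (simp add: mob_def)
qed

text \<open>Both generators multiply \<phi> by exp(pi i / 12); this is why
  \<open>phi_exponent_T\<close> and \<open>phi_exponent_V\<close> assert an increment of 1 modulo
  24.\<close>

lemma phi_multiplier:
  assumes det: "a * d - 2 * b * e = 1" and z: "Im z > 0"
  shows "exp (phi_log (mob a b (2 * e) d z)) = exp (of_real pi * \<i> * of_int (phi_exponent a b e d) / 12) * exp (phi_log z)"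
proof -
  define Z where "Z = (\<lambda>p::int. exp (of_real pi * \<i> * of_int p / 12))"
  have Zadd: "Z (p + 1) = Z p * exp (of_real pi * \<i> / 12)" for p
    by (simp add: Z_def ring_distribs add_divide_distrib flip: exp_add)
  define P where "P = (\<lambda>a b e d. exp (phi_log (mob a b (2 * e) d z)) = Z (phi_exponent a b e d) * exp (phi_log z))"
  have "P a b e d"
  proof (rule Gamma0_2_induct[where P = P, OF det])
    fix b
    show "P 1 b 0 1"
      by (simp add: P_def mob_def phi_exponent_def phi_log_translate Z_def exp_add)
    have "mob (-1) b (2 * 0) (-1) z = z + of_int (-b)" by (simp add: mob_def)
    thus "P (-1) b 0 (-1)"
      unfolding P_def by (simp only: phi_log_translate) (simp add: phi_exponent_def Z_def flip: exp_add)
  next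
    fix a b e d :: int assume det: "a * d - 2 * b * e = 1"
    have nz: "2 * e \<noteq> 0 \<or> d \<noteq> 0" using det by auto
    have "24 dvd phi_exponent (a + 2 * e) (b + d) e d - (phi_exponent a b e d + 1)"
      using phi_exponent_T[OF det] by (simp add: diff_diff_eq)
    hence "Z (phi_exponent (a + 2 * e) (b + d) e d) = Z (phi_exponent a b e d) * exp (of_real pi * \<i> / 12)"
      unfolding Zadd[symmetric] unfolding Z_def by (rule exp_pi_12_cong)
    moreover have "exp (phi_log (mob (a + 2 * e) (b + d) (2 * e) d z)) = exp (phi_log (mob a b (2 * e) d z)) * exp (of_real pi * \<i> / 12)"
      unfolding mob_T[OF z nz] using phi_log_translate[of "mob a b (2 * e) d z" 1] by (simp add: exp_add)
    ultimately show "P a b e d \<longleftrightarrow> P (a + 2 * e) (b + d) e d"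
      by (simp add: P_def)
  next
    fix a b e d :: int assume det: "a * d - 2 * b * e = 1"
    have det': "a * d - b * (2 * e) = 1" using det by simp
    have "24 dvd phi_exponent a b (e + a) (d + 2 * b) - (phi_exponent a b e d + 1)"
      using phi_exponent_V[OF det] by (simp add: diff_diff_eq)
    hence "Z (phi_exponent a b (e + a) (d + 2 * b)) = Z (phi_exponent a b e d) * exp (of_real pi * \<i> / 12)"
      unfolding Zadd[symmetric] unfolding Z_def by (rule exp_pi_12_cong)
    moreover have "mob a b (2 * (e + a)) (d + 2 * b) z = Vmap (mob a b (2 * e) d z)"
      using mob_V(1)[OF z det'] by (simp add: ring_distribs)
    hence "exp (phi_log (mob a b (2 * (e + a)) (d + 2 * b) z)) = exp (phi_log (mob a b (2 * e) d z)) * exp (of_real pi * \<i> / 12)"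
      using phi_log_Vmap[OF Im_mob_pos[OF z, of a d b "2 * e"]] det' by (simp add: exp_add)
    ultimately show "P a b e d \<longleftrightarrow> P a b (e + a) (d + 2 * b)"
      by (simp add: P_def)
  qed
  thus ?thesis by (simp add: P_def Z_def)
qed

lemma exp_pi_2_cong:
  assumes "4 dvd m - n"
  shows "exp (of_real pi * \<i> * of_int m / 2) = exp (of_real pi * \<i> * of_int n / 2)"
proof -
  from assms have "24 dvd 6 * m - 6 * n" by presburger
  from exp_pi_12_cong[OF this] show ?thesis by (simp add: mult_ac)
qed

text \<open>The translation contributes the factor i, \<open>Vmap\<close> only an automorphy factor
  of weight 1. When 4 divides b, the root of unity is (-1)^((d - 1) / 2), the nontrivial character
  modulo 4.\<close>

lemma kappa_multiplier:
  assumes det: "a * d - 2 * b * e = 1" and z: "Im z > 0"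
  shows "exp (kappa_log (mob a b (2 * e) d z)) =
    (of_int (2 * e) * z + of_int d) * exp (of_real pi * \<i> * of_int (b * d + d - 1) / 2) * exp (kappa_log z)"
proof -
  define Z where "Z = (\<lambda>p::int. exp (of_real pi * \<i> * of_int p / 2))"
  have Zadd: "Z (p + 1) = Z p * exp (of_real pi * \<i> / 2)" for p
    by (simp add: Z_def ring_distribs add_divide_distrib flip: exp_add)
  define P where "P = (\<lambda>a b e d. exp (kappa_log (mob a b (2 * e) d z)) = (of_int (2 * e) * z + of_int d) * Z (b * d + d - 1) * exp (kappa_log z))"
  have "P a b e d"
  proof (rule Gamma0_2_induct[where P = P, OF det])
    fix b
    show "P 1 b 0 1"
      by (simp add: P_def mob_def kappa_log_translate Z_def exp_add)
    have "mob (-1) b (2 * 0) (-1) z = z + of_int (-b)" by (simp add: mob_def)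
    moreover have "Z (b * (-1) + (-1) - 1) = - Z (- b)"
    proof -
      have "of_real pi * \<i> * of_int (b * (-1) + (-1) - 1) / 2 = of_real pi * \<i> * of_int (-b) / 2 + - (of_real pi * \<i>)"
        by (simp add: field_simps)
      hence "Z (b * (-1) + (-1) - 1) = Z (-b) * exp (- (of_real pi * \<i>))"
        unfolding Z_def by (simp only: exp_add)
      thus ?thesis by (simp add: exp_minus)
    qed
    ultimately show "P (-1) b 0 (-1)"
      unfolding P_def by (simp only: kappa_log_translate) (simp add: Z_def flip: exp_add)
  next
    fix a b e d :: int assume det: "a * d - 2 * b * e = 1"
    have nz: "2 * e \<noteq> 0 \<or> d \<noteq> 0" using det by auto
    have d: "odd d" using det by (metis dvd_diff_left_iff dvd_mult dvd_mult2 dvd_triv_left odd_one mult.assoc)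
    obtain k where k: "d * d = 1 + 8 * k" using odd_square_mod_8[OF d] .
    have "(b + d) * d + d - 1 - (b * d + d - 1 + 1) = 8 * k" using k by (simp add: algebra_simps)
    hence "4 dvd (b + d) * d + d - 1 - (b * d + d - 1 + 1)" by simp
    hence "Z ((b + d) * d + d - 1) = Z (b * d + d - 1) * exp (of_real pi * \<i> / 2)"
      unfolding Zadd[symmetric] unfolding Z_def by (rule exp_pi_2_cong)
    moreover have "exp (kappa_log (mob (a + 2 * e) (b + d) (2 * e) d z)) = exp (kappa_log (mob a b (2 * e) d z)) * exp (of_real pi * \<i> / 2)"
      unfolding mob_T[OF z nz] using kappa_log_translate[of "mob a b (2 * e) d z" 1] by (simp add: exp_add)
    ultimately show "P a b e d \<longleftrightarrow> P (a + 2 * e) (b + d) e d"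
      unfolding P_def by (simp only: mult.assoc mult.left_commute[of _ "exp (of_real pi * \<i> / 2)"]
        mult.commute[of _ "exp (of_real pi * \<i> / 2)"] mult_cancel_left) simp
  next
    fix a b e d :: int assume det: "a * d - 2 * b * e = 1"
    have det': "a * d - b * (2 * e) = 1" using det by simp
    have nz0: "2 * e \<noteq> 0 \<or> d \<noteq> 0" using det by auto
    note nz = mob_denom_nonzero[OF z nz0]
    have "even (b * (b + 1))" by simp
    then obtain m where "b * (b + 1) = 2 * m" by (elim evenE)
    hence "2 * (b * (b + 1)) = 4 * m" by simp
    hence "4 dvd 2 * (b * (b + 1))" by (metis dvd_triv_left)
    also have "2 * (b * (b + 1)) = b * (d + 2 * b) + (d + 2 * b) - 1 - (b * d + d - 1)"
      by (simp add: algebra_simps)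
    finally have "Z (b * (d + 2 * b) + (d + 2 * b) - 1) = Z (b * d + d - 1)"
      unfolding Z_def by (rule exp_pi_2_cong)
    moreover have "mob a b (2 * (e + a)) (d + 2 * b) z = Vmap (mob a b (2 * e) d z)"
      using mob_V(1)[OF z det'] by (simp add: ring_distribs)
    hence "exp (kappa_log (mob a b (2 * (e + a)) (d + 2 * b) z)) =
        (of_int (2 * (e + a)) * z + of_int (d + 2 * b)) / (of_int (2 * e) * z + of_int d) * exp (kappa_log (mob a b (2 * e) d z))"
      using exp_kappa_log_Vmap[OF Im_mob_pos[OF z, of a d b "2 * e"]] det' mob_V(2)[OF z det'] by (simp add: ring_distribs)
    moreover have "of_int (2 * (e + a)) * z + of_int (d + 2 * b) \<noteq> 0"
    proof (rule mob_denom_nonzero[OF z])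
      show "2 * (e + a) \<noteq> 0 \<or> d + 2 * b \<noteq> 0"
      proof (rule ccontr)
        assume "\<not> ?thesis"
        hence "e = -a" "d = -2 * b" by auto
        thus False using det by simp
      qed
    qed
    moreover have cancel: "X = W * c * K \<longleftrightarrow> U / W * X = U * c * K" if "U \<noteq> 0" "W \<noteq> 0" for U W X c K :: complex
      using that by (auto simp: field_simps)
    ultimately show "P a b e d \<longleftrightarrow> P a b (e + a) (d + 2 * b)"
      using nz unfolding P_def by (simp only: cancel)
  qed
  thus ?thesis by (simp add: P_def Z_def)
qed

subsection \<open>Size of \<open>\<eta>\<close> near the cusps\<close>

text \<open>The Euclidean algorithm again. The weight 2 on c makes the exchange S decrease the
  measure exactly when a is smaller than c in absolute value.\<close>

lemma SL2Z_induct: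
  fixes P :: "int \<Rightarrow> int \<Rightarrow> int \<Rightarrow> int \<Rightarrow> bool"
  assumes det: "a * d - b * c = 1"
    and base: "\<And>b. P 1 b 0 1" "\<And>b. P (-1) b 0 (-1)"
    and T: "\<And>a b c d. a * d - b * c = 1 \<Longrightarrow> P a b c d \<longleftrightarrow> P (a + c) (b + d) c d"
    and S: "\<And>a b c d. a * d - b * c = 1 \<Longrightarrow> P a b c d \<longleftrightarrow> P (-c) (-d) a b"
  shows "P a b c d"
  using det
proof (induction "nat (\<bar>a\<bar> + 2 * \<bar>c\<bar>)" arbitrary: a b c d rule: less_induct)
  case less
  have IH: "P a' b' c' d'" if "a' * d' - b' * c' = 1" "\<bar>a'\<bar> + 2 * \<bar>c'\<bar> < \<bar>a\<bar> + 2 * \<bar>c\<bar>" for a' b' c' d'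
    by (rule less.hyps) (use that in auto)
  show ?case
  proof (cases "c = 0")
    case True
    hence "a * d = 1" using less.prems by simp
    hence "a = 1 \<and> d = 1 \<or> a = -1 \<and> d = -1" by (auto simp: zmult_eq_1_iff)
    thus ?thesis using base True by auto
  next
    case c: False
    consider "\<bar>a\<bar> < \<bar>c\<bar>" | "\<bar>a\<bar> \<ge> \<bar>c\<bar>" "a * c > 0" | "\<bar>a\<bar> \<ge> \<bar>c\<bar>" "a * c < 0"
      using c by (metis abs_ge_zero abs_zero antisym_conv2 linorder_neqE linorder_not_less mult_eq_0_iff zero_less_abs_iff)
    thus ?thesis
    proof cases
      case 1
      have "P (-c) (-d) a b"
        using 1 less.prems by (intro IH) (auto simp: algebra_simps)
      thus ?thesis using S less.prems by simp
    next
      case 2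
      have "P (a - c) (b - d) c d"
        using 2 less.prems by (intro IH) (auto simp: algebra_simps zero_less_mult_iff)
      thus ?thesis using T[of "a - c" d "b - d" c] less.prems by (simp add: algebra_simps)
    next
      case 3
      have "P (a + c) (b + d) c d"
        using 3 less.prems by (intro IH) (auto simp: algebra_simps mult_less_0_iff)
      thus ?thesis using T[of a d b c] less.prems by simp
    qed
  qed
qed

text \<open>Absolute values remove the roots of unity of the multiplier, and the square turns the
  weight 1/2 into 1, so that the factor in \<open>eta_sq_modular\<close> contains no root.\<close>

definition eta_sq :: "complex \<Rightarrow> real" where "eta_sq z = norm (exp (2 * eta_log z))"

lemma eta_sq_pos [simp]: "eta_sq z > 0"
  by (simp add: eta_sq_def)

lemma eta_sq_inversion:
  assumes "Im z > 0"
  shows "eta_sq (-1/z) = norm z * eta_sq z"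
proof -
  have "z \<noteq> 0" using assms by auto
  hence "exp (2 * eta_log (-1/z)) = exp (2 * eta_log z) * (-\<i> * z)"
    unfolding eta_log_inversion[OF assms] by (simp add: ring_distribs exp_add)
  thus ?thesis by (simp add: eta_sq_def norm_mult)
qed

lemma eta_sq_translate: "eta_sq (z + of_int b) = eta_sq z"
  unfolding eta_sq_def eta_log_translate by (simp add: ring_distribs exp_add norm_mult norm_exp_eq_Re)

lemma mob_S:
  assumes "Im z > 0" "a * d - b * c = 1"
  shows "mob (-c) (-d) a b z = -1 / mob a b c d z"
    "norm (mob a b c d z) * norm (of_int c * z + of_int d) = norm (of_int a * z + of_int b)"
proof -
  have "c \<noteq> 0 \<or> d \<noteq> 0" using assms(2) by auto
  note nz = mob_denom_nonzero[OF assms(1) this]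
  have "mob (-c) (-d) a b z = - (of_int c * z + of_int d) / (of_int a * z + of_int b)"
    by (simp add: mob_def)
  thus "mob (-c) (-d) a b z = -1 / mob a b c d z" by (simp add: mob_def)
  show "norm (mob a b c d z) * norm (of_int c * z + of_int d) = norm (of_int a * z + of_int b)"
    unfolding norm_mult[symmetric] using nz by (simp add: mob_def)
qed

lemma eta_sq_modular:
  assumes det: "a * d - b * c = 1" and z: "Im z > 0"
  shows "eta_sq (mob a b c d z) = norm (of_int c * z + of_int d) * eta_sq z"
proof -
  define P where "P = (\<lambda>a b c d. eta_sq (mob a b c d z) = norm (of_int c * z + of_int d) * eta_sq z)"
  have "P a b c d"
  proof (rule SL2Z_induct[where P = P, OF det])
    fix b
    show "P 1 b 0 1" by (simp add: P_def mob_def eta_sq_translate)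
    have "mob (-1) b 0 (-1) z = z + of_int (-b)" by (simp add: mob_def)
    thus "P (-1) b 0 (-1)" unfolding P_def by (simp only: eta_sq_translate) simp
  next
    fix a b c d :: int assume det: "a * d - b * c = 1"
    hence "c \<noteq> 0 \<or> d \<noteq> 0" by auto
    thus "P a b c d \<longleftrightarrow> P (a + c) (b + d) c d"
      using mob_T[OF z, of c d a b] eta_sq_translate[of "mob a b c d z" 1] by (simp add: P_def)
    have "c \<noteq> 0 \<or> d \<noteq> 0" "a \<noteq> 0 \<or> b \<noteq> 0" using det by auto
    hence nz: "norm (of_int c * z + of_int d) \<noteq> 0" "norm (of_int a * z + of_int b) \<noteq> 0"
      using mob_denom_nonzero[OF z] by auto
    have "eta_sq (mob (-c) (-d) a b z) = norm (mob a b c d z) * eta_sq (mob a b c d z)"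
      unfolding mob_S(1)[OF z det] using Im_mob_pos[OF z, of a d b c] det by (intro eta_sq_inversion) auto
    also have "norm (mob a b c d z) = norm (of_int a * z + of_int b) / norm (of_int c * z + of_int d)"
      using mob_S(2)[OF z det] nz by (simp add: field_simps)
    finally have eq: "eta_sq (mob (-c) (-d) a b z) = norm (of_int a * z + of_int b) / norm (of_int c * z + of_int d) * eta_sq (mob a b c d z)" .
    have cancel: "X = W * K \<longleftrightarrow> U / W * X = U * K" if "U \<noteq> 0" "W \<noteq> 0" for U W X K :: real
      using that by (auto simp: field_simps)
    show "P a b c d \<longleftrightarrow> P (-c) (-d) a b"
      unfolding P_def eq by (rule cancel[OF nz(2,1)])
  qed
  thus ?thesis by (simp add: P_def)
qed

text \<open>
  The matrix $\mathrm{diag}(n,1)\gamma$ is $\gamma'$ times an upper triangular matrix with diagonal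
  $(\gcd(c,n), n/\gcd(c,n))$, for some $\gamma' \in SL_2(\mathbb{Z})$.
\<close>
lemma mob_scale_decompose:
  fixes n :: int
  assumes det: "a * d - b * c = 1" and n: "n > 0"
  defines "g \<equiv> gcd c n"
  obtains a' b' c' d' \<beta> where "a' * d' - b' * c' = 1"
    "\<And>z. Im z > 0 \<Longrightarrow> of_int n * mob a b c d z = mob a' b' c' d' (mob g \<beta> 0 (n div g) z)"
    "\<And>z. (of_int c' * mob g \<beta> 0 (n div g) z + of_int d') * of_int (n div g) = of_int c * z + of_int d"
proof -
  have g: "g > 0" using n by (simp add: g_def)
  define m where "m = n div g"
  define e where "e = c div g"
  have ng: "n = g * m" and cg: "c = g * e" by (simp_all add: m_def e_def g_def)
  have m: "m > 0" using n g ng by (simp add: zero_less_mult_iff)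
  have "coprime e m"
    using n unfolding e_def m_def g_def by (intro div_gcd_coprime) auto
  moreover have "coprime e a"
  proof (rule coprimeI)
    fix k assume "k dvd e" "k dvd a"
    hence "k dvd a * d - b * c" unfolding cg by (intro dvd_diff) auto
    thus "is_unit k" using det by simp
  qed
  ultimately have "coprime (m * a) e" by (simp add: coprime_commute)
  \<comment> \<open>The first column of \<gamma>' is (n a, c) divided by g, that is (m a, e). It is
    primitive, and Bezout coefficients complete it to determinant 1.\<close>
  then obtain u v where uv: "u * (m * a) + v * e = 1"
    using bezout_int[of "m * a" e] by (auto simp: coprime_iff_gcd_eq_1)
  \<comment> \<open>The upper right entry of the inverse of \<gamma>' times
    diag(n,1)\<gamma>.\<close>
  define \<beta> where "\<beta> = u * n * b + v * d"
  have det': "(m * a) * u - (- v) * e = 1" using uv by (simp add: algebra_simps)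
  have id1: "m * a * \<beta> - v * m = n * b"
  proof -
    have "m * a * \<beta> - v * m = (u * (m * a)) * (n * b) + v * m * (a * d - 1)"
      by (simp add: \<beta>_def algebra_simps)
    also have "a * d - 1 = b * c" using det by simp
    also have "(u * (m * a)) * (n * b) + v * m * (b * c) = n * b * (u * (m * a) + v * e)"
      by (simp add: cg ng algebra_simps)
    finally show ?thesis using uv by simp
  qed
  have id2: "e * \<beta> + u * m = d"
  proof -
    have "e * \<beta> + u * m = u * m * (1 + b * c) + v * e * d"
      by (simp add: \<beta>_def cg ng algebra_simps)
    also have "1 + b * c = a * d" using det by simp
    also have "u * m * (a * d) + v * e * d = d * (u * (m * a) + v * e)" by (simp add: algebra_simps)
    finally show ?thesis using uv by simp
  qed
  have m0: "(of_int m :: complex) \<noteq> 0" using m by simp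
  have U: "mob g \<beta> 0 m z = (of_int g * z + of_int \<beta>) / of_int m" for z by (simp add: mob_def)
  have den: "(of_int e * mob g \<beta> 0 m z + of_int u) * of_int m = of_int c * z + of_int d" for z
  proof -
    have "(of_int e * mob g \<beta> 0 m z + of_int u) * of_int m = of_int (g * e) * z + of_int (e * \<beta> + u * m)"
      unfolding U using m0 by (simp add: field_simps)
    thus ?thesis by (simp only: id2 flip: cg)
  qed
  have num: "(of_int (m * a) * mob g \<beta> 0 m z + of_int (-v)) * of_int m = of_int n * (of_int a * z + of_int b)" for z
  proof -
    have "(of_int (m * a) * mob g \<beta> 0 m z + of_int (-v)) * of_int m = of_int (g * m) * of_int a * z + of_int (m * a * \<beta> - v * m)"
      unfolding U using m0 by (simp add: field_simps)
    thus ?thesis by (simp only: id1 flip: ng) (simp add: algebra_simps)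
  qed
  have eq: "of_int n * mob a b c d z = mob (m * a) (-v) e u (mob g \<beta> 0 m z)" for z
  proof -
    have "of_int n * mob a b c d z = of_int n * (of_int a * z + of_int b) / (of_int c * z + of_int d)"
      by (simp add: mob_def)
    also have "\<dots> = ((of_int (m * a) * mob g \<beta> 0 m z + of_int (-v)) * of_int m) /
        ((of_int e * mob g \<beta> 0 m z + of_int u) * of_int m)" by (simp only: num den)
    also have "\<dots> = mob (m * a) (-v) e u (mob g \<beta> 0 m z)" using m0 by (simp add: mob_def)
    finally show ?thesis .
  qed
  show ?thesis
    by (rule that[of "m * a" u "-v" e \<beta>]) (use det' eq den in \<open>auto simp flip: m_def\<close>)
qed

text \<open>Two-sided, hence stable under inverses and quotients. For an eta quotient moved to a
  cusp, s is a negative multiple of its order there, obtained without any expansion at that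
  cusp.\<close>

definition comparable :: "(complex \<Rightarrow> real) \<Rightarrow> real \<Rightarrow> bool" where
  "comparable f s \<longleftrightarrow> (\<exists>C>0. \<exists>Y>0. \<forall>z. Im z \<ge> Y \<longrightarrow> f z \<le> C * exp (s * Im z) \<and> exp (s * Im z) \<le> C * f z)"

lemma comparable_mult:
  assumes "comparable f s" "comparable g t"
  shows "comparable (\<lambda>z. f z * g z) (s + t)"
proof -
  obtain C Y where f: "C > 0" "Y > 0" "\<And>z. Im z \<ge> Y \<Longrightarrow> f z \<le> C * exp (s * Im z) \<and> exp (s * Im z) \<le> C * f z"
    using assms(1) unfolding comparable_def by blast
  obtain D Z where g: "D > 0" "Z > 0" "\<And>z. Im z \<ge> Z \<Longrightarrow> g z \<le> D * exp (t * Im z) \<and> exp (t * Im z) \<le> D * g z"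
    using assms(2) unfolding comparable_def by blast
  have "f z * g z \<le> C * D * exp ((s + t) * Im z) \<and> exp ((s + t) * Im z) \<le> C * D * (f z * g z)"
    if "Im z \<ge> max Y Z" for z
  proof -
    have fz: "f z \<le> C * exp (s * Im z)" "exp (s * Im z) \<le> C * f z"
      and gz: "g z \<le> D * exp (t * Im z)" "exp (t * Im z) \<le> D * g z"
      using f(3)[of z] g(3)[of z] that by auto
    have "C * f z > 0" "D * g z > 0" using fz(2) gz(2) exp_gt_zero less_le_trans by blast+
    hence pos: "f z > 0" "g z > 0" using f(1) g(1) by (auto simp: zero_less_mult_iff)
    have "f z * g z \<le> (C * exp (s * Im z)) * (D * exp (t * Im z))"
      using fz gz pos f(1) by (intro mult_mono) auto
    moreover have "exp (s * Im z) * exp (t * Im z) \<le> (C * f z) * (D * g z)"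
      using fz gz pos f(1) by (intro mult_mono) auto
    ultimately show ?thesis by (simp add: ring_distribs exp_add mult_ac)
  qed
  thus ?thesis unfolding comparable_def using f g
    by (intro exI[of _ "C * D"] conjI exI[of _ "max Y Z"]) auto
qed

lemma comparable_inverse:
  assumes "comparable f s"
  shows "comparable (\<lambda>z. inverse (f z)) (- s)"
proof -
  obtain C Y where f: "C > 0" "Y > 0" "\<And>z. Im z \<ge> Y \<Longrightarrow> f z \<le> C * exp (s * Im z) \<and> exp (s * Im z) \<le> C * f z"
    using assms(1) unfolding comparable_def by blast
  have "inverse (f z) \<le> C * exp (- s * Im z) \<and> exp (- s * Im z) \<le> C * inverse (f z)"
    if "Im z \<ge> Y" for z
  proof -
    have fz: "f z \<le> C * exp (s * Im z)" "exp (s * Im z) \<le> C * f z" using f(3)[of z] that by auto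
    have "C * f z > 0" using fz(2) exp_gt_zero less_le_trans by blast
    hence pos: "f z > 0" using f(1) by (auto simp: zero_less_mult_iff)
    show ?thesis using fz pos f(1) by (simp add: exp_minus field_simps)
  qed
  thus ?thesis unfolding comparable_def using f by auto
qed

lemma comparable_divide:
  "comparable f s \<Longrightarrow> comparable g t \<Longrightarrow> comparable (\<lambda>z. f z / g z) (s - t)"
  using comparable_mult[OF _ comparable_inverse, of f s g t] by (simp add: divide_inverse)

lemma comparable_power: "comparable f s \<Longrightarrow> comparable (\<lambda>z. f z ^ n) (of_nat n * s)"
proof (induction n)
  case 0
  show ?case unfolding comparable_def by (auto intro!: exI[of _ 1])
next
  case (Suc n)
  from comparable_mult[OF Suc(2) Suc.IH[OF Suc(2)]] show ?case by (simp add: algebra_simps)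
qed

text \<open>The exponent comes from the factor q^(1/24) of \<eta>, squared. The remaining factor is
  the exponential of a power series in q, which is bounded on the closed disc belonging to Im w
  \<ge> y0.\<close>

lemma eta_sq_comparable:
  assumes "y0 > 0"
  obtains C where "C > 0" "\<And>w. Im w \<ge> y0 \<Longrightarrow> eta_sq w \<le> C * exp (- (pi / 6) * Im w)"
    "\<And>w. Im w \<ge> y0 \<Longrightarrow> exp (- (pi / 6) * Im w) \<le> C * eta_sq w"
proof -
  define r where "r = exp (-2 * pi * y0)"
  have "2 * pi * y0 > 0" using assms by (intro mult_pos_pos) auto
  hence r: "r < 1" unfolding r_def by (simp only: exp_less_one_iff)
  have "continuous_on (cball 0 r) (eval_fps eta_log_fps)"
  proof (rule continuous_on_subset[OF continuous_on_eval_fps])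
    show "cball 0 r \<subseteq> eball (0::complex) (fps_conv_radius eta_log_fps)"
    proof
      fix x :: complex assume "x \<in> cball 0 r"
      hence "ereal (norm x) < 1" using r by (simp add: one_ereal_def)
      also note eta_log_fps_conv_radius
      finally show "x \<in> eball 0 (fps_conv_radius eta_log_fps)" by (simp add: in_eball_iff)
    qed
  qed
  hence "bounded (eval_fps eta_log_fps ` cball 0 r)"
    by (intro compact_imp_bounded compact_continuous_image) auto
  then obtain B where B: "\<And>x. x \<in> cball 0 r \<Longrightarrow> norm (eval_fps eta_log_fps x) \<le> B"
    unfolding bounded_iff by blast
  have eq: "eta_sq w = exp (- (pi / 6) * Im w) * exp (2 * Re (eval_fps eta_log_fps (exp (2 * of_real pi * \<i> * w))))" for w
    unfolding eta_sq_def norm_exp_eq_Re eta_log_def exp_add[symmetric] by simp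
  have bd: "\<bar>Re (eval_fps eta_log_fps (exp (2 * of_real pi * \<i> * w)))\<bar> \<le> B" if "Im w \<ge> y0" for w
  proof -
    have "exp (2 * of_real pi * \<i> * w) \<in> cball 0 r"
      using that by (simp add: norm_exp_2pii r_def)
    from B[OF this] show ?thesis by (rule order.trans[OF abs_Re_le_cmod])
  qed
  show ?thesis
  proof (rule that[of "exp (2 * B)"])
    fix w assume w: "Im w \<ge> y0"
    let ?R = "Re (eval_fps eta_log_fps (exp (2 * of_real pi * \<i> * w)))"
    have "exp (2 * ?R) \<le> exp (2 * B)" using bd[OF w] by simp
    thus "eta_sq w \<le> exp (2 * B) * exp (- (pi / 6) * Im w)" unfolding eq by simp
    have "1 \<le> exp (2 * B + 2 * ?R)" using bd[OF w] by simp
    hence "1 \<le> exp (2 * B) * exp (2 * ?R)" by (simp only: exp_add)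
    hence "exp (- (pi / 6) * Im w) * 1 \<le> exp (- (pi / 6) * Im w) * (exp (2 * B) * exp (2 * ?R))"
      by (intro mult_left_mono) auto
    thus "exp (- (pi / 6) * Im w) \<le> exp (2 * B) * eta_sq w" unfolding eq by (simp only: mult_ac mult_1_right)
  qed auto
qed

text \<open>By \<open>mob_scale_decompose\<close> the argument is equivalent under SL_2(Z) to a
  point of height (g / m) Im z with g = gcd c n and n = g m, and g / m = g^2 / n. Dividing by the
  automorphy factor leaves a pure exponential size.\<close>

lemma eta_sq_cusp_comparable:
  fixes n :: int
  assumes det: "a * d - b * c = 1" and n: "n > 0"
  shows "comparable (\<lambda>z. eta_sq (of_int n * mob a b c d z) / norm (of_int c * z + of_int d))
           (- (pi / 6) * of_int ((gcd c n)\<^sup>2) / of_int n)"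
proof -
  define g where "g = gcd c n"
  obtain a' b' c' d' \<beta> where det': "a' * d' - b' * c' = 1"
    and eq0: "\<And>z. Im z > 0 \<Longrightarrow> of_int n * mob a b c d z = mob a' b' c' d' (mob (gcd c n) \<beta> 0 (n div gcd c n) z)"
    and den0: "\<And>z. (of_int c' * mob (gcd c n) \<beta> 0 (n div gcd c n) z + of_int d') * of_int (n div gcd c n) = of_int c * z + of_int d"
    by (rule mob_scale_decompose[OF det n]) (rule that)
  note eq = eq0[folded g_def] and den = den0[folded g_def]
  define m where "m = n div g"
  have g: "g > 0" using n by (simp add: g_def)
  have ng: "n = g * m" by (simp add: m_def g_def)
  have m: "m > 0" using n g ng by (simp add: zero_less_mult_iff)
  have Im: "Im (mob g \<beta> 0 m z) = of_int g / of_int m * Im z" for z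
    unfolding mob_def using Im_divide_of_real[of "of_int g * z + of_int \<beta>" "of_int m"] by simp
  obtain C where C: "C > 0" "\<And>w. Im w \<ge> 1 \<Longrightarrow> eta_sq w \<le> C * exp (- (pi / 6) * Im w)"
    "\<And>w. Im w \<ge> 1 \<Longrightarrow> exp (- (pi / 6) * Im w) \<le> C * eta_sq w"
    by (rule eta_sq_comparable[OF zero_less_one]) (rule that)
  define C' where "C' = C * of_int m"
  have main: "eta_sq (of_int n * mob a b c d z) / norm (of_int c * z + of_int d) = eta_sq (mob g \<beta> 0 m z) / of_int m"
    if z: "Im z > 0" for z
  proof -
    define w where "w = mob g \<beta> 0 m z"
    have w: "Im w > 0" using z g m by (simp add: w_def Im)
    have "c \<noteq> 0 \<or> d \<noteq> 0" using det by auto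
    note nz = mob_denom_nonzero[OF z this]
    have "norm (of_int c * z + of_int d) = norm (of_int c' * w + of_int d') * of_int m"
      using m unfolding den[of z, symmetric] w_def m_def by (simp add: norm_mult)
    moreover have "eta_sq (of_int n * mob a b c d z) = norm (of_int c' * w + of_int d') * eta_sq w"
      unfolding eq[OF z] m_def[symmetric] w_def[symmetric] by (rule eta_sq_modular[OF det' w])
    ultimately show ?thesis using m nz by (auto simp: w_def field_simps)
  qed
  have "eta_sq (of_int n * mob a b c d z) / norm (of_int c * z + of_int d) \<le> (C + C') * exp (- (pi / 6) * of_int (g\<^sup>2) / of_int n * Im z) \<and>
     exp (- (pi / 6) * of_int (g\<^sup>2) / of_int n * Im z) \<le> (C + C') * (eta_sq (of_int n * mob a b c d z) / norm (of_int c * z + of_int d))"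
    if z: "Im z \<ge> of_int m / of_int g" for z
  proof -
    have z0: "Im z > 0" using z g m by (meson divide_pos_pos less_le_trans of_int_0_less_iff)
    have w: "Im (mob g \<beta> 0 m z) \<ge> 1" using z g m by (simp add: Im field_simps)
    have ex: "- (pi / 6) * of_int (g\<^sup>2) / of_int n * Im z = - (pi / 6) * Im (mob g \<beta> 0 m z)"
      using g m by (simp add: Im ng power2_eq_square)
    have m1: "of_int m \<ge> (1::real)" using m by simp
    let ?e = "exp (- (pi / 6) * Im (mob g \<beta> 0 m z))"
    have "eta_sq (mob g \<beta> 0 m z) / of_int m \<le> eta_sq (mob g \<beta> 0 m z) / 1"
      using m1 by (intro divide_left_mono) (auto intro: less_imp_le)
    also have "\<dots> \<le> C * ?e" using C(2)[OF w] by simp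
    also have "\<dots> \<le> (C + C') * ?e" using C(1) m by (intro mult_right_mono) (auto simp: C'_def)
    finally have 1: "eta_sq (mob g \<beta> 0 m z) / of_int m \<le> (C + C') * ?e" .
    have "?e \<le> C * eta_sq (mob g \<beta> 0 m z)" by (rule C(3)[OF w])
    also have "\<dots> = C' * (eta_sq (mob g \<beta> 0 m z) / of_int m)" using m by (simp add: C'_def)
    also have "\<dots> \<le> (C + C') * (eta_sq (mob g \<beta> 0 m z) / of_int m)"
      using C(1) m by (intro mult_right_mono divide_nonneg_pos) (auto intro: less_imp_le)
    finally show ?thesis using 1 unfolding main[OF z0] ex by simp
  qed
  thus ?thesis unfolding comparable_def g_def[symmetric]
    using C(1) m g by (intro exI[of _ "C + C'"] conjI exI[of _ "of_int m / of_int g"])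
      (auto simp: C'_def intro!: add_pos_pos mult_pos_pos divide_pos_pos)
qed

subsection \<open>The basic eta quotients\<close>

text \<open>
  $\frac{\eta(z)\eta(23z)}{\eta(2z)\eta(46z)}$, the same at \<open>2z\<close>, and
  $\frac{\eta(4z)^4\eta(46z)^2}{\eta(2z)^2\eta(92z)^4}$.
\<close>
definition f0 :: "complex \<Rightarrow> complex" where "f0 z = exp (- phi_log z - phi_log (23 * z))"
definition x0 :: "complex \<Rightarrow> complex" where "x0 z = f0 (2 * z)"
definition K0 :: "complex \<Rightarrow> complex" where "K0 z = exp (kappa_log (2 * z) - kappa_log (46 * z))"

text \<open>The pair \<open>u\<close>, \<open>v\<close> stands for \<open>z\<close>,
  \<open>23 * z\<close> in either order; the reversed order serves the involution, which exchanges
  the two factors of \<open>f0\<close>.\<close>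

lemma f0_eqI:
  assumes "exp (phi_log w) = exp (of_real pi * \<i> * of_int m / 12) * exp (phi_log u)"
    and "exp (phi_log (23 * w)) = exp (of_real pi * \<i> * of_int n / 12) * exp (phi_log v)"
    and "24 dvd m + n" and "exp (phi_log u) * exp (phi_log v) = exp (phi_log z) * exp (phi_log (23 * z))"
  shows "f0 w = f0 z"
proof -
  have f: "f0 t = inverse (exp (phi_log t) * exp (phi_log (23 * t)))" for t
    by (simp add: f0_def exp_diff exp_minus field_simps)
  have "exp (phi_log w) * exp (phi_log (23 * w)) =
      exp (of_real pi * \<i> * of_int (m + n) / 12) * (exp (phi_log u) * exp (phi_log v))"
    unfolding assms(1,2) by (simp add: ring_distribs add_divide_distrib exp_add)
  also have "exp (of_real pi * \<i> * of_int (m + n) / 12) = exp (of_real pi * \<i> * of_int 0 / 12)"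
    by (rule exp_pi_12_cong) (use assms(3) in simp)
  finally show ?thesis unfolding f assms(4) by simp
qed

text \<open>The two multipliers belong to the matrices with entries (b, 23 e) and (23 b, e), so
  terms linear in b or e add up with the coefficient 1 + 23 = 24.\<close>

lemma f0_Gamma0:
  assumes det: "a * d - b * c = 1" and c: "46 dvd c" and z: "Im z > 0"
  shows "f0 (mob a b c d z) = f0 z"
proof -
  from c obtain e where e: "c = 46 * e" by auto
  have d: "odd d" using det unfolding e by (metis dvd_diff dvd_mult dvd_mult2 even_numeral mult.commute odd_one)
  obtain k where k: "d * d = 1 + 8 * k" using odd_square_mod_8[OF d] .
  have h: "(d * d - 1) div 2 = 4 * k" by (simp add: k)
  have det1: "a * d - 2 * b * (23 * e) = 1" "a * d - 2 * (23 * b) * e = 1" using det by (simp_all add: e)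
  have z': "Im (23 * z) > 0" using z by simp
  have 1: "exp (phi_log (mob a b c d z)) = exp (of_real pi * \<i> * of_int (phi_exponent a b (23 * e) d) / 12) * exp (phi_log z)"
    using phi_multiplier[OF det1(1) z] by (simp add: e)
  have "23 * mob a b c d z = mob a (23 * b) (2 * e) d (23 * z)"
    by (simp add: mob_def e algebra_simps)
  hence 2: "exp (phi_log (23 * mob a b c d z)) = exp (of_real pi * \<i> * of_int (phi_exponent a (23 * b) e d) / 12) * exp (phi_log (23 * z))"
    using phi_multiplier[OF det1(2) z'] by simp
  have "phi_exponent a b (23 * e) d + phi_exponent a (23 * b) e d =
      24 * (b * d + 46 * b * d * e * e + 2 * d * e - a * e + k)"
    unfolding phi_exponent_def h by (simp add: algebra_simps)
  hence "24 dvd phi_exponent a b (23 * e) d + phi_exponent a (23 * b) e d" by (metis dvd_triv_left)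
  from f0_eqI[OF 1 2 this refl] show ?thesis .
qed

text \<open>The matrix is an element of \<Gamma>_0(2) times diag(23, 1), so \<open>phi_log\<close>
  at the image is governed by 23 z, and after multiplication by 23 it is governed by z.\<close>

lemma f0_W:
  assumes det: "23 * a * d - 2 * b * c = 1" and z: "Im z > 0"
  shows "f0 (mob (23 * a) b (46 * c) (23 * d) z) = f0 z"
proof -
  let ?w = "mob (23 * a) b (46 * c) (23 * d) z"
  have d: "odd d" using det by (metis dvd_diff dvd_mult dvd_mult2 dvd_refl odd_one mult.assoc)
  obtain k where k: "d * d = 1 + 8 * k" using odd_square_mod_8[OF d] .
  have h: "(d * d - 1) div 2 = 4 * k" by (simp add: k)
  have "(23 * d) * (23 * d) - 1 = 529 * (d * d) - 1" by simp
  also have "\<dots> = 2 * (264 + 529 * 4 * k)" unfolding k by simp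
  finally have h': "((23 * d) * (23 * d) - 1) div 2 = 264 + 2116 * k" by simp
  have det1: "a * (23 * d) - 2 * b * c = 1" "(23 * a) * d - 2 * b * c = 1" using det by simp_all
  have z': "Im (23 * z) > 0" using z by simp
  have "?w = mob a b (2 * c) (23 * d) (23 * z)" by (simp add: mob_def algebra_simps)
  hence 1: "exp (phi_log ?w) = exp (of_real pi * \<i> * of_int (phi_exponent a b c (23 * d)) / 12) * exp (phi_log (23 * z))"
    using phi_multiplier[OF det1(1) z'] by simp
  have "23 * ?w = mob (23 * a) b (2 * c) d z"
  proof -
    have "of_int (46 * c) * z + of_int (23 * d) = 23 * (of_int (2 * c) * z + of_int d)" by simp
    moreover have "23 * (N / (23 * D)) = N / D" for N D :: complex by simp
    ultimately show ?thesis by (simp only: mob_def)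
  qed
  hence 2: "exp (phi_log (23 * ?w)) = exp (of_real pi * \<i> * of_int (phi_exponent (23 * a) b c d) / 12) * exp (phi_log z)"
    using phi_multiplier[OF det1(2) z] by simp
  have "phi_exponent a b c (23 * d) + phi_exponent (23 * a) b c d =
      24 * (b * d * (1 + 2 * c * c) + 2 * d * c - a * c + 33 + 265 * k)"
    unfolding phi_exponent_def h h' by (simp add: algebra_simps)
  hence "24 dvd phi_exponent a b c (23 * d) + phi_exponent (23 * a) b c d" by (metis dvd_triv_left)
  from f0_eqI[OF 1 2 this mult.commute] show ?thesis .
qed

lemma x0_Gamma0:
  assumes det: "a * d - b * c = 1" and c: "92 dvd c" and z: "Im z > 0"
  shows "x0 (mob a b c d z) = x0 z"
proof -
  from c obtain e where e: "c = 92 * e" by auto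
  have "2 * mob a b c d z = mob a (2 * b) (46 * e) d (2 * z)"
    by (simp add: mob_def e algebra_simps)
  thus ?thesis unfolding x0_def using f0_Gamma0[of a d "2 * b" "46 * e" "2 * z"] det z by (simp add: e)
qed

lemma x0_W:
  assumes det: "23 * a * d - 4 * b * c = 1" and z: "Im z > 0"
  shows "x0 (mob (23 * a) b (92 * c) (23 * d) z) = x0 z"
proof -
  have "2 * mob (23 * a) b (92 * c) (23 * d) z = mob (23 * a) (2 * b) (46 * c) (23 * d) (2 * z)"
    by (simp add: mob_def algebra_simps)
  thus ?thesis unfolding x0_def using f0_W[of a d "2 * b" c "2 * z"] det z by simp
qed

lemma K0_Gamma0:
  assumes det: "a * d - b * c = 1" and c: "92 dvd c" and z: "Im z > 0"
  shows "K0 (mob a b c d z) = K0 z"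
proof -
  from c obtain e where e: "c = 92 * e" by auto
  let ?w = "mob a b c d z"
  have nz: "of_int (92 * e) * z + of_int d \<noteq> 0"
    by (rule mob_denom_nonzero[OF z]) (use det e in auto)
  have det1: "a * d - 2 * (2 * b) * (23 * e) = 1" "a * d - 2 * (46 * b) * e = 1" using det by (simp_all add: e)
  have "2 * ?w = mob a (2 * b) (2 * (23 * e)) d (2 * z)" by (simp add: mob_def e algebra_simps)
  hence 1: "exp (kappa_log (2 * ?w)) = (of_int (92 * e) * z + of_int d) *
      exp (of_real pi * \<i> * of_int (2 * b * d + d - 1) / 2) * exp (kappa_log (2 * z))"
    using kappa_multiplier[OF det1(1), of "2 * z"] z by (simp add: mult_ac)
  have "46 * ?w = mob a (46 * b) (2 * e) d (46 * z)" by (simp add: mob_def e algebra_simps)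
  hence 2: "exp (kappa_log (46 * ?w)) = (of_int (92 * e) * z + of_int d) *
      exp (of_real pi * \<i> * of_int (46 * b * d + d - 1) / 2) * exp (kappa_log (46 * z))"
    using kappa_multiplier[OF det1(2), of "46 * z"] z by (simp add: mult_ac)
  have "46 * b * d + d - 1 - (2 * b * d + d - 1) = 4 * (11 * b * d)" by simp
  hence "4 dvd 46 * b * d + d - 1 - (2 * b * d + d - 1)" by (metis dvd_triv_left)
  hence 3: "exp (of_real pi * \<i> * of_int (46 * b * d + d - 1) / 2) = exp (of_real pi * \<i> * of_int (2 * b * d + d - 1) / 2)"
    by (rule exp_pi_2_cong)
  have cancel: "(u * v * p) / (u * v * q) = p / q" if "u \<noteq> 0" "v \<noteq> 0" for u v p q :: complex
    using that by simp
  show ?thesis unfolding K0_def exp_diff 1 2 3 by (rule cancel[OF nz]) simp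
qed

text \<open>The involution exchanges the two factors of \<open>K0\<close>. Their automorphy factors
  differ by 23, and their roots of unity by -1 because 23 is 3 modulo 4.\<close>

lemma K0_W:
  assumes det: "23 * a * d - 4 * b * c = 1" and z: "Im z > 0"
  shows "K0 (mob (23 * a) b (92 * c) (23 * d) z) = -23 / K0 z"
proof -
  let ?w = "mob (23 * a) b (92 * c) (23 * d) z"
  have nz: "of_int (4 * c) * z + of_int d \<noteq> 0"
    by (rule mob_denom_nonzero[OF z]) (use det in auto)
  have det1: "a * (23 * d) - 2 * (2 * b) * c = 1" "(23 * a) * d - 2 * (2 * b) * c = 1" using det by simp_all
  have d: "odd d" using det by (metis dvd_diff dvd_mult dvd_mult2 even_numeral odd_one mult.assoc)
  have "2 * ?w = mob a (2 * b) (2 * c) (23 * d) (46 * z)" by (simp add: mob_def algebra_simps)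
  hence 1: "exp (kappa_log (2 * ?w)) = (23 * (of_int (4 * c) * z + of_int d)) *
      exp (of_real pi * \<i> * of_int (46 * b * d + 23 * d - 1) / 2) * exp (kappa_log (46 * z))"
    using kappa_multiplier[OF det1(1), of "46 * z"] z by (simp add: algebra_simps)
  have "46 * ?w = mob (23 * a) (2 * b) (2 * c) d (2 * z)"
  proof -
    have "of_int (92 * c) * z + of_int (23 * d) = 23 * (of_int (4 * c) * z + of_int d)" by simp
    moreover have "46 * (N / (23 * D)) = (2 * N) / D" for N D :: complex by simp
    ultimately have "46 * ?w = (2 * (of_int (23 * a) * z + of_int b)) / (of_int (4 * c) * z + of_int d)"
      by (simp only: mob_def)
    thus ?thesis by (simp add: mob_def algebra_simps)
  qed
  hence 2: "exp (kappa_log (46 * ?w)) = (of_int (4 * c) * z + of_int d) *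
      exp (of_real pi * \<i> * of_int (2 * b * d + d - 1) / 2) * exp (kappa_log (2 * z))"
    using kappa_multiplier[OF det1(2), of "2 * z"] z by (simp add: algebra_simps)
  obtain m where m: "d = 2 * m + 1" using d by (elim oddE)
  have "46 * b * d + 23 * d - 1 - (2 * b * d + d - 1 + 2) = 4 * (11 * b * d + 11 * m + 5)"
    by (simp add: m algebra_simps)
  hence "4 dvd 46 * b * d + 23 * d - 1 - (2 * b * d + d - 1 + 2)" by (metis dvd_triv_left)
  hence "exp (of_real pi * \<i> * of_int (46 * b * d + 23 * d - 1) / 2) = exp (of_real pi * \<i> * of_int (2 * b * d + d - 1 + 2) / 2)"
    by (rule exp_pi_2_cong)
  also have "of_real pi * \<i> * of_int (2 * b * d + d - 1 + 2) / 2 = of_real pi * \<i> * of_int (2 * b * d + d - 1) / 2 + of_real pi * \<i>"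
    by (simp add: field_simps)
  also have "exp \<dots> = - exp (of_real pi * \<i> * of_int (2 * b * d + d - 1) / 2)"
    by (simp only: exp_add) simp
  finally have 3: "exp (of_real pi * \<i> * of_int (46 * b * d + 23 * d - 1) / 2) = - exp (of_real pi * \<i> * of_int (2 * b * d + d - 1) / 2)" .
  have cancel: "((23 * u) * - v * p) / (u * v * q) = -23 / (q / p)" if "u \<noteq> 0" "v \<noteq> 0" "p \<noteq> 0" "q \<noteq> 0" for u v p q :: complex
    using that by (simp add: field_simps)
  show ?thesis unfolding K0_def exp_diff 1 2 3 by (rule cancel[OF nz]) simp_all
qed

lemma eta_log_analytic: "eta_log analytic_on {z. Im z > 0}"
proof -
  have "eta_log holomorphic_on {z. Im z > 0}"
  proof (rule holomorphic_onI)
    fix z assume "z \<in> {z. Im z > 0}"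
    hence z: "Im z > 0" by simp
    obtain L where "(\<lambda>n. of_nat (divisor_sum n) * exp (2 * of_real pi * \<i> * z) ^ n) sums L"
      by (rule Lambert_sums[OF norm_q_less_1[OF z]]) (rule that)
    from eta_log_has_field_derivative[OF z this]
    show "eta_log field_differentiable at z within {z. Im z > 0}"
      by (auto simp: field_differentiable_def intro: has_field_derivative_at_within)
  qed
  thus ?thesis by (simp add: analytic_on_open open_halfspace_Im_gt)
qed

lemma eta_log_analytic' [analytic_intros]:
  assumes "g analytic_on A" "\<And>z. z \<in> A \<Longrightarrow> Im (g z) > 0"
  shows "(\<lambda>z. eta_log (g z)) analytic_on A"
  using analytic_on_compose_gen[OF assms(1) eta_log_analytic] assms(2) by (auto simp: o_def)

lemma basic_analytic:
  "f0 analytic_on {z. Im z > 0}" "x0 analytic_on {z. Im z > 0}" "K0 analytic_on {z. Im z > 0}"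
  unfolding f0_def[abs_def] x0_def[abs_def] K0_def[abs_def] phi_log_def kappa_log_def
  by (intro analytic_intros; simp)+

lemma basic_nonzero [simp]: "f0 z \<noteq> 0" "x0 z \<noteq> 0" "K0 z \<noteq> 0"
  by (simp_all add: f0_def x0_def K0_def)

section \<open>Orders of the basic functions at the cusps\<close>

lemma norm_f0: "norm (f0 w) ^ 2 = (eta_sq w * eta_sq (23 * w)) / (eta_sq (2 * w) * eta_sq (46 * w))"
proof -
  have "norm (f0 w) ^ 2 = norm (exp (2 * (- phi_log w - phi_log (23 * w))))"
    by (simp only: f0_def exp_double norm_power)
  also have "2 * (- phi_log w - phi_log (23 * w)) = (2 * eta_log w + 2 * eta_log (23 * w)) - (2 * eta_log (2 * w) + 2 * eta_log (46 * w))"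
    by (simp add: phi_log_def)
  finally show ?thesis by (simp only: exp_diff exp_add norm_divide norm_mult eta_sq_def)
qed

lemma norm_K0: "norm (K0 w) ^ 2 = (eta_sq (4 * w) ^ 4 * eta_sq (46 * w) ^ 2) / (eta_sq (2 * w) ^ 2 * eta_sq (92 * w) ^ 4)"
proof -
  have p: "norm (exp (of_nat n * (2 * eta_log u))) = eta_sq u ^ n" for n u
    by (simp only: exp_of_nat_mult norm_power eta_sq_def)
  have "norm (K0 w) ^ 2 = norm (exp (2 * (kappa_log (2 * w) - kappa_log (46 * w))))"
    by (simp only: K0_def exp_double norm_power)
  also have "2 * (kappa_log (2 * w) - kappa_log (46 * w)) = (of_nat 4 * (2 * eta_log (4 * w)) + of_nat 2 * (2 * eta_log (46 * w)))
     - (of_nat 2 * (2 * eta_log (2 * w)) + of_nat 4 * (2 * eta_log (92 * w)))"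
    by (simp add: kappa_log_def)
  finally show ?thesis by (simp only: exp_diff exp_add norm_divide norm_mult p)
qed

text \<open>Proportional to the order of \<open>\<eta>(nz)\<close> at a cusp with denominator \<open>c\<close>.\<close>
definition cusp_weight :: "int \<Rightarrow> int \<Rightarrow> real" where
  "cusp_weight c n = of_int ((gcd c n)\<^sup>2) / of_int n"

text \<open>Each quotient has equal total weight above and below the bar, so the factors |c z + d|
  cancel and the exponents of \<open>eta_sq_cusp_comparable\<close> combine linearly.\<close>

lemma cusp_comparable:
  assumes det: "a * d - b * c = 1"
  defines "G \<equiv> cusp_weight c"
  shows "comparable (\<lambda>z. norm (f0 (mob a b c d z)) ^ 2) (- (pi / 6) * (G 1 + G 23 - (G 2 + G 46)))"
    "comparable (\<lambda>z. norm (x0 (mob a b c d z)) ^ 2) (- (pi / 6) * (G 2 + G 46 - (G 4 + G 92)))"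
    "comparable (\<lambda>z. norm (K0 (mob a b c d z)) ^ 2) (- (pi / 6) * (4 * G 4 + 2 * G 46 - (2 * G 2 + 4 * G 92)))"
proof -
  define J where "J = (\<lambda>z. norm (of_int c * z + of_int d :: complex))"
  define E where "E = (\<lambda>n z. eta_sq (of_int n * mob a b c d z) / J z)"
  have E: "comparable (E n) (- (pi / 6) * G n)" if "n > 0" for n
    using eta_sq_cusp_comparable[OF det that] unfolding E_def J_def G_def cusp_weight_def
    by (simp only: times_divide_eq_right)
  have EE: "comparable (\<lambda>z. (E k z * E l z) / (E m z * E n z)) (- (pi / 6) * (G k + G l - (G m + G n)))"
    if "k > 0" "l > 0" "m > 0" "n > 0" for k l m n
  proof -
    have "- (pi / 6) * G k + - (pi / 6) * G l - (- (pi / 6) * G m + - (pi / 6) * G n) = - (pi / 6) * (G k + G l - (G m + G n))"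
      by (simp add: algebra_simps add_divide_distrib)
    thus ?thesis
      using comparable_divide[OF comparable_mult[OF E E] comparable_mult[OF E E], of k l m n] that by simp
  qed
  have J: "J z \<noteq> 0" if "Im z > 0" for z
  proof -
    have "c \<noteq> 0 \<or> d \<noteq> 0" using det by auto
    from mob_denom_nonzero[OF that this] show ?thesis by (simp add: J_def)
  qed
  have cong: "comparable g s" if "comparable f s" "\<And>z. Im z > 0 \<Longrightarrow> f z = g z" for f g s
  proof -
    from that(1) obtain C Y where "C > 0" "Y > 0" "\<And>z. Im z \<ge> Y \<Longrightarrow> f z \<le> C * exp (s * Im z) \<and> exp (s * Im z) \<le> C * f z"
      unfolding comparable_def by blast
    thus ?thesis unfolding comparable_def using that(2)
      by (intro exI[of _ C] conjI exI[of _ Y]) (auto simp: less_le_trans)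
  qed
  have cancel: "(p / j * (q / j)) / (r / j * (s / j)) = (p * q) / (r * s)" if "j \<noteq> 0" for p q r s j :: real
    using that by (simp add: field_simps)
  show "comparable (\<lambda>z. norm (f0 (mob a b c d z)) ^ 2) (- (pi / 6) * (G 1 + G 23 - (G 2 + G 46)))"
    by (rule cong[OF EE[of 1 23 2 46]]) (simp_all add: norm_f0 E_def cancel J)
  show "comparable (\<lambda>z. norm (x0 (mob a b c d z)) ^ 2) (- (pi / 6) * (G 2 + G 46 - (G 4 + G 92)))"
    by (rule cong[OF EE[of 2 46 4 92]]) (simp_all add: norm_f0 x0_def E_def cancel J)
  have cancel2: "((p / j) ^ 4 * (q / j) ^ 2) / ((r / j) ^ 2 * (s / j) ^ 4) = (p ^ 4 * q ^ 2) / (r ^ 2 * s ^ 4)" if "j \<noteq> 0" for p q r s j :: real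
    using that by (simp add: power_divide)
  have "comparable (\<lambda>z. (E 4 z ^ 4 * E 46 z ^ 2) / (E 2 z ^ 2 * E 92 z ^ 4))
     ((of_nat 4 * (- (pi / 6) * G 4) + of_nat 2 * (- (pi / 6) * G 46)) - (of_nat 2 * (- (pi / 6) * G 2) + of_nat 4 * (- (pi / 6) * G 92)))"
    by (intro comparable_divide comparable_mult comparable_power E) auto
  also have "(of_nat 4 * (- (pi / 6) * G 4) + of_nat 2 * (- (pi / 6) * G 46)) - (of_nat 2 * (- (pi / 6) * G 2) + of_nat 4 * (- (pi / 6) * G 92))
      = - (pi / 6) * (4 * G 4 + 2 * G 46 - (2 * G 2 + 4 * G 92))"
    by (simp add: algebra_simps)
  finally show "comparable (\<lambda>z. norm (K0 (mob a b c d z)) ^ 2) (- (pi / 6) * (4 * G 4 + 2 * G 46 - (2 * G 2 + 4 * G 92)))"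
    by (rule cong) (simp add: norm_K0 E_def cancel2 J)
qed

text \<open>This separates the primes 2 and 23: in the orders of \<open>f0\<close> and
  \<open>x0\<close> the prime 23 contributes only a common positive factor, and all inequalities
  become statements about c modulo 4.\<close>

lemma cusp_weight_23:
  fixes c k :: int
  assumes k: "k > 0" "\<not> 23 dvd k"
  shows "cusp_weight c (23 * k) = cusp_weight c 23 * cusp_weight c k"
proof -
  have "prime (23::int)" by simp
  hence cop: "coprime 23 k" using k(2) by (rule prime_imp_coprime)
  have "gcd c (23 * k) = gcd c 23 * gcd c k"
  proof (cases "23 dvd c")
    case True
    then obtain e where e: "c = 23 * e" by auto
    have "gcd c k = gcd e k" unfolding e using cop by (metis coprime_commute gcd_mult_left_left_cancel)
    moreover have "gcd c (23 * k) = 23 * gcd e k" unfolding e by (simp add: gcd_mult_left abs_mult)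
    moreover have "gcd c 23 = 23" unfolding e by (simp add: gcd_proj2_if_dvd)
    ultimately show ?thesis by simp
  next
    case False
    hence "coprime 23 c" using \<open>prime (23::int)\<close> by (metis prime_imp_coprime)
    hence "gcd c 23 = 1" "gcd c (23 * k) = gcd c k"
      using gcd_mult_right_left_cancel[of c 23 k] by (simp_all add: coprime_commute)
    thus ?thesis by simp
  qed
  thus ?thesis using k by (simp add: cusp_weight_def power_mult_distrib)
qed

lemma cusp_weight_small:
  "cusp_weight c 1 = 1"
  "cusp_weight c 2 = (if even c then 2 else 1 / 2)"
  "cusp_weight c 4 = (if 4 dvd c then 4 else if even c then 1 else 1 / 4)"
  "cusp_weight c 23 > 0"
proof -
  show "cusp_weight c 1 = 1" by (simp add: cusp_weight_def)
  have 2: "gcd c 2 = (if even c then 2 else 1)"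
    by (auto simp: gcd_proj2_if_dvd coprime_right_2_iff_odd)
  thus "cusp_weight c 2 = (if even c then 2 else 1 / 2)" by (simp add: cusp_weight_def)
  have "gcd c 4 = (if 4 dvd c then 4 else if even c then 2 else 1)"
  proof (cases "even c")
    case True
    then obtain e where e: "c = 2 * e" by auto
    have "gcd c 4 = 2 * gcd e 2" unfolding e using gcd_mult_left[of 2 e 2] by simp
    moreover have "gcd e 2 = (if even e then 2 else 1)"
      by (auto simp: gcd_proj2_if_dvd coprime_right_2_iff_odd)
    moreover have "4 dvd 2 * e \<longleftrightarrow> even e" by presburger
    ultimately show ?thesis using e by simp
  next
    case False
    hence "coprime c (2 ^ 2)" by (simp only: coprime_power_right_iff coprime_right_2_iff_odd) simp
    hence "gcd c 4 = 1" by simp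
    moreover have "\<not> 4 dvd c" using False by auto
    ultimately show ?thesis using False by simp
  qed
  thus "cusp_weight c 4 = (if 4 dvd c then 4 else if even c then 1 else 1 / 4)" by (simp add: cusp_weight_def)
  show "cusp_weight c 23 > 0" by (simp add: cusp_weight_def)
qed

lemma comparable_sq_bound:
  assumes "comparable (\<lambda>z. norm (F z :: complex) ^ 2) s"
  obtains C Y where "C > 0" "Y > 0" "\<And>z. Im z \<ge> Y \<Longrightarrow> norm (F z) \<le> C * exp (s / 2 * Im z)"
proof -
  obtain C Y where f: "C > 0" "Y > 0" "\<And>z. Im z \<ge> Y \<Longrightarrow> norm (F z) ^ 2 \<le> C * exp (s * Im z)"
    using assms unfolding comparable_def by blast
  have "norm (F z) \<le> sqrt C * exp (s / 2 * Im z)" if "Im z \<ge> Y" for z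
  proof (rule power2_le_imp_le)
    have "(sqrt C * exp (s / 2 * Im z)) ^ 2 = C * exp (s * Im z)"
      using f(1) by (simp add: power_mult_distrib flip: exp_double)
    thus "norm (F z) ^ 2 \<le> (sqrt C * exp (s / 2 * Im z)) ^ 2" using f(3)[OF that] by simp
  qed (use f in auto)
  thus ?thesis using f by (intro that[of "sqrt C" Y]) auto
qed

text \<open>Behaviour at the cusps \<open>a/c\<close>; those with \<open>4 dvd c\<close> are the images of \<open>\<infinity>\<close> under $\langle\Gamma_0(92), w_{23}\rangle$.\<close>
lemma cusp_comparable_exponents:
  assumes det: "a * d - b * c = 1"
  obtains sx sf sK where
    "comparable (\<lambda>z. norm (x0 (mob a b c d z)) ^ 2) sx" "comparable (\<lambda>z. norm (f0 (mob a b c d z)) ^ 2) sf"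
    "comparable (\<lambda>z. norm (K0 (mob a b c d z)) ^ 2) sK"
    "\<not> 4 dvd c \<Longrightarrow> sx < 0" "\<not> 4 dvd c \<Longrightarrow> sx + sf \<le> 0" "\<not> 4 dvd c \<Longrightarrow> 2 * sx - sf \<le> 0" "\<not> 4 dvd c \<Longrightarrow> sK = 0"
proof -
  define h where "h = cusp_weight c 23"
  have h: "h > 0" by (simp add: h_def cusp_weight_small)
  have w: "cusp_weight c 46 = h * cusp_weight c 2" "cusp_weight c 92 = h * cusp_weight c 4"
    using cusp_weight_23[of 2 c] cusp_weight_23[of 4 c] by (simp_all add: h_def)
  define p where "p = pi / 6 * (1 + h)"
  have p: "p > 0" using h by (simp add: p_def)
  note C = cusp_comparable[OF det]
  have f: "- (pi / 6) * (cusp_weight c 1 + cusp_weight c 23 - (cusp_weight c 2 + cusp_weight c 46)) = p * (cusp_weight c 2 - 1)"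
    unfolding w cusp_weight_small(1) h_def[symmetric] by (simp add: p_def algebra_simps)
  have x: "- (pi / 6) * (cusp_weight c 2 + cusp_weight c 46 - (cusp_weight c 4 + cusp_weight c 92)) = p * (cusp_weight c 4 - cusp_weight c 2)"
    unfolding w by (simp add: p_def algebra_simps)
  have K: "- (pi / 6) * (4 * cusp_weight c 4 + 2 * cusp_weight c 46 - (2 * cusp_weight c 2 + 4 * cusp_weight c 92)) =
     - (pi / 6) * (1 - h) * (4 * cusp_weight c 4 - 2 * cusp_weight c 2)"
  proof -
    have "4 * cusp_weight c 4 + 2 * (h * cusp_weight c 2) - (2 * cusp_weight c 2 + 4 * (h * cusp_weight c 4)) =
        (1 - h) * (4 * cusp_weight c 4 - 2 * cusp_weight c 2)" by (simp add: algebra_simps)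
    thus ?thesis unfolding w by (simp only: mult.assoc)
  qed
  show ?thesis
  proof (rule that[OF C(2)[unfolded x] C(1)[unfolded f] C(3)[unfolded K]])
    assume c: "\<not> 4 dvd c"
    show "p * (cusp_weight c 4 - cusp_weight c 2) < 0"
      using p c by (auto simp: cusp_weight_small mult_pos_neg)
    have "p * (cusp_weight c 4 - cusp_weight c 2) + p * (cusp_weight c 2 - 1) = p * (cusp_weight c 4 - 1)"
      by (simp add: algebra_simps)
    also have "\<dots> \<le> 0" using p c by (intro mult_nonneg_nonpos) (auto simp: cusp_weight_small)
    finally show "p * (cusp_weight c 4 - cusp_weight c 2) + p * (cusp_weight c 2 - 1) \<le> 0" .
    have "2 * (p * (cusp_weight c 4 - cusp_weight c 2)) - p * (cusp_weight c 2 - 1) = p * (2 * cusp_weight c 4 - 3 * cusp_weight c 2 + 1)"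
      by (simp add: algebra_simps)
    also have "\<dots> \<le> 0" using p c by (intro mult_nonneg_nonpos) (auto simp: cusp_weight_small)
    finally show "2 * (p * (cusp_weight c 4 - cusp_weight c 2)) - p * (cusp_weight c 2 - 1) \<le> 0" .
    \<comment> \<open>The weights for 2 and 4 are 1/2 and 1/4 if c is odd, and 2 and 1 if c is 2
      modulo 4; in both cases the last factor is 0. Hence \<open>K0\<close> has neither zero nor
      pole at these cusps.\<close>
    show "- (pi / 6) * (1 - h) * (4 * cusp_weight c 4 - 2 * cusp_weight c 2) = 0"
      using c by (auto simp: cusp_weight_small)
  qed
qed

section \<open>Pointwise values of elements of the function field\<close>

abbreviation reg :: "mero_uhp \<Rightarrow> complex \<Rightarrow> bool" where
  "reg F z \<equiv> eval_mero F analytic_on {z}"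

text \<open>Field operations agree with pointwise ones only off a sparse set, since poles carry the
  value 0. An analytic candidate \<open>g\<close> forces equality at the point itself, because the
  representative has its removable singularities removed.\<close>

lemma eval_mero_eqI_analytic:
  assumes ev: "eventually (\<lambda>w. eval_mero F w = g w) (cosparse uhp)" and g: "g analytic_on {z}" and z: "z \<in> uhp"
  shows "eval_mero F z = g z" "reg F z"
proof -
  have at: "eventually (\<lambda>w. eval_mero F w = g w) (at z)"
    using ev z by (rule eventually_cosparse_imp_eventually_at)
  have "eval_mero F z = remove_sings (eval_mero F) z" using remove_sings_eval_mero[OF z] by simp
  also have "\<dots> = remove_sings g z" by (rule remove_sings_cong[OF at refl])
  also have "\<dots> = g z" using g by simp
  finally show *: "eval_mero F z = g z" .
  hence "eventually (\<lambda>w. eval_mero F w = g w) (nhds z)" using at by (simp add: eventually_nhds_conv_at)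
  from analytic_at_cong[OF this refl] g show "reg F z" by blast
qed

lemma reg_add:
  assumes "reg F z" "reg G z" "z \<in> uhp"
  shows "eval_mero (F + G) z = eval_mero F z + eval_mero G z \<and> reg (F + G) z"
  using eval_mero_eqI_analytic[OF eventually_eval_mero_ops(3) analytic_on_add[OF assms(1,2)] assms(3)] by blast

lemma reg_diff:
  assumes "reg F z" "reg G z" "z \<in> uhp"
  shows "eval_mero (F - G) z = eval_mero F z - eval_mero G z \<and> reg (F - G) z"
  using eval_mero_eqI_analytic[OF eventually_eval_mero_ops(4) analytic_on_diff[OF assms(1,2)] assms(3)] by blast

lemma reg_mult:
  assumes "reg F z" "reg G z" "z \<in> uhp"
  shows "eval_mero (F * G) z = eval_mero F z * eval_mero G z \<and> reg (F * G) z"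
  using eval_mero_eqI_analytic[OF eventually_eval_mero_ops(6) analytic_on_mult[OF assms(1,2)] assms(3)] by blast

lemma reg_uminus:
  assumes "reg F z" "z \<in> uhp"
  shows "eval_mero (- F) z = - eval_mero F z \<and> reg (- F) z"
  using eval_mero_eqI_analytic[OF eventually_eval_mero_ops(5) analytic_on_neg[OF assms(1)] assms(2)] by blast

lemma reg_inverse:
  assumes "reg F z" "eval_mero F z \<noteq> 0" "z \<in> uhp"
  shows "eval_mero (inverse F) z = inverse (eval_mero F z) \<and> reg (inverse F) z"
proof -
  have "(\<lambda>w. inverse (eval_mero F w)) analytic_on {z}"
    by (rule analytic_on_inverse[OF assms(1)]) (use assms(2) in auto)
  from eval_mero_eqI_analytic[OF eventually_eval_mero_ops(7) this assms(3)] show ?thesis by blast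
qed

lemma reg_mero_of:
  assumes "g analytic_on uhp" "z \<in> uhp"
  shows "eval_mero (mero_of g) z = g z" "reg (mero_of g) z"
proof -
  have "g meromorphic_on uhp" using assms(1) by (rule analytic_on_imp_meromorphic_on)
  note * = eventually_eval_mero_of[OF this]
  have "g analytic_on {z}" using assms by (auto intro: analytic_on_subset)
  from eval_mero_eqI_analytic[OF * this assms(2)] show "eval_mero (mero_of g) z = g z" "reg (mero_of g) z" .
qed

definition cst :: "complex \<Rightarrow> mero_uhp" where "cst c = mero_of (\<lambda>_. c)"

lemma cst: "z \<in> uhp \<Longrightarrow> eval_mero (cst c) z = c" "z \<in> uhp \<Longrightarrow> reg (cst c) z"
  unfolding cst_def by (rule reg_mero_of; simp)+

lemma reg_zero_one: "z \<in> uhp \<Longrightarrow> eval_mero 0 z = 0 \<and> reg 0 z" "z \<in> uhp \<Longrightarrow> eval_mero 1 z = 1 \<and> reg 1 z"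
  using eval_mero_eqI_analytic[OF eventually_eval_mero_ops(1), of z] eval_mero_eqI_analytic[OF eventually_eval_mero_ops(2), of z]
  by auto

lemma reg_power: "reg F z \<Longrightarrow> z \<in> uhp \<Longrightarrow> eval_mero (F ^ n) z = eval_mero F z ^ n \<and> reg (F ^ n) z"
  by (induction n) (auto simp: reg_zero_one reg_mult)

lemma reg_prod: "(\<And>i. i \<in> A \<Longrightarrow> reg (f i) z) \<Longrightarrow> z \<in> uhp \<Longrightarrow> eval_mero (\<Prod>i\<in>A. f i) z = (\<Prod>i\<in>A. eval_mero (f i) z) \<and> reg (\<Prod>i\<in>A. f i) z"
  by (induction A rule: infinite_finite_induct) (auto simp: reg_zero_one reg_mult)

lemma cst_hom: "cst 0 = 0" "cst 1 = 1" "cst (a + b) = cst a + cst b" "cst (a * b) = cst a * cst b" "cst (- a) = - cst a"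
  by (rule mero_uhp_ext, simp add: cst reg_zero_one reg_add reg_mult reg_uminus)+

lemma cst_eq_0_iff [simp]: "cst c = 0 \<longleftrightarrow> c = 0"
proof
  assume "cst c = 0"
  hence "eval_mero (cst c) \<i> = eval_mero 0 \<i>" by simp
  thus "c = 0" using cst(1)[of \<i> c] reg_zero_one(1)[of \<i>] by (simp add: uhp_def)
qed (simp add: cst_hom)

lemma cst_inverse: "cst (inverse c) = inverse (cst c)"
proof (cases "c = 0")
  case False
  have "cst (inverse c) * cst c = 1" using False by (simp add: cst_hom flip: cst_hom(4))
  thus ?thesis using inverse_unique[of "cst c" "cst (inverse c)"] by (simp add: mult.commute)
qed (simp add: cst_hom)

lemma cst_of_nat: "cst (of_nat n) = of_nat n"
  by (induction n) (simp_all add: cst_hom)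

lemma cst_of_int: "cst (of_int n) = of_int n"
  by (cases n rule: int_cases2) (simp_all add: cst_of_nat cst_hom)

lemma cst_of_rat: "cst (of_rat r) = of_rat r"
proof (cases r)
  case (Fract a b)
  thus ?thesis by (simp add: of_rat_rat divide_inverse cst_hom cst_inverse cst_of_int)
qed

lemma cst_numeral: "cst (numeral n) = numeral n"
  using cst_of_nat[of "numeral n"] by simp

lemma eventually_uhp: "eventually (\<lambda>z. z \<in> uhp) (cosparse uhp)"
  by (rule eventually_in_cosparse) (use uhp_props in auto)

lemma eventually_moebius:
  assumes "eventually P (cosparse uhp)" "det M > 0"
  shows "eventually (\<lambda>z. P (moebius_mat M z)) (cosparse uhp)"
  unfolding eventually_cosparse_open_eq[OF uhp_props(1)]
proof
  fix z assume z: "z \<in> uhp"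
  have "eventually P (at (moebius_mat M z))"
    using assms z moebius_in_uhp by (intro eventually_cosparse_imp_eventually_at[OF assms(1)]) auto
  thus "eventually (\<lambda>z. P (moebius_mat M z)) (at z)"
    unfolding filtermap_moebius_at[OF z assms(2), symmetric] eventually_filtermap .
qed

lemma pullback_hom:
  assumes M: "det M > 0"
  shows "pullback M (F + G) = pullback M F + pullback M G" "pullback M (F - G) = pullback M F - pullback M G"
    "pullback M (F * G) = pullback M F * pullback M G" "pullback M (- F) = - pullback M F"
    "pullback M (inverse F) = inverse (pullback M F)" "pullback M (cst c) = cst c"
proof -
  have e: "eventually (\<lambda>z. eval_mero (pullback M H) z = eval_mero H (moebius_mat M z)) (cosparse uhp)" for H
    using eventually_uhp by eventually_elim (rule eval_pullback[OF M])
  show "pullback M (F + G) = pullback M F + pullback M G"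
    by (rule mero_uhp_eqI)
       (use e[of "F+G"] e[of F] e[of G] eventually_moebius[OF eventually_eval_mero_ops(3)[of F G] M]
         eventually_eval_mero_ops(3)[of "pullback M F" "pullback M G"] in \<open>eventually_elim, simp\<close>)
  show "pullback M (F - G) = pullback M F - pullback M G"
    by (rule mero_uhp_eqI)
       (use e[of "F-G"] e[of F] e[of G] eventually_moebius[OF eventually_eval_mero_ops(4)[of F G] M]
         eventually_eval_mero_ops(4)[of "pullback M F" "pullback M G"] in \<open>eventually_elim, simp\<close>)
  show "pullback M (F * G) = pullback M F * pullback M G"
    by (rule mero_uhp_eqI)
       (use e[of "F*G"] e[of F] e[of G] eventually_moebius[OF eventually_eval_mero_ops(6)[of F G] M]
         eventually_eval_mero_ops(6)[of "pullback M F" "pullback M G"] in \<open>eventually_elim, simp\<close>)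
  show "pullback M (- F) = - pullback M F"
    by (rule mero_uhp_eqI)
       (use e[of "-F"] e[of F] eventually_moebius[OF eventually_eval_mero_ops(5)[of F] M]
         eventually_eval_mero_ops(5)[of "pullback M F"] in \<open>eventually_elim, simp\<close>)
  show "pullback M (inverse F) = inverse (pullback M F)"
    by (rule mero_uhp_eqI)
       (use e[of "inverse F"] e[of F] eventually_moebius[OF eventually_eval_mero_ops(7)[of F] M]
         eventually_eval_mero_ops(7)[of "pullback M F"] in \<open>eventually_elim, simp\<close>)
  show "pullback M (cst c) = cst c"
    by (rule mero_uhp_ext) (simp add: eval_pullback[OF M] cst moebius_in_uhp M)
qed

lemma pullback_more:
  assumes M: "det M > 0"
  shows "pullback M 0 = 0" "pullback M 1 = 1" "pullback M (F ^ n) = pullback M F ^ n"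
    "pullback M (\<Prod>i\<in>A. f i) = (\<Prod>i\<in>A. pullback M (f i))" "pullback M (F / G) = pullback M F / pullback M G"
    "pullback M (numeral k) = numeral k"
proof -
  show 0: "pullback M 0 = 0" and 1: "pullback M 1 = 1"
    using pullback_hom(6)[OF M, of 0] pullback_hom(6)[OF M, of 1] by (simp_all add: cst_hom)
  show "pullback M (F ^ n) = pullback M F ^ n" by (induction n) (simp_all add: 1 pullback_hom M)
  show "pullback M (\<Prod>i\<in>A. f i) = (\<Prod>i\<in>A. pullback M (f i))"
    by (induction A rule: infinite_finite_induct) (simp_all add: 1 pullback_hom M)
  show "pullback M (F / G) = pullback M F / pullback M G" by (simp add: divide_inverse pullback_hom M)
  show "pullback M (numeral k) = numeral k" using pullback_hom(6)[OF M, of "numeral k"] by (simp add: cst_numeral)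
qed

lemma reg_pullback:
  assumes M: "det M > 0" and z: "z \<in> uhp" and F: "reg F (moebius_mat M z)"
  shows "reg (pullback M F) z"
proof -
  have ev: "eventually (\<lambda>w. eval_mero (pullback M F) w = (eval_mero F \<circ> moebius_mat M) w) (nhds z)"
    using eventually_nhds_in_open[OF uhp_props(1) z] by eventually_elim (simp add: eval_pullback M)
  have "(eval_mero F \<circ> moebius_mat M) analytic_on {z}"
    by (rule analytic_on_compose) (use moebius_analytic[OF M] z F in \<open>auto intro: analytic_on_subset\<close>)
  thus ?thesis unfolding analytic_at_cong[OF ev refl] .
qed

subsection \<open>Growth at the cusp at infinity and \<open>q\<close>-expansions\<close>

text \<open>An upper bound of exponential type at \<infinity>, with regularity included. For
  periodic functions it is equivalent to having a q-expansion, but it is easier to carry through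
  pullbacks and products.\<close>

definition growth :: "mero_uhp \<Rightarrow> real \<Rightarrow> bool" where
  "growth F k \<longleftrightarrow> (\<exists>Y>0. \<exists>C. \<forall>z. Im z \<ge> Y \<longrightarrow> reg F z \<and> norm (eval_mero F z) \<le> C * exp (k * Im z))"

lemma growthE:
  assumes "growth F k"
  obtains Y C where "Y > 0" "C \<ge> 0" "\<And>z. Im z \<ge> Y \<Longrightarrow> reg F z" "\<And>z. Im z \<ge> Y \<Longrightarrow> norm (eval_mero F z) \<le> C * exp (k * Im z)"
proof -
  obtain Y C where *: "Y > 0" "\<And>z. Im z \<ge> Y \<Longrightarrow> reg F z \<and> norm (eval_mero F z) \<le> C * exp (k * Im z)"
    using assms unfolding growth_def by blast
  have "0 \<le> C * exp (k * Im (of_real Y * \<i>))"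
    by (rule order.trans[OF norm_ge_zero conjunct2[OF *(2)]]) simp
  hence "C \<ge> 0" by (simp add: zero_le_mult_iff)
  show ?thesis by (rule that[OF *(1) \<open>C \<ge> 0\<close>]) (use *(2) in blast)+
qed

lemma growth_mono: "growth F k \<Longrightarrow> k \<le> l \<Longrightarrow> growth F l"
proof (elim growthE)
  fix Y C assume *: "k \<le> l" "Y > 0" "C \<ge> 0" "\<And>z. Im z \<ge> Y \<Longrightarrow> reg F z" "\<And>z. Im z \<ge> Y \<Longrightarrow> norm (eval_mero F z) \<le> C * exp (k * Im z)"
  have "norm (eval_mero F z) \<le> C * exp (l * Im z)" if "Im z \<ge> Y" for z
  proof -
    have "C * exp (k * Im z) \<le> C * exp (l * Im z)"
      using * that by (intro mult_left_mono) (auto intro: mult_right_mono)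
    thus ?thesis using *(5)[OF that] by simp
  qed
  thus "growth F l" unfolding growth_def using * by blast
qed

lemma growth_add:
  assumes "growth F k" "growth G k"
  shows "growth (F + G) k"
proof -
  obtain Y C where F: "Y > 0" "C \<ge> 0" "\<And>z. Im z \<ge> Y \<Longrightarrow> reg F z" "\<And>z. Im z \<ge> Y \<Longrightarrow> norm (eval_mero F z) \<le> C * exp (k * Im z)"
    using assms(1) by (rule growthE) blast
  obtain Y' C' where G: "Y' > 0" "C' \<ge> 0" "\<And>z. Im z \<ge> Y' \<Longrightarrow> reg G z" "\<And>z. Im z \<ge> Y' \<Longrightarrow> norm (eval_mero G z) \<le> C' * exp (k * Im z)"
    using assms(2) by (rule growthE) blast
  have "reg (F + G) z \<and> norm (eval_mero (F + G) z) \<le> (C + C') * exp (k * Im z)" if z: "Im z \<ge> max Y Y'" for z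
  proof -
    have "z \<in> uhp" using z F(1) by (simp add: uhp_def)
    hence *: "eval_mero (F + G) z = eval_mero F z + eval_mero G z" "reg (F + G) z"
      using reg_add F(3) G(3) z by auto
    have "norm (eval_mero F z + eval_mero G z) \<le> C * exp (k * Im z) + C' * exp (k * Im z)"
      using F(4)[of z] G(4)[of z] z by (intro order.trans[OF norm_triangle_ineq] add_mono) auto
    thus ?thesis using * by (simp add: ring_distribs)
  qed
  thus ?thesis unfolding growth_def using F(1) by (intro exI[of _ "max Y Y'"]) auto
qed

lemma growth_mult:
  assumes "growth F k" "growth G l"
  shows "growth (F * G) (k + l)"
proof -
  obtain Y C where F: "Y > 0" "C \<ge> 0" "\<And>z. Im z \<ge> Y \<Longrightarrow> reg F z" "\<And>z. Im z \<ge> Y \<Longrightarrow> norm (eval_mero F z) \<le> C * exp (k * Im z)"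
    using assms(1) by (rule growthE) blast
  obtain Y' C' where G: "Y' > 0" "C' \<ge> 0" "\<And>z. Im z \<ge> Y' \<Longrightarrow> reg G z" "\<And>z. Im z \<ge> Y' \<Longrightarrow> norm (eval_mero G z) \<le> C' * exp (l * Im z)"
    using assms(2) by (rule growthE) blast
  have "reg (F * G) z \<and> norm (eval_mero (F * G) z) \<le> (C * C') * exp ((k + l) * Im z)" if z: "Im z \<ge> max Y Y'" for z
  proof -
    have "z \<in> uhp" using z F(1) by (simp add: uhp_def)
    hence *: "eval_mero (F * G) z = eval_mero F z * eval_mero G z" "reg (F * G) z"
      using reg_mult F(3) G(3) z by auto
    have "norm (eval_mero F z * eval_mero G z) \<le> (C * exp (k * Im z)) * (C' * exp (l * Im z))"
      unfolding norm_mult using F(2) F(4)[of z] G(4)[of z] z by (intro mult_mono) auto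
    thus ?thesis using * by (simp add: ring_distribs exp_add mult_ac)
  qed
  thus ?thesis unfolding growth_def using F(1) by (intro exI[of _ "max Y Y'"]) auto
qed

lemma growth_cst: "growth (cst c) 0"
  unfolding growth_def by (intro exI[of _ 1] conjI exI[of _ "norm c"]) (auto simp: cst uhp_def)

lemma growth_power: "growth F k \<Longrightarrow> growth (F ^ n) (of_nat n * k)"
proof (induction n)
  case 0
  show ?case using growth_cst[of 1] by (simp add: cst_hom)
next
  case (Suc n)
  from growth_mult[OF Suc(2) Suc.IH[OF Suc(2)]] show ?case by (simp add: algebra_simps)
qed

definition qvar :: "nat \<Rightarrow> complex \<Rightarrow> complex" where "qvar h z = exp (2 * of_real pi * \<i> * z / of_nat h)"

lemma norm_qvar: "norm (qvar h z) = exp (- (2 * pi / real h) * Im z)"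
  by (simp add: qvar_def norm_exp_eq_Re)

lemma filterlim_qvar:
  assumes "h > 0"
  shows "filterlim (qvar h) (at 0) (filtercomap Im at_top)"
proof -
  have "filterlim (\<lambda>y::real. exp (- (2 * pi / real h) * y)) (nhds 0) at_top"
    using assms by (intro filterlim_compose[OF exp_at_bot] filterlim_tendsto_neg_mult_at_bot[OF tendsto_const] filterlim_ident) auto
  hence "filterlim (\<lambda>z. norm (qvar h z)) (nhds 0) (filtercomap Im at_top)"
    unfolding norm_qvar by (rule filterlim_compose[OF _ filterlim_filtercomap])
  hence "filterlim (qvar h) (nhds 0) (filtercomap Im at_top)" by (rule tendsto_norm_zero_cancel)
  thus ?thesis by (auto simp: filterlim_at qvar_def)
qed

lemma eventually_Im_gt: "eventually P (filtercomap Im at_top) \<longleftrightarrow> (\<exists>Y>0. \<forall>z. Im z \<ge> Y \<longrightarrow> P z)"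
proof
  assume "eventually P (filtercomap Im at_top)"
  then obtain Q where Q: "eventually Q at_top" "\<And>z. Q (Im z) \<Longrightarrow> P z" unfolding eventually_filtercomap by auto
  then obtain Y where "\<And>y. y \<ge> Y \<Longrightarrow> Q y" by (auto simp: eventually_at_top_linorder)
  thus "\<exists>Y>0. \<forall>z. Im z \<ge> Y \<longrightarrow> P z" using Q(2) by (intro exI[of _ "max 1 Y"]) auto
next
  assume "\<exists>Y>0. \<forall>z. Im z \<ge> Y \<longrightarrow> P z"
  then obtain Y where "\<And>z. Im z \<ge> Y \<Longrightarrow> P z" by auto
  thus "eventually P (filtercomap Im at_top)"
    unfolding eventually_filtercomap using eventually_ge_at_top[of Y] by (intro exI[of _ "\<lambda>y. y \<ge> Y"]) auto
qed

lemma has_q_expansionI: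
  assumes "f has_laurent_expansion L" "eventually (\<lambda>z. eval_mero F z = f (qvar h z)) (filtercomap Im at_top)" "h > 0"
  shows "has_q_expansion h F L"
proof -
  have "eventually (\<lambda>z. eval_fls L (qvar h z) = f (qvar h z)) (filtercomap Im at_top)"
    using assms(1) filterlim_qvar[OF assms(3)] unfolding has_laurent_expansion_def filterlim_iff by blast
  with assms(2) have "eventually (\<lambda>z. eval_mero F z = eval_fls L (qvar h z)) (filtercomap Im at_top)"
    by eventually_elim simp
  thus ?thesis using assms(1) by (simp add: has_q_expansion_def has_laurent_expansion_def qvar_def)
qed

lemma has_q_expansionD:
  assumes "has_q_expansion h F L"
  shows "eval_fls L has_laurent_expansion L" "eventually (\<lambda>z. eval_mero F z = eval_fls L (qvar h z)) (filtercomap Im at_top)"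
  using assms by (auto simp: has_q_expansion_def qvar_def intro: eval_fls_has_laurent_expansion)

lemma has_q_expansion_reg:
  assumes "has_q_expansion h F L" "h > 0"
  shows "eventually (\<lambda>z. reg F z \<and> z \<in> uhp) (filtercomap Im at_top)"
proof -
  have "eventually (\<lambda>q. ereal (norm q) < fls_conv_radius L \<and> q \<noteq> 0) (at 0)"
  proof -
    have "fls_conv_radius L > 0" using assms(1) by (simp add: has_q_expansion_def)
    hence "eventually (\<lambda>q. q \<in> eball 0 (fls_conv_radius L) - {0}) (at 0)"
      by (intro eventually_at_in_open) (auto simp: zero_ereal_def)
    thus ?thesis by eventually_elim auto
  qed
  hence "eventually (\<lambda>z. ereal (norm (qvar h z)) < fls_conv_radius L \<and> qvar h z \<noteq> 0) (filtercomap Im at_top)"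
    using filterlim_qvar[OF assms(2)] unfolding filterlim_iff by blast
  with has_q_expansionD(2)[OF assms(1)]
  have "eventually (\<lambda>z. eval_mero F z = eval_fls L (qvar h z) \<and> ereal (norm (qvar h z)) < fls_conv_radius L) (filtercomap Im at_top)"
    by eventually_elim auto
  then obtain Y where Y: "Y > 0" "\<And>z. Im z \<ge> Y \<Longrightarrow> eval_mero F z = eval_fls L (qvar h z)"
     "\<And>z. Im z \<ge> Y \<Longrightarrow> ereal (norm (qvar h z)) < fls_conv_radius L"
    unfolding eventually_Im_gt by blast
  have "reg F z \<and> z \<in> uhp" if z: "Im z \<ge> Y + 1" for z
  proof -
    have "open {z. Im z > Y}" by (rule open_halfspace_Im_gt)
    hence "eventually (\<lambda>w. w \<in> {z. Im z > Y}) (nhds z)" using z by (intro eventually_nhds_in_open) auto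
    hence ev: "eventually (\<lambda>w. eval_mero F w = eval_fls L (qvar h w)) (nhds z)"
      by eventually_elim (use Y(2) in auto)
    have "(\<lambda>w. eval_fls L (qvar h w)) analytic_on {z}"
      using Y(3)[of z] z assms(2) unfolding qvar_def by (intro analytic_intros) auto
    hence "reg F z" unfolding analytic_at_cong[OF ev refl] .
    thus ?thesis using z Y(1) by (simp add: uhp_def)
  qed
  thus ?thesis unfolding eventually_Im_gt using Y(1) by (intro exI[of _ "Y + 1"]) auto
qed

lemma has_q_expansion_ops:
  assumes F: "has_q_expansion h F L" and G: "has_q_expansion h G K" and h: "h > 0"
  shows "has_q_expansion h (F + G) (L + K)" "has_q_expansion h (F * G) (L * K)" "has_q_expansion h (- F) (- L)"
    "has_q_expansion h (F - G) (L - K)"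
proof -
  note ev = has_q_expansionD(2)[OF F] has_q_expansionD(2)[OF G] has_q_expansion_reg[OF F h] has_q_expansion_reg[OF G h]
  show "has_q_expansion h (F + G) (L + K)"
    by (rule has_q_expansionI[OF has_laurent_expansion_add[OF has_q_expansionD(1)[OF F] has_q_expansionD(1)[OF G]] _ h])
       (use ev in \<open>eventually_elim, simp add: reg_add\<close>)
  show "has_q_expansion h (F * G) (L * K)"
    by (rule has_q_expansionI[OF has_laurent_expansion_mult[OF has_q_expansionD(1)[OF F] has_q_expansionD(1)[OF G]] _ h])
       (use ev in \<open>eventually_elim, simp add: reg_mult\<close>)
  show "has_q_expansion h (- F) (- L)"
    by (rule has_q_expansionI[OF has_laurent_expansion_minus[OF has_q_expansionD(1)[OF F]] _ h])
       (use ev in \<open>eventually_elim, simp add: reg_uminus\<close>)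
  show "has_q_expansion h (F - G) (L - K)"
    by (rule has_q_expansionI[OF has_laurent_expansion_diff[OF has_q_expansionD(1)[OF F] has_q_expansionD(1)[OF G]] _ h])
       (use ev in \<open>eventually_elim, simp add: reg_diff\<close>)
qed

lemma has_q_expansion_cst: "h > 0 \<Longrightarrow> has_q_expansion h (cst c) (fls_const c)"
  by (rule has_q_expansionI[of "\<lambda>_. c"]) (auto simp: eventually_Im_gt cst uhp_def intro: exI[of _ 1])

lemma mero_zeroI:
  assumes "Y > 0" "\<And>z. Im z \<ge> Y \<Longrightarrow> eval_mero F z = 0"
  shows "F = 0"
proof (rule ccontr)
  assume "F \<noteq> 0"
  from eventually_eval_mero_nonzero[OF this] have "eventually (\<lambda>z. eval_mero F z \<noteq> 0) (at (of_real (Y + 1) * \<i>))"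
    using assms(1) by (intro eventually_cosparse_imp_eventually_at) (auto simp: uhp_def)
  moreover have "eventually (\<lambda>z. z \<in> {z. Im z > Y}) (at (of_real (Y + 1) * \<i>))"
    by (intro eventually_at_in_open' open_halfspace_Im_gt) auto
  ultimately have "eventually (\<lambda>z. False) (at (of_real (Y + 1) * \<i>))"
    by eventually_elim (use assms(2) in force)
  thus False by simp
qed

lemma has_q_expansion_eq_0_iff:
  assumes "has_q_expansion h F L" "h > 0"
  shows "F = 0 \<longleftrightarrow> L = 0"
proof
  assume "L = 0"
  hence "eventually (\<lambda>z. eval_mero F z = 0) (filtercomap Im at_top)" using has_q_expansionD(2)[OF assms(1)] by simp
  thus "F = 0" unfolding eventually_Im_gt using mero_zeroI by blast
next
  assume "F = 0"
  show "L = 0"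
  proof (rule ccontr)
    assume "L \<noteq> 0"
    hence "eventually (\<lambda>q. eval_fls L q \<noteq> 0) (at 0)"
      using has_q_expansionD(1)[OF assms(1)] has_laurent_expansion_nonzero_imp_eventually_nonzero by blast
    hence "eventually (\<lambda>z. eval_fls L (qvar h z) \<noteq> 0) (filtercomap Im at_top)"
      using filterlim_qvar[OF assms(2)] unfolding filterlim_iff by blast
    with has_q_expansionD(2)[OF assms(1)] has_q_expansion_reg[OF assms]
    have "eventually (\<lambda>z. False) (filtercomap Im at_top)"
      by eventually_elim (use \<open>F = 0\<close> reg_zero_one(1) in auto)
    then obtain Y where Y: "\<And>z. Im z \<ge> Y \<Longrightarrow> False" unfolding eventually_Im_gt by auto
    show False using Y[of "of_real Y * \<i>"] by simp
  qed
qed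

lemma has_q_expansion_unique:
  assumes "has_q_expansion h F L" "has_q_expansion h F K" "h > 0"
  shows "L = K"
  using has_q_expansion_eq_0_iff[OF has_q_expansion_ops(4)[OF assms] assms(3)] by simp

lemma has_q_expansion_inverse:
  assumes F: "has_q_expansion h F L" and h: "h > 0"
  shows "has_q_expansion h (inverse F) (inverse L)"
proof (cases "L = 0")
  case True
  thus ?thesis using assms has_q_expansion_eq_0_iff[OF assms] by simp
next
  case False
  hence "eventually (\<lambda>q. eval_fls L q \<noteq> 0) (at 0)"
    using has_q_expansionD(1)[OF F] has_laurent_expansion_nonzero_imp_eventually_nonzero by blast
  hence "eventually (\<lambda>z. eval_fls L (qvar h z) \<noteq> 0) (filtercomap Im at_top)"
    using filterlim_qvar[OF h] unfolding filterlim_iff by blast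
  note ev = this has_q_expansionD(2)[OF F] has_q_expansion_reg[OF F h]
  show ?thesis
    by (rule has_q_expansionI[OF has_laurent_expansion_inverse[OF has_q_expansionD(1)[OF F]] _ h])
       (use ev in \<open>eventually_elim, simp add: reg_inverse\<close>)
qed

lemma has_q_expansion_imp_growth:
  assumes F: "has_q_expansion h F L" and h: "h > 0"
  shows "growth F (- (2 * pi / real h) * real_of_int (fls_subdegree L))"
proof -
  define B where "B = eval_fps (fls_base_factor_to_fps L)"
  have "fps_conv_radius (fls_base_factor_to_fps L) > 0"
    using F by (simp add: has_q_expansion_def fls_conv_radius_altdef)
  hence "isCont B 0" unfolding B_def by (intro continuous_intros) (auto simp: zero_ereal_def)
  hence "(B \<longlongrightarrow> B 0) (at 0)" by (simp add: isCont_def)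
  hence "((\<lambda>q. norm (B q)) \<longlongrightarrow> norm (B 0)) (at 0)" by (rule tendsto_norm)
  hence "eventually (\<lambda>q. norm (B q) < norm (B 0) + 1) (at 0)" by (rule order_tendstoD) simp
  hence "eventually (\<lambda>z. norm (B (qvar h z)) < norm (B 0) + 1) (filtercomap Im at_top)"
    using filterlim_qvar[OF h] unfolding filterlim_iff by blast
  with has_q_expansionD(2)[OF F] has_q_expansion_reg[OF F h]
  have "eventually (\<lambda>z. reg F z \<and> norm (eval_mero F z) \<le> (norm (B 0) + 1) * exp (- (2 * pi / real h) * real_of_int (fls_subdegree L) * Im z)) (filtercomap Im at_top)"
  proof eventually_elim
    case (elim z)
    have "norm (qvar h z powi fls_subdegree L) = exp (- (2 * pi / real h) * Im z) powi fls_subdegree L"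
      by (simp only: norm_power_int norm_qvar)
    also have "\<dots> = exp (- (2 * pi / real h) * real_of_int (fls_subdegree L) * Im z)"
      by (subst exp_power_int) (simp add: mult_ac)
    finally have "norm (eval_mero F z) = norm (B (qvar h z)) * exp (- (2 * pi / real h) * real_of_int (fls_subdegree L) * Im z)"
      using elim(1) by (simp add: eval_fls_def B_def norm_mult)
    also have "\<dots> \<le> (norm (B 0) + 1) * exp (- (2 * pi / real h) * real_of_int (fls_subdegree L) * Im z)"
      using elim(3) by (intro mult_right_mono) auto
    finally show ?case using elim by simp
  qed
  thus ?thesis unfolding growth_def eventually_Im_gt by blast
qed

section \<open>Pullback by integer matrices given by their entries\<close>

definition mat2 :: "int \<Rightarrow> int \<Rightarrow> int \<Rightarrow> int \<Rightarrow> int ^ 2 ^ 2" where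
  "mat2 a b c d = vector [vector [a, b], vector [c, d]]"

lemma mat2_simps [simp]:
  "mat2 a b c d $ 1 $ 1 = a" "mat2 a b c d $ 1 $ 2 = b" "mat2 a b c d $ 2 $ 1 = c" "mat2 a b c d $ 2 $ 2 = d"
  "det (mat2 a b c d) = a * d - b * c" "moebius_mat (mat2 a b c d) z = mob a b c d z"
  by (simp_all add: mat2_def det_2 moebius_mat_def' mob_def)

lemma mat2_mult: "mat2 a b c d ** mat2 a' b' c' d' = mat2 (a * a' + b * c') (a * b' + b * d') (c * a' + d * c') (c * b' + d * d')"
  by (simp add: vec_eq_iff matrix_matrix_mult_def sum_2 forall_2)

lemma mat2_cases: obtains a b c d where "M = mat2 a b c d"
  using that[of "M $ 1 $ 1" "M $ 1 $ 2" "M $ 2 $ 1" "M $ 2 $ 2"] by (simp add: vec_eq_iff forall_2)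

lemma pullback_mat1: "pullback (mat2 1 0 0 1) F = F"
  by (rule mero_uhp_ext) (simp add: eval_pullback mob_def)

lemma pullback_mult_mat2:
  assumes "det A > 0" "det B > 0"
  shows "pullback B (pullback A F) = pullback (A ** B) F"
  using pullback_mult[OF assms] by simp

lemma adj2_mult:
  assumes "det M = 1"
  shows "adj2 M ** M = mat2 1 0 0 1" "M ** adj2 M = mat2 1 0 0 1" "det (adj2 M) = 1"
proof -
  obtain a b c d where M: "M = mat2 a b c d" by (rule mat2_cases)
  have *: "adj2 M = mat2 d (-b) (-c) a" by (simp add: M adj2_def mat2_def)
  show "adj2 M ** M = mat2 1 0 0 1" "M ** adj2 M = mat2 1 0 0 1" "det (adj2 M) = 1"
    unfolding * unfolding M mat2_mult using assms by (simp_all add: M algebra_simps)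
qed

lemma pullback_adj2:
  assumes "det M = 1"
  shows "pullback M (pullback (adj2 M) F) = F" "pullback (adj2 M) (pullback M F) = F"
  using adj2_mult[OF assms] assms by (simp_all add: pullback_mult_mat2 pullback_mat1)

text \<open>Periodicity makes \<open>F\<close> a function of q on a punctured disc, the growth bound
  makes q^N times it bounded, and Riemann's theorem removes the singularity.\<close>

lemma periodic_growth_imp_q_expansion:
  assumes per: "\<And>z. z \<in> uhp \<Longrightarrow> eval_mero F (z + of_nat h) = eval_mero F z"
    and h: "h > 0" and F: "growth F k" and N: "k * real h \<le> 2 * pi * real N"
  obtains L where "has_q_expansion h F L" "\<And>n. n < - int N \<Longrightarrow> fls_nth L n = 0"
proof -
  obtain Y C where Y: "Y > 0" "C \<ge> 0" "\<And>z. Im z \<ge> Y \<Longrightarrow> reg F z" "\<And>z. Im z \<ge> Y \<Longrightarrow> norm (eval_mero F z) \<le> C * exp (k * Im z)"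
    using F by (rule growthE) blast
  have per_nat: "eval_mero F (z + of_nat h * of_nat n) = eval_mero F z" if "z \<in> uhp" for z n
  proof (induction n)
    case (Suc n)
    have "z + of_nat h * of_nat n \<in> uhp" using that by (simp add: uhp_def)
    from per[OF this] Suc show ?case by (simp add: algebra_simps)
  qed simp
  have per_int: "eval_mero F (z + of_nat h * of_int n) = eval_mero F z" if z: "z \<in> uhp" for z n
  proof (cases n rule: int_cases2)
    case (nonneg m)
    thus ?thesis using per_nat[OF z, of m] by simp
  next
    case (nonpos m)
    have "z + of_nat h * of_int n \<in> uhp" using z by (simp add: uhp_def)
    from per_nat[OF this, of m] nonpos show ?thesis by (simp add: algebra_simps)
  qed
  define c where "c = of_nat h / (2 * of_real pi * \<i>)"
  have c0: "c \<noteq> 0" using h by (simp add: c_def)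
  \<comment> \<open>The principal logarithm inverts \<open>qvar\<close> up to integer multiples of
    the period, which do not change \<open>F\<close>.\<close>
  define G where "G = (\<lambda>q. eval_mero F (c * Ln q))"
  have qc: "qvar h (c * w) = exp w" for w
    using h by (simp add: qvar_def c_def)
  have Gq: "G (qvar h z) = eval_mero F z" if "z \<in> uhp" for z
  proof -
    have "exp (Ln (qvar h z)) = exp (2 * of_real pi * \<i> * z / of_nat h)" by (simp add: qvar_def)
    then obtain n where n: "Ln (qvar h z) = 2 * of_real pi * \<i> * z / of_nat h + of_real (real_of_int (2 * n) * pi) * \<i>"
      unfolding exp_eq by blast
    have "c * Ln (qvar h z) = z + of_nat h * of_int n"
      unfolding n c_def using h by (simp add: field_simps)
    thus ?thesis using per_int[OF that] by (simp add: G_def)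
  qed
  have Im_of_norm: "Im z = - (real h / (2 * pi)) * ln (norm (qvar h z))" for z
    unfolding norm_qvar using h by simp
  define r where "r = exp (- (2 * pi / real h) * Y)"
  have r: "r > 0" "r < 1" using Y(1) h by (simp_all add: r_def)
  have cover: "\<exists>z. qvar h z = q \<and> Im z > Y" if "q \<noteq> 0" "norm q < r" for q
  proof (intro exI conjI)
    show q: "qvar h (c * Ln q) = q" using that by (simp add: qc)
    have "norm (qvar h (c * Ln q)) < r" using that q by simp
    hence "(2 * pi / real h) * Y < (2 * pi / real h) * Im (c * Ln q)" unfolding norm_qvar r_def by simp
    moreover have p: "0 < 2 * pi / real h" using h by simp
    ultimately show "Im (c * Ln q) > Y" by (simp only: mult_less_cancel_left_pos[OF p])
  qed
  have G_analytic: "G analytic_on {q}" if q: "q \<noteq> 0" "norm q < r" for q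
  proof -
    obtain z where z: "qvar h z = q" "Im z > Y" using cover[OF q] by blast
    \<comment> \<open>The principal logarithm jumps on the negative axis. Near q it is replaced by
      the branch through z, which uses \<open>Ln\<close> only near 1.\<close>
    define \<psi> where "\<psi> = (\<lambda>p. z + c * Ln (p / q))"
    have q\<psi>: "qvar h (\<psi> p) = p" if "p \<noteq> 0" for p
    proof -
      have "qvar h (\<psi> p) = qvar h z * qvar h (c * Ln (p / q))"
        by (simp add: \<psi>_def qvar_def ring_distribs add_divide_distrib exp_add)
      thus ?thesis using that q(1) by (simp add: qc z(1))
    qed
    have "open (ball 0 1 - {0::complex})" by auto
    hence "eventually (\<lambda>p. p \<in> ball 0 1 - {0}) (nhds q)"
      using q r by (intro eventually_nhds_in_open) auto
    hence ev: "eventually (\<lambda>p. G p = eval_mero F (\<psi> p)) (nhds q)"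
    proof eventually_elim
      case (elim p)
      hence p: "p \<noteq> 0" "norm p < 1" by auto
      have "ln (norm (qvar h (\<psi> p))) < 0" using p by (simp add: q\<psi>)
      hence "Im (\<psi> p) > 0" unfolding Im_of_norm[of "\<psi> p"] using h by (intro mult_neg_neg) auto
      hence "\<psi> p \<in> uhp" by (simp add: uhp_def)
      from Gq[OF this] show ?case using p by (simp add: q\<psi>)
    qed
    have "(eval_mero F \<circ> \<psi>) analytic_on {q}"
    proof (rule analytic_on_compose)
      show "\<psi> analytic_on {q}" unfolding \<psi>_def using q(1) by (intro analytic_intros) auto
      show "eval_mero F analytic_on \<psi> ` {q}" using Y(3)[of z] z(2) q(1) by (simp add: \<psi>_def)
    qed
    hence "(\<lambda>p. eval_mero F (\<psi> p)) analytic_on {q}" by (simp add: o_def)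
    thus ?thesis unfolding analytic_at_cong[OF ev refl] .
  qed
  define f where "f = (\<lambda>q. q ^ N * G q)"
  have hol: "f holomorphic_on (ball 0 r - {0})"
  proof -
    have "f analytic_on {q}" if "q \<in> ball 0 r - {0}" for q
      unfolding f_def by (intro analytic_on_mult analytic_on_power analytic_on_ident G_analytic) (use that in auto)
    hence "f analytic_on (ball 0 r - {0})" by (subst analytic_on_analytic_at) blast
    thus ?thesis by (rule analytic_imp_holomorphic)
  qed
  have "norm (f q) \<le> C" if q: "q \<noteq> 0" "norm q < r" for q
  proof -
    obtain z where z: "qvar h z = q" "Im z > Y" using cover[OF q] by blast
    have "z \<in> uhp" using z(2) Y(1) by (simp add: uhp_def)
    hence "norm (f q) = norm (qvar h z) ^ N * norm (eval_mero F z)"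
      unfolding f_def z(1)[symmetric] using Gq[OF \<open>z \<in> uhp\<close>] by (simp add: norm_mult norm_power)
    also have "\<dots> \<le> norm (qvar h z) ^ N * (C * exp (k * Im z))"
      using Y(4)[of z] z(2) by (intro mult_left_mono) auto
    also have "\<dots> = C * exp ((k - 2 * pi / real h * real N) * Im z)"
      unfolding norm_qvar exp_of_nat_mult[symmetric] by (simp add: algebra_simps flip: exp_add)
    also have "k - 2 * pi / real h * real N \<le> 0" using N h by (simp add: field_simps)
    hence "(k - 2 * pi / real h * real N) * Im z \<le> 0"
      using z(2) Y(1) by (intro mult_nonpos_nonneg) auto
    hence "C * exp ((k - 2 * pi / real h * real N) * Im z) \<le> C * 1"
      using Y(2) by (intro mult_left_mono) auto
    finally show ?thesis by simp
  qed
  hence "eventually (\<lambda>q. norm (f q) \<le> C) (at 0)"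
    using r eventually_at_in_open[of "ball 0 r" 0] by (auto elim!: eventually_mono)
  hence "\<exists>g. g holomorphic_on ball 0 r \<and> (\<forall>z\<in>ball 0 r - {0}. g z = f z)"
    using holomorphic_on_extend_bounded[OF hol] r by auto
  then obtain g where g: "g holomorphic_on ball 0 r" "\<And>z. z \<in> ball 0 r - {0} \<Longrightarrow> g z = f z" by blast
  have "g analytic_on {0}" unfolding analytic_at using g(1) r by (intro exI[of _ "ball 0 r"]) auto
  hence "g has_laurent_expansion fps_to_fls (fps_expansion g 0)"
    by (intro has_laurent_expansion_fps analytic_at_imp_has_fps_expansion_0)
  hence "(\<lambda>x. g x * x powi (- int N)) has_laurent_expansion (fls_shift (int N) (fps_to_fls (fps_expansion g 0)))"
    by (rule has_laurent_expansion_shift')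
  moreover have "eventually (\<lambda>z. eval_mero F z = g (qvar h z) * qvar h z powi (- int N)) (filtercomap Im at_top)"
    unfolding eventually_Im_gt
  proof (intro exI[of _ "Y + 1"] conjI allI impI)
    fix z assume z: "Im z \<ge> Y + 1"
    have "z \<in> uhp" using z Y(1) by (simp add: uhp_def)
    have nz: "qvar h z \<noteq> 0" by (simp add: qvar_def)
    have "(2 * pi / real h) * Y < (2 * pi / real h) * Im z" using h z by (intro mult_strict_left_mono) auto
    hence "norm (qvar h z) < r" unfolding norm_qvar r_def by simp
    hence "g (qvar h z) = qvar h z ^ N * eval_mero F z"
      using g(2)[of "qvar h z"] nz Gq[OF \<open>z \<in> uhp\<close>] by (simp add: f_def)
    thus "eval_mero F z = g (qvar h z) * qvar h z powi (- int N)"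
      using nz by (simp add: power_int_minus field_simps)
  qed (use Y(1) in auto)
  ultimately have "has_q_expansion h F (fls_shift (int N) (fps_to_fls (fps_expansion g 0)))"
    using h by (rule has_q_expansionI)
  thus ?thesis by (rule that) simp
qed

subsection \<open>Reduction theory and the maximum principle\<close>

text \<open>Only finitely many heights above Im z occur in the orbit, since they bound the bottom
  rows (c, d). A point of maximal height, translated into the strip, has norm at least 1, as z
  \<mapsto> -1/z would raise it otherwise. The rational bound 1/2 stands in for sqrt 3 / 2.\<close>

lemma fundamental_domain:
  assumes z: "z \<in> uhp"
  obtains M where "det M = 1" "Im (moebius_mat M z) \<ge> 1 / 2" "\<bar>Re (moebius_mat M z)\<bar> \<le> 1 / 2"
proof -
  have y: "Im z > 0" using z by (simp add: uhp_def)
  define S where "S = {Im (moebius_mat M z) |M. det M = 1 \<and> Im (moebius_mat M z) \<ge> Im z}"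
  define A B where "A = \<lceil>1 / Im z\<rceil>" and "B = \<lceil>1 + (1 / Im z) * norm z\<rceil>"
  have S_iff: "v \<in> S \<longleftrightarrow> (\<exists>M. det M = 1 \<and> v = Im (moebius_mat M z) \<and> v \<ge> Im z)" for v
    unfolding S_def by blast
  have "S \<subseteq> (\<lambda>(c, d). Im z / (norm (of_int c * z + of_int d))\<^sup>2) ` ({-A..A} \<times> {-B..B})"
  proof
    fix v assume "v \<in> S"
    then obtain M where M: "det M = 1" "v = Im (moebius_mat M z)" "v \<ge> Im z" unfolding S_iff by blast
    obtain a b c d where abcd: "M = mat2 a b c d" by (rule mat2_cases)
    define n where "n = norm (of_int c * z + of_int d)"
    have v: "v = Im z / n\<^sup>2" unfolding M(2) Im_moebius M(1) by (simp add: abcd n_def)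
    have "c \<noteq> 0 \<or> d \<noteq> 0" using M(1) by (auto simp: abcd)
    hence n0: "n > 0" using mob_denom_nonzero[OF y, of c d] by (simp add: n_def)
    have "Im z \<le> Im z / n\<^sup>2" using M(3) v by simp
    hence "n\<^sup>2 \<le> 1" using y n0 by (simp add: field_simps)
    hence n1: "n \<le> 1" using power2_le_imp_le[of n 1] by simp
    have "\<bar>Im (of_int c * z + of_int d)\<bar> \<le> n" unfolding n_def by (rule abs_Im_le_cmod)
    hence "\<bar>of_int c\<bar> * Im z \<le> 1" using n1 y by (simp add: abs_mult)
    hence cb: "\<bar>of_int c\<bar> \<le> 1 / Im z" using y by (simp add: field_simps)
    have "norm (of_int d :: complex) \<le> n + norm (of_int c * z)"
      unfolding n_def using norm_triangle_ineq4[of "of_int c * z + of_int d" "of_int c * z"] by simp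
    hence "\<bar>of_int d\<bar> \<le> n + \<bar>of_int c\<bar> * norm z" by (simp add: norm_mult)
    also have "\<dots> \<le> 1 + (1 / Im z) * norm z" using n1 cb by (intro add_mono mult_right_mono) auto
    finally have db: "\<bar>of_int d\<bar> \<le> 1 + (1 / Im z) * norm z" .
    have cd: "real_of_int \<bar>c\<bar> \<le> 1 / Im z" "real_of_int \<bar>d\<bar> \<le> 1 + (1 / Im z) * norm z" using cb db by simp_all
    have "real_of_int \<bar>c\<bar> \<le> real_of_int A" "real_of_int \<bar>d\<bar> \<le> real_of_int B"
      unfolding A_def B_def by (rule order.trans[OF cd(1) le_of_int_ceiling], rule order.trans[OF cd(2) le_of_int_ceiling])
    hence "\<bar>c\<bar> \<le> A" "\<bar>d\<bar> \<le> B" by (simp_all only: of_int_le_iff)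
    hence "(c, d) \<in> {-A..A} \<times> {-B..B}" by auto
    thus "v \<in> (\<lambda>(c, d). Im z / (norm (of_int c * z + of_int d))\<^sup>2) ` ({-A..A} \<times> {-B..B})"
      by (rule rev_image_eqI) (simp add: v n_def)
  qed
  hence fin: "finite S" by (rule finite_subset) auto
  have "Im z \<in> S" unfolding S_iff
    by (rule exI[of _ "mat2 1 0 0 1"]) (simp add: mob_def)
  hence ne: "S \<noteq> {}" by auto
  have "Max S \<in> S" using fin ne by (rule Max_in)
  then obtain M where "det M = 1" "Max S = Im (moebius_mat M z)" "Max S \<ge> Im z" unfolding S_iff by blast
  hence M: "det M = 1" "Im (moebius_mat M z) = Max S" "Max S \<ge> Im z" by simp_all
  define n where "n = - round (Re (moebius_mat M z))"
  define w where "w = moebius_mat (mat2 1 n 0 1 ** M) z"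
  have w: "w = moebius_mat M z + of_int n"
    unfolding w_def using z M(1) by (simp add: moebius_mult mob_def)
  have Imw: "Im w = Max S" by (simp add: w M(2))
  have Rew: "\<bar>Re w\<bar> \<le> 1 / 2"
    using of_int_round_abs_le[of "Re (moebius_mat M z)"] by (simp add: w n_def abs_minus_commute)
  have wu: "w \<in> uhp" using Imw M(3) y by (simp add: uhp_def)
  have "norm w \<ge> 1"
  proof (rule ccontr)
    assume "\<not> norm w \<ge> 1"
    hence "norm w < 1" by simp
    moreover have "norm w > 0" using wu by (auto simp: uhp_def)
    ultimately have sq: "(norm w)\<^sup>2 < 1" "(norm w)\<^sup>2 > 0" by (simp_all add: power_less_one_iff)
    define M' where "M' = mat2 0 (-1) 1 0 ** (mat2 1 n 0 1 ** M)"
    have d: "det (mat2 1 n 0 1 ** M) = 1" "det M' = 1" using M(1) by (simp_all add: M'_def det_mul)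
    have "moebius_mat M' z = moebius_mat (mat2 0 (-1) 1 0) w"
      unfolding M'_def w_def using z d by (intro moebius_mult) auto
    hence "Im (moebius_mat M' z) = Im w / (norm w)\<^sup>2"
      unfolding Im_moebius[of "mat2 0 (-1) 1 0"] by (simp add: Im_mob)
    also have "\<dots> > Im w" using sq wu by (simp add: uhp_def field_simps)
    finally have gt: "Im (moebius_mat M' z) > Max S" using Imw by simp
    hence "Im z \<le> Im (moebius_mat M' z)" using M(3) by simp
    hence "Im (moebius_mat M' z) \<in> S" unfolding S_iff using d by blast
    hence "Im (moebius_mat M' z) \<le> Max S" using fin by (rule Max_ge[rotated])
    thus False using gt by simp
  qed
  hence "1 \<le> (Re w)\<^sup>2 + (Im w)\<^sup>2" by (simp add: cmod_power2[symmetric])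
  moreover have "(Re w)\<^sup>2 \<le> (1 / 2)\<^sup>2" using Rew power_mono[of "\<bar>Re w\<bar>" "1 / 2" 2] by simp
  ultimately have "(1 / 2)\<^sup>2 \<le> (Im w)\<^sup>2" by (simp add: power2_eq_square)
  hence "1 / 2 \<le> Im w" by (rule power2_le_imp_le) (use wu in \<open>simp add: uhp_def\<close>)
  moreover have "det (mat2 1 n 0 1 ** M) = 1" using M(1) by (simp add: det_mul)
  ultimately show ?thesis using Rew unfolding w_def by (intro that[of "mat2 1 n 0 1 ** M"]) auto
qed

text \<open>Beyond some height |G| is smaller than at a chosen nonzero value, so by reduction it
  attains its maximum over the half plane in a compact box. Then G is constant, which contradicts
  its decay.\<close>

lemma level_one_zero:
  assumes inv: "\<And>M. det M = 1 \<Longrightarrow> pullback M G = G" and r: "\<And>z. z \<in> uhp \<Longrightarrow> reg G z"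
    and gr: "growth G k" "k < 0"
  shows "G = 0"
proof (rule ccontr)
  assume "G \<noteq> 0"
  have "\<exists>z0\<in>uhp. eval_mero G z0 \<noteq> 0"
  proof (rule ccontr)
    assume "\<not> ?thesis"
    hence "G = 0" by (intro mero_uhp_ext) (auto simp: reg_zero_one)
    thus False using \<open>G \<noteq> 0\<close> by simp
  qed
  then obtain z0 where z0: "z0 \<in> uhp" "eval_mero G z0 \<noteq> 0" by blast
  define eps where "eps = norm (eval_mero G z0)"
  have eps: "eps > 0" using z0 by (simp add: eps_def)
  obtain Y C where Y: "Y > 0" "C \<ge> 0" "\<And>z. Im z \<ge> Y \<Longrightarrow> norm (eval_mero G z) \<le> C * exp (k * Im z)"
    using gr(1) by (rule growthE) blast
  have "((\<lambda>y. C * exp (k * y)) \<longlongrightarrow> C * 0) at_top"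
    using gr(2) by (intro tendsto_mult tendsto_const filterlim_compose[OF exp_at_bot] filterlim_tendsto_neg_mult_at_bot[OF tendsto_const] filterlim_ident) auto
  hence "eventually (\<lambda>y. C * exp (k * y) < eps) at_top" using eps by (intro order_tendstoD(2)) simp_all
  then obtain Y1 where Y1: "\<And>y. y \<ge> Y1 \<Longrightarrow> C * exp (k * y) < eps" unfolding eventually_at_top_linorder by blast
  define Y2 where "Y2 = max 1 (max Y Y1)"
  have small: "norm (eval_mero G z) < eps" if "Im z \<ge> Y2" for z
    using Y(3)[of z] Y1[of "Im z"] that by (simp add: Y2_def)
  have G_inv: "eval_mero G (moebius_mat M z) = eval_mero G z" if "det M = 1" "z \<in> uhp" for M z
    using eval_pullback[of M z G] inv[OF that(1)] that by simp
  define Box where "Box = cbox (Complex (-1/2) (1/2)) (Complex (1/2) Y2)"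
  have Box: "z \<in> Box \<longleftrightarrow> \<bar>Re z\<bar> \<le> 1 / 2 \<and> Im z \<ge> 1 / 2 \<and> Im z \<le> Y2" for z
    by (auto simp: Box_def in_cbox_complex_iff abs_le_iff)
  have Box_uhp: "Box \<subseteq> uhp" by (auto simp: Box uhp_def)
  have red: "\<exists>w. eval_mero G w = eval_mero G z \<and> (w \<in> Box \<or> Im w \<ge> Y2)" if "z \<in> uhp" for z
  proof -
    obtain M where M: "det M = 1" "Im (moebius_mat M z) \<ge> 1 / 2" "\<bar>Re (moebius_mat M z)\<bar> \<le> 1 / 2"
      using \<open>z \<in> uhp\<close> by (rule fundamental_domain)
    show ?thesis using M G_inv[OF M(1) that] by (intro exI[of _ "moebius_mat M z"]) (auto simp: Box)
  qed
  obtain w0 where w0: "eval_mero G w0 = eval_mero G z0" "w0 \<in> Box \<or> Im w0 \<ge> Y2" using red[OF z0(1)] by blast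
  have w0B: "w0 \<in> Box" using w0 small[of w0] by (auto simp: eps_def)
  have G_an: "eval_mero G analytic_on uhp" using r by (subst analytic_on_analytic_at) auto
  have cont: "continuous_on Box (\<lambda>z. norm (eval_mero G z))"
    by (intro continuous_on_norm continuous_on_subset[OF holomorphic_on_imp_continuous_on[OF analytic_imp_holomorphic[OF G_an]] Box_uhp])
  have comp: "compact Box" by (simp add: Box_def)
  have ne: "Box \<noteq> {}" using w0B by blast
  obtain z1 where z1: "z1 \<in> Box" "\<And>z. z \<in> Box \<Longrightarrow> norm (eval_mero G z) \<le> norm (eval_mero G z1)"
    using continuous_attains_sup[OF comp ne cont] by blast
  have le: "norm (eval_mero G z) \<le> norm (eval_mero G z1)" if "z \<in> uhp" for z
  proof -
    obtain w where w: "eval_mero G w = eval_mero G z" "w \<in> Box \<or> Im w \<ge> Y2" using red[OF \<open>z \<in> uhp\<close>] by blast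
    have "eps \<le> norm (eval_mero G z1)" using z1(2)[OF w0B] w0(1) by (simp add: eps_def)
    thus ?thesis using w z1(2)[of w] small[of w] by auto
  qed
  have "eval_mero G constant_on uhp"
    by (rule maximum_modulus_principle[OF analytic_imp_holomorphic[OF G_an] uhp_props(1,2,1), of z1])
       (use z1 Box_uhp le in auto)
  then obtain c where c: "\<And>z. z \<in> uhp \<Longrightarrow> eval_mero G z = c" unfolding constant_on_def by blast
  have "of_real Y2 * \<i> \<in> uhp" by (simp add: uhp_def Y2_def)
  hence "eval_mero G (of_real Y2 * \<i>) = eval_mero G z0" using c z0(1) by simp
  thus False using small[of "of_real Y2 * \<i>"] by (simp add: eps_def)
qed

text \<open>The product \<open>P\<close> over the set of distinct conjugates is invariant, because
  SL_2(Z) permutes this set. \<open>F\<close> itself is one of the factors, so \<open>P\<close>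
  decays and is 0; then some conjugate, and hence \<open>F\<close>, is 0.\<close>

lemma vanishing_principle:
  assumes fin: "finite {pullback M F |M. det M = 1}" and r: "\<And>z. z \<in> uhp \<Longrightarrow> reg F z"
    and bd: "\<And>M. det M = 1 \<Longrightarrow> growth (pullback M F) 0" and gr: "growth F k" "k < 0"
  shows "F = 0"
proof -
  define S where "S = {pullback M F |M. det M = 1}"
  define P where "P = \<Prod>S"
  have F_in: "F \<in> S" unfolding S_def using pullback_mat1[of F] by (intro CollectI exI[of _ "mat2 1 0 0 1"]) auto
  have inv: "pullback A P = P" if A: "det A = 1" for A
  proof -
    have img: "pullback A ` S = S"
    proof (intro equalityI subsetI)
      fix G assume "G \<in> pullback A ` S"
      then obtain M where "det M = 1" "G = pullback A (pullback M F)" unfolding S_def by blast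
      thus "G \<in> S" unfolding S_def using A
        by (intro CollectI exI[of _ "M ** A"]) (simp add: pullback_mult_mat2 det_mul)
    next
      fix G assume "G \<in> S"
      then obtain M where M: "det M = 1" "G = pullback M F" unfolding S_def by blast
      have "G = pullback A (pullback (adj2 A) (pullback M F))" using pullback_adj2(1)[OF A] M by simp
      moreover have "pullback (adj2 A) (pullback M F) = pullback (M ** adj2 A) F"
        using M adj2_mult(3)[OF A] by (simp add: pullback_mult_mat2)
      moreover have "pullback (M ** adj2 A) F \<in> S"
        unfolding S_def using M adj2_mult(3)[OF A] by (intro CollectI exI[of _ "M ** adj2 A"]) (simp add: det_mul)
      ultimately show "G \<in> pullback A ` S" by auto
    qed
    have inj: "inj_on (pullback A) S"
      by (rule eq_card_imp_inj_on) (use fin img in \<open>simp_all add: S_def\<close>)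
    have "pullback A P = (\<Prod>G\<in>S. pullback A G)" unfolding P_def using A by (subst pullback_more(4)) simp_all
    also have "\<dots> = \<Prod>(pullback A ` S)" using inj by (subst prod.reindex) simp_all
    finally show ?thesis unfolding img P_def .
  qed
  have regs: "reg G z" if "G \<in> S" "z \<in> uhp" for G z
  proof -
    obtain M where M: "det M = 1" "G = pullback M F" using \<open>G \<in> S\<close> unfolding S_def by blast
    show ?thesis unfolding M(2) using M(1) that(2) by (intro reg_pullback r moebius_in_uhp) auto
  qed
  have regP: "reg P z" if "z \<in> uhp" for z
    using reg_prod[of S "\<lambda>G. G" z] regs[OF _ that] that by (simp add: P_def)
  have "growth (\<Prod>T) 0" if "finite T" "T \<subseteq> S" for T
    using that
  proof (induction T rule: finite_induct)
    case empty
    show ?case using growth_cst[of 1] by (simp add: cst_hom)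
  next
    case (insert G T)
    have "growth G 0" using insert.prems bd by (auto simp: S_def)
    from growth_mult[OF this insert.IH] insert show ?case by simp
  qed
  hence "growth (\<Prod>(S - {F})) 0" using fin by (simp add: S_def)
  from growth_mult[OF gr(1) this] have "growth P k"
    using fin F_in prod.remove[of S F "\<lambda>G. G"] by (simp add: P_def S_def)
  hence "P = 0" using inv regP gr(2) by (intro level_one_zero[of P k])
  hence "0 \<in> S" using fin unfolding P_def S_def[symmetric] by (simp add: prod_zero_iff)
  then obtain M where "det M = 1" "0 = pullback M F" unfolding S_def by blast
  hence M: "det M = 1" "pullback M F = 0" by simp_all
  have "F = pullback (adj2 M) 0" using pullback_adj2(2)[OF M(1), of F] M(2) by simp
  thus ?thesis using adj2_mult(3)[OF M(1)] by (simp add: pullback_more)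
qed

text \<open>A coset of \<open>Gamma0 N\<close> is recognized by the bottom row modulo N: if M and M0
  share it, the lower left entry c d' - d c' of M ** adj2 M0 is divisible by N.\<close>

lemma finite_coset_reps:
  assumes N: "N > 0"
  obtains R :: "(int ^ 2 ^ 2) set" where "finite R" "\<And>M. M \<in> R \<Longrightarrow> det M = 1"
    "\<And>M. det M = 1 \<Longrightarrow> \<exists>M0\<in>R. \<exists>A\<in>Gamma0 N. M = A ** M0"
proof -
  define key where "key = (\<lambda>M :: int ^ 2 ^ 2. (M $ 2 $ 1 mod int N, M $ 2 $ 2 mod int N))"
  define D where "D = {M :: int ^ 2 ^ 2. det M = 1}"
  define pick where "pick = (\<lambda>p. SOME M. M \<in> D \<and> key M = p)"
  have pick: "pick (key M) \<in> D" "key (pick (key M)) = key M" if "M \<in> D" for M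
    using someI_ex[of "\<lambda>M'. M' \<in> D \<and> key M' = key M"] that unfolding pick_def by blast+
  have "key ` D \<subseteq> {0..<int N} \<times> {0..<int N}" using N by (auto simp: key_def)
  hence "finite (key ` D)" by (rule finite_subset) auto
  hence fin: "finite (pick ` key ` D)" by (rule finite_imageI)
  show ?thesis
  proof (rule that[OF fin])
    fix M assume "M \<in> pick ` key ` D"
    thus "det M = 1" using pick by (auto simp: D_def)
  next
    fix M :: "int ^ 2 ^ 2" assume dM: "det M = 1"
    hence M: "M \<in> D" by (simp add: D_def)
    define M0 where "M0 = pick (key M)"
    have M0: "det M0 = 1" "key M0 = key M" using pick[OF M] by (auto simp: M0_def D_def)
    obtain a b c d where m: "M = mat2 a b c d" by (rule mat2_cases)
    obtain a' b' c' d' where m0: "M0 = mat2 a' b' c' d'" by (rule mat2_cases)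
    have adj: "adj2 M0 = mat2 d' (-b') (-c') a'" by (simp add: m0 adj2_def mat2_def)
    have cong: "int N dvd c - c'" "int N dvd d - d'"
      using M0(2) by (auto simp: key_def m m0 mod_eq_dvd_iff dvd_diff_commute)
    have "c * d' - d * c' = (c - c') * d' - (d - d') * c'" by (simp add: algebra_simps)
    also have "int N dvd \<dots>" by (rule dvd_diff[OF dvd_mult2[OF cong(1)] dvd_mult2[OF cong(2)]])
    finally have "M ** adj2 M0 \<in> Gamma0 N"
      unfolding Gamma0_def using dM adj2_mult(3)[OF M0(1)]
      by (auto simp: det_mul) (simp add: m adj mat2_mult)
    moreover have "(M ** adj2 M0) ** M0 = M"
      unfolding matrix_mul_assoc[symmetric] adj2_mult(1)[OF M0(1)] by (simp add: m mat2_mult)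
    moreover have "M0 \<in> pick ` key ` D" using M by (simp add: M0_def)
    ultimately show "\<exists>M0\<in>pick ` key ` D. \<exists>A\<in>Gamma0 N. M = A ** M0"
      by (metis (no_types))
  qed
qed

lemma pullback_coset:
  assumes "\<And>A. A \<in> Gamma0 N \<Longrightarrow> pullback A F = F" "A \<in> Gamma0 N" "det M = 1"
  shows "pullback (A ** M) F = pullback M F"
proof -
  have "det A = 1" using assms(2) by (simp add: Gamma0_def)
  thus ?thesis using assms pullback_mult[of A M F] by simp
qed

subsection \<open>Subfields\<close>

lemma has_q_expansion_one_zero: "h > 0 \<Longrightarrow> has_q_expansion h 0 0" "h > 0 \<Longrightarrow> has_q_expansion h 1 1"
  using has_q_expansion_cst[of h 0] has_q_expansion_cst[of h 1] by (simp_all add: cst_hom)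

lemma is_subfield_modular_functions:
  assumes N: "N > 0"
  shows "is_subfield (modular_functions N)"
proof -
  have d: "det A > 0" if "A \<in> Gamma0 N" for A using that by (simp add: Gamma0_def)
  have p: "0 < det M" if "det M = 1" for M :: "int ^ 2 ^ 2" using that by simp
  show ?thesis
    unfolding is_subfield_def
  proof (intro conjI ballI)
    show "0 \<in> modular_functions N" "1 \<in> modular_functions N"
      using N has_q_expansion_one_zero by (auto simp: modular_functions_def pullback_more d p)
    fix F assume F: "F \<in> modular_functions N"
    have F': "\<And>A. A \<in> Gamma0 N \<Longrightarrow> pullback A F = F" "\<And>M. det M = 1 \<Longrightarrow> \<exists>L. has_q_expansion N (pullback M F) L"
      using F by (auto simp: modular_functions_def)
    show "- F \<in> modular_functions N" "inverse F \<in> modular_functions N"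
      unfolding modular_functions_def
      using F' has_q_expansion_inverse[OF _ N] has_q_expansion_ops(3)[OF _ has_q_expansion_one_zero(1)[OF N] N]
      by (auto simp: pullback_hom d p) blast+
    fix G assume G: "G \<in> modular_functions N"
    have G': "\<And>A. A \<in> Gamma0 N \<Longrightarrow> pullback A G = G" "\<And>M. det M = 1 \<Longrightarrow> \<exists>L. has_q_expansion N (pullback M G) L"
      using G by (auto simp: modular_functions_def)
    have "\<exists>L. has_q_expansion N (pullback M (F + G)) L" "\<exists>L. has_q_expansion N (pullback M (F * G)) L" if "det M = 1" for M
      using F'(2)[OF that] G'(2)[OF that] has_q_expansion_ops(1,2)[OF _ _ N]
      by (auto simp: pullback_hom p that) blast+
    thus "F + G \<in> modular_functions N" "F * G \<in> modular_functions N"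
      unfolding modular_functions_def using F' G' by (auto simp: pullback_hom d)
  qed
qed

definition rational_fls :: "complex fls \<Rightarrow> bool" where
  "rational_fls L \<longleftrightarrow> (\<forall>n. fls_nth L n \<in> \<rat>)"

lemma rational_fls_mult:
  assumes "rational_fls L" "rational_fls K"
  shows "rational_fls (L * K)"
  unfolding rational_fls_def fls_times_nth(2) using assms
  by (auto simp: rational_fls_def intro!: Rats_sum Rats_mult)

text \<open>In L * K = 1 each coefficient of K appears multiplied by the lowest coefficient of L,
  the other terms involving earlier coefficients of K; this is a recursion over the
  rationals.\<close>

lemma rational_fls_inverse:
  assumes L: "rational_fls L"
  shows "rational_fls (inverse L)"
proof (cases "L = 0")
  case False
  define K where "K = inverse L"
  have LK: "L * K = 1" using False by (simp add: K_def)
  define s where "s = fls_subdegree L"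
  define t where "t = fls_subdegree K"
  have s0: "fls_nth L s \<noteq> 0" using False by (simp add: s_def)
  have "fls_nth K m \<in> \<rat>" for m
  proof (induction "nat (m - t)" arbitrary: m rule: less_induct)
    case less
    show ?case
    proof (cases "m < t")
      case True
      thus ?thesis by (simp add: t_def)
    next
      case m: False
      have "fls_nth (L * K) (m + s) = (\<Sum>i=s..m + s - t. fls_nth L i * fls_nth K (m + s - i))"
        unfolding s_def t_def by (rule fls_times_nth(2))
      also have "{s..m + s - t} = insert s {s + 1..m + s - t}" using m by auto
      also have "(\<Sum>i\<in>\<dots>. fls_nth L i * fls_nth K (m + s - i)) =
          fls_nth L s * fls_nth K m + (\<Sum>i=s + 1..m + s - t. fls_nth L i * fls_nth K (m + s - i))"
        by (subst sum.insert) auto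
      finally have eq: "fls_nth K m = (fls_nth (L * K) (m + s) - (\<Sum>i=s + 1..m + s - t. fls_nth L i * fls_nth K (m + s - i))) / fls_nth L s"
        using s0 by (simp add: field_simps)
      have "fls_nth (L * K) (m + s) \<in> \<rat>" unfolding LK by simp
      moreover have "(\<Sum>i=s + 1..m + s - t. fls_nth L i * fls_nth K (m + s - i)) \<in> \<rat>"
      proof (intro Rats_sum Rats_mult)
        fix i assume "i \<in> {s + 1..m + s - t}"
        thus "fls_nth K (m + s - i) \<in> \<rat>" by (intro less) auto
      qed (use L in \<open>auto simp: rational_fls_def\<close>)
      ultimately show ?thesis unfolding eq using L by (auto simp: rational_fls_def intro!: Rats_divide Rats_diff)
    qed
  qed
  thus ?thesis by (simp add: rational_fls_def K_def)
qed (simp add: rational_fls_def)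

lemma X0_function_field_alt:
  "X0_function_field N = {F \<in> modular_functions N. \<exists>L. has_q_expansion 1 F L \<and> rational_fls L}"
  by (simp add: X0_function_field_def rational_fls_def)

lemma is_subfield_X0_function_field:
  assumes N: "N > 0"
  shows "is_subfield (X0_function_field N)"
proof -
  define Q where "Q = {F. \<exists>L. has_q_expansion 1 F L \<and> rational_fls L}"
  have "is_subfield Q"
    unfolding is_subfield_def Q_def
  proof (intro conjI ballI)
    show "0 \<in> {F. \<exists>L. has_q_expansion 1 F L \<and> rational_fls L}" "1 \<in> {F. \<exists>L. has_q_expansion 1 F L \<and> rational_fls L}"
      using has_q_expansion_one_zero[of 1] by (auto simp: rational_fls_def intro!: exI)
    fix F assume "F \<in> {F. \<exists>L. has_q_expansion 1 F L \<and> rational_fls L}"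
    then obtain L where L: "has_q_expansion 1 F L" "rational_fls L" by auto
    show "- F \<in> {F. \<exists>L. has_q_expansion 1 F L \<and> rational_fls L}"
      using has_q_expansion_ops(3)[OF L(1) L(1)] L(2) by (auto simp: rational_fls_def intro!: exI[of _ "-L"])
    show "inverse F \<in> {F. \<exists>L. has_q_expansion 1 F L \<and> rational_fls L}"
      using has_q_expansion_inverse[OF L(1)] rational_fls_inverse[OF L(2)] by auto
    fix G assume "G \<in> {F. \<exists>L. has_q_expansion 1 F L \<and> rational_fls L}"
    then obtain K where K: "has_q_expansion 1 G K" "rational_fls K" by auto
    show "F + G \<in> {F. \<exists>L. has_q_expansion 1 F L \<and> rational_fls L}"
      using has_q_expansion_ops(1)[OF L(1) K(1)] L(2) K(2) by (auto simp: rational_fls_def intro!: exI[of _ "L + K"])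
    show "F * G \<in> {F. \<exists>L. has_q_expansion 1 F L \<and> rational_fls L}"
      using has_q_expansion_ops(2)[OF L(1) K(1)] rational_fls_mult[OF L(2) K(2)] by auto
  qed
  moreover have "X0_function_field N = modular_functions N \<inter> Q"
    by (auto simp: X0_function_field_alt Q_def)
  ultimately show ?thesis
    using is_subfield_modular_functions[OF N] by (auto simp: is_subfield_def)
qed

lemma of_rat_in_subfield:
  assumes "is_subfield K"
  shows "(of_rat r :: 'a :: field_char_0) \<in> K"
proof -
  have nat: "of_nat n \<in> K" for n using assms by (induction n) (auto simp: is_subfield_def)
  have int: "of_int n \<in> K" for n using assms nat by (cases n rule: int_cases2) (auto simp: is_subfield_def)
  show ?thesis
  proof (cases r)
    case (Fract a b)
    thus ?thesis using assms int by (simp add: of_rat_rat divide_inverse is_subfield_def)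
  qed
qed

lemma rat_adjoin_subset:
  fixes K :: "'a :: field_char_0 set"
  shows "is_subfield K \<Longrightarrow> S \<subseteq> K \<Longrightarrow> rat_adjoin S \<subseteq> K"
proof -
  assume K: "is_subfield K" "S \<subseteq> K"
  have "\<rat> \<subseteq> K"
  proof
    fix q :: 'a assume "q \<in> \<rat>"
    then obtain r where "q = of_rat r" by (rule Rats_cases)
    thus "q \<in> K" using of_rat_in_subfield[OF K(1)] by simp
  qed
  thus "rat_adjoin S \<subseteq> K" unfolding rat_adjoin_def using K by blast
qed

lemma is_subfield_rat_adjoin: "is_subfield (rat_adjoin S)"
  unfolding rat_adjoin_def by (auto simp: is_subfield_def)

lemma rat_adjoin_superset: "S \<subseteq> rat_adjoin S"
  unfolding rat_adjoin_def by auto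

text \<open>Extends {c} to a basis of the complex numbers over the rationals. The normalization at c
  serves to keep one chosen coefficient of a relation nonzero.\<close>

lemma rat_functional:
  fixes c :: complex
  assumes "c \<noteq> 0"
  obtains \<phi> :: "complex \<Rightarrow> rat" where "\<And>a b. \<phi> (a + b) = \<phi> a + \<phi> b" "\<And>r a. \<phi> (of_rat r * a) = r * \<phi> a" "\<phi> c = 1"
proof -
  interpret p: vector_space_pair "\<lambda>(r::rat) (a::complex). of_rat r * a" "\<lambda>(r::rat) (a::rat). r * a"
    by unfold_locales (simp_all add: algebra_simps of_rat_add of_rat_mult)
  have "p.vs1.independent {c}" using assms by simp
  from p.linear_independent_extend[OF this, of "\<lambda>_. 1"] obtain g where
    g: "Vector_Spaces.linear (\<lambda>(r::rat) (a::complex). of_rat r * a) (\<lambda>(r::rat) (a::rat). r * a) g" "g c = 1" by auto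
  interpret l: Vector_Spaces.linear "\<lambda>(r::rat) (a::complex). of_rat r * a" "\<lambda>(r::rat) (a::rat). r * a" g by (rule g(1))
  show ?thesis by (rule that[of g]) (use g(2) in \<open>auto simp: l.add l.scale\<close>)
qed

lemma has_q_expansion_lincomb:
  assumes "finite I" "\<And>i. i \<in> I \<Longrightarrow> has_q_expansion 1 (B i) (L i)"
  shows "has_q_expansion 1 (\<Sum>i\<in>I. cst (c i) * B i) (\<Sum>i\<in>I. fls_const (c i) * L i)"
  using assms
proof (induction I rule: finite_induct)
  case empty
  thus ?case by (simp add: has_q_expansion_one_zero)
next
  case (insert i I)
  have "has_q_expansion 1 (cst (c i) * B i) (fls_const (c i) * L i)"
    using insert by (intro has_q_expansion_ops(2) has_q_expansion_cst) auto
  from has_q_expansion_ops(1)[OF this insert.IH] insert show ?case by simp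
qed

text \<open>
  A linear relation over the complex numbers between functions with rational \<open>q\<close>-expansions yields relations
  over $\mathbb{Q}$, by applying a $\mathbb{Q}$-linear functional to its coefficients.
\<close>
lemma rational_descent:
  fixes \<phi> :: "complex \<Rightarrow> rat"
  assumes "finite I" and B: "\<And>i. i \<in> I \<Longrightarrow> \<exists>L. has_q_expansion 1 (B i) L \<and> rational_fls L"
    and zero: "(\<Sum>i\<in>I. cst (c i) * B i) = 0"
    and add: "\<And>a b. \<phi> (a + b) = \<phi> a + \<phi> b" and scale: "\<And>r a. \<phi> (of_rat r * a) = r * \<phi> a"
  shows "(\<Sum>i\<in>I. of_rat (\<phi> (c i)) * B i) = 0"
proof -
  obtain L where L: "\<And>i. i \<in> I \<Longrightarrow> has_q_expansion 1 (B i) (L i)" "\<And>i. i \<in> I \<Longrightarrow> rational_fls (L i)"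
    using B by metis
  have phi0: "\<phi> 0 = 0" using add[of 0 0] by simp
  have phi_sum: "\<phi> (\<Sum>i\<in>I. g i) = (\<Sum>i\<in>I. \<phi> (g i))" for g :: "_ \<Rightarrow> complex"
    using assms(1) by (induction I rule: finite_induct) (auto simp: add phi0)
  \<comment> \<open>The q-coefficients are rational, so the functional can be moved past them, and
    the relation survives coefficient by coefficient.\<close>
  have phi_mult: "of_rat (\<phi> (a * b)) = of_rat (\<phi> a) * b" if "b \<in> \<rat>" for a b :: complex
  proof -
    obtain r where "b = of_rat r" using \<open>b \<in> \<rat>\<close> by (rule Rats_cases)
    thus ?thesis using scale[of r a] by (simp add: mult.commute of_rat_mult)
  qed
  have nth: "fls_nth (\<Sum>i\<in>I. fls_const (d i) * L i) n = (\<Sum>i\<in>I. d i * fls_nth (L i) n)" for d n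
    using assms(1) by (induction I rule: finite_induct) auto
  have 0: "(\<Sum>i\<in>I. fls_const (c i) * L i) = 0"
    using has_q_expansion_eq_0_iff[OF has_q_expansion_lincomb[OF assms(1) L(1)]] zero by simp
  have "(\<Sum>i\<in>I. fls_const (of_rat (\<phi> (c i))) * L i) = 0"
  proof (rule fls_eqI)
    fix n
    have "(\<Sum>i\<in>I. of_rat (\<phi> (c i)) * fls_nth (L i) n) = (\<Sum>i\<in>I. of_rat (\<phi> (c i * fls_nth (L i) n)) :: complex)"
      using L(2) by (intro sum.cong) (auto simp: phi_mult rational_fls_def)
    also have "\<dots> = of_rat (\<phi> (\<Sum>i\<in>I. c i * fls_nth (L i) n))" by (simp add: phi_sum of_rat_sum)
    also have "(\<Sum>i\<in>I. c i * fls_nth (L i) n) = 0" using arg_cong[OF 0, of "\<lambda>L. fls_nth L n"] by (simp add: nth)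
    finally show "fls_nth (\<Sum>i\<in>I. fls_const (of_rat (\<phi> (c i))) * L i) n = fls_nth 0 n" by (simp add: nth phi0)
  qed
  hence "(\<Sum>i\<in>I. cst (of_rat (\<phi> (c i))) * B i) = 0"
    using has_q_expansion_eq_0_iff[OF has_q_expansion_lincomb[OF assms(1) L(1)]] by simp
  thus ?thesis by (simp add: cst_of_rat)
qed

subsection \<open>Initial coefficients\<close>

text \<open>Coefficient lists of integers, on which power series identities are checked by
  evaluation. All lists below have length 12, covering the exponents -11, ..., 0 of a function with
  a pole of order 11.\<close>

definition begins :: "complex fps \<Rightarrow> int list \<Rightarrow> bool" where
  "begins F xs \<longleftrightarrow> (\<forall>i<length xs. fps_nth F i = of_int (xs ! i))"

definition list_mult :: "int list \<Rightarrow> int list \<Rightarrow> int list" where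
  "list_mult xs ys = map (\<lambda>k. \<Sum>i\<leftarrow>[0..<Suc k]. xs ! i * ys ! (k - i)) [0..<length xs]"

lemma begins_mult:
  assumes "begins F xs" "begins G ys" "length ys = length xs" "list_mult xs ys = zs"
  shows "begins (F * G) zs"
  unfolding begins_def
proof (intro allI impI)
  fix k assume "k < length zs"
  hence k: "k < length xs" using assms(4) by (auto simp: list_mult_def)
  have "fps_nth (F * G) k = (\<Sum>i=0..k. fps_nth F i * fps_nth G (k - i))" by (rule fps_mult_nth)
  also have "\<dots> = (\<Sum>i=0..k. of_int (xs ! i * ys ! (k - i)))"
    using assms k by (intro sum.cong) (auto simp: begins_def)
  also have "\<dots> = of_int (\<Sum>i=0..k. xs ! i * ys ! (k - i))" by simp
  also have "(\<Sum>i=0..k. xs ! i * ys ! (k - i)) = (\<Sum>i\<leftarrow>[0..<Suc k]. xs ! i * ys ! (k - i))"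
    by (subst sum_list_distinct_conv_sum_set) (simp_all add: atLeastLessThanSuc_atLeastAtMost del: upt_Suc)
  also have "\<dots> = zs ! k" using assms(4) k by (auto simp: list_mult_def simp del: upt_Suc)
  finally show "fps_nth (F * G) k = of_int (zs ! k)" .
qed

lemma begins_cong: "begins F xs \<Longrightarrow> xs = ys \<Longrightarrow> begins F ys" by simp

lemma begins_add:
  "begins F xs \<Longrightarrow> begins G ys \<Longrightarrow> length ys = length xs \<Longrightarrow> map2 (+) xs ys = zs \<Longrightarrow> begins (F + G) zs"
  by (auto simp: begins_def)

lemma begins_diff:
  "begins F xs \<Longrightarrow> begins G ys \<Longrightarrow> length ys = length xs \<Longrightarrow> map2 (-) xs ys = zs \<Longrightarrow> begins (F - G) zs"
  by (auto simp: begins_def)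

lemma begins_numeral: "begins (numeral k) (numeral k # replicate n 0)"
  by (auto simp: begins_def nth_Cons fps_numeral_nth split: nat.splits)

lemma begins_X_power: "begins (fps_X ^ k) (map (\<lambda>i. if i = k then 1 else 0) [0..<n])"
  by (auto simp: begins_def fps_X_power_nth)

text \<open>The inverse is not computed but proposed, and verified by one multiplication. Low
  coefficients of G = F^-1 * (F * G) depend only on low coefficients of F * G.\<close>

lemma begins_inverse:
  assumes F: "begins F xs" and "list_mult xs ys = 1 # replicate (length xs - 1) 0" "length ys = length xs" "xs \<noteq> []" "fps_nth F 0 \<noteq> 0"
  shows "begins (inverse F) ys"
proof -
  define G where "G = Abs_fps (\<lambda>i. of_int (ys ! i) :: complex)"
  have G: "begins G ys" by (simp add: begins_def G_def)
  have FG: "begins (F * G) (1 # replicate (length xs - 1) 0)" using begins_mult[OF F G] assms by simp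
  show ?thesis
    unfolding begins_def
  proof (intro allI impI)
    fix k assume k: "k < length ys"
    have FG_nth: "fps_nth (F * G) i = (if i = 0 then 1 else 0)" if "i \<le> k" for i
      using FG that k assms(3,4) by (auto simp: begins_def nth_Cons split: nat.splits)
    have "G = inverse F * (F * G)"
      using assms(5) by (simp add: mult.assoc[symmetric] inverse_mult_eq_1)
    hence "fps_nth G k = (\<Sum>i=0..k. fps_nth (inverse F) i * fps_nth (F * G) (k - i))"
      using fps_mult_nth by metis
    also have "\<dots> = (\<Sum>i=0..k. if i = k then fps_nth (inverse F) i else 0)"
      by (intro sum.cong) (auto simp: FG_nth)
    also have "\<dots> = fps_nth (inverse F) k" by simp
    finally show "fps_nth (inverse F) k = of_int (ys ! k)" by (simp add: G_def)
  qed
qed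

section \<open>The power series of the product of the factors 1 - q^n\<close>

definition eta_fps :: "complex fps" where "eta_fps = fps_compose (fps_exp 1) eta_log_fps"

lemma eta_log_fps_0 [simp]: "fps_nth eta_log_fps 0 = 0"
  by (simp add: eta_log_fps_def)

lemma eta_fps_recurrence:
  "fps_nth eta_fps 0 = 1"
  "fps_nth eta_fps (Suc n) = - (\<Sum>i\<le>n. fps_nth eta_fps i * of_nat (divisor_sum (Suc n - i))) / of_nat (Suc n)"
proof -
  show "fps_nth eta_fps 0 = 1" by (simp add: eta_fps_def)
  have "fps_deriv eta_fps = eta_fps * fps_deriv eta_log_fps"
    unfolding eta_fps_def by (subst fps_compose_deriv) simp_all
  hence "fps_nth (fps_deriv eta_fps) n = fps_nth (eta_fps * fps_deriv eta_log_fps) n" by simp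
  also have "\<dots> = (\<Sum>i=0..n. fps_nth eta_fps i * fps_nth (fps_deriv eta_log_fps) (n - i))" by (rule fps_mult_nth)
  also have "\<dots> = (\<Sum>i=0..n. - (fps_nth eta_fps i * of_nat (divisor_sum (Suc n - i))))"
  proof (intro sum.cong refl)
    fix i assume "i \<in> {0..n}"
    hence "Suc n - i = Suc (n - i)" by auto
    thus "fps_nth eta_fps i * fps_nth (fps_deriv eta_log_fps) (n - i) = - (fps_nth eta_fps i * of_nat (divisor_sum (Suc n - i)))"
      by (simp add: eta_log_fps_def del: of_nat_Suc)
  qed
  also have "\<dots> = - (\<Sum>i\<le>n. fps_nth eta_fps i * of_nat (divisor_sum (Suc n - i)))"
    by (simp add: sum_negf atLeast0AtMost)
  finally have "of_nat (Suc n) * fps_nth eta_fps (Suc n) = - (\<Sum>i\<le>n. fps_nth eta_fps i * of_nat (divisor_sum (Suc n - i)))"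
    by simp
  thus "fps_nth eta_fps (Suc n) = - (\<Sum>i\<le>n. fps_nth eta_fps i * of_nat (divisor_sum (Suc n - i))) / of_nat (Suc n)"
    by (metis nonzero_mult_div_cancel_left of_nat_neq_0)
qed

lemma eta_fps_rational: "fps_nth eta_fps n \<in> \<rat>"
proof (induction n rule: less_induct)
  case (less n)
  show ?case
  proof (cases n)
    case (Suc m)
    have "(\<Sum>i\<le>m. fps_nth eta_fps i * of_nat (divisor_sum (Suc m - i))) \<in> \<rat>"
      using less Suc by (intro Rats_sum Rats_mult) auto
    thus ?thesis unfolding Suc eta_fps_recurrence(2) by (intro Rats_divide) auto
  qed (simp add: eta_fps_recurrence)
qed

lemma divisor_sum_eq: "n > 0 \<Longrightarrow> divisor_sum n = (\<Sum>d\<leftarrow>[1..<Suc n]. if d dvd n then d else 0)"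
proof -
  assume n: "n > 0"
  have "(\<Sum>d\<leftarrow>[1..<Suc n]. if d dvd n then d else 0) = (\<Sum>d\<in>{1..n}. if d dvd n then d else 0)"
    by (subst sum_list_distinct_conv_sum_set) (simp_all add: atLeastLessThanSuc_atLeastAtMost del: upt_Suc)
  also have "\<dots> = (\<Sum>d\<in>{d\<in>{1..n}. d dvd n}. d)" by (rule sum.inter_filter[symmetric]) simp
  also have "{d\<in>{1..n}. d dvd n} = {d. d dvd n}" using n by (auto dest: dvd_imp_le intro!: Suc_leI Nat.gr0I)
  finally show ?thesis by (simp only: divisor_sum_def)
qed

lemma divisor_sum_values:
  "divisor_sum 1 = 1" "divisor_sum 2 = 3" "divisor_sum 3 = 4" "divisor_sum 4 = 7" "divisor_sum 5 = 6" "divisor_sum 6 = 12"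
  "divisor_sum 7 = 8" "divisor_sum 8 = 15" "divisor_sum 9 = 13" "divisor_sum 10 = 18" "divisor_sum 11 = 12"
  by (subst divisor_sum_eq, simp, code_simp)+

text \<open>Below 12 the nonzero coefficients of positive index sit at the pentagonal numbers 1, 2,
  5 and 7. They come from the recurrence given by the logarithmic derivative.\<close>

lemma eta_fps_values:
  "fps_nth eta_fps 1 = -1" "fps_nth eta_fps 2 = -1" "fps_nth eta_fps 3 = 0" "fps_nth eta_fps 4 = 0" "fps_nth eta_fps 5 = 1"
  "fps_nth eta_fps 6 = 0" "fps_nth eta_fps 7 = 1" "fps_nth eta_fps 8 = 0" "fps_nth eta_fps 9 = 0" "fps_nth eta_fps 10 = 0" "fps_nth eta_fps 11 = 0"
proof -
  define p where "p = fps_nth eta_fps"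
  define s where "s = (\<lambda>n. of_nat (divisor_sum n) :: complex)"
  have s: "s 1 = 1" "s 2 = 3" "s 3 = 4" "s 4 = 7" "s 5 = 6" "s 6 = 12" "s 7 = 8" "s 8 = 15" "s 9 = 13" "s 10 = 18" "s 11 = 12"
    by (simp_all only: s_def divisor_sum_values) simp_all
  have p0: "p 0 = 1" by (simp add: p_def eta_fps_recurrence)
  have rec: "p n = - (\<Sum>i\<leftarrow>[0..<n]. p i * s (n - i)) / of_nat n" if n: "n > 0" for n
  proof -
    obtain m where m: "n = Suc m" using n gr0_conv_Suc by blast
    have "(\<Sum>i\<leftarrow>[0..<n]. p i * s (n - i)) = (\<Sum>i\<le>m. p i * s (Suc m - i))"
      unfolding m by (subst sum_list_distinct_conv_sum_set) (simp_all add: atLeast0LessThan lessThan_Suc_atMost del: upt_Suc)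
    thus ?thesis unfolding m p_def s_def eta_fps_recurrence(2) by simp
  qed
  have u: "[0..<1] = [0]" "[0..<2] = [0,1]" "[0..<3] = [0,1,2]" "[0..<4] = [0,1,2,3]" "[0..<5] = [0,1,2,3,4]" "[0..<6] = [0,1,2,3,4,5]"
    "[0..<7] = [0,1,2,3,4,5,6]" "[0..<8] = [0,1,2,3,4,5,6,7]" "[0..<9] = [0,1,2,3,4,5,6,7,8]" "[0..<10] = [0,1,2,3,4,5,6,7,8,9]"
    "[0..<11] = [0,1,2,3,4,5,6,7,8,9,10::nat]"
    by (simp_all add: upt_conv_Cons)
  have p1: "p 1 = -1" using rec[of 1, unfolded u] by (simp add: s p0 s[unfolded One_nat_def])
  have p2: "p 2 = -1" using rec[of 2, unfolded u] by (simp add: s p0 p1 s[unfolded One_nat_def] p1[unfolded One_nat_def])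
  note q = s p0 p1 p2 s[unfolded One_nat_def] p1[unfolded One_nat_def]
  have p3: "p 3 = 0" using rec[of 3, unfolded u] by (simp add: q)
  have p4: "p 4 = 0" using rec[of 4, unfolded u] by (simp add: q p3)
  have p5: "p 5 = 1" using rec[of 5, unfolded u] by (simp add: q p3 p4)
  have p6: "p 6 = 0" using rec[of 6, unfolded u] by (simp add: q p3 p4 p5)
  have p7: "p 7 = 1" using rec[of 7, unfolded u] by (simp add: q p3 p4 p5 p6)
  have p8: "p 8 = 0" using rec[of 8, unfolded u] by (simp add: q p3 p4 p5 p6 p7)
  have p9: "p 9 = 0" using rec[of 9, unfolded u] by (simp add: q p3 p4 p5 p6 p7 p8)
  have p10: "p 10 = 0" using rec[of 10, unfolded u] by (simp add: q p3 p4 p5 p6 p7 p8 p9)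
  have p11: "p 11 = 0" using rec[of 11, unfolded u] by (simp add: q p3 p4 p5 p6 p7 p8 p9 p10)
  show "fps_nth eta_fps 1 = -1" "fps_nth eta_fps 2 = -1" "fps_nth eta_fps 3 = 0" "fps_nth eta_fps 4 = 0" "fps_nth eta_fps 5 = 1"
  "fps_nth eta_fps 6 = 0" "fps_nth eta_fps 7 = 1" "fps_nth eta_fps 8 = 0" "fps_nth eta_fps 9 = 0" "fps_nth eta_fps 10 = 0" "fps_nth eta_fps 11 = 0"
    using p1 p2 p3 p4 p5 p6 p7 p8 p9 p10 p11 by (simp_all add: p_def)
qed

definition eta_fps_at :: "nat \<Rightarrow> complex fps" where "eta_fps_at d = fps_compose eta_fps (fps_X ^ d)"

lemma eta_fps_at_nth:
  assumes "d > 0"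
  shows "fps_nth (eta_fps_at d) n = (if d dvd n then fps_nth eta_fps (n div d) else 0)"
proof -
  have "fps_nth (eta_fps_at d) n = (\<Sum>i=0..n. fps_nth eta_fps i * (if n = d * i then 1 else 0))"
    by (simp add: eta_fps_at_def fps_compose_nth fps_X_power_nth flip: power_mult)
  also have "\<dots> = (\<Sum>i=0..n. if i = n div d \<and> d dvd n then fps_nth eta_fps i else 0)"
    using assms by (intro sum.cong) auto
  also have "\<dots> = (if d dvd n then fps_nth eta_fps (n div d) else 0)" by auto
  finally show ?thesis .
qed

text \<open>The levels 23, 46 and 92 all fall under the last case: their factors are 1 up to q^11,
  so only 1, 2 and 4 influence the comparison of coefficients.\<close>

lemma eta_fps_at_begins:
  "begins (eta_fps_at 1) [1, -1, -1, 0, 0, 1, 0, 1, 0, 0, 0, 0]"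
  "begins (eta_fps_at 2) [1, 0, -1, 0, -1, 0, 0, 0, 0, 0, 1, 0]"
  "begins (eta_fps_at 4) [1, 0, 0, 0, -1, 0, 0, 0, -1, 0, 0, 0]"
  "d \<ge> 12 \<Longrightarrow> begins (eta_fps_at d) (1 # replicate 11 0)"
proof -
  have B: "begins F xs" if "length xs = 12" "\<forall>i\<in>set [0..<12]. fps_nth F i = of_int (xs ! i)" for F xs
    using that by (auto simp: begins_def)
  have u: "[0..<12] = [0,1,2,3,4,5,6,7,8,9,10,11::nat]" by code_simp
  show "begins (eta_fps_at 1) [1, -1, -1, 0, 0, 1, 0, 1, 0, 0, 0, 0]"
    by (rule B) (simp_all add: u eta_fps_at_nth eta_fps_values eta_fps_values[unfolded One_nat_def] eta_fps_recurrence(1))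
  show "begins (eta_fps_at 2) [1, 0, -1, 0, -1, 0, 0, 0, 0, 0, 1, 0]"
    by (rule B) (simp_all add: u eta_fps_at_nth eta_fps_values eta_fps_values[unfolded One_nat_def] eta_fps_recurrence(1))
  show "begins (eta_fps_at 4) [1, 0, 0, 0, -1, 0, 0, 0, -1, 0, 0, 0]"
    by (rule B) (simp_all add: u eta_fps_at_nth eta_fps_values eta_fps_values[unfolded One_nat_def] eta_fps_recurrence(1))
  assume d: "d \<ge> 12"
  have "i = 0" if "d dvd i" "i < 12" for i using d that by (auto dest: dvd_imp_le)
  thus "begins (eta_fps_at d) (1 # replicate 11 0)"
    unfolding begins_def using d by (auto simp: eta_fps_at_nth eta_fps_recurrence(1) nth_Cons' dest: less_imp_diff_less)
qed

lemma eta_fps_at_0 [simp]: "d > 0 \<Longrightarrow> fps_nth (eta_fps_at d) 0 = 1"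
  by (simp add: eta_fps_at_nth eta_fps_recurrence)

definition x_fps :: "complex fps" where
  "x_fps = eta_fps_at 2 * eta_fps_at 46 * inverse (eta_fps_at 4 * eta_fps_at 92)"
definition A_fps :: "complex fps" where
  "A_fps = eta_fps_at 1 * eta_fps_at 23 * inverse (eta_fps_at 4 * eta_fps_at 92)"
definition K_fps :: "complex fps" where
  "K_fps = (eta_fps_at 4 ^ 2) ^ 2 * eta_fps_at 46 ^ 2 * inverse (eta_fps_at 2 ^ 2 * (eta_fps_at 92 ^ 2) ^ 2)"
text \<open>The expansion of q^3 y. The summands 1 and x of y receive the powers q^3 and q that
  bring them to the pole order 3 of A.\<close>

definition y_fps :: "complex fps" where "y_fps = A_fps + fps_X ^ 3 + fps_X ^ 1 * x_fps"

lemma begins_mult_one: "begins F xs \<Longrightarrow> begins G (1 # replicate 11 0) \<Longrightarrow> length xs = 12 \<Longrightarrow> begins (F * G) xs"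
proof -
  assume *: "begins F xs" "begins G (1 # replicate 11 0)" "length xs = 12"
  show "begins (F * G) xs" unfolding begins_def
  proof (intro allI impI)
    fix k assume k: "k < length xs"
    have "fps_nth (F * G) k = (\<Sum>i=0..k. fps_nth F i * fps_nth G (k - i))" by (rule fps_mult_nth)
    also have "\<dots> = (\<Sum>i=0..k. if i = k then fps_nth F i else 0)"
      using * k by (intro sum.cong) (auto simp: begins_def nth_Cons split: nat.splits)
    also have "\<dots> = of_int (xs ! k)" using *(1) k by (simp add: begins_def)
    finally show "fps_nth (F * G) k = of_int (xs ! k)" .
  qed
qed

lemma fps_begins:
  "begins x_fps [1, 0, -1, 0, 0, 0, -1, 0, 1, 0, -1, 0]"
  "begins A_fps [1, -1, -1, 0, 1, 0, -1, 1, 2, -1, -2, 1]"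
  "begins (inverse A_fps) [1, 1, 2, 3, 4, 6, 9, 12, 16, 22, 29, 38]"
  "begins y_fps [1, 0, -1, 0, 1, 0, -1, 0, 2, 0, -2, 0]"
  "begins K_fps [1, 0, 2, 0, 1, 0, 2, 0, 2, 0, 0, 0]"
proof -
  note one = eta_fps_at_begins(4)
  have one2: "begins (eta_fps_at d ^ 2) (1 # replicate 11 0)" if "d \<ge> 12" for d
    unfolding power2_eq_square by (rule begins_mult_one[OF one[OF that] one[OF that]]) simp
  have one4: "begins ((eta_fps_at d ^ 2) ^ 2) (1 # replicate 11 0)" if "d \<ge> 12" for d
    unfolding power2_eq_square[of "eta_fps_at d ^ 2"] by (rule begins_mult_one[OF one2[OF that] one2[OF that]]) simp
  have "begins (eta_fps_at 4 * eta_fps_at 92) [1, 0, 0, 0, -1, 0, 0, 0, -1, 0, 0, 0]"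
    by (rule begins_mult_one[OF eta_fps_at_begins(3) one]) simp_all
  hence i4: "begins (inverse (eta_fps_at 4 * eta_fps_at 92)) [1, 0, 0, 0, 1, 0, 0, 0, 2, 0, 0, 0]"
    by (rule begins_inverse) (code_simp, simp, simp, simp)
  have "begins (eta_fps_at 2 * eta_fps_at 46) [1, 0, -1, 0, -1, 0, 0, 0, 0, 0, 1, 0]"
    by (rule begins_mult_one[OF eta_fps_at_begins(2) one]) simp_all
  from begins_mult[OF this i4 _ refl] show x: "begins x_fps [1, 0, -1, 0, 0, 0, -1, 0, 1, 0, -1, 0]"
    unfolding x_fps_def by (rule begins_cong) code_simp+
  have "begins (eta_fps_at 1 * eta_fps_at 23) [1, -1, -1, 0, 0, 1, 0, 1, 0, 0, 0, 0]"
    by (rule begins_mult_one[OF eta_fps_at_begins(1) one]) simp_all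
  from begins_mult[OF this i4 _ refl] show A: "begins A_fps [1, -1, -1, 0, 1, 0, -1, 1, 2, -1, -2, 1]"
    unfolding A_fps_def by (rule begins_cong) code_simp+
  have "fps_nth A_fps 0 \<noteq> 0" by (simp add: A_fps_def)
  show "begins (inverse A_fps) [1, 1, 2, 3, 4, 6, 9, 12, 16, 22, 29, 38]"
    by (rule begins_inverse[OF A]) (code_simp, simp, simp, simp add: \<open>fps_nth A_fps 0 \<noteq> 0\<close>)
  have X3: "begins (fps_X ^ 3) [0, 0, 0, 1, 0, 0, 0, 0, 0, 0, 0, 0]" and X1: "begins (fps_X ^ 1) [0, 1, 0, 0, 0, 0, 0, 0, 0, 0, 0, 0]"
    using begins_X_power[of 3 12] begins_X_power[of 1 12] by (simp_all add: upt_conv_Cons)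
  have Xx: "begins (fps_X ^ 1 * x_fps) [0, 1, 0, -1, 0, 0, 0, -1, 0, 1, 0, -1]"
    by (rule begins_mult[OF X1 x]) code_simp+
  have "begins (A_fps + fps_X ^ 3) [1, -1, -1, 1, 1, 0, -1, 1, 2, -1, -2, 1]"
    by (rule begins_add[OF A X3]) simp_all
  from begins_add[OF this Xx] show "begins y_fps [1, 0, -1, 0, 1, 0, -1, 0, 2, 0, -2, 0]"
    unfolding y_fps_def by simp
  have "begins (eta_fps_at 4 ^ 2) [1, 0, 0, 0, -2, 0, 0, 0, -1, 0, 0, 0]"
    unfolding power2_eq_square by (rule begins_mult[OF eta_fps_at_begins(3) eta_fps_at_begins(3)]) code_simp+
  from begins_mult[OF this this _ refl] have "begins ((eta_fps_at 4 ^ 2) ^ 2) [1, 0, 0, 0, -4, 0, 0, 0, 2, 0, 0, 0]"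
    unfolding power2_eq_square[of "eta_fps_at 4 ^ 2"] by (rule begins_cong) code_simp+
  from begins_mult_one[OF this one2] have 1: "begins ((eta_fps_at 4 ^ 2) ^ 2 * eta_fps_at 46 ^ 2) [1, 0, 0, 0, -4, 0, 0, 0, 2, 0, 0, 0]"
    by simp
  have "begins (eta_fps_at 2 ^ 2) [1, 0, -2, 0, -1, 0, 2, 0, 1, 0, 2, 0]"
    unfolding power2_eq_square by (rule begins_mult[OF eta_fps_at_begins(2) eta_fps_at_begins(2)]) code_simp+
  from begins_mult_one[OF this one4] have "begins (eta_fps_at 2 ^ 2 * (eta_fps_at 92 ^ 2) ^ 2) [1, 0, -2, 0, -1, 0, 2, 0, 1, 0, 2, 0]"
    by simp
  hence "begins (inverse (eta_fps_at 2 ^ 2 * (eta_fps_at 92 ^ 2) ^ 2)) [1, 0, 2, 0, 5, 0, 10, 0, 20, 0, 36, 0]"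
    by (rule begins_inverse) (code_simp, simp, simp, simp)
  from begins_mult[OF 1 this _ refl] show "begins K_fps [1, 0, 2, 0, 1, 0, 2, 0, 2, 0, 0, 0]"
    unfolding K_fps_def by (rule begins_cong) code_simp+
qed

text \<open>The two relations, with every term multiplied by the power of q that brings it to the
  common pole order: 3 in the first relation, 11 in the second. In particular 23/K vanishes to order
  11 and gets q^22, while y x^j has order 3 + 2 j and gets q^(8 - 2 j).\<close>

lemma relation_fps_begins:
  "begins (A_fps - x_fps ^ 2 * x_fps * inverse A_fps + 2 * fps_X ^ 3 + 2 * (fps_X ^ 1 * x_fps)) (replicate 12 0)"
  "begins (K_fps - 23 * (fps_X ^ 22 * inverse K_fps) - y_fps * (22 * fps_X ^ 8 + 26 * (fps_X ^ 6 * x_fps) + 18 * (fps_X ^ 4 * x_fps ^ 2)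
     + 7 * (fps_X ^ 2 * (x_fps ^ 2 * x_fps)) + (x_fps ^ 2) ^ 2)) (replicate 12 0)"
proof -
  note x = fps_begins(1) and A = fps_begins(2) and iA = fps_begins(3) and y = fps_begins(4) and K = fps_begins(5)
  have x2: "begins (x_fps ^ 2) [1, 0, -2, 0, 1, 0, -2, 0, 4, 0, -4, 0]"
    unfolding power2_eq_square by (rule begins_mult[OF x x]) code_simp+
  have x3: "begins (x_fps ^ 2 * x_fps) [1, 0, -3, 0, 3, 0, -4, 0, 9, 0, -12, 0]"
    by (rule begins_mult[OF x2 x]) code_simp+
  have x4: "begins ((x_fps ^ 2) ^ 2) [1, 0, -4, 0, 6, 0, -8, 0, 17, 0, -28, 0]"
    unfolding power2_eq_square[of "x_fps ^ 2"] by (rule begins_mult[OF x2 x2]) code_simp+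
  have num: "begins (numeral k) (numeral k # replicate 11 0)" for k by (rule begins_numeral)
  have Xk: "begins (fps_X ^ 1) [0, 1, 0, 0, 0, 0, 0, 0, 0, 0, 0, 0]" "begins (fps_X ^ 2) [0, 0, 1, 0, 0, 0, 0, 0, 0, 0, 0, 0]"
    "begins (fps_X ^ 3) [0, 0, 0, 1, 0, 0, 0, 0, 0, 0, 0, 0]" "begins (fps_X ^ 4) [0, 0, 0, 0, 1, 0, 0, 0, 0, 0, 0, 0]"
    "begins (fps_X ^ 6) [0, 0, 0, 0, 0, 0, 1, 0, 0, 0, 0, 0]" "begins (fps_X ^ 8) [0, 0, 0, 0, 0, 0, 0, 0, 1, 0, 0, 0]"
    "begins (fps_X ^ 22) [0, 0, 0, 0, 0, 0, 0, 0, 0, 0, 0, 0]"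
    using begins_X_power[of 1 12] begins_X_power[of 2 12] begins_X_power[of 3 12] begins_X_power[of 4 12] begins_X_power[of 6 12]
      begins_X_power[of 8 12] begins_X_power[of 22 12] by (simp_all add: upt_conv_Cons)
  note mul = begins_mult[OF _ _ _ refl] and ad = begins_add[OF _ _ _ refl] and df = begins_diff[OF _ _ _ refl]
  have "begins (A_fps - x_fps ^ 2 * x_fps * inverse A_fps + 2 * fps_X ^ 3 + 2 * (fps_X ^ 1 * x_fps))
     (map2 (+) (map2 (+) (map2 (-) [1, -1, -1, 0, 1, 0, -1, 1, 2, -1, -2, 1] (list_mult [1, 0, -3, 0, 3, 0, -4, 0, 9, 0, -12, 0] [1, 1, 2, 3, 4, 6, 9, 12, 16, 22, 29, 38]))
        (list_mult (2 # replicate 11 0) [0, 0, 0, 1, 0, 0, 0, 0, 0, 0, 0, 0]))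
       (list_mult (2 # replicate 11 0) (list_mult [0, 1, 0, 0, 0, 0, 0, 0, 0, 0, 0, 0] [1, 0, -1, 0, 0, 0, -1, 0, 1, 0, -1, 0])))"
    by (intro ad df mul A x3 iA num Xk x) (simp_all add: list_mult_def)
  thus "begins (A_fps - x_fps ^ 2 * x_fps * inverse A_fps + 2 * fps_X ^ 3 + 2 * (fps_X ^ 1 * x_fps)) (replicate 12 0)"
    by (rule begins_cong) code_simp
  have "fps_nth K_fps 0 \<noteq> 0" by (simp add: K_fps_def)
  have iK: "begins (inverse K_fps) [1, 0, -2, 0, 3, 0, -6, 0, 11, 0, -18, 0]"
    by (rule begins_inverse[OF K]) (code_simp, simp, simp, simp add: \<open>fps_nth K_fps 0 \<noteq> 0\<close>)
  have Q: "begins (22 * fps_X ^ 8 + 26 * (fps_X ^ 6 * x_fps) + 18 * (fps_X ^ 4 * x_fps ^ 2) + 7 * (fps_X ^ 2 * (x_fps ^ 2 * x_fps)) + (x_fps ^ 2) ^ 2)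
      [1, 0, 3, 0, 3, 0, 3, 0, 3, 0, -1, 0]"
  proof -
    have "begins (22 * fps_X ^ 8 + 26 * (fps_X ^ 6 * x_fps) + 18 * (fps_X ^ 4 * x_fps ^ 2) + 7 * (fps_X ^ 2 * (x_fps ^ 2 * x_fps)) + (x_fps ^ 2) ^ 2)
      (map2 (+) (map2 (+) (map2 (+) (map2 (+) (list_mult (22 # replicate 11 0) [0, 0, 0, 0, 0, 0, 0, 0, 1, 0, 0, 0])
        (list_mult (26 # replicate 11 0) (list_mult [0, 0, 0, 0, 0, 0, 1, 0, 0, 0, 0, 0] [1, 0, -1, 0, 0, 0, -1, 0, 1, 0, -1, 0])))
        (list_mult (18 # replicate 11 0) (list_mult [0, 0, 0, 0, 1, 0, 0, 0, 0, 0, 0, 0] [1, 0, -2, 0, 1, 0, -2, 0, 4, 0, -4, 0])))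
        (list_mult (7 # replicate 11 0) (list_mult [0, 0, 1, 0, 0, 0, 0, 0, 0, 0, 0, 0] [1, 0, -3, 0, 3, 0, -4, 0, 9, 0, -12, 0])))
        [1, 0, -4, 0, 6, 0, -8, 0, 17, 0, -28, 0])"
      by (intro ad mul num Xk x x2 x3 x4) (simp_all add: list_mult_def)
    thus ?thesis by (rule begins_cong) code_simp
  qed
  have "begins (K_fps - 23 * (fps_X ^ 22 * inverse K_fps) - y_fps * (22 * fps_X ^ 8 + 26 * (fps_X ^ 6 * x_fps) + 18 * (fps_X ^ 4 * x_fps ^ 2)
     + 7 * (fps_X ^ 2 * (x_fps ^ 2 * x_fps)) + (x_fps ^ 2) ^ 2))
    (map2 (-) (map2 (-) [1, 0, 2, 0, 1, 0, 2, 0, 2, 0, 0, 0] (list_mult (23 # replicate 11 0) (list_mult [0, 0, 0, 0, 0, 0, 0, 0, 0, 0, 0, 0] [1, 0, -2, 0, 3, 0, -6, 0, 11, 0, -18, 0])))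
       (list_mult [1, 0, -1, 0, 1, 0, -1, 0, 2, 0, -2, 0] [1, 0, 3, 0, 3, 0, 3, 0, 3, 0, -1, 0]))"
    by (intro df mul num K Xk iK y Q) (simp_all add: list_mult_def)
  thus "begins (K_fps - 23 * (fps_X ^ 22 * inverse K_fps) - y_fps * (22 * fps_X ^ 8 + 26 * (fps_X ^ 6 * x_fps) + 18 * (fps_X ^ 4 * x_fps ^ 2)
     + 7 * (fps_X ^ 2 * (x_fps ^ 2 * x_fps)) + (x_fps ^ 2) ^ 2)) (replicate 12 0)"
    by (rule begins_cong) code_simp
qed

text \<open>\<open>F\<close> is $q^{-n} P(q)$ near \<open>\<infinity>\<close>.\<close>
abbreviation qx :: "mero_uhp \<Rightarrow> int \<Rightarrow> complex fps \<Rightarrow> bool" where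
  "qx F n P \<equiv> has_q_expansion 1 F (fls_shift n (fps_to_fls P))"

lemma qx_mult: "qx F n P \<Longrightarrow> qx G m Q \<Longrightarrow> qx (F * G) (n + m) (P * Q)"
  using has_q_expansion_ops(2)[of 1 F "fls_shift n (fps_to_fls P)" G "fls_shift m (fps_to_fls Q)"]
  by (simp add: fls_shifted_times_simps fls_times_fps_to_fls add.commute)

lemma fls_shift_fps_diff:
  "fls_shift n (fps_to_fls P) + fls_shift n (fps_to_fls Q) = fls_shift n (fps_to_fls (P + Q))"
  "fls_shift n (fps_to_fls P) - fls_shift n (fps_to_fls Q) = fls_shift n (fps_to_fls (P - Q))"
proof -
  show "fls_shift n (fps_to_fls P) + fls_shift n (fps_to_fls Q) = fls_shift n (fps_to_fls (P + Q))"
    by (rule fls_eqI) (simp only: fls_plus_nth fls_shift_nth fps_to_fls_nth fps_add_nth if_distrib split: if_split, simp)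
  show "fls_shift n (fps_to_fls P) - fls_shift n (fps_to_fls Q) = fls_shift n (fps_to_fls (P - Q))"
    by (rule fls_eqI) (simp only: fls_minus_nth fls_shift_nth fps_to_fls_nth fps_sub_nth split: if_split, simp)
qed

lemma qx_add: "qx F n P \<Longrightarrow> qx G n Q \<Longrightarrow> qx (F + G) n (P + Q)"
  and qx_diff: "qx F n P \<Longrightarrow> qx G n Q \<Longrightarrow> qx (F - G) n (P - Q)"
  using has_q_expansion_ops(1,4)[OF _ _ zero_less_one, of F "fls_shift n (fps_to_fls P)" G "fls_shift n (fps_to_fls Q)"]
  unfolding fls_shift_fps_diff by blast+

text \<open>Pads an expansion, so that functions with different pole orders can be added by
  \<open>qx_add\<close>.\<close>

lemma qx_raise:
  assumes "qx F n P"
  shows "qx F (n + int k) (fps_X ^ k * P)"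
proof -
  have "fls_shift (n + int k) (fps_to_fls (fps_X ^ k * P)) = fls_shift n (fps_to_fls P)"
    by (rule fls_eqI) (auto simp: fps_X_power_mult_nth nat_diff_distrib intro!: arg_cong[of _ _ "fps_nth P"])
  thus ?thesis using assms by simp
qed

lemma qx_cst: "qx (cst c) 0 (fps_const c)"
proof -
  have "fls_shift 0 (fps_to_fls (fps_const c)) = fls_const c" by simp
  thus ?thesis using has_q_expansion_cst[of 1 c] by simp
qed

lemma qx_numeral: "qx (numeral k) 0 (numeral k)"
  using qx_cst[of "numeral k"] by (simp add: cst_numeral numeral_fps_const)

lemma qx_power: "qx F n P \<Longrightarrow> qx (F ^ k) (int k * n) (P ^ k)"
proof (induction k)
  case 0
  show ?case using qx_cst[of 1] by (simp add: cst_hom)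
next
  case (Suc k)
  from qx_mult[OF Suc.prems Suc.IH[OF Suc.prems]] show ?case by (simp add: ring_distribs)
qed

lemma qx_inverse:
  assumes "qx F n P" "fps_nth P 0 \<noteq> 0"
  shows "qx (inverse F) (- n) (inverse P)"
proof -
  have "fls_shift n (fps_to_fls P) * fls_shift (- n) (fps_to_fls (inverse P)) = fps_to_fls (P * inverse P)"
    by (simp add: fls_shifted_times_simps fls_times_fps_to_fls)
  also have "P * inverse P = 1" using assms(2) by (simp add: inverse_mult_eq_1')
  finally have "inverse (fls_shift n (fps_to_fls P)) = fls_shift (- n) (fps_to_fls (inverse P))"
    using inverse_unique by simp
  thus ?thesis using has_q_expansion_inverse[OF assms(1)] by simp
qed

section \<open>Eta quotients as functions of q\<close>

definition eta_exp :: "nat \<Rightarrow> complex \<Rightarrow> complex" where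
  "eta_exp d q = exp (eval_fps eta_log_fps (q ^ d))"

lemma eta_exp_expansion:
  assumes "d > 0"
  shows "eta_exp d has_fps_expansion eta_fps_at d"
proof -
  have "fps_conv_radius eta_log_fps > 0"
    by (rule less_le_trans[OF _ eta_log_fps_conv_radius]) simp
  hence "eval_fps eta_log_fps has_fps_expansion eta_log_fps" by (rule eval_fps_has_fps_expansion)
  hence "(exp \<circ> eval_fps eta_log_fps) has_fps_expansion eta_fps"
    unfolding eta_fps_def by (intro has_fps_expansion_compose has_fps_expansion_exp1) simp_all
  moreover have "(\<lambda>q::complex. q ^ d) has_fps_expansion fps_X ^ d"
    by (intro fps_expansion_intros)
  ultimately have "((exp \<circ> eval_fps eta_log_fps) \<circ> (\<lambda>q. q ^ d)) has_fps_expansion eta_fps_at d"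
    unfolding eta_fps_at_def by (rule has_fps_expansion_compose) (use assms in simp)
  thus ?thesis by (simp add: eta_exp_def[abs_def] o_def)
qed

lemma exp_eta_log:
  "exp (eta_log (of_nat d * z)) = exp (of_real pi * \<i> * z / 12 * of_nat d) * eta_exp d (qvar 1 z)"
proof -
  have "exp (2 * of_real pi * \<i> * (of_nat d * z)) = qvar 1 z ^ d"
    by (simp add: qvar_def mult_ac flip: exp_of_nat_mult)
  thus ?thesis by (simp add: eta_log_def eta_exp_def exp_add mult_ac)
qed

lemma eta_exp_nonzero [simp]: "eta_exp d q \<noteq> 0"
  by (simp add: eta_exp_def)

text \<open>The pole orders come from the powers of \<open>t\<close>, which is q^(1/24): 2 + 46 - 4
  - 92 = -2 * 24 for x, 1 + 23 - 4 - 92 = -3 * 24 for x f, and 16 + 92 - 4 - 368 = -11 * 24 for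
  K.\<close>

lemma basic_product:
  "x0 z * qvar 1 z ^ 2 = eta_exp 2 (qvar 1 z) * eta_exp 46 (qvar 1 z) * inverse (eta_exp 4 (qvar 1 z) * eta_exp 92 (qvar 1 z))"
  "x0 z * f0 z * qvar 1 z ^ 3 = eta_exp 1 (qvar 1 z) * eta_exp 23 (qvar 1 z) * inverse (eta_exp 4 (qvar 1 z) * eta_exp 92 (qvar 1 z))"
  "K0 z * qvar 1 z ^ 11 = (eta_exp 4 (qvar 1 z) ^ 2) ^ 2 * eta_exp 46 (qvar 1 z) ^ 2 * inverse (eta_exp 2 (qvar 1 z) ^ 2 * (eta_exp 92 (qvar 1 z) ^ 2) ^ 2)"
proof -
  define t where "t = exp (of_real pi * \<i> * z / 12)"
  define E where "E = (\<lambda>d. eta_exp d (qvar 1 z))"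
  have t: "t \<noteq> 0" by (simp add: t_def)
  have E: "E d \<noteq> 0" for d by (simp add: E_def)
  have e: "exp (eta_log (of_nat d * z)) = t ^ d * E d" for d
    unfolding exp_eta_log t_def E_def by (simp add: mult_ac flip: exp_of_nat_mult)
  have e': "exp (eta_log z) = t * E 1" "exp (eta_log (2 * z)) = t ^ 2 * E 2" "exp (eta_log (4 * z)) = t ^ 4 * E 4"
    "exp (eta_log (23 * z)) = t ^ 23 * E 23" "exp (eta_log (46 * z)) = t ^ 46 * E 46" "exp (eta_log (92 * z)) = t ^ 92 * E 92"
    using e[of 1] e[of 2] e[of 4] e[of 23] e[of 46] e[of 92] by simp_all
  have q: "qvar 1 z = t ^ 24"
    unfolding t_def qvar_def by (simp add: mult_ac flip: exp_of_nat_mult)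
  have f: "f0 z = (t * E 1) * (t ^ 23 * E 23) / ((t ^ 2 * E 2) * (t ^ 46 * E 46))"
    unfolding f0_def phi_log_def e'[symmetric] by (simp add: exp_diff exp_add field_simps flip: exp_minus)
  have x: "x0 z = (t ^ 2 * E 2) * (t ^ 46 * E 46) / ((t ^ 4 * E 4) * (t ^ 92 * E 92))"
    unfolding x0_def f0_def phi_log_def e'[symmetric] by (simp add: exp_diff exp_add field_simps flip: exp_minus)
  have K: "K0 z = ((t ^ 4 * E 4) ^ 4 * (t ^ 46 * E 46) ^ 2) / ((t ^ 2 * E 2) ^ 2 * (t ^ 92 * E 92) ^ 4)"
  proof -
    have "K0 z = exp (4 * eta_log (4 * z) + 2 * eta_log (46 * z) - (2 * eta_log (2 * z) + 4 * eta_log (92 * z)))"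
      unfolding K0_def kappa_log_def by (rule arg_cong[of _ _ exp]) (simp add: algebra_simps)
    also have "\<dots> = (exp (eta_log (4 * z)) ^ 4 * exp (eta_log (46 * z)) ^ 2) / (exp (eta_log (2 * z)) ^ 2 * exp (eta_log (92 * z)) ^ 4)"
      by (simp add: exp_diff exp_add flip: exp_of_nat_mult)
    finally show ?thesis unfolding e' .
  qed
  have can: "(p * a) * (q * b) / ((s * c) * (v * d)) * r = a * b * inverse (c * d)"
    if "p * q * r = s * v" "s \<noteq> 0" "v \<noteq> 0" for a b c d p q r s v :: complex
  proof -
    have "(p * a) * (q * b) / ((s * c) * (v * d)) * r = (p * q * r) * (a * b) / ((s * v) * (c * d))" by (simp add: mult_ac)
    also have "\<dots> = a * b * inverse (c * d)" using that(2,3) unfolding that(1)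
      by (subst mult_divide_mult_cancel_left) (simp_all add: divide_inverse)
    finally show ?thesis .
  qed
  have Ed: "eta_exp d (qvar 1 z) = E d" for d by (simp add: E_def)
  have tn: "t ^ n \<noteq> 0" for n using t by simp
  show "x0 z * qvar 1 z ^ 2 = eta_exp 2 (qvar 1 z) * eta_exp 46 (qvar 1 z) * inverse (eta_exp 4 (qvar 1 z) * eta_exp 92 (qvar 1 z))"
    unfolding Ed unfolding x q by (rule can[OF _ tn tn]) (simp flip: power_add power_mult)
  have xf: "x0 z * f0 z = (t * E 1) * (t ^ 23 * E 23) / ((t ^ 4 * E 4) * (t ^ 92 * E 92))"
    unfolding x f using E[of 2] E[of 46] tn[of 2] tn[of 46] by simp
  have "t * t ^ 23 = t ^ 24" by (simp flip: power_Suc)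
  hence "t * t ^ 23 * (t ^ 24) ^ 3 = t ^ 4 * t ^ 92" by (simp flip: power_add power_mult)
  from can[OF this tn tn]
  show "x0 z * f0 z * qvar 1 z ^ 3 = eta_exp 1 (qvar 1 z) * eta_exp 23 (qvar 1 z) * inverse (eta_exp 4 (qvar 1 z) * eta_exp 92 (qvar 1 z))"
    unfolding Ed unfolding xf q .
  have K': "K0 z = (t ^ 16 * (E 4 ^ 2) ^ 2) * (t ^ 92 * E 46 ^ 2) / ((t ^ 4 * E 2 ^ 2) * (t ^ 368 * (E 92 ^ 2) ^ 2))"
    unfolding K by (simp add: power_mult_distrib flip: power_mult)
  show "K0 z * qvar 1 z ^ 11 = (eta_exp 4 (qvar 1 z) ^ 2) ^ 2 * eta_exp 46 (qvar 1 z) ^ 2 * inverse (eta_exp 2 (qvar 1 z) ^ 2 * (eta_exp 92 (qvar 1 z) ^ 2) ^ 2)"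
    unfolding Ed unfolding K' q by (rule can[OF _ tn tn]) (simp flip: power_add power_mult)
qed

definition XX :: mero_uhp where "XX = mero_of x0"
definition FF :: mero_uhp where "FF = mero_of f0"
definition KK :: mero_uhp where "KK = mero_of K0"
definition AA :: mero_uhp where "AA = XX * FF"

lemma analytic_uhp: "x0 analytic_on uhp" "f0 analytic_on uhp" "K0 analytic_on uhp"
  using basic_analytic by (simp_all add: uhp_def)

lemma basic_eval:
  assumes "z \<in> uhp"
  shows "eval_mero XX z = x0 z" "reg XX z" "eval_mero FF z = f0 z" "reg FF z" "eval_mero KK z = K0 z" "reg KK z"
    "eval_mero AA z = x0 z * f0 z" "reg AA z"
proof -
  show x: "eval_mero XX z = x0 z" "reg XX z" "eval_mero FF z = f0 z" "reg FF z" "eval_mero KK z = K0 z" "reg KK z"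
    unfolding XX_def FF_def KK_def using reg_mero_of[OF _ assms] analytic_uhp by auto
  show "eval_mero AA z = x0 z * f0 z" "reg AA z"
    unfolding AA_def using reg_mult[OF x(2) x(4) assms] x by auto
qed

lemma basic_mero_nonzero [simp]: "XX \<noteq> 0" "FF \<noteq> 0" "KK \<noteq> 0" "AA \<noteq> 0"
proof -
  have i: "\<i> \<in> uhp" by (simp add: uhp_def)
  show "XX \<noteq> 0" "FF \<noteq> 0" "KK \<noteq> 0" "AA \<noteq> 0"
    using basic_eval[OF i] reg_zero_one(1)[OF i] by auto
qed

lemma qxI:
  assumes P: "g has_fps_expansion P" and e: "\<And>z. z \<in> uhp \<Longrightarrow> eval_mero F z * qvar 1 z ^ n = g (qvar 1 z)"
  shows "qx F (int n) P"
proof (rule has_q_expansionI)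
  show "(\<lambda>q. g q * q powi (- int n)) has_laurent_expansion fls_shift (int n) (fps_to_fls P)"
    by (rule has_laurent_expansion_shift'[OF has_laurent_expansion_fps[OF P]])
  have "eval_mero F z = g (qvar 1 z) * qvar 1 z powi (- int n)" if "Im z \<ge> 1" for z
  proof -
    have "z \<in> uhp" using that by (simp add: uhp_def)
    thus ?thesis using e[of z] by (simp add: qvar_def power_int_minus field_simps)
  qed
  thus "eventually (\<lambda>z. eval_mero F z = g (qvar 1 z) * qvar 1 z powi (- int n)) (filtercomap Im at_top)"
    unfolding eventually_Im_gt by (intro exI[of _ 1]) simp
qed simp

lemma fps_nth_0_nonzero: "fps_nth x_fps 0 = 1" "fps_nth A_fps 0 = 1" "fps_nth K_fps 0 = 1"
  by (simp_all add: x_fps_def A_fps_def K_fps_def power2_eq_square)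

lemma basic_qx: "qx XX 2 x_fps" "qx AA 3 A_fps" "qx KK 11 K_fps"
proof -
  have "(\<lambda>q. eta_exp 2 q * eta_exp 46 q * inverse (eta_exp 4 q * eta_exp 92 q)) has_fps_expansion x_fps"
    unfolding x_fps_def by (intro fps_expansion_intros eta_exp_expansion) simp_all
  moreover have "eval_mero XX z * qvar 1 z ^ 2 = (\<lambda>q. eta_exp 2 q * eta_exp 46 q * inverse (eta_exp 4 q * eta_exp 92 q)) (qvar 1 z)" if "z \<in> uhp" for z
    using that by (simp only: basic_eval basic_product)
  ultimately have "qx XX (int 2) x_fps" by (rule qxI)
  thus "qx XX 2 x_fps" by simp
  have "(\<lambda>q. eta_exp 1 q * eta_exp 23 q * inverse (eta_exp 4 q * eta_exp 92 q)) has_fps_expansion A_fps"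
    unfolding A_fps_def by (intro fps_expansion_intros eta_exp_expansion) simp_all
  moreover have "eval_mero AA z * qvar 1 z ^ 3 = (\<lambda>q. eta_exp 1 q * eta_exp 23 q * inverse (eta_exp 4 q * eta_exp 92 q)) (qvar 1 z)" if "z \<in> uhp" for z
    using that by (simp only: basic_eval basic_product)
  ultimately have "qx AA (int 3) A_fps" by (rule qxI)
  thus "qx AA 3 A_fps" by simp
  have "(\<lambda>q. (eta_exp 4 q ^ 2) ^ 2 * eta_exp 46 q ^ 2 * inverse (eta_exp 2 q ^ 2 * (eta_exp 92 q ^ 2) ^ 2)) has_fps_expansion K_fps"
    unfolding K_fps_def by (intro fps_expansion_intros eta_exp_expansion) (simp_all add: power2_eq_square)
  moreover have "eval_mero KK z * qvar 1 z ^ 11 = (\<lambda>q. (eta_exp 4 q ^ 2) ^ 2 * eta_exp 46 q ^ 2 * inverse (eta_exp 2 q ^ 2 * (eta_exp 92 q ^ 2) ^ 2)) (qvar 1 z)" if "z \<in> uhp" for z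
    using that by (simp only: basic_eval basic_product)
  ultimately have "qx KK (int 11) K_fps" by (rule qxI)
  thus "qx KK 11 K_fps" by simp
qed

lemma rational_fls_fps: "(\<And>n. fps_nth P n \<in> \<rat>) \<Longrightarrow> rational_fls (fls_shift k (fps_to_fls P))"
  by (simp add: rational_fls_def)

lemma fps_rational: "fps_nth x_fps n \<in> \<rat>" "fps_nth A_fps n \<in> \<rat>" "fps_nth K_fps n \<in> \<rat>"
proof -
  have m: "\<forall>n. fps_nth (P * Q) n \<in> \<rat>" if "\<forall>n. fps_nth P n \<in> \<rat>" "\<forall>n. fps_nth Q n \<in> \<rat>" for P Q :: "complex fps"
    using that by (auto simp: fps_mult_nth intro!: Rats_sum Rats_mult)
  have i: "\<forall>n. fps_nth (inverse P) n \<in> \<rat>" if P: "\<forall>n. fps_nth P n \<in> \<rat>" and 0: "fps_nth P 0 \<noteq> 0" for P :: "complex fps"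
  proof
    fix n
    have "rational_fls (fps_to_fls P)" using rational_fls_fps[of P 0] P by simp
    hence "rational_fls (inverse (fps_to_fls P))" by (rule rational_fls_inverse)
    moreover have "inverse (fps_to_fls P) = fps_to_fls (inverse P)"
      using 0 by (intro inverse_unique) (simp add: inverse_mult_eq_1' flip: fls_times_fps_to_fls)
    ultimately have "fls_nth (fps_to_fls (inverse P)) (int n) \<in> \<rat>" unfolding rational_fls_def by metis
    thus "fps_nth (inverse P) n \<in> \<rat>" by simp
  qed
  have e: "\<forall>n. fps_nth (eta_fps_at d) n \<in> \<rat>" if "d > 0" for d
    using that by (simp add: eta_fps_at_nth eta_fps_rational)
  show "fps_nth x_fps n \<in> \<rat>"
    unfolding x_fps_def by (rule spec[of _ n], intro m i e) simp_all
  show "fps_nth A_fps n \<in> \<rat>"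
    unfolding A_fps_def by (rule spec[of _ n], intro m i e) simp_all
  show "fps_nth K_fps n \<in> \<rat>"
    unfolding K_fps_def power2_eq_square by (rule spec[of _ n], intro m i e) simp_all
qed

subsection \<open>The Atkin--Lehner involution on functions\<close>

lemma pullback_scalar: "n \<noteq> 0 \<Longrightarrow> pullback (mat2 n 0 0 n) F = F"
  by (rule mero_uhp_ext) (simp add: eval_pullback mob_def zero_less_mult_iff flip: power2_eq_square)

lemma growth_upper_triangular:
  assumes F: "growth F k" and g: "g > 0" and m: "m > 0"
  shows "growth (pullback (mat2 g \<beta> 0 m) F) (k * of_int g / of_int m)"
proof -
  obtain Y C where Y: "Y > 0" "C \<ge> 0" "\<And>z. Im z \<ge> Y \<Longrightarrow> reg F z" "\<And>z. Im z \<ge> Y \<Longrightarrow> norm (eval_mero F z) \<le> C * exp (k * Im z)"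
    using F by (rule growthE) blast
  have d: "det (mat2 g \<beta> 0 m) > 0" using g m by simp
  have "reg (pullback (mat2 g \<beta> 0 m) F) z \<and> norm (eval_mero (pullback (mat2 g \<beta> 0 m) F) z) \<le> C * exp (k * of_int g / of_int m * Im z)"
    if z: "Im z \<ge> Y * of_int m / of_int g" for z
  proof -
    have "Y * of_int m / of_int g > 0" using Y(1) g m by simp
    hence u: "z \<in> uhp" using z by (simp add: uhp_def)
    have I: "Im (mob g \<beta> 0 m z) = of_int g * Im z / of_int m"
      by (simp add: mob_def)
    moreover have "of_int g * Im z / of_int m \<ge> Y" using z g m by (simp add: field_simps)
    ultimately have Y': "Im (mob g \<beta> 0 m z) \<ge> Y" by simp
    have "reg (pullback (mat2 g \<beta> 0 m) F) z" using reg_pullback[OF d u] Y(3)[OF Y'] by simp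
    moreover have "norm (eval_mero (pullback (mat2 g \<beta> 0 m) F) z) \<le> C * exp (k * Im (mob g \<beta> 0 m z))"
      using Y(4)[OF Y'] eval_pullback[OF d u] by simp
    ultimately show ?thesis unfolding I by (simp add: mult_ac)
  qed
  moreover have "Y * of_int m / of_int g > 0" using Y(1) g m by simp
  ultimately show ?thesis unfolding growth_def by blast
qed

text \<open>The conjugate of the translation by N under any M of determinant 1 lies in
  \<open>Gamma0 N\<close>. Hence \<open>pullback M F\<close> has period N, and a growth bound is
  enough for its expansion in exp(2 pi i z / N).\<close>

lemma modular_functions_growth:
  assumes N: "N > 0"
  shows "F \<in> modular_functions N \<longleftrightarrow>
    (\<forall>M\<in>Gamma0 N. pullback M F = F) \<and> (\<forall>M. det M = 1 \<longrightarrow> (\<exists>k. growth (pullback M F) k))"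
    (is "_ \<longleftrightarrow> ?I \<and> ?G")
proof
  assume "F \<in> modular_functions N"
  thus "?I \<and> ?G"
    unfolding modular_functions_def using has_q_expansion_imp_growth[OF _ N] by blast
next
  assume "?I \<and> ?G"
  hence I: ?I and G: ?G by auto
  have "\<exists>L. has_q_expansion N (pullback M F) L" if M: "det M = 1" for M
  proof -
    obtain k where k: "growth (pullback M F) k" using G M by blast
    define T where "T = mat2 1 (int N) 0 1"
    obtain a b c d where abcd: "M = mat2 a b c d" by (rule mat2_cases)
    have det: "a * d - b * c = 1" using M abcd by simp
    \<comment> \<open>This is M T M^-1 with the translation T by N.\<close>
    define A where "A = mat2 (1 - int N * a * c) (int N * a * a) (- int N * c * c) (1 + int N * a * c)"
    have A: "A \<in> Gamma0 N" by (simp add: A_def Gamma0_def algebra_simps)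
    have "A ** M = mat2 ((1 - int N * a * c) * a + int N * a * a * c) ((1 - int N * a * c) * b + int N * a * a * d)
       (- int N * c * c * a + (1 + int N * a * c) * c) (- int N * c * c * b + (1 + int N * a * c) * d)"
      unfolding A_def abcd mat2_mult ..
    also have "(1 - int N * a * c) * b + int N * a * a * d = b + int N * a * (a * d - b * c)" by (simp add: algebra_simps)
    also have "(- int N * c * c * b + (1 + int N * a * c) * d) = d + int N * c * (a * d - b * c)" by (simp add: algebra_simps)
    finally have "A ** M = mat2 a (b + int N * a) c (d + int N * c)"
      unfolding det by (simp add: algebra_simps)
    also have "\<dots> = M ** T" by (simp add: abcd T_def mat2_mult algebra_simps)
    finally have AM: "M ** T = A ** M" ..
    have "pullback T (pullback M F) = pullback (A ** M) F"
      using pullback_mult_mat2[of M T F] M unfolding AM[symmetric] by (simp add: T_def)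
    also have "\<dots> = pullback M F" using pullback_coset[OF _ A M] I by blast
    finally have T: "pullback T (pullback M F) = pullback M F" .
    have "eval_mero (pullback M F) (z + of_nat N) = eval_mero (pullback M F) z" if z: "z \<in> uhp" for z
    proof -
      have "eval_mero (pullback T (pullback M F)) z = eval_mero (pullback M F) (moebius_mat T z)"
        by (rule eval_pullback[OF _ z]) (simp add: T_def)
      thus ?thesis unfolding T by (simp add: T_def mob_def)
    qed
    moreover obtain n where "k * real N / (2 * pi) \<le> real n" using real_arch_simple by blast
    hence "k * real N \<le> 2 * pi * real n" by (simp add: field_simps)
    ultimately show ?thesis using periodic_growth_imp_q_expansion[OF _ N k] by metis
  qed
  thus "F \<in> modular_functions N" using I by (simp add: modular_functions_def)
qed

text \<open>An Atkin-Lehner matrix of trace 0. Its square is the scalar -23, so that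
  \<open>w\<close> is an involution on all meromorphic functions and not just on modular
  ones.\<close>

definition W0 :: "int ^ 2 ^ 2" where "W0 = mat2 23 1 (-552) (-23)"

lemma W0: "W0 \<in> atkin_lehner_matrices 92 23" "det W0 = 23"
  by (simp_all add: W0_def atkin_lehner_matrices_def)

abbreviation w :: "mero_uhp \<Rightarrow> mero_uhp" where "w \<equiv> pullback W0"

lemma atkin_lehner_w:
  assumes "F \<in> modular_functions 92"
  shows "atkin_lehner 92 23 F = w F" "M \<in> atkin_lehner_matrices 92 23 \<Longrightarrow> pullback M F = w F"
proof -
  have e: "atkin_lehner 92 23 F = pullback M F" if "M \<in> atkin_lehner_matrices 92 23" for M
    by (rule atkin_lehner_eq_pullback[of 23 92, OF _ _ assms that]) simp_all
  show "atkin_lehner 92 23 F = w F" by (rule e[OF W0(1)])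
  show "pullback M F = w F" if "M \<in> atkin_lehner_matrices 92 23"
    using e[OF that] e[OF W0(1)] by (rule trans[OF sym])
qed

lemma w_w: "w (w F) = F"
proof -
  have "w (w F) = pullback (W0 ** W0) F" by (rule pullback_mult_mat2) (simp_all add: W0(2))
  also have "W0 ** W0 = mat2 (-23) 0 0 (-23)" by (simp add: W0_def mat2_mult)
  also have "pullback \<dots> F = F" by (rule pullback_scalar) simp
  finally show ?thesis .
qed

lemmas w_hom = pullback_hom[of W0, unfolded W0(2), simplified] pullback_more[of W0, unfolded W0(2), simplified]

text \<open>For invariance, W0 times an element of \<open>Gamma0 92\<close> is again an Atkin-Lehner
  matrix. For growth, W0 M is a matrix of determinant 1 times an upper triangular one, so the cusp
  of \<open>w F\<close> is a cusp of \<open>F\<close> with rescaled height.\<close>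

lemma w_modular:
  assumes F: "F \<in> modular_functions 92"
  shows "w F \<in> modular_functions 92"
proof -
  have "pullback A (w F) = w F" if A: "A \<in> Gamma0 92" for A
  proof -
    obtain a b c d where abcd: "A = mat2 a b c d" by (rule mat2_cases)
    have det: "det A = 1" and c: "92 dvd c" using A by (auto simp: Gamma0_def abcd)
    obtain e where e: "c = 92 * e" using c by blast
    have "W0 ** A = mat2 (23 * (a + 4 * e)) (23 * b + d) (92 * (- 6 * a - 23 * e)) (23 * (- 24 * b - d))"
      by (simp add: W0_def abcd mat2_mult e)
    moreover have "det (W0 ** A) = 23" by (simp add: det_mul W0(2) det)
    ultimately have "W0 ** A \<in> atkin_lehner_matrices 92 23"
      by (simp add: atkin_lehner_matrices_def del: mat2_simps(5))
    thus ?thesis using pullback_mult_mat2[of W0 A F] atkin_lehner_w(2)[OF F] by (simp add: W0(2) det)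
  qed
  moreover have "\<exists>k. growth (pullback M (w F)) k" if M: "det M = 1" for M
  proof -
    obtain a b c d where abcd: "M = mat2 a b c d" by (rule mat2_cases)
    have det: "a * d - b * c = 1" using M abcd by simp
    define g where "g = gcd c 23"
    define m where "m = 23 div g"
    obtain a' b' c' d' \<beta> where s: "a' * d' - b' * c' = 1"
      "\<And>z. Im z > 0 \<Longrightarrow> of_int 23 * mob a b c d z = mob a' b' c' d' (mob g \<beta> 0 m z)"
      unfolding g_def m_def by (rule mob_scale_decompose[OF det, of 23]) simp_all
    have g: "g > 0" by (simp add: g_def)
    have "g dvd 23" by (simp add: g_def)
    hence "g * m = 23" by (simp add: m_def)
    hence m: "m > 0" using zero_less_mult_pos[OF _ g, of m] by simp
    \<comment> \<open>W0 = M1 diag(23, 1); \<open>mob_scale_decompose\<close> then moves diag(23, 1)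
      past M.\<close>
    define M1 where "M1 = mat2 1 1 (-24) (-23)"
    define M2 where "M2 = mat2 a' b' c' d'"
    define U where "U = mat2 g \<beta> 0 m"
    have dets: "det M1 = 1" "det M2 = 1" "det U > 0" using s g m by (simp_all add: M1_def M2_def U_def)
    obtain k where k: "growth (pullback (M1 ** M2) F) k"
    proof -
      have "det (M1 ** M2) = 1" by (simp add: det_mul dets)
      thus ?thesis using F that unfolding modular_functions_growth[OF zero_less_numeral] by blast
    qed
    have "pullback M (w F) = pullback U (pullback (M1 ** M2) F)"
    proof (rule mero_uhp_ext)
      fix z assume z: "z \<in> uhp"
      have Mz: "moebius_mat M z \<in> uhp" using moebius_in_uhp[OF z] M by simp
      have Uz: "moebius_mat U z \<in> uhp" using moebius_in_uhp[OF z dets(3)] .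
      have W: "W0 = M1 ** mat2 23 0 0 1" by (simp add: W0_def M1_def mat2_mult)
      have "eval_mero (pullback M (w F)) z = eval_mero F (moebius_mat W0 (moebius_mat M z))"
        using z Mz M by (simp add: eval_pullback W0(2))
      also have "moebius_mat W0 (moebius_mat M z) = moebius_mat M1 (moebius_mat (mat2 23 0 0 1) (moebius_mat M z))"
        unfolding W by (subst moebius_mult[OF Mz]) simp_all
      also have "moebius_mat (mat2 23 0 0 1) (moebius_mat M z) = moebius_mat M2 (moebius_mat U z)"
        using s(2)[of z] z by (simp add: abcd M2_def U_def uhp_def) (simp add: mob_def)
      also have "moebius_mat M1 (moebius_mat M2 (moebius_mat U z)) = moebius_mat (M1 ** M2) (moebius_mat U z)"
        by (rule moebius_mult[OF Uz, symmetric]) (simp_all add: dets)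
      also have "eval_mero F \<dots> = eval_mero (pullback U (pullback (M1 ** M2) F)) z"
        using z Uz dets by (simp add: eval_pullback det_mul)
      finally show "eval_mero (pullback M (w F)) z = eval_mero (pullback U (pullback (M1 ** M2) F)) z" .
    qed
    thus ?thesis using growth_upper_triangular[OF k g m, of \<beta>] unfolding U_def by auto
  qed
  ultimately show ?thesis unfolding modular_functions_growth[OF zero_less_numeral] by blast
qed

lemma uhp_imp_Im: "z \<in> uhp \<Longrightarrow> Im z > 0"
  by (simp add: uhp_def)

lemma basic_Gamma0:
  assumes "M \<in> Gamma0 92"
  shows "pullback M XX = XX" "pullback M FF = FF" "pullback M KK = KK"
proof -
  obtain a b c d where M: "M = mat2 a b c d" by (rule mat2_cases)
  have det: "a * d - b * c = 1" and c: "92 dvd c" using assms by (auto simp: Gamma0_def M)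
  have d: "det M > 0" using det by (simp add: M)
  have c': "46 dvd c" by (rule dvd_trans[OF _ c]) simp
  have "eval_mero (pullback M XX) z = eval_mero XX z" "eval_mero (pullback M FF) z = eval_mero FF z"
    "eval_mero (pullback M KK) z = eval_mero KK z" if z: "z \<in> uhp" for z
    using x0_Gamma0[OF det c uhp_imp_Im[OF z]] f0_Gamma0[OF det c' uhp_imp_Im[OF z]] K0_Gamma0[OF det c uhp_imp_Im[OF z]]
    by (simp_all add: eval_pullback[OF d z] basic_eval[OF z] basic_eval[OF moebius_in_uhp[OF z d]]) (simp_all add: M)
  thus "pullback M XX = XX" "pullback M FF = FF" "pullback M KK = KK" by (simp_all add: mero_uhp_ext)
qed

lemma basic_w: "w XX = XX" "w FF = FF" "w KK = cst (-23) * inverse KK"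
proof -
  have d: "det W0 > 0" by (simp add: W0)
  \<comment> \<open>W0 is the matrix of \<open>x0_W\<close> and \<open>K0_W\<close> for a = b = 1, d
    = -1, c = -6, and that of \<open>f0_W\<close> for c = -12.\<close>
  have mw: "moebius_mat W0 z = mob 23 1 (-552) (-23) z" for z by (simp add: W0_def)
  have "eval_mero (w XX) z = eval_mero XX z" "eval_mero (w FF) z = eval_mero FF z" if z: "z \<in> uhp" for z
    using x0_W[of 1 "-1" 1 "-6" z] f0_W[of 1 "-1" 1 "-12" z] uhp_imp_Im[OF z]
    by (simp_all add: eval_pullback[OF d z] basic_eval[OF z] basic_eval[OF moebius_in_uhp[OF z d]]) (simp_all add: mw)
  thus "w XX = XX" "w FF = FF" by (simp_all add: mero_uhp_ext)
  show "w KK = cst (-23) * inverse KK"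
  proof (rule mero_uhp_ext)
    fix z assume z: "z \<in> uhp"
    have nz: "eval_mero KK z \<noteq> 0" by (simp add: basic_eval z)
    have "eval_mero (cst (-23) * inverse KK) z = -23 * inverse (K0 z)"
      using reg_mult[OF cst(2)[OF z] conjunct2[OF reg_inverse[OF basic_eval(6)[OF z] nz z]] z]
        reg_inverse[OF basic_eval(6)[OF z] nz z] by (simp add: cst z basic_eval)
    moreover have "eval_mero (w KK) z = -23 / K0 z"
      using K0_W[of 1 "-1" 1 "-6" z] uhp_imp_Im[OF z]
      by (simp add: eval_pullback[OF d z] basic_eval[OF z] basic_eval[OF moebius_in_uhp[OF z d]]) (simp add: mw)
    ultimately show "eval_mero (w KK) z = eval_mero (cst (-23) * inverse KK) z" by (simp add: divide_inverse)
  qed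
qed

lemma mero_of_inverse:
  assumes g: "g analytic_on uhp" and nz: "\<And>z. g z \<noteq> 0"
  shows "inverse (mero_of g) = mero_of (\<lambda>z. inverse (g z))"
proof (rule mero_uhp_ext)
  fix z assume z: "z \<in> uhp"
  have "(\<lambda>z. inverse (g z)) analytic_on uhp" using g nz by (intro analytic_intros) auto
  from reg_mero_of(1)[OF this z] reg_mero_of[OF g z] reg_inverse[of "mero_of g" z]
  show "eval_mero (inverse (mero_of g)) z = eval_mero (mero_of (\<lambda>z. inverse (g z))) z" using nz z by simp
qed

lemma unit_growth:
  assumes g: "g analytic_on uhp" and M: "a * d - b * c = 1"
    and s: "comparable (\<lambda>z. norm (g (mob a b c d z)) ^ 2) s"
  shows "growth (pullback (mat2 a b c d) (mero_of g)) (s / 2)"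
proof -
  obtain C Y where Y: "Y > 0" "\<And>z. Im z \<ge> Y \<Longrightarrow> norm (g (mob a b c d z)) \<le> C * exp (s / 2 * Im z)"
    by (rule comparable_sq_bound[OF s]) (rule that)
  have d: "det (mat2 a b c d) > 0" using M by simp
  have "reg (pullback (mat2 a b c d) (mero_of g)) z \<and> norm (eval_mero (pullback (mat2 a b c d) (mero_of g)) z) \<le> C * exp (s / 2 * Im z)"
    if z: "Im z \<ge> Y" for z
  proof -
    have u: "z \<in> uhp" using z Y(1) by (simp add: uhp_def)
    note Mz = moebius_in_uhp[OF u d]
    show ?thesis
      using reg_pullback[OF d u reg_mero_of(2)[OF g Mz]] eval_pullback[OF d u, of "mero_of g"] reg_mero_of(1)[OF g Mz] Y(2)[OF z] by simp
  qed
  thus ?thesis unfolding growth_def using Y(1) by blast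
qed

text \<open>The exponents are half of those in \<open>cusp_comparable_exponents\<close>, where
  squared norms are compared.\<close>

lemma basic_cusp_growth:
  assumes "det M = 1"
  obtains sx sf sK where "growth (pullback M XX) sx" "growth (pullback M FF) sf" "growth (pullback M (inverse FF)) (- sf)"
    "growth (pullback M KK) sK" "growth (pullback M (inverse KK)) (- sK)"
    "\<not> 4 dvd M $ 2 $ 1 \<Longrightarrow> sx < 0 \<and> sx + sf \<le> 0 \<and> 2 * sx - sf \<le> 0 \<and> sK = 0"
proof -
  obtain a b c d where M: "M = mat2 a b c d" by (rule mat2_cases)
  have det: "a * d - b * c = 1" using assms by (simp add: M)
  obtain sx sf sK where s: "comparable (\<lambda>z. norm (x0 (mob a b c d z)) ^ 2) sx" "comparable (\<lambda>z. norm (f0 (mob a b c d z)) ^ 2) sf"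
    "comparable (\<lambda>z. norm (K0 (mob a b c d z)) ^ 2) sK"
    "\<not> 4 dvd c \<Longrightarrow> sx < 0" "\<not> 4 dvd c \<Longrightarrow> sx + sf \<le> 0" "\<not> 4 dvd c \<Longrightarrow> 2 * sx - sf \<le> 0" "\<not> 4 dvd c \<Longrightarrow> sK = 0"
    by (rule cusp_comparable_exponents[OF det]) (rule that)
  have inv: "growth (pullback M (inverse (mero_of g))) (- (t / 2))"
    if "g analytic_on uhp" "\<And>z. g z \<noteq> 0" "comparable (\<lambda>z. norm (g (mob a b c d z)) ^ 2) t" for g t
  proof -
    have an: "(\<lambda>z. inverse (g z)) analytic_on uhp" using that(1,2) by (intro analytic_intros) auto
    have "comparable (\<lambda>z. norm (inverse (g (mob a b c d z))) ^ 2) (- t)"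
      using comparable_inverse[OF that(3)] by (simp add: norm_inverse power_inverse)
    from unit_growth[OF an det this] show ?thesis unfolding mero_of_inverse[OF that(1,2)] M by simp
  qed
  show ?thesis
  proof (rule that)
    show "growth (pullback M XX) (sx / 2)" unfolding M XX_def by (rule unit_growth[OF analytic_uhp(1) det s(1)])
    show "growth (pullback M FF) (sf / 2)" unfolding M FF_def by (rule unit_growth[OF analytic_uhp(2) det s(2)])
    show "growth (pullback M KK) (sK / 2)" unfolding M KK_def by (rule unit_growth[OF analytic_uhp(3) det s(3)])
    show "growth (pullback M (inverse FF)) (- (sf / 2))" unfolding FF_def by (rule inv[OF analytic_uhp(2) _ s(2)]) simp
    show "growth (pullback M (inverse KK)) (- (sK / 2))" unfolding KK_def by (rule inv[OF analytic_uhp(3) _ s(3)]) simp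
    show "sx / 2 < 0 \<and> sx / 2 + sf / 2 \<le> 0 \<and> 2 * (sx / 2) - sf / 2 \<le> 0 \<and> sK / 2 = 0" if "\<not> 4 dvd M $ 2 $ 1"
    proof -
      have c: "\<not> 4 dvd c" using that by (simp add: M)
      show ?thesis using s(4-7)[OF c] by simp
    qed
  qed
qed

lemma basic_modular: "XX \<in> modular_functions 92" "FF \<in> modular_functions 92" "KK \<in> modular_functions 92"
  unfolding modular_functions_growth[OF zero_less_numeral]
  using basic_Gamma0 by (blast elim: basic_cusp_growth)+

lemma is_subfieldD:
  assumes "is_subfield K"
  shows "0 \<in> K" "1 \<in> K" "a \<in> K \<Longrightarrow> b \<in> K \<Longrightarrow> a + b \<in> K" "a \<in> K \<Longrightarrow> b \<in> K \<Longrightarrow> a * b \<in> K" "a \<in> K \<Longrightarrow> - a \<in> K"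
    "a \<in> K \<Longrightarrow> inverse a \<in> K" "a \<in> K \<Longrightarrow> b \<in> K \<Longrightarrow> a - b \<in> K" "a \<in> K \<Longrightarrow> b \<in> K \<Longrightarrow> a / b \<in> K" "a \<in> K \<Longrightarrow> a ^ n \<in> K"
    "numeral k \<in> K"
proof -
  show r: "0 \<in> K" "1 \<in> K" "a \<in> K \<Longrightarrow> b \<in> K \<Longrightarrow> a + b \<in> K" "a \<in> K \<Longrightarrow> b \<in> K \<Longrightarrow> a * b \<in> K" "a \<in> K \<Longrightarrow> - a \<in> K"
    "a \<in> K \<Longrightarrow> inverse a \<in> K" for a b using assms unfolding is_subfield_def by blast+
  show "a - b \<in> K" if "a \<in> K" "b \<in> K" using r(3)[OF that(1) r(5)[OF that(2)]] by simp
  show "a / b \<in> K" if "a \<in> K" "b \<in> K" using r(4)[OF that(1) r(6)[OF that(2)]] by (simp add: divide_inverse)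
  show "a ^ n \<in> K" if "a \<in> K" using that by (induction n) (auto intro: r)
  have "of_nat m \<in> K" for m by (induction m) (auto intro: r)
  from this[of "numeral k"] show "numeral k \<in> K" by simp
qed

lemma cst_modular: "cst c \<in> modular_functions 92"
proof -
  have "growth (pullback M (cst c)) 0" if "det M = 1" for M using that by (simp add: pullback_hom growth_cst)
  moreover have "pullback M (cst c) = cst c" if "M \<in> Gamma0 92" for M using that by (simp add: pullback_hom Gamma0_def)
  ultimately show ?thesis unfolding modular_functions_growth[OF zero_less_numeral] by blast
qed

lemmas modular_ops = is_subfieldD[OF is_subfield_modular_functions[OF zero_less_numeral]]

section \<open>The complex function field of the quotient by the involution\<close>

definition plus_functions :: "mero_uhp set" where
  "plus_functions = {F \<in> modular_functions 92. w F = F}"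

lemma plus_functionsD: "F \<in> plus_functions \<Longrightarrow> F \<in> modular_functions 92" "F \<in> plus_functions \<Longrightarrow> w F = F"
  by (auto simp: plus_functions_def)

lemma is_subfield_plus_functions: "is_subfield plus_functions"
  unfolding is_subfield_def plus_functions_def by (auto simp: w_hom intro: modular_ops)

lemmas plus_ops = is_subfieldD[OF is_subfield_plus_functions]

lemma cst_plus: "cst c \<in> plus_functions"
  using cst_modular by (simp add: plus_functions_def w_hom)

text \<open>
  Invariant functions whose only poles on the quotient by the involution are at \<open>\<infinity>\<close>; boundedness at the cusps
  with \<open>4 dvd c\<close> other than \<open>\<infinity>\<close> is a consequence of boundedness at \<open>\<infinity>\<close> (\<open>growth_at_4_cusps\<close>).
\<close>
definition plus_regular :: "mero_uhp \<Rightarrow> bool" where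
  "plus_regular G \<longleftrightarrow> G \<in> plus_functions \<and> (\<forall>z\<in>uhp. reg G z) \<and> (\<forall>M. det M = 1 \<longrightarrow> \<not> 4 dvd M $ 2 $ 1 \<longrightarrow> growth (pullback M G) 0)"

lemma plus_regularI:
  "G \<in> plus_functions \<Longrightarrow> (\<And>z. z \<in> uhp \<Longrightarrow> reg G z) \<Longrightarrow> (\<And>M. det M = 1 \<Longrightarrow> \<not> 4 dvd M $ 2 $ 1 \<Longrightarrow> growth (pullback M G) 0) \<Longrightarrow> plus_regular G"
  by (simp add: plus_regular_def)

lemma plus_regularD:
  assumes "plus_regular G"
  shows "G \<in> plus_functions" "z \<in> uhp \<Longrightarrow> reg G z" "det M = 1 \<Longrightarrow> \<not> 4 dvd M $ 2 $ 1 \<Longrightarrow> growth (pullback M G) 0"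
  using assms by (auto simp: plus_regular_def)

lemma plus_regular_cst: "plus_regular (cst c)"
  by (rule plus_regularI) (auto simp: cst_plus cst pullback_hom growth_cst)

lemma plus_regular_add:
  assumes "plus_regular F" "plus_regular G"
  shows "plus_regular (F + G)"
proof (rule plus_regularI)
  show "F + G \<in> plus_functions" using plus_regularD(1)[OF assms(1)] plus_regularD(1)[OF assms(2)] by (rule plus_ops(3))
  show "reg (F + G) z" if "z \<in> uhp" for z using reg_add[OF plus_regularD(2)[OF assms(1) that] plus_regularD(2)[OF assms(2) that] that] by simp
  show "growth (pullback M (F + G)) 0" if "det M = 1" "\<not> 4 dvd M $ 2 $ 1" for M
    using growth_add[OF plus_regularD(3)[OF assms(1) that] plus_regularD(3)[OF assms(2) that]] that(1) by (simp add: pullback_hom)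
qed

lemma plus_regular_mult:
  assumes "plus_regular F" "plus_regular G"
  shows "plus_regular (F * G)"
proof (rule plus_regularI)
  show "F * G \<in> plus_functions" using plus_regularD(1)[OF assms(1)] plus_regularD(1)[OF assms(2)] by (rule plus_ops(4))
  show "reg (F * G) z" if "z \<in> uhp" for z using reg_mult[OF plus_regularD(2)[OF assms(1) that] plus_regularD(2)[OF assms(2) that] that] by simp
  show "growth (pullback M (F * G)) 0" if "det M = 1" "\<not> 4 dvd M $ 2 $ 1" for M
    using growth_mult[OF plus_regularD(3)[OF assms(1) that] plus_regularD(3)[OF assms(2) that]] that(1) by (simp add: pullback_hom)
qed

lemma plus_regular_numeral: "plus_regular (numeral k)" and plus_regular_one: "plus_regular 1"
  using plus_regular_cst[of "numeral k"] plus_regular_cst[of 1] by (simp_all add: cst_numeral cst_hom)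

lemma plus_regular_diff: "plus_regular F \<Longrightarrow> plus_regular G \<Longrightarrow> plus_regular (F - G)"
  using plus_regular_add[of F "cst (-1) * G"] plus_regular_mult[OF plus_regular_cst[of "-1"], of G] by (simp add: cst_hom)

lemma plus_regular_power: "plus_regular F \<Longrightarrow> plus_regular (F ^ n)"
  by (induction n) (auto intro: plus_regular_mult plus_regular_one)

lemmas plus_regular_intros = plus_regular_add plus_regular_mult plus_regular_diff plus_regular_power plus_regular_numeral plus_regular_one plus_regular_cst

text \<open>If 23 divides c, then M lies in \<open>Gamma0 92\<close>. Otherwise M times a suitable
  upper triangular B is an Atkin-Lehner matrix, which fixes G; so \<open>pullback M G\<close> is the
  pullback of G by the adjugate B' of B, and boundedness at \<infinity> carries over.\<close>

lemma growth_at_4_cusps: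
  assumes G: "G \<in> plus_functions" and g: "growth G 0" and M: "det M = 1" "4 dvd M $ 2 $ 1"
  shows "growth (pullback M G) 0"
proof -
  note Gm = plus_functionsD[OF G]
  obtain a b c d where abcd: "M = mat2 a b c d" by (rule mat2_cases)
  have det: "a * d - b * c = 1" and c4: "4 dvd c" using M by (simp_all add: abcd)
  show ?thesis
  proof (cases "23 dvd c")
    case True
    have "lcm 4 23 dvd c" using c4 True by (rule lcm_least)
    moreover have "lcm 4 23 = (92::int)" by code_simp
    ultimately have "M \<in> Gamma0 92" using M(1) by (simp add: Gamma0_def abcd)
    hence "pullback M G = G" using Gm(1) by (simp add: modular_functions_def)
    thus ?thesis using g by simp
  next
    case False
    have "prime (23::int)" by simp
    hence "coprime c 23" using prime_imp_coprime[OF _ False] by (simp add: coprime_commute)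
    then obtain u v where uv: "u * c + v * 23 = 1" using bezout_int[of c 23] by (auto simp: coprime_iff_gcd_eq_1)
    \<comment> \<open>Solves c \<beta> + d = 0 modulo 23, as the lower right entry of an
      Atkin-Lehner matrix requires.\<close>
    define \<beta> where "\<beta> = - (d * u)"
    define B where "B = mat2 23 \<beta> 0 1"
    define B' where "B' = mat2 1 (- \<beta>) 0 23"
    have "c * \<beta> + d = d * (1 - u * c)" by (simp add: \<beta>_def algebra_simps)
    also have "1 - u * c = v * 23" using uv by simp
    finally have e: "c * \<beta> + d = 23 * (d * v)" by simp
    have "M ** B = mat2 (a * 23) (a * \<beta> + b) (c * 23) (c * \<beta> + d)" by (simp add: abcd B_def mat2_mult)
    moreover have "det (M ** B) = 23" by (simp add: det_mul M(1) B_def)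
    moreover have "92 dvd c * 23" using c4 by (auto elim!: dvdE)
    ultimately have "M ** B \<in> atkin_lehner_matrices 92 23"
      by (simp add: atkin_lehner_matrices_def e del: mat2_simps(5))
    hence "pullback B (pullback M G) = G"
      using pullback_mult_mat2[of M B G] atkin_lehner_w(2)[OF Gm(1)] Gm(2) by (simp add: M(1) B_def)
    hence "pullback B' G = pullback B' (pullback B (pullback M G))" by simp
    also have "\<dots> = pullback (B ** B') (pullback M G)" by (rule pullback_mult_mat2) (simp_all add: B_def B'_def)
    also have "B ** B' = mat2 23 0 0 23" by (simp add: B_def B'_def mat2_mult)
    also have "pullback \<dots> (pullback M G) = pullback M G" by (rule pullback_scalar) simp
    finally show ?thesis using growth_upper_triangular[OF g, of 1 23 "- \<beta>"] by (simp add: B'_def)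
  qed
qed

text \<open>Decay at \<infinity> gives boundedness at all cusps with \<open>4 dvd c\<close>, and the
  definition of \<open>plus_regular\<close> covers the others; finitely many cosets give finitely
  many conjugates.\<close>

lemma plus_regular_eq_0:
  assumes G: "plus_regular G" and gr: "growth G k" "k < 0"
  shows "G = 0"
proof (rule vanishing_principle)
  note Gm = plus_functionsD[OF plus_regularD(1)[OF G]]
  obtain R :: "(int ^ 2 ^ 2) set" where R: "finite R" "\<And>M. M \<in> R \<Longrightarrow> det M = 1" "\<And>M. det M = 1 \<Longrightarrow> \<exists>M0\<in>R. \<exists>A\<in>Gamma0 92. M = A ** M0"
    by (rule finite_coset_reps[of 92]) (simp, rule that)
  have inv: "\<And>A. A \<in> Gamma0 92 \<Longrightarrow> pullback A G = G" using Gm(1) by (simp add: modular_functions_def)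
  have "{pullback M G |M. det M = 1} \<subseteq> (\<lambda>M. pullback M G) ` R"
  proof
    fix H assume "H \<in> {pullback M G |M. det M = 1}"
    then obtain M where M: "det M = 1" "H = pullback M G" by blast
    obtain M0 A where A: "M0 \<in> R" "A \<in> Gamma0 92" "M = A ** M0" using R(3)[OF M(1)] by blast
    have "H = pullback M0 G" unfolding M(2) A(3) by (rule pullback_coset[OF inv A(2) R(2)[OF A(1)]])
    thus "H \<in> (\<lambda>M. pullback M G) ` R" using A(1) by blast
  qed
  thus "finite {pullback M G |M. det M = 1}" using R(1) finite_surj by blast
  show "reg G z" if "z \<in> uhp" for z using plus_regularD(2)[OF G that] .
  have g0: "growth G 0" using growth_mono[OF gr(1)] gr(2) by simp
  show "growth (pullback M G) 0" if "det M = 1" for M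
    using growth_at_4_cusps[OF plus_regularD(1)[OF G] g0 that] plus_regularD(3)[OF G that] by blast
qed (use gr in auto)

lemma qx_lower:
  assumes "qx F (m + int k) P" "\<And>i. i < k \<Longrightarrow> fps_nth P i = 0"
  shows "qx F m (fps_shift k P)"
proof -
  have "P = fps_X ^ k * fps_shift k P"
    by (rule fps_ext) (use assms(2) in \<open>simp add: fps_X_power_mult_nth\<close>)
  moreover have "fls_shift (m + int k) (fps_to_fls (fps_X ^ k * fps_shift k P)) = fls_shift m (fps_to_fls (fps_shift k P))"
    by (rule fls_eqI) (auto simp: fps_X_power_mult_nth nat_diff_distrib intro!: arg_cong[of _ _ "fps_nth P"])
  ultimately show ?thesis using assms(1) by simp
qed

lemma plus_regular_const:
  assumes G: "plus_regular G" and P: "qx G 0 P"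
  shows "G = cst (fps_nth P 0)"
proof -
  define H where "H = G - cst (fps_nth P 0)"
  define R where "R = P - fps_const (fps_nth P 0)"
  define L where "L = fps_to_fls R"
  have "qx H 0 R" unfolding H_def R_def using qx_diff[OF P qx_cst] .
  hence HL: "has_q_expansion 1 H L" by (simp add: L_def)
  have hbH: "plus_regular H" unfolding H_def by (intro plus_regular_intros G)
  have "H = 0"
  proof (cases "L = 0")
    case True
    thus ?thesis using has_q_expansion_eq_0_iff[OF HL] by simp
  next
    case False
    have nz: "fls_nth L (fls_subdegree L) \<noteq> 0" using False by simp
    have "fls_nth L i = 0" if "i \<le> 0" for i
      using that by (cases "i = 0") (auto simp: L_def R_def)
    hence "fls_subdegree L > 0" using nz by (meson linorder_not_le)
    hence "- (2 * pi / real 1) * real_of_int (fls_subdegree L) < 0" by simp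
    with has_q_expansion_imp_growth[OF HL zero_less_one] show ?thesis by (rule plus_regular_eq_0[OF hbH])
  qed
  thus ?thesis by (simp add: H_def)
qed

text \<open>The coefficients of index 0, ..., n are the polar part and the constant term. Once they
  vanish, G is the constant 0.\<close>

lemma plus_regular_begins_zero:
  assumes G: "plus_regular G" and P: "qx G (int n) P" and b: "begins P (replicate 12 0)" and n: "n \<le> 11"
  shows "G = 0"
proof -
  have z: "fps_nth P i = 0" if "i \<le> n" for i using b that n by (simp add: begins_def)
  have "qx G 0 (fps_shift n P)" by (rule qx_lower) (use P z in auto)
  from plus_regular_const[OF G this] show ?thesis using z[of n] by (simp add: cst_hom)
qed

subsection \<open>The functions \<open>x\<close>, \<open>y\<close>, \<open>t\<close> and their relations\<close>

text \<open>\<open>XX\<close>, \<open>YY\<close>, \<open>TT\<close> are the generators $x$, $y$, $t$; \<open>AA\<close> and \<open>BB = XX ^ 3 / AA\<close> become $y - 1 - x$ and $y + 1 + x$.\<close>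
definition BB :: mero_uhp where "BB = XX ^ 2 * inverse FF"
definition YY :: mero_uhp where "YY = AA + 1 + XX"
definition TT :: mero_uhp where "TT = KK + 23 * inverse KK"
definition DD :: mero_uhp where "DD = KK - 23 * inverse KK"

lemma AA_BB: "AA * BB = XX ^ 3" "BB = XX ^ 3 * inverse AA"
  by (simp_all add: AA_def BB_def power2_eq_square power3_eq_cube field_simps)

lemma w_basic: "w AA = AA" "w BB = BB" "w YY = YY" "w DD = DD" "w TT = - TT"
proof -
  show "w AA = AA" "w BB = BB" "w YY = YY"
    by (simp_all add: AA_def BB_def YY_def w_hom basic_w)
  have "inverse (w KK) = - (KK / 23)" by (simp add: basic_w cst_hom cst_numeral field_simps)
  thus "w DD = DD" "w TT = - TT"
    by (simp_all add: DD_def TT_def w_hom) (simp_all add: basic_w cst_hom cst_numeral)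
qed

text \<open>The inequalities of \<open>basic_cusp_growth\<close> are made for this:
  \<open>sx < 0\<close> for x, \<open>sx + sf \<le> 0\<close> for AA,
  \<open>2 * sx - sf \<le> 0\<close> for BB, and \<open>sK = 0\<close> for both terms of DD.\<close>

lemma plus_regular_basic: "plus_regular XX" "plus_regular AA" "plus_regular BB" "plus_regular YY" "plus_regular DD"
proof -
  have iF: "inverse FF \<in> plus_functions" "FF \<in> plus_functions"
    using basic_modular basic_w by (simp_all add: plus_functions_def w_hom modular_ops)
  have rF: "reg (inverse FF) z" "reg (inverse KK) z" if "z \<in> uhp" for z
    using reg_inverse[OF basic_eval(4)[OF that] _ that] reg_inverse[OF basic_eval(6)[OF that] _ that] by (simp_all add: basic_eval that)
  show x: "plus_regular XX"
  proof (rule plus_regularI)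
    show "XX \<in> plus_functions" using basic_modular basic_w by (simp add: plus_functions_def)
    show "growth (pullback M XX) 0" if M: "det M = 1" "\<not> 4 dvd M $ 2 $ 1" for M
      by (rule basic_cusp_growth[OF M(1)]) (use M(2) in \<open>auto elim: growth_mono\<close>)
  qed (simp add: basic_eval)
  show a: "plus_regular AA"
  proof (rule plus_regularI)
    show "AA \<in> plus_functions" unfolding AA_def using plus_regularD(1)[OF x] iF(2) by (rule plus_ops)
    show "growth (pullback M AA) 0" if M: "det M = 1" "\<not> 4 dvd M $ 2 $ 1" for M
    proof (rule basic_cusp_growth[OF M(1)])
      fix sx sf sK assume *: "growth (pullback M XX) sx" "growth (pullback M FF) sf"
        "\<not> 4 dvd M $ 2 $ 1 \<Longrightarrow> sx < 0 \<and> sx + sf \<le> 0 \<and> 2 * sx - sf \<le> 0 \<and> sK = 0"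
      have "growth (pullback M AA) (sx + sf)" using growth_mult[OF *(1,2)] M(1) by (simp add: AA_def pullback_hom)
      thus "growth (pullback M AA) 0" by (rule growth_mono) (use *(3) M(2) in simp)
    qed
  qed (simp add: basic_eval)
  show "plus_regular BB"
  proof (rule plus_regularI)
    show "BB \<in> plus_functions" unfolding BB_def by (rule plus_ops(4)[OF plus_ops(9)[OF plus_regularD(1)[OF x]] iF(1)])
    show "growth (pullback M BB) 0" if M: "det M = 1" "\<not> 4 dvd M $ 2 $ 1" for M
    proof (rule basic_cusp_growth[OF M(1)])
      fix sx sf sK assume *: "growth (pullback M XX) sx" "growth (pullback M (inverse FF)) (- sf)"
        "\<not> 4 dvd M $ 2 $ 1 \<Longrightarrow> sx < 0 \<and> sx + sf \<le> 0 \<and> 2 * sx - sf \<le> 0 \<and> sK = 0"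
      have "growth (pullback M BB) (sx + sx + - sf)"
        using growth_mult[OF growth_mult[OF *(1,1)] *(2)] M(1) by (simp add: BB_def pullback_hom power2_eq_square)
      thus "growth (pullback M BB) 0" by (rule growth_mono) (use *(3) M(2) in simp)
    qed
    show "reg BB z" if "z \<in> uhp" for z
      unfolding BB_def using reg_mult[OF conjunct2[OF reg_power[OF basic_eval(2)[OF that] that]] rF(1)[OF that] that] by simp
  qed
  show "plus_regular YY" unfolding YY_def by (intro plus_regular_intros x a)
  show "plus_regular DD"
  proof (rule plus_regularI)
    show "DD \<in> plus_functions" unfolding plus_functions_def
      using w_basic(4) basic_modular(3) by (auto simp: DD_def intro: modular_ops)
    show "growth (pullback M DD) 0" if M: "det M = 1" "\<not> 4 dvd M $ 2 $ 1" for M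
    proof (rule basic_cusp_growth[OF M(1)])
      fix sx sf sK assume *: "growth (pullback M KK) sK" "growth (pullback M (inverse KK)) (- sK)"
        "\<not> 4 dvd M $ 2 $ 1 \<Longrightarrow> sx < 0 \<and> sx + sf \<le> 0 \<and> 2 * sx - sf \<le> 0 \<and> sK = 0"
      have "growth (pullback M KK) 0" "growth (pullback M (inverse KK)) 0" using * M(2) by simp_all
      from growth_add[OF this(1) growth_mult[OF growth_cst[of "-23"] this(2), simplified]]
      show "growth (pullback M DD) 0" using M(1) by (simp add: DD_def pullback_hom pullback_more cst_hom cst_numeral)
    qed
    show "reg DD z" if "z \<in> uhp" for z
      using reg_diff[OF basic_eval(6)[OF that] conjunct2[OF reg_mult[OF cst(2)[OF that, of 23] rF(2)[OF that] that]] that]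
      by (simp add: DD_def cst_numeral)
  qed
qed

lemma qx_basic: "qx YY 3 y_fps" "qx (inverse AA) (-3) (inverse A_fps)" "qx (inverse KK) (-11) (inverse K_fps)"
  "fps_nth y_fps 0 = 1" "fps_nth y_fps 1 = 0" "fps_nth x_fps 1 = 0"
proof -
  have 1: "qx 1 3 (fps_X ^ 3)" using qx_raise[OF qx_cst[of 1], of 3] by (simp add: cst_hom)
  have X: "qx XX 3 (fps_X ^ 1 * x_fps)" using qx_raise[OF basic_qx(1), of 1] by simp
  show "qx YY 3 y_fps" unfolding YY_def y_fps_def by (rule qx_add[OF qx_add[OF basic_qx(2) 1] X])
  show "qx (inverse AA) (-3) (inverse A_fps)" "qx (inverse KK) (-11) (inverse K_fps)"
    by (rule qx_inverse[OF basic_qx(2)], simp add: fps_nth_0_nonzero, rule qx_inverse[OF basic_qx(3)], simp add: fps_nth_0_nonzero)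
  show "fps_nth y_fps 0 = 1" "fps_nth y_fps 1 = 0" "fps_nth x_fps 1 = 0"
    using fps_begins(1,4) unfolding begins_def by (auto dest!: spec[of _ "0::nat"] spec[of _ "1::nat"])
qed

lemma relation_AA: "AA - BB + 2 + 2 * XX = 0"
proof (rule plus_regular_begins_zero[OF _ _ relation_fps_begins(1), of _ 3])
  show "plus_regular (AA - BB + 2 + 2 * XX)" by (intro plus_regular_intros plus_regular_basic)
  have "qx (XX ^ 2 * XX * inverse AA) 3 (x_fps ^ 2 * x_fps * inverse A_fps)"
    using qx_mult[OF qx_mult[OF qx_power[OF basic_qx(1), of 2] basic_qx(1)] qx_basic(2)] by simp
  hence B: "qx BB 3 (x_fps ^ 2 * x_fps * inverse A_fps)" by (simp add: AA_BB(2) power2_eq_square power3_eq_cube)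
  have 2: "qx 2 3 (2 * fps_X ^ 3)" using qx_raise[OF qx_numeral[of "num.Bit0 num.One"], of 3] by (simp add: mult.commute)
  have X: "qx (2 * XX) 3 (2 * (fps_X ^ 1 * x_fps))" using qx_raise[OF qx_mult[OF qx_numeral[of "num.Bit0 num.One"] basic_qx(1)], of 1] by (simp add: mult_ac)
  show "qx (AA - BB + 2 + 2 * XX) (int 3) (A_fps - x_fps ^ 2 * x_fps * inverse A_fps + 2 * fps_X ^ 3 + 2 * (fps_X ^ 1 * x_fps))"
    using qx_add[OF qx_add[OF qx_diff[OF basic_qx(2) B] 2] X] by simp
qed simp

lemma relation_DD: "DD = YY * (XX ^ 4 + 7 * XX ^ 3 + 18 * XX ^ 2 + 26 * XX + 22)"
proof -
  have "DD - YY * (22 + 26 * XX + 18 * XX ^ 2 + 7 * (XX ^ 2 * XX) + (XX ^ 2) ^ 2) = 0"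
  proof (rule plus_regular_begins_zero[OF _ _ relation_fps_begins(2), of _ 11])
    show "plus_regular (DD - YY * (22 + 26 * XX + 18 * XX ^ 2 + 7 * (XX ^ 2 * XX) + (XX ^ 2) ^ 2))" by (intro plus_regular_intros plus_regular_basic)
    have iK: "qx (23 * inverse KK) 11 (23 * (fps_X ^ 22 * inverse K_fps))"
      using qx_raise[OF qx_mult[OF qx_numeral[of "num.Bit1 (num.Bit1 (num.Bit1 (num.Bit0 num.One)))"] qx_basic(3)], of 22] by (simp add: mult_ac)
    have D: "qx DD 11 (K_fps - 23 * (fps_X ^ 22 * inverse K_fps))" unfolding DD_def by (rule qx_diff[OF basic_qx(3) iK])
    have x2: "qx (XX ^ 2) 4 (x_fps ^ 2)" using qx_power[OF basic_qx(1), of 2] by simp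
    have x3: "qx (XX ^ 2 * XX) 6 (x_fps ^ 2 * x_fps)" using qx_mult[OF x2 basic_qx(1)] by simp
    have x4: "qx ((XX ^ 2) ^ 2) 8 ((x_fps ^ 2) ^ 2)" using qx_power[OF x2, of 2] by simp
    have r: "qx (numeral k * F) 8 (numeral k * (fps_X ^ j * P))" if "qx F n P" "n + int j = 8" for k F n P j
      using qx_raise[OF qx_mult[OF qx_numeral[of k] that(1)], of j] that(2) by (simp add: mult_ac)
    have c: "qx (numeral k) 8 (numeral k * fps_X ^ 8)" for k
      using qx_raise[OF qx_numeral[of k], of 8] by (simp add: mult_ac)
    have "qx (22 + 26 * XX + 18 * XX ^ 2 + 7 * (XX ^ 2 * XX) + (XX ^ 2) ^ 2) 8
       (22 * fps_X ^ 8 + 26 * (fps_X ^ 6 * x_fps) + 18 * (fps_X ^ 4 * x_fps ^ 2) + 7 * (fps_X ^ 2 * (x_fps ^ 2 * x_fps)) + (x_fps ^ 2) ^ 2)"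
      by (intro qx_add c x4 r[OF basic_qx(1)] r[OF x2] r[OF x3]) simp_all
    from qx_mult[OF qx_basic(1) this]
    have "qx (YY * (22 + 26 * XX + 18 * XX ^ 2 + 7 * (XX ^ 2 * XX) + (XX ^ 2) ^ 2)) 11
       (y_fps * (22 * fps_X ^ 8 + 26 * (fps_X ^ 6 * x_fps) + 18 * (fps_X ^ 4 * x_fps ^ 2) + 7 * (fps_X ^ 2 * (x_fps ^ 2 * x_fps)) + (x_fps ^ 2) ^ 2))"
      by simp
    from qx_diff[OF D this]
    show "qx (DD - YY * (22 + 26 * XX + 18 * XX ^ 2 + 7 * (XX ^ 2 * XX) + (XX ^ 2) ^ 2)) (int 11)
       (K_fps - 23 * (fps_X ^ 22 * inverse K_fps) - y_fps * (22 * fps_X ^ 8 + 26 * (fps_X ^ 6 * x_fps) + 18 * (fps_X ^ 4 * x_fps ^ 2)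
     + 7 * (fps_X ^ 2 * (x_fps ^ 2 * x_fps)) + (x_fps ^ 2) ^ 2))" by simp
  qed simp
  thus ?thesis by algebra
qed

text \<open>A difference of two squares: (y - 1 - x)(y + 1 + x) = AA * BB = x^3.\<close>

lemma equation_YY: "YY ^ 2 = XX ^ 3 + XX ^ 2 + 2 * XX + 1"
proof -
  have "BB = AA + 2 + 2 * XX" using relation_AA by algebra
  thus ?thesis using AA_BB(1) unfolding YY_def by algebra
qed

lemma equation_TT:
  "TT ^ 2 = (3 + XX) ^ 2 * (8 + 4 * XX + 4 * XX ^ 2 + XX ^ 3) *
     (8 + 20 * XX + 28 * XX ^ 2 + 25 * XX ^ 3 + 14 * XX ^ 4 + 5 * XX ^ 5 + XX ^ 6)"
proof -
  have "KK * inverse KK = 1" by simp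
  hence "TT ^ 2 = DD ^ 2 + 92" unfolding TT_def DD_def by algebra
  also have "\<dots> = YY ^ 2 * (XX ^ 4 + 7 * XX ^ 3 + 18 * XX ^ 2 + 26 * XX + 22) ^ 2 + 92"
    unfolding relation_DD by (simp only: power_mult_distrib)
  finally show ?thesis unfolding equation_YY by algebra
qed

subsection \<open>Functions invariant under the involution\<close>

definition ev :: "complex poly \<Rightarrow> mero_uhp \<Rightarrow> mero_uhp" where "ev p F = poly (map_poly cst p) F"

lemma ev_hom:
  "ev 0 F = 0" "ev (pCons c p) F = cst c + F * ev p F" "ev (p + q) F = ev p F + ev q F" "ev (smult c p) F = cst c * ev p F"
  "ev (p * q) F = ev p F * ev q F" "ev 1 F = 1" "ev (p ^ n) F = ev p F ^ n" "ev (\<Prod>i\<in>S. f i) F = (\<Prod>i\<in>S. ev (f i) F)"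
  "ev (monom 1 n) F = F ^ n"
proof -
  show z: "ev 0 F = 0" for F by (simp add: ev_def)
  show pc: "ev (pCons c p) F = cst c + F * ev p F" for c p F by (simp add: ev_def map_poly_pCons cst_hom)
  show a: "ev (p + q) F = ev p F + ev q F" for p q F
    unfolding ev_def by (subst map_poly_additive) (simp_all add: cst_hom)
  show s: "ev (smult c p) F = cst c * ev p F" for c p F
    by (induction p) (simp_all add: z pc cst_hom algebra_simps)
  show m: "ev (p * q) F = ev p F * ev q F" for p q F
    by (induction p) (simp_all add: z pc a s cst_hom algebra_simps)
  show o: "ev 1 F = 1" for F by (simp add: one_pCons pc z cst_hom)
  show "ev (p ^ n) F = ev p F ^ n" by (induction n) (simp_all add: m o)
  show "ev (\<Prod>i\<in>S. f i) F = (\<Prod>i\<in>S. ev (f i) F)" by (induction S rule: infinite_finite_induct) (simp_all add: m o)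
  show "ev (monom 1 n) F = F ^ n" by (induction n) (simp_all add: monom_0 monom_Suc pc z cst_hom)
qed

text \<open>Over the complex numbers p splits into linear factors, and in the field of meromorphic
  functions one of them has to vanish at F.\<close>

lemma algebraic_imp_const:
  assumes "ev p F = 0" "p \<noteq> 0"
  shows "\<exists>a. F = cst a"
  using assms
proof (induction "degree p" arbitrary: p)
  case 0
  then obtain c where "p = [:c:]" "c \<noteq> 0" by (metis degree_eq_zeroE pCons_0_0)
  thus ?case using 0 by (simp add: ev_hom)
next
  case (Suc n)
  have "\<not> constant (poly p)" using Suc.hyps(2) by (simp add: constant_degree)
  then obtain a where "poly p a = 0" using fundamental_theorem_of_algebra by blast
  then obtain q where q: "p = [:-a, 1:] * q" unfolding poly_eq_0_iff_dvd by (rule dvdE)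
  have qn: "q \<noteq> 0" using q Suc.prems(2) by auto
  have "degree p = Suc (degree q)" unfolding q by (subst degree_mult_eq) (use qn in auto)
  hence dq: "n = degree q" using Suc.hyps(2) by simp
  have "ev p F = (F - cst a) * ev q F" unfolding q ev_hom by (simp add: cst_hom)
  hence "F - cst a = 0 \<or> ev q F = 0" using Suc.prems(1) by simp
  thus ?case
  proof
    assume "F - cst a = 0"
    thus ?thesis by (intro exI[of _ a]) simp
  next
    assume "ev q F = 0"
    from Suc.hyps(1)[OF dq this qn] show ?thesis .
  qed
qed

lemma pole_imp_not_const:
  assumes "qx F (int (Suc n)) P" "fps_nth P 0 \<noteq> 0"
  shows "F \<noteq> cst a"
proof
  assume "F = cst a"
  with has_q_expansion_unique[OF assms(1) _ zero_less_one, of "fls_const a"] has_q_expansion_cst[OF zero_less_one, of a]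
  have "fls_shift (int (Suc n)) (fps_to_fls P) = fls_const a" by simp
  hence "fls_nth (fls_shift (int (Suc n)) (fps_to_fls P)) (- int (Suc n)) = fls_nth (fls_const a) (- int (Suc n))" by (rule arg_cong)
  thus False using assms(2) by simp
qed

lemma XX_transcendental: "ev p XX = 0 \<Longrightarrow> p = 0"
  using algebraic_imp_const[of p XX] pole_imp_not_const[of XX 1 x_fps] basic_qx(1) fps_nth_0_nonzero(1) by fastforce

text \<open>
  With a simple pole at \<open>\<infinity>\<close> only, \<open>G\<close> would make \<open>XX\<close> and \<open>YY\<close> polynomials of degrees 2 and 3 in \<open>G\<close>, a
  rational parametrization of the elliptic curve; comparing coefficients in its equation is contradictory.
\<close>
lemma no_simple_pole:
  assumes G: "plus_regular G" and P: "qx G 1 P" "fps_nth P 0 = 1" "fps_nth P 1 = 0"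
  shows False
proof -
  have P2: "qx (G * G) 2 (P * P)" using qx_mult[OF P(1) P(1)] by simp
  have P3: "qx (G * G * G) 3 (P * P * P)" using qx_mult[OF P2 P(1)] by simp
  have pp: "fps_nth (P * P) 0 = 1" "fps_nth (P * P) 1 = 0" "fps_nth (P * P * P) 0 = 1" "fps_nth (P * P * P) 1 = 0"
    using P(2,3) by (simp_all add: fps_mult_nth_1 fps_mult_nth_1[unfolded One_nat_def])
  have lt2: "i = 0 \<or> i = 1" if "i < 2" for i :: nat using that by auto
  have "qx (XX - G * G) 2 (x_fps - P * P)" by (rule qx_diff[OF basic_qx(1) P2])
  moreover have "fps_nth (x_fps - P * P) i = 0" if "i < 2" for i
    using lt2[OF that] pp fps_nth_0_nonzero(1) qx_basic(6) by auto
  ultimately have "qx (XX - G * G) 0 (fps_shift 2 (x_fps - P * P))" using qx_lower[of _ 0 2] by simp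
  moreover have "plus_regular (XX - G * G)" by (intro plus_regular_intros plus_regular_basic G)
  \<comment> \<open>The normalization of P makes the coefficients of q^-2 and q^-1 in
    \<open>XX\<close> and G^2 agree.\<close>
  ultimately obtain \<beta> where \<beta>: "XX - G * G = cst \<beta>" using plus_regular_const by blast
  \<comment> \<open>Index 2 is the exponent -1: subtracting b G removes the simple pole left in
    \<open>YY - G * G * G\<close>.\<close>
  define b where "b = fps_nth (y_fps - P * P * P) 2"
  have "qx (YY - G * G * G) 3 (y_fps - P * P * P)" by (rule qx_diff[OF qx_basic(1) P3])
  moreover have "qx (cst b * G) 3 (fps_X ^ 2 * (fps_const b * P))" using qx_raise[OF qx_mult[OF qx_cst P(1)], where k = 2] by simp
  ultimately have "qx (YY - G * G * G - cst b * G) 3 (y_fps - P * P * P - fps_X ^ 2 * (fps_const b * P))" by (rule qx_diff)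
  moreover have "fps_nth (y_fps - P * P * P - fps_X ^ 2 * (fps_const b * P)) i = 0" if "i < 3" for i
  proof -
    have "i = 0 \<or> i = 1 \<or> i = 2" using that by auto
    moreover have "fps_nth (fps_X ^ 2 * (fps_const b * P)) 2 = b" using P(2) by (simp add: fps_X_power_mult_nth)
    moreover have "fps_nth (fps_X ^ 2 * (fps_const b * P)) 0 = 0" "fps_nth (fps_X ^ 2 * (fps_const b * P)) 1 = 0"
      by (simp_all add: fps_X_power_mult_nth)
    ultimately show ?thesis using pp qx_basic(4,5) unfolding b_def by auto
  qed
  ultimately have "qx (YY - G * G * G - cst b * G) 0 (fps_shift 3 (y_fps - P * P * P - fps_X ^ 2 * (fps_const b * P)))"
    using qx_lower[of _ 0 3] by simp
  moreover have "plus_regular (YY - G * G * G - cst b * G)" by (intro plus_regular_intros plus_regular_basic G)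
  ultimately obtain c where c: "YY - G * G * G - cst b * G = cst c" using plus_regular_const by blast
  \<comment> \<open>The coefficients of y^2 - (x^3 + x^2 + 2 x + 1) as a polynomial in G after the
    substitution. The sixth powers cancel and there is no fifth power.\<close>
  define p where "p = [:c ^ 2 + - (\<beta> ^ 3 + \<beta> ^ 2 + 2 * \<beta> + 1), 2 * b * c, b ^ 2 + - (3 * \<beta> ^ 2 + 2 * \<beta> + 2), 2 * c, 2 * b + - (3 * \<beta> + 1):]"
  have x: "XX = G * G + cst \<beta>" using \<beta> by (simp add: algebra_simps)
  have y: "YY = G * G * G + cst b * G + cst c" using c by (simp add: algebra_simps)
  have "ev p G = 0"
    using equation_YY unfolding x y p_def ev_hom power2_eq_square power3_eq_cube cst_hom cst_numeral by algebra
  moreover have "G \<noteq> cst a" for a using pole_imp_not_const[of G 0 P] P by simp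
  ultimately have "p = 0" using algebraic_imp_const by blast
  hence e: "c ^ 2 + - (\<beta> ^ 3 + \<beta> ^ 2 + 2 * \<beta> + 1) = 0" "b ^ 2 + - (3 * \<beta> ^ 2 + 2 * \<beta> + 2) = 0" "2 * c = 0" "2 * b + - (3 * \<beta> + 1) = 0"
    unfolding p_def pCons_eq_0_iff by blast+
  \<comment> \<open>Eliminating b and c leaves a quadratic and the cubic for \<beta>. The Euclidean
    algorithm reduces them to 5 \<beta> = 2 and \<beta>^2 - \<beta> + 3 = 0, and the value of the
    latter at 2/5 is 69/25.\<close>
  have "3 * \<beta> ^ 2 + 2 * \<beta> + 7 = 0" using e(2,4) by algebra
  moreover have "\<beta> ^ 3 + \<beta> ^ 2 + 2 * \<beta> + 1 = 0" using e(1,3) by algebra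
  ultimately have "5 * \<beta> - 2 = 0" "\<beta> ^ 2 - \<beta> + 3 = 0" by algebra+
  hence "(69::complex) = 0" by algebra
  thus False by simp
qed

text \<open>The products x^m and x^m y have pole orders 2 m and 2 m + 3, so each order except 1 is
  available for cancelling a leading term.\<close>

lemma plus_regular_imp_polynomial_aux:
  assumes "plus_regular G" "qx G (int n) P"
  shows "\<exists>p q. G = ev p XX + ev q XX * YY"
  using assms
proof (induction n arbitrary: G P rule: less_induct)
  case (less n)
  note G = less.prems
  have lower: "\<exists>p q. G = ev p XX + ev q XX * YY" if l: "fps_nth P 0 = 0" "n > 0" "plus_regular G" "qx G (int n) P" for G P
  proof -
    obtain m where m: "n = Suc m" using l(2) gr0_conv_Suc by blast
    have "qx G (int m) (fps_shift 1 P)" by (rule qx_lower) (use l m in \<open>auto simp: add.commute\<close>)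
    with less.IH[of m G] l(3) m show ?thesis by blast
  qed
  consider "n = 0" | "n = 1" "fps_nth P 0 = 0" | "n = 1" "fps_nth P 0 \<noteq> 0" | "n \<ge> 2" by linarith
  thus ?case
  proof cases
    case 1
    hence "G = cst (fps_nth P 0)" using plus_regular_const G by simp
    hence "G = ev [:fps_nth P 0:] XX + ev 0 XX * YY" by (simp add: ev_hom)
    thus ?thesis by blast
  next
    case 2
    show ?thesis by (rule lower[OF 2(2) _ G]) (simp add: 2)
  next
    case 3
    \<comment> \<open>Scaling and subtracting a constant brings the expansion into the normalized
      form of \<open>no_simple_pole\<close>.\<close>
    define c where "c = inverse (fps_nth P 0)"
    define e where "e = c * fps_nth P 1"
    define G' where "G' = cst c * G - cst e"
    have "qx (cst c * G) 1 (fps_const c * P)" using qx_mult[OF qx_cst G(2)] 3 by simp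
    moreover have "qx (cst e) 1 (fps_X ^ 1 * fps_const e)" using qx_raise[OF qx_cst, where k = 1] by simp
    ultimately have "qx G' 1 (fps_const c * P - fps_X ^ 1 * fps_const e)" unfolding G'_def by (rule qx_diff)
    moreover have "fps_nth (fps_const c * P - fps_X ^ 1 * fps_const e) 0 = 1" using 3 by (simp add: c_def)
    moreover have "fps_nth (fps_const c * P - fps_X ^ 1 * fps_const e) 1 = 0" by (simp add: e_def)
    moreover have "plus_regular G'" unfolding G'_def by (intro plus_regular_intros G)
    ultimately show ?thesis using no_simple_pole by blast
  next
    case 4
    have x0: "fps_nth (x_fps ^ m) 0 = 1" for m by (induction m) (simp_all add: fps_nth_0_nonzero)
    obtain H Q r s where H: "plus_regular H" "qx H (int n) Q" "fps_nth Q 0 = 1" "H = ev r XX + ev s XX * YY"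
    proof (cases "even n")
      case True
      then obtain m where m: "n = 2 * m" by blast
      have "qx (XX ^ m) (int n) (x_fps ^ m)" using qx_power[OF basic_qx(1), of m] by (simp add: m mult.commute)
      moreover note x0[of m]
      moreover have "XX ^ m = ev (monom 1 m) XX + ev 0 XX * YY" by (simp add: ev_hom)
      ultimately show ?thesis using that[of "XX ^ m"] plus_regular_power[OF plus_regular_basic(1)] by blast
    next
      case False
      then obtain k where k: "n = 2 * k + 1" by (rule oddE)
      define m where "m = k - 1"
      have m: "n = 2 * m + 3" using k 4 by (simp add: m_def)
      have "qx (XX ^ m * YY) (int n) (x_fps ^ m * y_fps)"
        using qx_mult[OF qx_power[OF basic_qx(1), of m] qx_basic(1)] by (simp add: m mult.commute)
      moreover have "fps_nth (x_fps ^ m * y_fps) 0 = 1" by (simp add: x0 qx_basic(4))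
      moreover have "XX ^ m * YY = ev 0 XX + ev (monom 1 m) XX * YY" by (simp add: ev_hom)
      moreover have "plus_regular (XX ^ m * YY)" by (intro plus_regular_intros plus_regular_basic)
      ultimately show ?thesis using that[of "XX ^ m * YY"] by blast
    qed
    define c where "c = fps_nth P 0"
    have cH: "qx (cst c * H) (int n) (fps_const c * Q)" using qx_mult[OF qx_cst H(2)] by simp
    have "\<exists>p q. G - cst c * H = ev p XX + ev q XX * YY"
    proof (rule lower)
      show "qx (G - cst c * H) (int n) (P - fps_const c * Q)" by (rule qx_diff[OF G(2) cH])
      show "plus_regular (G - cst c * H)" by (intro plus_regular_intros G H)
    qed (use H(3) 4 in \<open>simp_all add: c_def\<close>)
    then obtain p q where "G - cst c * H = ev p XX + ev q XX * YY" by blast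
    hence "G = ev p XX + ev q XX * YY + cst c * H" by (simp add: algebra_simps)
    also have "\<dots> = ev (p + smult c r) XX + ev (q + smult c s) XX * YY"
      unfolding H(4) by (simp add: ev_hom algebra_simps)
    finally show ?thesis by blast
  qed
qed

text \<open>At \<infinity> the width is 1, because z \<mapsto> z + 1 comes from
  \<open>Gamma0 92\<close>; the definition of modular functions only provides an expansion in
  q^(1/92).\<close>

lemma modular_q_expansion:
  assumes "G \<in> modular_functions 92"
  obtains n P where "qx G (int n) P"
proof -
  have I: "\<forall>M\<in>Gamma0 92. pullback M G = G" and gr: "\<forall>M. det M = 1 \<longrightarrow> (\<exists>k. growth (pullback M G) k)"
    using assms unfolding modular_functions_growth[OF zero_less_numeral] by auto
  have "mat2 1 0 0 1 \<in> Gamma0 92" "mat2 1 1 0 1 \<in> Gamma0 92" by (simp_all add: Gamma0_def)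
  hence p1: "pullback (mat2 1 1 0 1) G = G" using I by blast
  obtain k where "growth (pullback (mat2 1 0 0 1) G) k" using gr[rule_format, of "mat2 1 0 0 1"] by auto
  hence k: "growth G k" by (simp add: pullback_mat1)
  have per: "eval_mero G (z + of_nat 1) = eval_mero G z" if "z \<in> uhp" for z
    using eval_pullback[of "mat2 1 1 0 1" z G] that p1 by (simp add: mob_def)
  obtain N where "k / (2 * pi) \<le> real N" using real_arch_simple by blast
  hence N: "k * real 1 \<le> 2 * pi * real N" by (simp add: field_simps)
  obtain L where L: "has_q_expansion 1 G L" "\<And>n. n < - int N \<Longrightarrow> fls_nth L n = 0"
    using periodic_growth_imp_q_expansion[OF _ zero_less_one k N] per by metis
  define P where "P = Abs_fps (\<lambda>i. fls_nth L (int i - int N))"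
  have "fls_shift (int N) (fps_to_fls P) = L"
    by (rule fls_eqI) (use L(2) in \<open>auto simp: P_def\<close>)
  with L(1) have "qx G (int N) P" by simp
  thus ?thesis by (rule that)
qed

lemma plus_regular_imp_polynomial:
  assumes "plus_regular G"
  shows "\<exists>p q. G = ev p XX + ev q XX * YY"
proof -
  obtain n P where "qx G (int n) P" using modular_q_expansion[OF plus_functionsD(1)[OF plus_regularD(1)[OF assms]]] .
  thus ?thesis by (rule plus_regular_imp_polynomial_aux[OF assms])
qed

text \<open>In Laurent series at z0 the factor H has positive subdegree or is 0, so m factors
  outweigh a pole of order m. A bound from some m0 on lets one exponent serve several poles.\<close>

lemma clear_pole:
  assumes H: "reg H z0" "eval_mero H z0 = 0" and z0: "z0 \<in> uhp"
  shows "\<exists>m0. \<forall>m\<ge>m0. reg (H ^ m * F) z0"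
proof -
  define lexp where "lexp = (\<lambda>F L. (\<lambda>u. eval_mero F (z0 + u)) has_laurent_expansion L)"
  have lmult: "lexp (F * G) (L * K)" if "lexp F L" "lexp G K" for F G L K
  proof -
    have 1: "(\<lambda>u. eval_mero F (z0 + u) * eval_mero G (z0 + u)) has_laurent_expansion L * K"
      using that unfolding lexp_def by (rule has_laurent_expansion_mult)
    have "eventually (\<lambda>z. eval_mero (F * G) z = eval_mero F z * eval_mero G z) (at z0)"
      by (rule eventually_cosparse_imp_eventually_at[OF eventually_eval_mero_ops(6) z0])
    hence 2: "eventually (\<lambda>u. eval_mero F (z0 + u) * eval_mero G (z0 + u) = eval_mero (F * G) (z0 + u)) (at 0)"
      by (simp add: at_to_0' eventually_filtermap add_ac eq_commute)
    from 1 show ?thesis unfolding lexp_def has_laurent_expansion_cong[OF 2 refl] .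
  qed
  obtain P where "(\<lambda>u. eval_mero H (z0 + u)) has_fps_expansion P" using analytic_at_imp_has_fps_expansion[OF H(1)] by blast
  hence P: "lexp H (fps_to_fls P)" "fps_nth P 0 = 0"
    using has_laurent_expansion_fps has_fps_expansion_imp_0_eq_fps_nth_0 H(2) unfolding lexp_def by fastforce+
  define K where "K = fps_to_fls P"
  have K: "lexp H K" using P(1) by (simp add: K_def)
  have K1: "fls_subdegree K \<ge> 1" if "K \<noteq> 0"
  proof -
    have "fls_nth K (fls_subdegree K) \<noteq> 0" using that by simp
    moreover have "fls_nth K i = 0" if "i \<le> 0" for i using that P(2) by (cases "i = 0") (auto simp: K_def)
    ultimately have "\<not> fls_subdegree K \<le> 0" by blast
    thus ?thesis by simp
  qed
  have "\<exists>L. lexp F L" using eval_mero_mero[of F] z0 unfolding meromorphic_on_def lexp_def by blast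
  then obtain L where L: "lexp F L" by blast
  have one: "lexp 1 1"
  proof -
    have "eventually (\<lambda>z. 1 = eval_mero 1 z) (at z0)"
      by (rule eventually_mono[OF eventually_cosparse_imp_eventually_at[OF eventually_eval_mero_ops(2) z0]]) simp
    hence 2: "eventually (\<lambda>u. 1 = eval_mero 1 (z0 + u)) (at 0)"
      by (simp add: at_to_0' eventually_filtermap add_ac)
    have 1: "(\<lambda>_::complex. 1) has_laurent_expansion 1" by (rule has_laurent_expansion_1)
    from 1 show ?thesis unfolding lexp_def has_laurent_expansion_cong[OF 2 refl] .
  qed
  have Km: "lexp (H ^ m) (K ^ m)" for m
  proof (induction m)
    case (Suc m)
    show ?case unfolding power_Suc by (rule lmult[OF K Suc])
  qed (simp add: one)
  have "reg (H ^ m * F) z0" if m: "m \<ge> nat (- fls_subdegree L)" for m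
  proof -
    have e: "(\<lambda>u. eval_mero (H ^ m * F) (z0 + u)) has_laurent_expansion K ^ m * L" using lmult[OF Km L] by (simp add: lexp_def)
    have "fls_subdegree (K ^ m * L) \<ge> 0"
    proof (cases "K ^ m * L = 0")
      case False
      hence "K ^ m \<noteq> 0" "L \<noteq> 0" by auto
      hence s: "fls_subdegree (K ^ m * L) = int m * fls_subdegree K + fls_subdegree L" by (simp add: fls_subdegree_pow)
      show ?thesis
      proof (cases "m = 0")
        case True
        thus ?thesis using s m by simp
      next
        case m0: False
        hence "K \<noteq> 0" using \<open>K ^ m \<noteq> 0\<close> by auto
        hence "int m * 1 \<le> int m * fls_subdegree K" using K1 by (intro mult_left_mono) auto
        thus ?thesis using s m by linarith
      qed
    next
      case True
      show ?thesis unfolding True by simp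
    qed
    hence "\<not> is_pole (eval_mero (H ^ m * F)) z0" using is_pole_fls_subdegree_iff[OF e] by simp
    thus ?thesis by (rule nicely_meromorphic_on_imp_analytic_at[OF eval_mero_nice z0])
  qed
  thus ?thesis by blast
qed

lemma finite_poles:
  assumes "compact K" "K \<subseteq> uhp"
  shows "finite {z\<in>K. \<not> reg F z}"
proof -
  obtain pts where pts: "pts \<subseteq> uhp" "pts sparse_in uhp" "eval_mero F analytic_on uhp - pts"
    by (rule meromorphic_onE[OF eval_mero_mero[of F]])
  have "reg F z" if "z \<in> K" "z \<notin> pts" for z
    by (rule analytic_on_subset[OF pts(3)]) (use that assms(2) in auto)
  hence "{z\<in>K. \<not> reg F z} \<subseteq> K \<inter> pts" by blast
  moreover have "finite (K \<inter> pts)"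
    by (rule sparse_in_compact_finite[OF sparse_in_subset[OF pts(2) assms(2)] assms(1)])
  ultimately show ?thesis by (rule finite_subset)
qed

lemma ev_plus: "F \<in> plus_functions \<Longrightarrow> ev p F \<in> plus_functions"
proof (induction p)
  case 0
  show ?case by (simp add: ev_hom plus_ops)
next
  case (pCons a p)
  show ?case unfolding ev_hom by (rule plus_ops(3)[OF cst_plus plus_ops(4)[OF pCons(3) pCons(2)[OF pCons(3)]]])
qed

text \<open>
  Modulo $\Gamma_0(92)$ the poles lie in finitely many translates of a compact box, so \<open>XX\<close> takes only finitely
  many values \<open>v\<close> at them.
\<close>
lemma clear_poles:
  assumes G: "G \<in> plus_functions"
  shows "\<exists>d. d \<noteq> 0 \<and> (\<forall>z\<in>uhp. reg (ev d XX * G) z)"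
proof -
  have gr: "\<exists>k. growth (pullback M G) k" if "det M = 1" for M
    using plus_functionsD(1)[OF G] that unfolding modular_functions_growth[OF zero_less_numeral] by blast
  obtain R :: "(int ^ 2 ^ 2) set" where R: "finite R" "\<And>M. M \<in> R \<Longrightarrow> det M = 1" "\<And>M. det M = 1 \<Longrightarrow> \<exists>M0\<in>R. \<exists>A\<in>Gamma0 92. M = A ** M0"
    by (rule finite_coset_reps[of 92]) (simp, rule that)
  have "\<exists>Y. \<forall>z. Im z \<ge> Y \<longrightarrow> reg (pullback M G) z" if "M \<in> R" for M
    using gr[OF R(2)[OF that]] unfolding growth_def by blast
  then obtain Y where Y: "\<And>M z. M \<in> R \<Longrightarrow> Im z \<ge> Y M \<Longrightarrow> reg (pullback M G) z" by metis
  define box where "box = (\<lambda>M. cbox (Complex (- 1 / 2) (1 / 2)) (Complex (1 / 2) (Y M)))"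
  have box: "z \<in> box M \<longleftrightarrow> \<bar>Re z\<bar> \<le> 1 / 2 \<and> 1 / 2 \<le> Im z \<and> Im z \<le> Y M" for z M
    by (auto simp: box_def in_cbox_complex_iff)
  define P where "P = (\<lambda>M. {z\<in>box M. \<not> reg (pullback M G) z})"
  have P: "finite (P M)" for M
    unfolding P_def by (rule finite_poles) (auto simp: box uhp_def, simp add: box_def compact_cbox)
  define V where "V = (\<Union>M\<in>R. eval_mero (pullback M XX) ` P M)"
  have V: "finite V" unfolding V_def using R(1) P by blast
  define h where "h = (\<Prod>v\<in>V. [:- v, 1:])"
  have h0: "h \<noteq> 0" using V by (simp add: h_def)
  define H where "H = ev h XX"
  have Hp: "H = (\<Prod>v\<in>V. XX + cst (- v))" by (simp add: H_def h_def ev_hom cst_hom)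
  have XXr: "reg (pullback M XX) z" if "M \<in> R" "z \<in> uhp" for M z
    by (rule reg_pullback) (use that R(2) basic_eval(2) moebius_in_uhp in auto)
  have HM: "reg (pullback M H) z \<and> eval_mero (pullback M H) z = (\<Prod>v\<in>V. eval_mero (pullback M XX) z + - v)"
    if M: "M \<in> R" and z: "z \<in> uhp" for M z
  proof -
    have d: "det M > 0" using R(2)[OF M] by simp
    have a: "reg (pullback M XX + cst (- v)) z" "eval_mero (pullback M XX + cst (- v)) z = eval_mero (pullback M XX) z + - v" for v
      using reg_add[OF XXr[OF M z] cst(2)[OF z, of "- v"] z] by (simp_all add: cst z)
    have "pullback M H = (\<Prod>v\<in>V. pullback M XX + cst (- v))"
      unfolding Hp by (simp only: pullback_more[OF d] pullback_hom[OF d])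
    thus ?thesis using reg_prod[of V "\<lambda>v. pullback M XX + cst (- v)", OF a(1) z] by (simp only: a)
  qed
  have "\<exists>m0. \<forall>m\<ge>m0. reg (pullback M H ^ m * pullback M G) z" if M: "M \<in> R" and z: "z \<in> P M" for M z
  proof -
    have u: "z \<in> uhp" using z by (auto simp: P_def box uhp_def)
    have "eval_mero (pullback M XX) z \<in> V" using M z by (auto simp: V_def)
    hence "(\<Prod>v\<in>V. eval_mero (pullback M XX) z + - v) = 0"
      by (intro prod_zero[OF V] bexI[of _ "eval_mero (pullback M XX) z"]) simp_all
    thus ?thesis using clear_pole[OF _ _ u] HM[OF M u] by simp
  qed
  then obtain m0 where m0: "\<And>M z m. M \<in> R \<Longrightarrow> z \<in> P M \<Longrightarrow> m \<ge> m0 M z \<Longrightarrow> reg (pullback M H ^ m * pullback M G) z" by metis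
  define m where "m = (\<Sum>M\<in>R. \<Sum>z\<in>P M. m0 M z)"
  have m: "m0 M z \<le> m" if "M \<in> R" "z \<in> P M" for M z
  proof -
    have "m0 M z \<le> (\<Sum>z\<in>P M. m0 M z)" by (rule member_le_sum[OF that(2)]) (use P in auto)
    also have "\<dots> \<le> m" unfolding m_def by (rule member_le_sum[OF that(1)]) (use R(1) in auto)
    finally show ?thesis .
  qed
  define Q where "Q = H ^ m * G"
  have regM: "reg (pullback M Q) z" if M: "M \<in> R" and z: "\<bar>Re z\<bar> \<le> 1 / 2" "1 / 2 \<le> Im z" for M z
  proof -
    have d: "det M > 0" using R(2)[OF M] by simp
    have u: "z \<in> uhp" using z by (simp add: uhp_def)
    have e: "pullback M Q = pullback M H ^ m * pullback M G" unfolding Q_def by (simp only: pullback_hom[OF d] pullback_more[OF d])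
    show ?thesis
    proof (cases "z \<in> P M")
      case True
      show ?thesis unfolding e by (rule m0[OF M True m[OF M True]])
    next
      case False
      have "reg (pullback M G) z"
      proof (cases "Im z \<le> Y M")
        case True
        thus ?thesis using False z by (simp add: P_def box)
      next
        case 2: False
        thus ?thesis by (intro Y[OF M]) simp
      qed
      thus ?thesis unfolding e using reg_mult[OF conjunct2[OF reg_power[OF conjunct1[OF HM[OF M u]] u]] _ u] by blast
    qed
  qed
  have "XX \<in> plus_functions" by (rule plus_regularD(1)[OF plus_regular_basic(1)])
  hence "H \<in> plus_functions" unfolding H_def by (rule ev_plus)
  hence "Q \<in> plus_functions" unfolding Q_def by (rule plus_ops(4)[OF plus_ops(9) G])
  hence inv: "\<And>A. A \<in> Gamma0 92 \<Longrightarrow> pullback A Q = Q" using plus_functionsD(1) by (auto simp: modular_functions_def)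
  have "reg Q z" if z: "z \<in> uhp" for z
  proof -
    obtain M where M: "det M = 1" "Im (moebius_mat M z) \<ge> 1 / 2" "\<bar>Re (moebius_mat M z)\<bar> \<le> 1 / 2"
      by (rule fundamental_domain[OF z]) (rule that)
    \<comment> \<open>M moves z into the strip and \<open>adj2 M\<close> moves it back; modulo
      \<open>Gamma0 92\<close> the latter is one of the finitely many representatives, for which
      \<open>regM\<close> applies.\<close>
    obtain M0 A where A: "M0 \<in> R" "A \<in> Gamma0 92" "adj2 M = A ** M0" using R(3)[OF adj2_mult(3)[OF M(1)]] by blast
    have "pullback (adj2 M) Q = pullback M0 Q" unfolding A(3) by (rule pullback_coset[OF inv A(2) R(2)[OF A(1)]])
    hence "reg (pullback (adj2 M) Q) (moebius_mat M z)" using regM[OF A(1) M(3,2)] by simp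
    hence "reg (pullback M (pullback (adj2 M) Q)) z" using M(1) by (intro reg_pullback[OF _ z]) simp_all
    thus ?thesis unfolding pullback_adj2(1)[OF M(1)] .
  qed
  moreover have "Q = ev (h ^ m) XX * G" by (simp add: Q_def H_def ev_hom)
  moreover have "h ^ m \<noteq> 0" using h0 by simp
  ultimately show ?thesis by blast
qed

text \<open>At the cusps with c not divisible by 4 the function x vanishes, so a power of x
  compensates the growth there. Finitely many representatives make one power sufficient.\<close>

lemma clear_denominators:
  assumes G: "G \<in> plus_functions"
  shows "\<exists>d. d \<noteq> 0 \<and> plus_regular (ev d XX * G)"
proof -
  have XXp: "XX \<in> plus_functions" by (rule plus_regularD(1)[OF plus_regular_basic(1)])
  obtain d where d: "d \<noteq> 0" "\<And>z. z \<in> uhp \<Longrightarrow> reg (ev d XX * G) z" using clear_poles[OF G] by blast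
  define G1 where "G1 = ev d XX * G"
  have G1: "G1 \<in> plus_functions" unfolding G1_def by (rule plus_ops(4)[OF ev_plus[OF XXp] G])
  obtain R :: "(int ^ 2 ^ 2) set" where R: "finite R" "\<And>M. M \<in> R \<Longrightarrow> det M = 1" "\<And>M. det M = 1 \<Longrightarrow> \<exists>M0\<in>R. \<exists>A\<in>Gamma0 92. M = A ** M0"
    by (rule finite_coset_reps[of 92]) (simp, rule that)
  have "\<exists>N. \<forall>n\<ge>N. growth (pullback M (XX ^ n * G1)) 0" if M: "M \<in> R" "\<not> 4 dvd M $ 2 $ 1" for M
  proof -
    obtain s where s: "growth (pullback M XX) s" "s < 0"
      by (rule basic_cusp_growth[OF R(2)[OF M(1)]]) (use M(2) that in blast)
    obtain k where k: "growth (pullback M G1) k"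
      using plus_functionsD(1)[OF G1] R(2)[OF M(1)] unfolding modular_functions_growth[OF zero_less_numeral] by blast
    obtain N where N: "k / (- s) \<le> real N" using real_arch_simple by blast
    have "growth (pullback M (XX ^ n * G1)) 0" if n: "n \<ge> N" for n
    proof -
      have "k / (- s) \<le> real n" using N n by linarith
      hence "k \<le> real n * (- s)" using s(2) by (simp add: field_simps)
      hence le: "real n * s + k \<le> 0" by simp
      have dM: "det M > 0" using R(2)[OF M(1)] by simp
      have "pullback M (XX ^ n * G1) = pullback M XX ^ n * pullback M G1" by (simp only: pullback_hom[OF dM] pullback_more[OF dM])
      thus ?thesis using growth_mono[OF growth_mult[OF growth_power[OF s(1)] k] le] by simp
    qed
    thus ?thesis by blast
  qed
  then obtain N where N: "\<And>M n. M \<in> R \<Longrightarrow> \<not> 4 dvd M $ 2 $ 1 \<Longrightarrow> n \<ge> N M \<Longrightarrow> growth (pullback M (XX ^ n * G1)) 0" by metis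
  define n where "n = (\<Sum>M\<in>R. N M)"
  have n: "N M \<le> n" if "M \<in> R" for M unfolding n_def by (rule member_le_sum[OF that]) (use R(1) in auto)
  define Q where "Q = XX ^ n * G1"
  have Q: "Q \<in> plus_functions" unfolding Q_def by (rule plus_ops(4)[OF plus_ops(9)[OF XXp] G1])
  hence inv: "\<And>A. A \<in> Gamma0 92 \<Longrightarrow> pullback A Q = Q" using plus_functionsD(1) by (auto simp: modular_functions_def)
  have "plus_regular Q"
  proof (rule plus_regularI[OF Q])
    show "reg Q z" if z: "z \<in> uhp" for z
      unfolding Q_def G1_def using reg_mult[OF conjunct2[OF reg_power[OF basic_eval(2)[OF z] z]] d(2)[OF z] z] by blast
    show "growth (pullback M Q) 0" if M: "det M = 1" "\<not> 4 dvd M $ 2 $ 1" for M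
    proof -
      obtain M0 A where A: "M0 \<in> R" "A \<in> Gamma0 92" "M = A ** M0" using R(3)[OF M(1)] by blast
      have e: "pullback M Q = pullback M0 Q" unfolding A(3) by (rule pullback_coset[OF inv A(2) R(2)[OF A(1)]])
      \<comment> \<open>The condition on the lower left entry modulo 4 passes to the representative,
        since A is lower left divisible by 92.\<close>
      have "M $ 2 $ 1 = A $ 2 $ 1 * M0 $ 1 $ 1 + A $ 2 $ 2 * M0 $ 2 $ 1"
        by (simp add: A(3) matrix_matrix_mult_def sum_2)
      moreover have "4 dvd A $ 2 $ 1" using A(2) dvd_trans[of "4::int" 92 "A $ 2 $ 1"] by (simp add: Gamma0_def)
      ultimately have "\<not> 4 dvd M0 $ 2 $ 1" using M(2) by auto
      thus ?thesis unfolding e unfolding Q_def using N[OF A(1) _ n[OF A(1)]] by blast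
    qed
  qed
  moreover have "Q = ev (monom 1 n * d) XX * G" by (simp add: Q_def G1_def ev_hom)
  moreover have "monom 1 n * d \<noteq> 0" using d(1) by simp
  ultimately show ?thesis by blast
qed

lemma plus_functions_rational:
  assumes "G \<in> plus_functions"
  shows "\<exists>d p q. d \<noteq> 0 \<and> ev d XX * G = ev p XX + ev q XX * YY"
  using clear_denominators[OF assms] plus_regular_imp_polynomial by blast

subsection \<open>Descent to the rational numbers\<close>

abbreviation rv :: "rat poly \<Rightarrow> mero_uhp \<Rightarrow> mero_uhp" where "rv r F \<equiv> poly (map_poly of_rat r) F"

lemma rv_ev: "rv r F = ev (map_poly of_rat r) F"
  unfolding ev_def by (subst map_poly_map_poly) (simp_all add: cst_hom o_def cst_of_rat)

lemma poly_eq_sum_upto: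
  fixes p :: "'a :: comm_semiring_1 poly"
  assumes "degree p \<le> N"
  shows "poly p x = (\<Sum>i\<le>N. coeff p i * x ^ i)"
  unfolding poly_altdef by (rule sum.mono_neutral_left) (use assms in \<open>auto simp: coeff_eq_0\<close>)

text \<open>The functional is applied to all coefficients of the polynomials \<open>p j\<close>.
  Normalizing it at the leading coefficient of \<open>p 0\<close> keeps \<open>r 0\<close>
  nonzero.\<close>

lemma rational_relation:
  fixes b :: "nat \<Rightarrow> mero_uhp"
  assumes b: "\<And>j. j < m \<Longrightarrow> b j \<in> X0_function_field 92" and m: "m > 0"
    and zero: "(\<Sum>j<m. ev (p j) XX * b j) = 0" and p0: "p 0 \<noteq> 0"
  obtains r where "r 0 \<noteq> 0" "(\<Sum>j<m. rv (r j) XX * b j) = 0"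
proof -
  have "lead_coeff (p 0) \<noteq> 0" using p0 by simp
  then obtain \<phi> where \<phi>: "\<And>a b. \<phi> (a + b) = \<phi> a + \<phi> b" "\<And>r a. \<phi> (of_rat r * a) = r * \<phi> a" "\<phi> (lead_coeff (p 0)) = 1"
    by (rule rat_functional) blast
  have \<phi>0: "\<phi> 0 = 0" using \<phi>(1)[of 0 0] by simp
  define N where "N = (\<Sum>j<m. degree (p j))"
  have N: "degree (p j) \<le> N" if "j < m" for j
    unfolding N_def by (rule member_le_sum) (use that in auto)
  define r where "r = (\<lambda>j. map_poly \<phi> (p j))"
  have X: "XX \<in> X0_function_field 92"
    using basic_qx(1) basic_modular(1) rational_fls_fps[OF fps_rational(1)] unfolding X0_function_field_alt by blast
  note K = is_subfieldD[OF is_subfield_X0_function_field[of 92, OF zero_less_numeral]]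
  have B: "\<exists>L. has_q_expansion 1 (XX ^ snd ji * b (fst ji)) L \<and> rational_fls L" if "ji \<in> {..<m} \<times> {..N}" for ji
  proof -
    have "XX ^ snd ji * b (fst ji) \<in> X0_function_field 92" by (rule K(4)[OF K(9)[OF X] b]) (use that in auto)
    thus ?thesis unfolding X0_function_field_alt by blast
  qed
  have e: "ev (p j) XX = (\<Sum>i\<le>N. cst (coeff (p j) i) * XX ^ i)" if "j < m" for j
    unfolding ev_def using poly_eq_sum_upto[OF order.trans[OF map_poly_degree_leq N[OF that]], of cst XX]
    by (simp add: coeff_map_poly cst_hom)
  have f: "rv (r j) XX = (\<Sum>i\<le>N. of_rat (\<phi> (coeff (p j) i)) * XX ^ i)" if "j < m" for j
  proof -
    have "degree (r j) \<le> N" unfolding r_def by (rule order.trans[OF map_poly_degree_leq N[OF that]])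
    from poly_eq_sum_upto[OF order.trans[OF map_poly_degree_leq this], of of_rat XX] show ?thesis
      by (simp add: coeff_map_poly r_def \<phi>0)
  qed
  have "(\<Sum>ji\<in>{..<m} \<times> {..N}. cst (coeff (p (fst ji)) (snd ji)) * (XX ^ snd ji * b (fst ji))) = (\<Sum>j<m. ev (p j) XX * b j)"
    by (simp add: sum.cartesian_product' e sum_distrib_right mult.assoc)
  hence z: "(\<Sum>ji\<in>{..<m} \<times> {..N}. cst (coeff (p (fst ji)) (snd ji)) * (XX ^ snd ji * b (fst ji))) = 0" using zero by simp
  have "(\<Sum>ji\<in>{..<m} \<times> {..N}. of_rat (\<phi> (coeff (p (fst ji)) (snd ji))) * (XX ^ snd ji * b (fst ji))) = 0"
    by (rule rational_descent[OF _ B z \<phi>(1,2)]) auto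
  moreover have "(\<Sum>ji\<in>{..<m} \<times> {..N}. of_rat (\<phi> (coeff (p (fst ji)) (snd ji))) * (XX ^ snd ji * b (fst ji))) = (\<Sum>j<m. rv (r j) XX * b j)"
    by (simp add: sum.cartesian_product' f sum_distrib_right mult.assoc)
  ultimately have "(\<Sum>j<m. rv (r j) XX * b j) = 0" by simp
  moreover have "r 0 \<noteq> 0"
  proof
    assume "r 0 = 0"
    hence "coeff (r 0) (degree (p 0)) = 0" by simp
    thus False using \<phi>(3) \<phi>0 by (simp add: r_def coeff_map_poly)
  qed
  ultimately show ?thesis using that by blast
qed

lemma rv_in_subfield:
  assumes "is_subfield L" "F \<in> L"
  shows "rv r F \<in> L"
proof (induction r)
  case 0
  show ?case using is_subfieldD(1)[OF assms(1)] by simp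
next
  case (pCons a r)
  have "rv (pCons a r) F = of_rat a + F * rv r F" by (simp add: map_poly_pCons)
  thus ?case using is_subfieldD(3,4)[OF assms(1)] of_rat_in_subfield[OF assms(1)] assms(2) pCons(2) by metis
qed

lemma map_of_rat_eq_0_iff: "map_poly of_rat r = (0 :: complex poly) \<longleftrightarrow> r = 0"
  by (simp add: poly_eq_iff coeff_map_poly)

text \<open>The rational relation can be solved for \<open>b 0\<close>, because a nonzero polynomial
  in the transcendental function x is nonzero.\<close>

lemma in_subfield_of_relation:
  fixes b :: "nat \<Rightarrow> mero_uhp"
  assumes L: "is_subfield L" "XX \<in> L" and b: "\<And>j. j < m \<Longrightarrow> b j \<in> X0_function_field 92" "\<And>j. 0 < j \<Longrightarrow> j < m \<Longrightarrow> b j \<in> L"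
    and m: "m > 0" and zero: "(\<Sum>j<m. ev (p j) XX * b j) = 0" and p0: "p 0 \<noteq> 0"
  shows "b 0 \<in> L"
proof -
  obtain r where r: "r 0 \<noteq> 0" "(\<Sum>j<m. rv (r j) XX * b j) = 0"
    by (rule rational_relation[OF b(1) m zero p0]) (assumption, rule that)
  have nz: "rv (r 0) XX \<noteq> 0" using XX_transcendental[of "map_poly of_rat (r 0)"] r(1) by (auto simp: rv_ev map_of_rat_eq_0_iff)
  note K = is_subfieldD[OF L(1)]
  have S: "(\<Sum>j\<in>{1..<m}. rv (r j) XX * b j) \<in> L"
  proof -
    have "(\<Sum>j\<in>A. rv (r j) XX * b j) \<in> L" if "finite A" "A \<subseteq> {1..<m}" for A
      using that
    proof (induction A rule: finite_induct)
      case (insert j A)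
      have "rv (r j) XX * b j \<in> L" using insert.prems by (intro K(4) rv_in_subfield[OF L] b(2)) auto
      thus ?case using insert K(3) by simp
    qed (simp add: K(1))
    thus ?thesis by simp
  qed
  have "{..<m} = insert 0 {1..<m}" using m by auto
  hence "rv (r 0) XX * b 0 + (\<Sum>j\<in>{1..<m}. rv (r j) XX * b j) = 0" using r(2) by simp
  hence "rv (r 0) XX * b 0 = - (\<Sum>j\<in>{1..<m}. rv (r j) XX * b j)" by (rule eq_neg_iff_add_eq_0[THEN iffD2])
  hence "b 0 = - (\<Sum>j\<in>{1..<m}. rv (r j) XX * b j) / rv (r 0) XX" using nz by (simp add: field_simps)
  moreover have "- (\<Sum>j\<in>{1..<m}. rv (r j) XX * b j) / rv (r 0) XX \<in> L"
    by (rule K(8)[OF K(5)[OF S] rv_in_subfield[OF L]])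
  ultimately show ?thesis by simp
qed

lemmas X0_ops = is_subfieldD[OF is_subfield_X0_function_field[of 92, OF zero_less_numeral]]

lemma generators_in_X0: "XX \<in> X0_function_field 92" "YY \<in> X0_function_field 92" "TT \<in> X0_function_field 92"
proof -
  have AAm: "AA \<in> modular_functions 92" by (rule plus_functionsD(1)[OF plus_regularD(1)[OF plus_regular_basic(2)]])
  show X: "XX \<in> X0_function_field 92"
    using basic_qx(1) basic_modular(1) rational_fls_fps[OF fps_rational(1)] unfolding X0_function_field_alt by blast
  have A: "AA \<in> X0_function_field 92"
    using basic_qx(2) AAm rational_fls_fps[OF fps_rational(2)] unfolding X0_function_field_alt by blast
  have K: "KK \<in> X0_function_field 92"
    using basic_qx(3) basic_modular(3) rational_fls_fps[OF fps_rational(3)] unfolding X0_function_field_alt by blast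
  show "YY \<in> X0_function_field 92" unfolding YY_def by (rule X0_ops(3)[OF X0_ops(3)[OF A X0_ops(2)] X])
  show "TT \<in> X0_function_field 92" unfolding TT_def by (rule X0_ops(3)[OF K X0_ops(4)[OF X0_ops(10) X0_ops(6)[OF K]]])
qed

lemma X0_modular: "F \<in> X0_function_field 92 \<Longrightarrow> F \<in> modular_functions 92"
  by (simp add: X0_function_field_def)

lemma ev_uminus: "ev (- p) F = - ev p F"
  using ev_hom(3)[of p "- p" F] ev_hom(1)[of F] by (simp add: eq_neg_iff_add_eq_0 add.commute)

lemma invariants_eq: "{f \<in> X0_function_field 92. atkin_lehner 92 23 f = f} = rat_adjoin {XX, YY}"
proof
  show "{f \<in> X0_function_field 92. atkin_lehner 92 23 f = f} \<subseteq> rat_adjoin {XX, YY}"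
  proof
    fix F assume "F \<in> {f \<in> X0_function_field 92. atkin_lehner 92 23 f = f}"
    hence F: "F \<in> X0_function_field 92" "atkin_lehner 92 23 F = F" by auto
    hence "F \<in> plus_functions" using atkin_lehner_w(1)[OF X0_modular[OF F(1)]] X0_modular[OF F(1)] by (simp add: plus_functions_def)
    then obtain d p q where d: "d \<noteq> 0" "ev d XX * F = ev p XX + ev q XX * YY" using plus_functions_rational by blast
    \<comment> \<open>The identity d F = p + q y is read as a linear relation among F, 1 and y, with
      F at index 0 to be solved for.\<close>
    define b where "b = (\<lambda>j::nat. if j = 0 then F else if j = 1 then 1 else YY :: mero_uhp)"
    define c where "c = (\<lambda>j::nat. if j = 0 then - d else if j = 1 then p else q)"
    have z: "(\<Sum>j<3. ev (c j) XX * b j) = 0" using d(2) by (simp add: numeral_eq_Suc b_def c_def ev_uminus)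
    have "b 0 \<in> rat_adjoin {XX, YY}"
    proof (rule in_subfield_of_relation[OF is_subfield_rat_adjoin _ _ _ _ z])
      show "b j \<in> X0_function_field 92" for j using F(1) generators_in_X0 X0_ops(2) by (simp add: b_def)
      show "b j \<in> rat_adjoin {XX, YY}" if "0 < j" for j
        using that rat_adjoin_superset[of "{XX, YY}"] is_subfieldD(2)[OF is_subfield_rat_adjoin[of "{XX, YY}"]] by (simp add: b_def)
    qed (use d(1) rat_adjoin_superset[of "{XX, YY}"] in \<open>auto simp: c_def\<close>)
    thus "F \<in> rat_adjoin {XX, YY}" by (simp add: b_def)
  qed
  have eq: "{f \<in> X0_function_field 92. atkin_lehner 92 23 f = f} = {f \<in> X0_function_field 92. w f = f}"
    using atkin_lehner_w(1)[OF X0_modular] by auto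
  show "rat_adjoin {XX, YY} \<subseteq> {f \<in> X0_function_field 92. atkin_lehner 92 23 f = f}"
    unfolding eq
  proof (rule rat_adjoin_subset)
    show "is_subfield {f \<in> X0_function_field 92. w f = f}"
      unfolding is_subfield_def using X0_ops(1-6) by (simp add: w_hom)
    show "{XX, YY} \<subseteq> {f \<in> X0_function_field 92. w f = f}"
      using generators_in_X0 basic_w(1) w_basic(3) by simp
  qed
qed

lemma TT_sq_poly:
  obtains R where "R \<noteq> 0" "ev R XX = TT ^ 2"
proof
  define R where "R = [:3, 1:] ^ 2 * [:8, 4, 4, 1:] * [:8, 20, 28, 25, 14, 5, 1 :: complex:]"
  show "R \<noteq> 0"
    by (simp only: R_def mult_eq_0_iff power_eq_0_iff pCons_eq_0_iff one_neq_zero simp_thms)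
  show "ev R XX = TT ^ 2" unfolding R_def equation_TT ev_hom cst_hom cst_numeral by algebra
qed

lemma TT_nonzero: "TT \<noteq> 0"
proof
  obtain R where R: "R \<noteq> 0" "ev R XX = TT ^ 2" by (rule TT_sq_poly)
  assume "TT = 0"
  thus False using XX_transcendental[of R] R by simp
qed

lemma function_field_eq: "X0_function_field 92 = rat_adjoin {XX, YY, TT}"
proof
  show "rat_adjoin {XX, YY, TT} \<subseteq> X0_function_field 92"
    by (rule rat_adjoin_subset[OF is_subfield_X0_function_field]) (use generators_in_X0 in auto)
  show "X0_function_field 92 \<subseteq> rat_adjoin {XX, YY, TT}"
  proof
    fix F assume F: "F \<in> X0_function_field 92"
    note Fm = X0_modular[OF F]
    \<comment> \<open>F is half the sum of F + w F and F - w F. The second part is anti-invariant,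
      and multiplication by the anti-invariant t makes it invariant.\<close>
    have "F + w F \<in> modular_functions 92" "(F - w F) * TT \<in> modular_functions 92"
      using Fm w_modular[OF Fm] X0_modular[OF generators_in_X0(3)] by (simp_all add: modular_ops)
    hence ab: "F + w F \<in> plus_functions" "(F - w F) * TT \<in> plus_functions"
      unfolding plus_functions_def by (simp_all add: w_hom w_w w_basic(5) add.commute algebra_simps)
    obtain d p q where d: "d \<noteq> 0" "ev d XX * (F + w F) = ev p XX + ev q XX * YY"
      using plus_functions_rational[OF ab(1)] by blast
    obtain e r s where e: "e \<noteq> 0" "ev e XX * ((F - w F) * TT) = ev r XX + ev s XX * YY"
      using plus_functions_rational[OF ab(2)] by blast
    obtain R where R: "R \<noteq> 0" "ev R XX = TT ^ 2" by (rule TT_sq_poly)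
    define b where "b = (\<lambda>j::nat. if j = 0 then F else if j = 1 then 1 else if j = 2 then YY else if j = 3 then TT else YY * TT)"
    \<comment> \<open>With R = t^2 one has 2 d e R F = e R d (F + w F) + d e (F - w F) t * t. Both
      parts are known up to polynomial denominators, which gives a relation among F, 1, y, t and y
      t.\<close>
    define c where "c = (\<lambda>j::nat. if j = 0 then smult (-2) (d * e * R) else if j = 1 then e * R * p else if j = 2 then e * R * q
      else if j = 3 then d * r else d * s)"
    have "(\<Sum>j<5. ev (c j) XX * b j) = - (cst 2 * (ev d XX * ev e XX * ev R XX) * F) + ev e XX * ev R XX * (ev p XX + ev q XX * YY)
        + ev d XX * (ev r XX + ev s XX * YY) * TT"
      by (simp add: numeral_eq_Suc b_def c_def ev_hom ev_uminus algebra_simps)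
    also have "\<dots> = 0"
      unfolding d(2)[symmetric] e(2)[symmetric] R(2) cst_hom cst_numeral by algebra
    finally have z: "(\<Sum>j<5. ev (c j) XX * b j) = 0" .
    have "b 0 \<in> rat_adjoin {XX, YY, TT}"
    proof (rule in_subfield_of_relation[OF is_subfield_rat_adjoin _ _ _ _ z])
      show "b j \<in> X0_function_field 92" for j using F generators_in_X0 by (simp add: b_def X0_ops)
      show "b j \<in> rat_adjoin {XX, YY, TT}" if "0 < j" for j
        using that rat_adjoin_superset[of "{XX, YY, TT}"] is_subfieldD(2,4)[OF is_subfield_rat_adjoin[of "{XX, YY, TT}"]] by (simp add: b_def)
    qed (use d(1) e(1) R(1) rat_adjoin_superset[of "{XX, YY, TT}"] in \<open>auto simp: c_def\<close>)
    thus "F \<in> rat_adjoin {XX, YY, TT}" by (simp add: b_def)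
  qed
qed

subsection \<open>The ideal of relations\<close>

text \<open>A relation gives p^2 = q^2 (x^3 + x^2 + 2 x + 1) for polynomials, impossible for nonzero
  q because the degrees have different parity.\<close>

lemma linear_independent_1_y:
  assumes "ev p XX + ev q XX * YY = 0"
  shows "p = 0 \<and> q = 0"
proof -
  have "ev (p * p + - (q * q * [:1, 2, 1, 1:])) XX = ev (p * p) XX + ev (smult (-1) (q * q * [:1, 2, 1, 1:])) XX"
    by (simp add: ev_hom(3))
  also have "\<dots> = 0"
    unfolding ev_hom cst_hom cst_numeral using assms equation_YY by algebra
  finally have "p * p + - (q * q * [:1, 2, 1, 1:]) = 0" by (rule XX_transcendental)
  hence eq: "p * p = q * q * [:1, 2, 1, 1:]" by (simp only: add_eq_0_iff2 minus_minus)
  have "q = 0"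
  proof (rule ccontr)
    assume q: "q \<noteq> 0"
    hence "q * q * [:1, 2, 1, 1:] \<noteq> 0" by (simp only: mult_eq_0_iff pCons_eq_0_iff one_neq_zero simp_thms)
    hence p: "p \<noteq> 0" using eq by auto
    have "degree (p * p) = 2 * degree p" using p by (simp add: degree_mult_eq)
    moreover have "degree (q * q * [:1, 2, 1, 1:]) = 2 * degree q + 3" using q by (simp add: degree_mult_eq del: mult_pCons_right)
    ultimately have "2 * degree p = 2 * degree q + 3" using eq by simp
    thus False by presburger
  qed
  thus ?thesis using eq by simp
qed

text \<open>Applied to T^2 - g over Q[X][Y], then to Y^2 - f over Q[X]; monic divisors permit this
  over any commutative ring.\<close>

lemma divide_by_monic_quadratic:
  fixes q :: "'a :: comm_ring_1"
  shows "\<exists>B s0 s1. R = B * [:- q, 0, 1:] + [:s0, s1:]"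
proof (induction R)
  case 0
  show ?case by (intro exI[of _ 0]) simp
next
  case (pCons a R)
  then obtain B s0 s1 where R: "R = B * [:- q, 0, 1:] + [:s0, s1:]" by blast
  have gen: "u + X * (B * Q + s) = (X * B + c) * Q + (u + X * s - c * Q)" for u X B Q s c :: "'a poly"
    by (simp add: algebra_simps)
  have "pCons a R = [:a:] + [:0, 1:] * R" by simp
  also have "\<dots> = ([:0, 1:] * B + [:s1:]) * [:- q, 0, 1:] + ([:a:] + [:0, 1:] * [:s0, s1:] - [:s1:] * [:- q, 0, 1:])"
    unfolding R by (rule gen)
  also have "[:a:] + [:0, 1:] * [:s0, s1:] - [:s1:] * [:- q, 0, 1:] = [:a + s1 * q, s0:]" by simp
  finally show ?case by blast
qed

lemma eval3_more:
  fixes x y t :: "'a :: field_char_0"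
  shows "eval3 0 x y t = 0" "eval3 (numeral k) x y t = numeral k" "eval3 (P - Q) x y t = eval3 P x y t - eval3 Q x y t"
    "eval3 (P ^ n) x y t = eval3 P x y t ^ n"
proof -
  show z: "eval3 0 x y t = 0" using eval3_hom(4)[of 0 0 x y t] by simp
  have "eval3 (of_nat m) x y t = of_nat m" for m by (induction m) (simp_all add: z eval3_hom)
  from this[of "numeral k"] show "eval3 (numeral k) x y t = numeral k" by simp
  show "eval3 (P - Q) x y t = eval3 P x y t - eval3 Q x y t" using eval3_hom(4)[of "P - Q" Q x y t] by simp
  show "eval3 (P ^ n) x y t = eval3 P x y t ^ n" by (induction n) (simp_all add: eval3_hom)
qed

lemma eval3_bilinear:
  "eval3 [:[:r0, r1:], [:r2, r3:]:] x y t =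
     poly (map_poly of_rat r0) x + y * poly (map_poly of_rat r1) x + t * (poly (map_poly of_rat r2) x + y * poly (map_poly of_rat r3) x)"
  by (simp add: eval3_def map_poly_pCons)

lemma constant_hom:
  "[:[:a:]:] + [:[:b:]:] = [:[:a + b:]:]" "[:[:a:]:] * [:[:b:]:] = [:[:a * b:]:]" "[:[:a:]:] ^ n = [:[:a ^ n:]:]"
  "(1 :: 'a poly poly) = [:[:1:]:]" "(numeral k :: 'a poly poly) = [:[:numeral k:]:]" for a b :: "'a :: comm_ring_1"
  by (induction n) (simp_all add: one_pCons numeral_poly)

text \<open>Two divisions leave a remainder r0 + r1 Y + T (r2 + r3 Y). The involution separates its
  two halves, and the independence of 1 and y over the rational functions of x makes all four
  coefficients vanish.\<close>

lemma relation_ideal: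
  "{R. eval3 R XX YY TT = 0} = {A * (varY ^ 2 - (varX ^ 3 + varX ^ 2 + 2 * varX + 1)) +
     B * (varT ^ 2 - (3 + varX) ^ 2 * (8 + 4 * varX + 4 * varX ^ 2 + varX ^ 3) *
        (8 + 20 * varX + 28 * varX ^ 2 + 25 * varX ^ 3 + 14 * varX ^ 4 + 5 * varX ^ 5 + varX ^ 6)) |A B. True}"
  (is "_ = {A * ?P + B * ?Q |A B. True}")
proof
  have PQ: "eval3 ?P XX YY TT = 0" "eval3 ?Q XX YY TT = 0"
    unfolding eval3_hom eval3_more equation_YY equation_TT by simp_all
  show "{A * ?P + B * ?Q |A B. True} \<subseteq> {R. eval3 R XX YY TT = 0}"
    using PQ by (auto simp only: mem_Collect_eq eval3_hom mult_zero_right add_0)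
  define X where "X = [:0, 1 :: rat:]"
  define f where "f = X ^ 3 + X ^ 2 + 2 * X + 1"
  define g where "g = (3 + X) ^ 2 * (8 + 4 * X + 4 * X ^ 2 + X ^ 3) *
        (8 + 20 * X + 28 * X ^ 2 + 25 * X ^ 3 + 14 * X ^ 4 + 5 * X ^ 5 + X ^ 6)"
  have vX: "varX = [:[:X:]:]" by (simp add: varX_def X_def)
  have fg: "varX ^ 3 + varX ^ 2 + 2 * varX + 1 = [:[:f:]:]"
    "(3 + varX) ^ 2 * (8 + 4 * varX + 4 * varX ^ 2 + varX ^ 3) *
        (8 + 20 * varX + 28 * varX ^ 2 + 25 * varX ^ 3 + 14 * varX ^ 4 + 5 * varX ^ 5 + varX ^ 6) = [:[:g:]:]"
    unfolding f_def g_def vX by (simp_all only: constant_hom)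
  have P: "?P = [:[:- f, 0, 1:]:]" unfolding fg(1) by (simp add: varY_def power2_eq_square)
  have Q: "?Q = [:- [:g:], 0, 1:]" unfolding fg(2) by (simp add: varT_def power2_eq_square)
  show "{R. eval3 R XX YY TT = 0} \<subseteq> {A * ?P + B * ?Q |A B. True}"
  proof
    fix R assume "R \<in> {R. eval3 R XX YY TT = 0}"
    hence R0: "eval3 R XX YY TT = 0" by simp
    obtain B s0 s1 where B: "R = B * [:- [:g:], 0, 1:] + [:s0, s1:]" using divide_by_monic_quadratic by blast
    obtain C0 r0 r1 where C0: "s0 = C0 * [:- f, 0, 1:] + [:r0, r1:]" using divide_by_monic_quadratic by blast
    obtain C1 r2 r3 where C1: "s1 = C1 * [:- f, 0, 1:] + [:r2, r3:]" using divide_by_monic_quadratic by blast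
    have "[:s0, s1:] = [:C0, C1:] * [:[:- f, 0, 1:]:] + [:[:r0, r1:], [:r2, r3:]:]"
      unfolding C0 C1 by (simp add: mult.commute)
    hence R: "R = [:C0, C1:] * ?P + B * ?Q + [:[:r0, r1:], [:r2, r3:]:]"
      unfolding P Q B by (simp only: add_ac)
    have "eval3 R XX YY TT = eval3 [:[:r0, r1:], [:r2, r3:]:] XX YY TT"
      unfolding R eval3_hom(4,5) PQ by simp
    hence z: "rv r0 XX + YY * rv r1 XX + TT * (rv r2 XX + YY * rv r3 XX) = 0" using R0 by (simp add: eval3_bilinear)
    have wr: "w (rv r XX) = rv r XX" for r
      unfolding rv_ev using ev_plus[OF plus_regularD(1)[OF plus_regular_basic(1)]] plus_functionsD(2) by blast
    \<comment> \<open>Only t changes sign under the involution, so the sum and the difference with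
      the original equation isolate the two halves.\<close>
    have "w (rv r0 XX + YY * rv r1 XX + TT * (rv r2 XX + YY * rv r3 XX)) = 0" unfolding z by (simp add: w_hom)
    hence z': "rv r0 XX + YY * rv r1 XX - TT * (rv r2 XX + YY * rv r3 XX) = 0" by (simp add: w_hom wr w_basic)
    have "2 * (rv r0 XX + rv r1 XX * YY) = 0" using z z' by algebra
    hence a: "rv r0 XX + rv r1 XX * YY = 0" by (simp only: mult_eq_0_iff numeral_neq_zero simp_thms)
    have "2 * TT * (rv r2 XX + rv r3 XX * YY) = 0" using z z' by algebra
    hence b: "rv r2 XX + rv r3 XX * YY = 0" using TT_nonzero by (simp only: mult_eq_0_iff numeral_neq_zero simp_thms)
    have "r0 = 0 \<and> r1 = 0" "r2 = 0 \<and> r3 = 0"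
      using linear_independent_1_y a b unfolding rv_ev map_of_rat_eq_0_iff[symmetric] by blast+
    hence "R = [:C0, C1:] * ?P + B * ?Q" unfolding R by simp
    thus "R \<in> {A * ?P + B * ?Q |A B. True}" by blast
  qed
qed

theorem mainTheorem13:
  shows "\<exists>x \<in> X0_function_field 92. \<exists>y \<in> X0_function_field 92. \<exists>t \<in> X0_function_field 92.
    X0_function_field 92 = rat_adjoin {x, y, t} \<and>
    {f \<in> X0_function_field 92. atkin_lehner 92 23 f = f} = rat_adjoin {x, y} \<and>
    atkin_lehner 92 23 t = - t \<and>
    y ^ 2 = x ^ 3 + x ^ 2 + 2 * x + 1 \<and>
    t ^ 2 = (3 + x) ^ 2 * (8 + 4 * x + 4 * x ^ 2 + x ^ 3) *
      (8 + 20 * x + 28 * x ^ 2 + 25 * x ^ 3 + 14 * x ^ 4 + 5 * x ^ 5 + x ^ 6) \<and>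
    is_birational_model (X0_function_field 92)
      (varY ^ 2 - (varX ^ 3 + varX ^ 2 + 2 * varX + 1))
      (varT ^ 2 - (3 + varX) ^ 2 * (8 + 4 * varX + 4 * varX ^ 2 + varX ^ 3) *
        (8 + 20 * varX + 28 * varX ^ 2 + 25 * varX ^ 3 + 14 * varX ^ 4 + 5 * varX ^ 5 + varX ^ 6))
      x y t"
proof (rule bexI[OF _ generators_in_X0(1)], rule bexI[OF _ generators_in_X0(2)], rule bexI[OF _ generators_in_X0(3)], intro conjI)
  show "atkin_lehner 92 23 TT = - TT"
    using atkin_lehner_w(1)[OF X0_modular[OF generators_in_X0(3)]] w_basic(5) by simp
  show "is_birational_model (X0_function_field 92)
      (varY ^ 2 - (varX ^ 3 + varX ^ 2 + 2 * varX + 1))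
      (varT ^ 2 - (3 + varX) ^ 2 * (8 + 4 * varX + 4 * varX ^ 2 + varX ^ 3) *
        (8 + 20 * varX + 28 * varX ^ 2 + 25 * varX ^ 3 + 14 * varX ^ 4 + 5 * varX ^ 5 + varX ^ 6))
      XX YY TT"
    unfolding is_birational_model_def by (intro conjI function_field_eq[symmetric] relation_ideal)
qed (rule function_field_eq invariants_eq equation_YY equation_TT)+

end
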